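(* Let $a>0$, $\sigma>1$ and $\nu>0$. Let $u^0\in (H^1_{a,\sigma}(\mathbb{R}^3))^3$ be such that $\operatorname{div} u^0=0$. Then there exist a unique $T^*\in(0,\infty]$ and a unique solution $u\in \mathcal{C}([0,T^* ),H^1_{a,\sigma}(\mathbb{R}^3))$ of the Navier-Stokes system (NSE) with initial data $u^0$ such that $u\notin \mathcal{C}([0,T^*],H^1_{a,\sigma}(\mathbb{R}^3))$. Moreover, if $T^*<\infty$, then there are constants $c_1=c_1(u^0,a,\sigma)>0$ and $c_2=c_2(u^0,\sigma)>0$ such that, for all $t\in[0,T^* )$, $$\frac{c_1}{(T^*-t)^{\frac{2\sigma_0+1}{3\sigma}+\frac{1}{3}}}\exp\Big[\frac{a c_2}{(T^*-t)^{\frac{1}{3\sigma}}}\Big]\leq \|u(t)\|_{H^1_{a,\sigma}},$$ where $2\sigma_0$ is the integer part of $2\sigma$.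
   Context: Fourier transform: $\mathcal{F}(f)(\xi)=\widehat f(\xi)=\int_{\mathbb{R}^3}e^{-ix\cdot\xi}f(x)\,dx$. $H^s(\mathbb{R}^3)$ is the usual inhomogeneous Sobolev space, with $\|f\|_{H^s}^2=(2\pi)^{-3}\int_{\mathbb{R}^3}(1+|\xi|^2)^s|\widehat f(\xi)|^2d\xi$. For $a\ge 0$, $s\ge0$, $\sigma\geq 1$, $e^{a|D|^{1/\sigma}}$ is the Fourier multiplier with symbol $e^{a|\xi|^{1/\sigma}}$, and the Sobolev-Gevrey space is $H^s_{a,\sigma}(\mathbb{R}^3)=\{f\in L^2(\mathbb{R}^3):\ e^{a|D|^{1/\sigma}}f\in H^s(\mathbb{R}^3)\}$ with norm $\|f\|_{H^s_{a,\sigma}}=\|e^{a|D|^{1/\sigma}}f\|_{H^s}$. For vector fields, $|\widehat u(\xi)|$ denotes the Euclidean norm of the vector $\widehat u(\xi)$ and the same notation for the norms is used. $u\in\mathcal{C}(I,H^1_{a,\sigma}(\mathbb{R}^3))$ for a vector field means that $u$ is continuous from $I$ to $(H^1_{a,\sigma}(\mathbb{R}^3))^3$. The three-dimensional incompressible Navier-Stokes system (NSE), with fixed viscosity $\nu>0$, is $$\partial_t u-\nu\Delta u+u\cdot\nabla u=-\nabla p,\qquad \operatorname{div}u=0\ \text{ in }\mathbb{R}^+\times\mathbb{R}^3,\qquad u(0,x)=u^0(x)\ \text{ in }\mathbb{R}^3,$$ where $u=(u_1,u_2,u_3)$ is the (real-valued) velocity, $p$ the pressure, $u\cdot\nabla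 u=u_1\partial_1u+u_2\partial_2u+u_3\partial_3u$. The pressure is determined by the divergence-free condition, and a solution is understood through the integral form $$u(t)=e^{\nu t\Delta}u^0-\int_0^te^{\nu(t-\tau)\Delta}\mathbb{P}\operatorname{div}(u\otimes u)(\tau)\,d\tau,\qquad \mathcal{F}(\mathbb{P}f)(\xi)=\widehat f(\xi)-\frac{\widehat f(\xi)\cdot\xi}{|\xi|^2}\xi,$$ where $f\otimes g=(g_1f,g_2f,g_3f)$ and $\operatorname{div}(f\otimes g)=(\operatorname{div}(g_1f),\operatorname{div}(g_2f),\operatorname{div}(g_3f))$. The condition $u\notin\mathcal{C}([0,T^*],H^1_{a,\sigma}(\mathbb{R}^3))$ expresses maximality: if $T^*<\infty$, $u$ does not extend to a continuous function on $[0,T^*]$ with values in $H^1_{a,\sigma}(\mathbb{R}^3)$; it is no condition when $T^*=\infty$. The viscosity $\nu$ is fixed, so constants may also depend on it. *)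

theory Defs
  imports "HOL-Analysis.Analysis"
begin

text \<open>
  Elements of function spaces over \<open>\<real>\<^sup>3\<close> are represented by Borel functions; two functions
  represent the same element iff they agree almost everywhere, so equality of elements is always
  stated with \<open>AE\<close>. Operators are chosen by \<open>SOME\<close> and are determined up to null sets.
\<close>

definition L2 :: "(real^3 \<Rightarrow> 'b::euclidean_space) set" where
  "L2 = {f \<in> borel_measurable lborel. integrable lborel (\<lambda>x. (norm (f x))\<^sup>2)}"

definition cvec :: "real^3 \<Rightarrow> complex^3" where
  "cvec v = (\<chi> j. complex_of_real (v $ j))"

definition fourier_integral :: "(real^3 \<Rightarrow> complex^3) \<Rightarrow> real^3 \<Rightarrow> complex^3" where
  "fourier_integral f \<xi> = (\<integral>x. exp (- (\<i> * complex_of_real (x \<bullet> \<xi>))) *s f x \<partial>lborel)"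

text \<open>The Fourier transform on \<open>L2\<close> is the \<open>L2\<close>-limit of the Fourier integrals of the truncations
  of \<open>f\<close> to balls. The limit is stated with the nonnegative integral, which is \<open>\<infinity>\<close> (and not \<open>0\<close>)
  on functions that are not square integrable.\<close>

definition fourier :: "(real^3 \<Rightarrow> complex^3) \<Rightarrow> real^3 \<Rightarrow> complex^3" where
  "fourier f = (SOME g. g \<in> L2 \<and>
     (\<lambda>n::nat. \<integral>\<^sup>+\<xi>. ennreal ((norm
        (fourier_integral (\<lambda>x. indicator (cball 0 (real n)) x *\<^sub>R f x) \<xi> - g \<xi>))\<^sup>2) \<partial>lborel)
     \<longlonglongrightarrow> 0)"

definition sobolev_space :: "real \<Rightarrow> (real^3 \<Rightarrow> complex^3) set" where
  "sobolev_space s = {f \<in> L2.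
     integrable lborel (\<lambda>\<xi>. (1 + (norm \<xi>)\<^sup>2) powr s * (norm (fourier f \<xi>))\<^sup>2)}"

definition sobolev_norm :: "real \<Rightarrow> (real^3 \<Rightarrow> complex^3) \<Rightarrow> real" where
  "sobolev_norm s f = sqrt (1 / (2 * pi) ^ 3 *
     (\<integral>\<xi>. (1 + (norm \<xi>)\<^sup>2) powr s * (norm (fourier f \<xi>))\<^sup>2 \<partial>lborel))"

text \<open>A symbol may be matrix valued: \<open>m \<xi>\<close> acts on the vector \<open>fourier f \<xi>\<close>.\<close>

definition is_fourier_multiplier ::
  "(real^3 \<Rightarrow> complex^3 \<Rightarrow> complex^3) \<Rightarrow> (real^3 \<Rightarrow> complex^3) \<Rightarrow> (real^3 \<Rightarrow> complex^3) \<Rightarrow> bool" where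
  "is_fourier_multiplier m f g \<longleftrightarrow>
     g \<in> L2 \<and> (AE \<xi> in lborel. fourier g \<xi> = m \<xi> (fourier f \<xi>))"

definition fourier_multiplier ::
  "(real^3 \<Rightarrow> complex^3 \<Rightarrow> complex^3) \<Rightarrow> (real^3 \<Rightarrow> complex^3) \<Rightarrow> (real^3 \<Rightarrow> complex^3)" where
  "fourier_multiplier m f = (SOME g. is_fourier_multiplier m f g)"

definition gevrey_symbol :: "real \<Rightarrow> real \<Rightarrow> real^3 \<Rightarrow> complex^3 \<Rightarrow> complex^3" where
  "gevrey_symbol a \<sigma> \<xi> v = complex_of_real (exp (a * norm \<xi> powr (1 / \<sigma>))) *s v"

definition heat_symbol :: "real \<Rightarrow> real^3 \<Rightarrow> complex^3 \<Rightarrow> complex^3" where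
  "heat_symbol t \<xi> v = complex_of_real (exp (- t * (norm \<xi>)\<^sup>2)) *s v"

definition leray_symbol :: "real^3 \<Rightarrow> complex^3 \<Rightarrow> complex^3" where
  "leray_symbol \<xi> v =
     v - ((\<Sum>j\<in>UNIV. v $ j * complex_of_real (\<xi> $ j)) / complex_of_real ((norm \<xi>)\<^sup>2)) *s cvec \<xi>"

abbreviation heat :: "real \<Rightarrow> (real^3 \<Rightarrow> complex^3) \<Rightarrow> real^3 \<Rightarrow> complex^3" where
  "heat t \<equiv> fourier_multiplier (heat_symbol t)"

abbreviation leray :: "(real^3 \<Rightarrow> complex^3) \<Rightarrow> real^3 \<Rightarrow> complex^3" where
  "leray \<equiv> fourier_multiplier leray_symbol"

text \<open>As \<open>s \<ge> 0\<close>, the requirement that \<open>exp (a |D| powr (1/\<sigma>)) f\<close> lies in \<open>sobolev_space s\<close>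
  includes that it lies in \<open>L2\<close>. The space asks for existence, so that it does not depend
  on the value of \<open>SOME\<close> outside the domain of the multiplier.\<close>

definition gevrey_space :: "real \<Rightarrow> real \<Rightarrow> real \<Rightarrow> (real^3 \<Rightarrow> complex^3) set" where
  "gevrey_space a \<sigma> s =
     {f \<in> L2. \<exists>g \<in> sobolev_space s. is_fourier_multiplier (gevrey_symbol a \<sigma>) f g}"

definition gevrey_norm :: "real \<Rightarrow> real \<Rightarrow> real \<Rightarrow> (real^3 \<Rightarrow> complex^3) \<Rightarrow> real" where
  "gevrey_norm a \<sigma> s f = sobolev_norm s (fourier_multiplier (gevrey_symbol a \<sigma>) f)"

definition gevrey_continuous_on ::
  "real \<Rightarrow> real \<Rightarrow> real \<Rightarrow> real set \<Rightarrow> (real \<Rightarrow> real^3 \<Rightarrow> real^3) \<Rightarrow> bool" where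
  "gevrey_continuous_on a \<sigma> s I u \<longleftrightarrow>
     (\<forall>t\<in>I. cvec \<circ> u t \<in> gevrey_space a \<sigma> s) \<and>
     (\<forall>t\<in>I. ((\<lambda>r. gevrey_norm a \<sigma> s (cvec \<circ> (\<lambda>x. u r x - u t x))) \<longlongrightarrow> 0) (at t within I))"

text \<open>\<open>div w = g\<close> in the sense of distributions, tested against compactly supported
  \<open>C\<^sup>1\<close> functions \<open>\<phi>\<close> with gradient \<open>G\<close>.\<close>

definition has_weak_div :: "(real^3 \<Rightarrow> real^3) \<Rightarrow> (real^3 \<Rightarrow> real) \<Rightarrow> bool" where
  "has_weak_div w g \<longleftrightarrow>
     (\<forall>\<phi> G. (\<forall>x. GDERIV \<phi> x :> G x) \<and> continuous_on UNIV G \<and> bounded {x. \<phi> x \<noteq> 0} \<longrightarrow>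
        (\<integral>x. w x \<bullet> G x \<partial>lborel) = - (\<integral>x. g x * \<phi> x \<partial>lborel))"

text \<open>\<open>div (f \<otimes> g)\<close> has \<open>k\<close>-th component \<open>div (g\<^sub>k f)\<close>.\<close>

definition div_tensor :: "(real^3 \<Rightarrow> real^3) \<Rightarrow> (real^3 \<Rightarrow> real^3) \<Rightarrow> real^3 \<Rightarrow> real^3" where
  "div_tensor f g =
     (SOME h. h \<in> L2 \<and> (\<forall>k. has_weak_div (\<lambda>x. (g x $ k) *\<^sub>R f x) (\<lambda>x. h x $ k)))"

text \<open>\<open>w\<close> is the integral over \<open>S\<close> of the \<open>L2\<close>-valued function \<open>h\<close>: the integral commutes with
  the pairing with every element of the (self-dual) Hilbert space \<open>L2\<close>. Here \<open>\<bullet>\<close> is the real inner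
  product of \<open>\<complex>\<^sup>3\<close>; it suffices because \<open>\<phi>\<close> may be replaced by \<open>\<i> \<phi>\<close>.\<close>

definition has_L2_integral ::
  "(real \<Rightarrow> real^3 \<Rightarrow> complex^3) \<Rightarrow> real set \<Rightarrow> (real^3 \<Rightarrow> complex^3) \<Rightarrow> bool" where
  "has_L2_integral h S w \<longleftrightarrow>
     w \<in> L2 \<and> (\<forall>\<tau>\<in>S. h \<tau> \<in> L2) \<and>
     (\<forall>\<phi>\<in>L2. set_integrable lborel S (\<lambda>\<tau>. \<integral>x. h \<tau> x \<bullet> \<phi> x \<partial>lborel) \<and>
        (LBINT \<tau>:S. (\<integral>x. h \<tau> x \<bullet> \<phi> x \<partial>lborel)) = (\<integral>x. w x \<bullet> \<phi> x \<partial>lborel))"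

definition nse_mild_solution_on ::
  "real \<Rightarrow> (real^3 \<Rightarrow> real^3) \<Rightarrow> real set \<Rightarrow> (real \<Rightarrow> real^3 \<Rightarrow> real^3) \<Rightarrow> bool" where
  "nse_mild_solution_on \<nu> u0 I u \<longleftrightarrow>
     (\<forall>t\<in>I. \<exists>w.
        has_L2_integral
          (\<lambda>\<tau>. heat (\<nu> * (t - \<tau>)) (leray (cvec \<circ> div_tensor (u \<tau>) (u \<tau>)))) {0..t} w \<and>
        (AE x in lborel. cvec (u t x) = heat (\<nu> * t) (cvec \<circ> u0) x - w x))"

text \<open>\<open>u\<close> is a solution on \<open>[0,T)\<close> in \<open>C([0,T), H\<^sup>1\<^sub>a\<^sub>,\<^sub>\<sigma>)\<close> which, if \<open>T < \<infinity>\<close>, has no extension to an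
  element of \<open>C([0,T], H\<^sup>1\<^sub>a\<^sub>,\<^sub>\<sigma>)\<close>. Values of \<open>u\<close> outside \<open>[0,T)\<close> are irrelevant.\<close>

definition nse_maximal_solution ::
  "real \<Rightarrow> real \<Rightarrow> real \<Rightarrow> (real^3 \<Rightarrow> real^3) \<Rightarrow> ereal \<Rightarrow> (real \<Rightarrow> real^3 \<Rightarrow> real^3) \<Rightarrow> bool" where
  "nse_maximal_solution \<nu> a \<sigma> u0 T u \<longleftrightarrow>
     0 < T \<and>
     gevrey_continuous_on a \<sigma> 1 {t. 0 \<le> t \<and> ereal t < T} u \<and>
     nse_mild_solution_on \<nu> u0 {t. 0 \<le> t \<and> ereal t < T} u \<and>
     (T < \<infinity> \<longrightarrow>
        \<not> (\<exists>v. gevrey_continuous_on a \<sigma> 1 {0..real_of_ereal T} v \<and>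
              (\<forall>t. 0 \<le> t \<and> ereal t < T \<longrightarrow> (AE x in lborel. v t x = u t x))))"

end

theory Submission
  imports Defs "HOL-Probability.Probability"
begin

text \<open>The equation is solved on the Fourier side. The transform \<open>U t\<close> of the velocity satisfies Duhamel's formula for almost every frequency and all times at once, and the nonlinearity is, up to the Leray projection and one factor \<open>xi\<close>, the convolution of \<open>U t\<close> with itself. All estimates are weighted \<open>L2\<close> bounds for convolutions of nonnegative functions.

Well-posedness needs a weight for which the weighted \<open>L2\<close> space is closed under convolution (\<open>conv_weight\<close>). The derivative in the nonlinearity is paid for by the heat kernel (\<open>heat_kernel_CS\<close>), and the Picard iteration is dominated by a scalar one, so that solutions have a time-independent majorant (\<open>local_existence_majorant\<close>, \<open>fsol_unique\<close>, \<open>fsol_maximal\<close>). Solutions stay real and divergence free and satisfy the energy inequality (\<open>fsol_energy\<close>).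

The blow-up rate rests on one property of the Gevrey weight: since \<open>\<sigma> > 1\<close>, the exponent is subadditive with a gain, \<open>(x + y) powr th \<le> x powr th + th * y powr th\<close> for \<open>y \<le> x\<close> and \<open>th = 1 / \<sigma>\<close>. The lower of two interacting frequencies is therefore measured in a weaker Gevrey norm, and as long as some weak Gevrey norm stays bounded, so does the given one (\<open>gevrey_bootstrap\<close>). Hence local existence may be run with the weight \<open>1 + (|xi| / \<rho>)^3\<close> and an arbitrarily small Gevrey exponent. Its convolution constant is of order \<open>\<rho>^3\<close>, the \<open>L2\<close> norm is bounded by the energy \<open>E\<close>, and so at distance \<open>T - t\<close> from the blow-up time the sixth moment of \<open>|U t|^2\<close> exceeds \<open>E * \<rho>^6\<close> for \<open>\<rho>^3\<close> of order \<open>\<nu> / (E * (T - t))\<close> (\<open>cubic_weight_blowup\<close>). Frequencies below \<open>\<rho> / 2\<close> cannot account for this, and above \<open>\<rho> / 2\<close> the Gevrey weight is exponentially large in \<open>a * (T - t) powr (- 1 / (3 * \<sigma>))\<close> (\<open>gevrey_norm_lower_bound\<close>, \<open>blowup_rate\<close>). The power of \<open>T - t\<close> in front is absorbed by half of the exponent; it is here that \<open>2 * \<sigma>\<^sub>0 + 1 > 2 * \<sigma>\<close> enters, to make that power larger than one.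

The remaining parts connect this with the definitions: the \<open>L2\<close> Fourier transform with inversion and Parseval's formula, derived from Gaussians; products as convolutions and weak divergences as multiplication by \<open>i xi\<close>; the weak time integral as a pointwise one (\<open>L2_integral_fourier\<close>); and, for uniqueness among all continuous solutions, a jointly measurable version of an arbitrary one (\<open>mild_fsol\<close>).\<close>

section \<open>Notation\<close>

text \<open>Integrals without a measure are over Lebesgue measure, and \<open>hk\<close> is the heat multiplier.\<close>

abbreviation (input) nnint :: "('a::euclidean_space => ennreal) => ennreal" (binder "NI " 10)
  where "nnint f \<equiv> nn_integral lborel f"

abbreviation (input) lint :: "('a::euclidean_space => 'b::{banach, second_countable_topology}) => 'b" (binder "LI " 10)
  where "lint f \<equiv> integral\<^sup>L lborel f"

abbreviation (input) seqlim :: "(nat => 'a::topological_space) => 'a => bool" ("(_ ---> _)" [60, 60] 60)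
  where "X ---> L \<equiv> X \<longlonglongrightarrow> L"

abbreviation (input) aelb :: "('a::euclidean_space => bool) => bool" (binder "AL " 10)
  where "aelb P \<equiv> AE x in lborel. P x"

abbreviation (input) "bmeas \<equiv> borel_measurable borel"
abbreviation (input) "bmeas2 \<equiv> borel_measurable (borel \<Otimes>\<^sub>M borel)"
abbreviation (input) "cplx \<equiv> complex_of_real"
abbreviation (input) hk :: "real => real => real^3 => real"
  where "hk \<nu> t xi \<equiv> exp (- \<nu> * t * (norm xi)\<^sup>2)"

section \<open>Square integrable functions\<close>

definition sqnorm :: "(real^3 => 'b::euclidean_space) => ennreal" where
 "sqnorm f = (NI x. ennreal ((norm (f x))^2))"

lemma L2_iff: "f \<in> L2 \<longleftrightarrow> f \<in> bmeas & sqnorm f < \<infinity>"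
 by (auto simp: L2_def sqnorm_def integrable_iff_bounded)

lemma L2_measurable: "f \<in> L2 ==> f \<in> bmeas"
 by (simp add: L2_iff)

lemma L2_sqnorm: "f \<in> L2 ==> sqnorm f < \<infinity>"
 by (simp add: L2_iff)

lemma ennreal_norm_add_sq:
 "ennreal ((norm (x + y :: 'b::euclidean_space))^2) <= 2 * ennreal ((norm x)^2) + 2 * ennreal ((norm y)^2)"
proof -
 have "(norm (x + y))^2 <= (norm x + norm y)^2"
  by (intro power_mono norm_triangle_ineq) auto
 also have "... <= 2 * (norm x)^2 + 2 * (norm y)^2"
  using sum_squares_bound[of "norm x" "norm y"] by (simp add: power2_sum)
 finally have "ennreal ((norm (x + y))^2) <= ennreal (2 * (norm x)^2 + 2 * (norm y)^2)"
  by (rule ennreal_leI)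
 also have "... = 2 * ennreal ((norm x)^2) + 2 * ennreal ((norm y)^2)"
  by (simp add: ennreal_plus ennreal_mult')
 finally show ?thesis .
qed

lemma sqnorm_add_le:
 assumes [measurable]: "f \<in> bmeas" "g \<in> bmeas"
 shows "sqnorm (%x. f x + g x) <= 2 * sqnorm f + 2 * sqnorm g"
proof -
 have "sqnorm (%x. f x + g x)
   <= (NI x. 2 * ennreal ((norm (f x))^2) + 2 * ennreal ((norm (g x))^2))"
  unfolding sqnorm_def by (intro nn_integral_mono ennreal_norm_add_sq)
 also have "... = 2 * sqnorm f + 2 * sqnorm g"
  unfolding sqnorm_def by (simp add: nn_integral_add nn_integral_cmult)
 finally show ?thesis .
qed

lemma sqnorm_minus: "sqnorm (%x. - f x) = sqnorm f"
 by (simp add: sqnorm_def)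

lemma sqnorm_minus_commute: "sqnorm (%x. f x - g x) = sqnorm (%x. g x - f x)"
 by (simp add: sqnorm_def norm_minus_commute)

lemma sqnorm_diff_le:
 assumes [measurable]: "f \<in> bmeas" "g \<in> bmeas"
 shows "sqnorm (%x. f x - g x) <= 2 * sqnorm f + 2 * sqnorm g"
 using sqnorm_add_le[of f "%x. - g x"] by (simp add: sqnorm_minus)

lemma sqnorm_diff_triangle:
 assumes [measurable]: "f \<in> bmeas" "g \<in> bmeas" "h \<in> bmeas"
 shows "sqnorm (%x. f x - h x) <= 2 * sqnorm (%x. f x - g x) + 2 * sqnorm (%x. g x - h x)"
 using sqnorm_add_le[of "%x. f x - g x" "%x. g x - h x"] by simp

lemma sqnorm_mono:
 assumes "AL x. norm (f x) <= norm (g x)"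
 shows "sqnorm f <= sqnorm g"
 unfolding sqnorm_def using assms
 by (intro nn_integral_mono_AE) (auto elim!: eventually_mono intro!: ennreal_leI power_mono)

lemma sqnorm_cong_AE:
 assumes "AL x. f x = g x"
 shows "sqnorm f = sqnorm g"
 unfolding sqnorm_def using assms by (intro nn_integral_cong_AE) (auto elim: eventually_mono)

lemma sqnorm_eq_0_iff:
 assumes [measurable]: "f \<in> bmeas"
 shows "sqnorm f = 0 \<longleftrightarrow> (AL x. f x = 0)"
 unfolding sqnorm_def by (subst nn_integral_0_iff_AE) (auto simp: ennreal_eq_0_iff power2_eq_square mult_le_0_iff)

lemma L2_add: "f \<in> L2 ==> g \<in> L2 ==> (%x. f x + g x) \<in> L2"
 unfolding L2_iff
 by (auto intro!: le_less_trans[OF sqnorm_add_le] simp: ennreal_add_less_top ennreal_mult_less_top)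

lemma L2_diff: "f \<in> L2 ==> g \<in> L2 ==> (%x. f x - g x) \<in> L2"
 unfolding L2_iff
 by (auto intro!: le_less_trans[OF sqnorm_diff_le] simp: ennreal_add_less_top ennreal_mult_less_top)

lemma L2_bound:
 assumes "f \<in> L2" "g \<in> bmeas" "AL x. norm (g x) <= C * norm (f x)"
 shows "g \<in> L2"
proof -
 have "AL x. norm (g x) <= norm (C *\<^sub>R f x)"
  using assms(3) by eventually_elim (simp, meson abs_ge_self mult_right_mono norm_ge_zero order_trans)
 then have "sqnorm g <= sqnorm (%x. C *\<^sub>R f x)" by (rule sqnorm_mono)
 also have "... = ennreal (C\<^sup>2) * sqnorm f"
  using assms(1) unfolding sqnorm_def L2_iff
  by (subst nn_integral_cmult[symmetric]) (auto simp: power_mult_distrib ennreal_mult)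
 also have "... < \<infinity>" using assms(1) by (auto simp: L2_iff ennreal_mult_less_top)
 finally show ?thesis using assms(2) by (simp add: L2_iff)
qed

lemma L2_0 [simp]: "(%x. 0) \<in> L2"
 by (simp add: L2_iff sqnorm_def)

lemma L2_cong_AE:
 assumes "f \<in> L2" "g \<in> bmeas" "AL x. f x = g x"
 shows "g \<in> L2"
 using assms sqnorm_cong_AE[OF assms(3)] by (simp add: L2_iff)

lemma nn_integral_norm_mult_le:
 assumes [measurable]: "f \<in> bmeas" "g \<in> bmeas"
 shows "(NI x. ennreal (norm (f x) * norm (g x)))^2 <= sqnorm f * sqnorm g"
 using Cauchy_Schwarz_nn_integral[of "%x. ennreal (norm (f x))" lborel "%x. ennreal (norm (g x))"]
 by (simp add: sqnorm_def ennreal_mult ennreal_power)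

lemma L2_norm_mult_integrable:
 fixes f :: "real^3 => 'b::euclidean_space" and g :: "real^3 => 'c::euclidean_space"
 assumes "f \<in> L2" "g \<in> L2"
 shows "integrable lborel (%x. norm (f x) * norm (g x))"
proof -
 have [measurable]: "f \<in> bmeas" "g \<in> bmeas"
  using assms by (auto simp: L2_iff)
 have "(NI x. ennreal (norm (f x) * norm (g x)))^2 <= sqnorm f * sqnorm g"
  by (rule nn_integral_norm_mult_le) auto
 also have "... < \<infinity>" using assms by (auto simp: L2_iff ennreal_mult_less_top)
 finally have "(NI x. ennreal (norm (f x) * norm (g x))) < \<infinity>"
  by (auto simp: less_top[symmetric] power_eq_top_ennreal)
 then show ?thesis by (auto intro!: integrableI_bounded)
qed

lemma L2_mult_integrable:
 fixes f g :: "real^3 => 'b::{euclidean_space,real_normed_field}"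
 assumes "f \<in> L2" "g \<in> L2"
 shows "integrable lborel (%x. f x * g x)"
 by (rule Bochner_Integration.integrable_bound[OF L2_norm_mult_integrable[OF assms]])
   (use assms in \<open>auto simp: L2_iff norm_mult intro!: borel_measurable_times\<close>)

lemma L2_inner_integrable:
 fixes f g :: "real^3 => 'b::euclidean_space"
 assumes "f \<in> L2" "g \<in> L2"
 shows "integrable lborel (%x. f x \<bullet> g x)"
 by (rule Bochner_Integration.integrable_bound[OF L2_norm_mult_integrable[OF assms]])
   (use assms in \<open>auto simp: L2_iff norm_mult Cauchy_Schwarz_ineq2 intro!: borel_measurable_inner\<close>)

lemma L2_pairing_bound:
 fixes f g :: "real^3 => complex"
 assumes "f \<in> L2" "g \<in> L2"
 shows "ennreal ((norm (LI x. f x * g x))^2) <= sqnorm f * sqnorm g"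
proof -
 have "ennreal (norm (LI x. f x * g x)) <= (NI x. ennreal (norm (f x * g x)))"
  by (rule integral_norm_bound_ennreal[OF L2_mult_integrable[OF assms]])
 then have "(ennreal (norm (LI x. f x * g x)))^2 <= (NI x. ennreal (norm (f x) * norm (g x)))^2"
  by (auto simp: norm_mult power_mono)
 also have "... <= sqnorm f * sqnorm g"
  using assms by (intro nn_integral_norm_mult_le) (auto simp: L2_iff)
 finally show ?thesis by (simp add: ennreal_power)
qed

lemma tendsto_0_ennreal_sq:
 fixes f :: "nat => real"
 assumes "(%n. ennreal ((f n)^2)) ---> 0"
 shows "f ---> 0"
proof -
 have "(%n. (f n)^2) ---> 0"
  using assms by (subst (asm) ennreal_0[symmetric], subst (asm) tendsto_ennreal_iff) auto
 then have "(%n. sqrt ((f n)^2)) ---> sqrt 0" by (intro tendsto_intros)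
 then show ?thesis by (simp add: tendsto_rabs_zero_iff)
qed

lemma L2_pairing_tendsto:
 fixes f g :: "real^3 => complex"
 assumes "!!n. F n \<in> L2" "f \<in> L2" "g \<in> L2" "(%n. sqnorm (%x. F n x - f x)) ---> 0"
 shows "(%n. (LI x. F n x * g x)) ---> (LI x. f x * g x)"
proof -
 have eq: "(LI x. F n x * g x) - (LI x. f x * g x) = (LI x. (F n x - f x) * g x)" for n
  using assms by (subst Bochner_Integration.integral_diff[symmetric])
   (auto intro!: L2_mult_integrable simp: algebra_simps)
 have "(%n. sqnorm (%x. F n x - f x) * sqnorm g) ---> 0 * sqnorm g"
  using assms by (intro ennreal_tendsto_cmult tendsto_mult_ennreal tendsto_const) (auto simp: L2_iff)
 then have lim: "(%n. sqnorm (%x. F n x - f x) * sqnorm g) ---> 0" by simp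
 have "(%n. ennreal ((norm (LI x. (F n x - f x) * g x))^2)) ---> 0"
  by (rule tendsto_sandwich[OF _ _ tendsto_const lim])
    (auto intro!: always_eventually L2_pairing_bound L2_diff assms)
 then have "(%n. norm (LI x. (F n x - f x) * g x)) ---> 0"
  by (rule tendsto_0_ennreal_sq)
 then show ?thesis
  unfolding eq[symmetric] by (subst (asm) tendsto_norm_zero_iff) (simp add: LIM_zero_iff)
qed

section \<open>Completeness of L2 and the exchange of integrals\<close>

text \<open>An \<open>L2\<close> limit is found as a pointwise limit: along a subsequence with summable errors the increments converge absolutely almost everywhere, and Fatou's lemma bounds the distance to the limit.\<close>

lemma L2_complete:
 fixes F :: "nat => real^3 => 'b::euclidean_space"
 assumes F: "!!n. F n \<in> L2" and Cau: "!!n m. n <= m ==> sqnorm (%x. F m x - F n x) <= e n" and e: "e ---> 0"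
 shows "\<exists>g\<in>L2. (%n. sqnorm (%x. F n x - g x)) ---> 0"
proof -
 have [measurable]: "!!n. F n \<in> bmeas" using F by (auto simp: L2_iff)
 have "\<exists>N. \<forall>n\<ge>N. e n < ennreal ((1/4)^k)" for k :: nat
  using order_tendstoD(2)[OF e, of "ennreal ((1/4)^k)"] by (auto simp: eventually_sequentially)
 then obtain N where N: "!!k n. n \<ge> N k ==> e n < ennreal ((1/4)^k)" by metis
 define r where "r k = (\<Sum>j\<le>k. N j) + k" for k
 have r_mono: "r k <= r (Suc k)" for k by (simp add: r_def)
 have r_ge: "r k \<ge> k" for k by (simp add: r_def)
 have rN: "r k \<ge> N k" for k unfolding r_def by (simp add: trans_le_add1 member_le_sum)
 define D where "D k x = F (r (Suc k)) x - F (r k) x" for k x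
 have [measurable]: "!!k. D k \<in> bmeas" unfolding D_def by measurable
 have D_le: "sqnorm (D k) <= ennreal ((1/4)^k)" for k
  unfolding D_def using Cau[OF r_mono[of k]] N[OF rN[of k]] by auto
 have "(NI x. (\<Sum>k. ennreal (2^k * (norm (D k x))^2))) = (\<Sum>k. (NI x. ennreal (2^k * (norm (D k x))^2)))"
  by (intro nn_integral_suminf) measurable
 also have "... = (\<Sum>k. ennreal (2^k) * sqnorm (D k))"
  unfolding sqnorm_def by (subst nn_integral_cmult[symmetric]) (auto simp: ennreal_mult)
 also have "... <= (\<Sum>k. ennreal ((1/2)^k))"
 proof (intro suminf_le)
  fix k :: nat
  have "ennreal (2^k) * sqnorm (D k) <= ennreal (2^k) * ennreal ((1/4)^k)" by (intro mult_left_mono D_le) auto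
  also have "... = ennreal ((1/2)^k)" by (simp add: ennreal_mult[symmetric] power_mult_distrib[symmetric])
  finally show "ennreal (2^k) * sqnorm (D k) <= ennreal ((1/2)^k)" .
 qed auto
 also have "... = ennreal (\<Sum>k. (1/2)^k)" by (intro suminf_ennreal2) (auto intro: summable_geometric)
 also have "... < \<infinity>" by simp
 finally have fin: "(NI x. (\<Sum>k. ennreal (2^k * (norm (D k x))^2))) \<noteq> \<infinity>" by simp
 have "AL x. (\<Sum>k. ennreal (2^k * (norm (D k x))^2)) \<noteq> \<infinity>"
  by (rule nn_integral_PInf_AE[OF _ fin]) measurable
 then have conv: "AL x. convergent (%k. F (r k) x)"
 proof eventually_elim
  fix x assume fin: "(\<Sum>k. ennreal (2^k * (norm (D k x))^2)) \<noteq> \<infinity>"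
  define A where "A k = ennreal (2^k * (norm (D k x))^2)" for k
  define C where "C = enn2real (suminf A)"
  have "suminf A \<noteq> \<infinity>" using fin unfolding A_def[abs_def] .
  then have sA: "suminf A = ennreal C" unfolding C_def by (simp add: ennreal_enn2real_if)
  have C0: "C \<ge> 0" by (simp add: C_def)
  have C: "2^k * (norm (D k x))^2 <= C" for k
  proof -
   have "sum A {k} <= suminf A" by (rule sum_le_suminf[OF summableI]) auto
   then have "A k <= ennreal C" using sA by simp
   then show ?thesis using C0 unfolding A_def by (subst (asm) ennreal_le_iff) auto
  qed
  have bd: "norm (D k x) <= sqrt C * (1 / sqrt 2)^k" for k
  proof (rule power2_le_imp_le)
   have "(sqrt C * (1 / sqrt 2)^k)^2 = C * ((1 / sqrt 2)^2)^k"
    using C0 by (simp only: power_mult_distrib power_mult[symmetric] mult.commute real_sqrt_pow2)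
   also have "... = C / 2^k" by (simp add: power_divide)
   finally show "(norm (D k x))^2 <= (sqrt C * (1 / sqrt 2)^k)^2"
    using C[of k] by (simp add: pos_le_divide_eq mult.commute)
  qed (use C0 in auto)
  have "summable (%k. sqrt C * (1 / sqrt 2)^k)"
   by (intro summable_mult summable_geometric) (auto simp: real_less_rsqrt)
  then have "summable (%k. D k x)" by (rule summable_comparison_test'[where N=0]) (use bd in auto)
  then have "convergent (%n. \<Sum>k<n. D k x)" by (simp add: summable_iff_convergent)
  moreover have "(\<Sum>k<n. D k x) = F (r n) x - F (r 0) x" for n
   unfolding D_def by (rule sum_lessThan_telescope)
  ultimately have "convergent (%n. (F (r n) x - F (r 0) x) + F (r 0) x)"
   by (intro convergent_add convergent_const) simp
  then show "convergent (%k. F (r k) x)" by simp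
 qed
 define g where "g x = lim (%k. F (r k) x)" for x
 have [measurable]: "g \<in> bmeas" unfolding g_def by measurable
 have lim: "AL x. (%k. F (r k) x) ---> g x"
  using conv by eventually_elim (simp add: g_def convergent_LIMSEQ_iff)
 have le: "sqnorm (%x. F n x - g x) <= e n" for n
 proof -
  have "sqnorm (%x. F n x - g x) = (NI x. liminf (%k. ennreal ((norm (F n x - F (r k) x))^2)))"
   unfolding sqnorm_def
  proof (rule nn_integral_cong_AE, use lim in eventually_elim)
   fix x assume "(%k. F (r k) x) ---> g x"
   then have "(%k. ennreal ((norm (F n x - F (r k) x))^2)) ---> ennreal ((norm (F n x - g x))^2)"
    by (intro tendsto_intros tendsto_ennrealI)
   then show "ennreal ((norm (F n x - g x))^2) = liminf (%k. ennreal ((norm (F n x - F (r k) x))^2))"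
    by (intro lim_imp_Liminf[symmetric]) auto
  qed
  also have "... <= liminf (%k. sqnorm (%x. F n x - F (r k) x))"
   unfolding sqnorm_def by (intro nn_integral_liminf) measurable
  also have "... <= e n"
  proof -
   have "\<forall>\<^sub>F k in sequentially. sqnorm (%x. F n x - F (r k) x) <= e n"
    using eventually_ge_at_top[of n]
   proof eventually_elim
    fix k assume "n <= k"
    then have "n <= r k" using r_ge[of k] by linarith
    then show "sqnorm (%x. F n x - F (r k) x) <= e n"
     using Cau[of n "r k"] sqnorm_minus_commute[of "F n" "F (r k)"] by simp
   qed
   then have "liminf (%k. sqnorm (%x. F n x - F (r k) x)) <= liminf (%k::nat. e n)" by (rule Liminf_mono)
   then show ?thesis by (simp add: Liminf_const)
  qed
  finally show ?thesis .
 qed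
 have "g \<in> L2"
 proof -
  have "sqnorm g <= 2 * sqnorm (F (r 0)) + 2 * sqnorm (%x. F (r 0) x - g x)"
   using sqnorm_diff_le[of "F (r 0)" "%x. F (r 0) x - g x"] by simp
  also have "... < \<infinity>" using F[of "r 0"] le[of "r 0"] N[OF rN[of 0]]
   by (auto simp: L2_iff ennreal_add_less_top ennreal_mult_less_top intro: le_less_trans less_trans)
  finally show ?thesis by (simp add: L2_iff)
 qed
 moreover have "(%n. sqnorm (%x. F n x - g x)) ---> 0"
  by (rule tendsto_sandwich[OF _ _ tendsto_const e]) (use le in auto)
 ultimately show ?thesis by blast
qed

lemma lborel_Fubini_swap:
 fixes f :: "'a::euclidean_space => 'b::euclidean_space => 'c::{banach, second_countable_topology}"
 assumes [measurable]: "(%(x, y). f x y) \<in> borel_measurable (lborel \<Otimes>\<^sub>M lborel)"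
  and fin: "(NI x. NI y. norm (f x y)) < \<infinity>"
 shows "(LI x. LI y. f x y) = (LI y. LI x. f x y)"
proof -
 have "integrable (lborel \<Otimes>\<^sub>M lborel) (%(x, y). f x y)"
 proof (rule integrableI_bounded)
  have "(\<integral>\<^sup>+p. norm (case p of (x, y) => f x y) \<partial>(lborel \<Otimes>\<^sub>M lborel)) = (NI x. NI y. norm (f x y))"
   by (subst lborel.nn_integral_fst[symmetric]) (auto simp: split_beta')
  then show "(\<integral>\<^sup>+p. norm (case p of (x, y) => f x y) \<partial>(lborel \<Otimes>\<^sub>M lborel)) < \<infinity>" using fin by simp
 qed measurable
 then show ?thesis using lborel_pair.Fubini_integral[of f] by simp
qed

section \<open>Gaussians\<close>

lemma gauss_fourier_real:
 assumes c: "c > 0"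
 shows "has_bochner_integral lborel (%x::real. exp (- (\<i> * cplx (t * x))) * cplx (exp (- c * x\<^sup>2 / 2)))
   (cplx (sqrt (2 * pi / c) * exp (- t\<^sup>2 / (2 * c))))"
proof -
 define s where "s = sqrt c"
 have s: "s > 0" "s\<^sup>2 = c" using c by (auto simp: s_def)
 define h where "h x = exp (- (\<i> * cplx (t / s * x))) * cplx (std_normal_density x)" for x
 have [measurable]: "h \<in> bmeas" unfolding h_def by measurable
 have int: "integrable lborel h"
  by (rule Bochner_Integration.integrable_bound[OF integrable_normal_density[of 1 0]])
    (auto simp: h_def norm_mult norm_exp_eq_Re)
 have "char std_normal_distribution (- t / s) = (LI x. std_normal_density x *\<^sub>R iexp (- t / s * x))"
  unfolding char_def by (subst integral_density) (auto simp: )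
 also have "... = integral\<^sup>L lborel h"
  unfolding h_def by (intro Bochner_Integration.integral_cong) (auto simp: scaleR_conv_of_real)
 finally have val: "integral\<^sup>L lborel h = cplx (exp (- (t / s)\<^sup>2 / 2))"
  by (simp add: char_std_normal_distribution)
 have "has_bochner_integral lborel h (cplx (exp (- (t / s)\<^sup>2 / 2)))"
  using int val by (simp add: has_bochner_integral_iff)
 then have "has_bochner_integral lborel (%x. h (0 + s * x)) (cplx (exp (- (t / s)\<^sup>2 / 2)) /\<^sub>R \<bar>s\<bar>)"
  using s by (subst lborel_has_bochner_integral_real_affine_iff[where t=0 and c=s, symmetric]) auto
 from has_bochner_integral_mult_right[OF this, of "cplx (sqrt (2 * pi))"]
 have *: "has_bochner_integral lborel (%x. cplx (sqrt (2 * pi)) * h (0 + s * x))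
  (cplx (sqrt (2 * pi)) * (cplx (exp (- (t / s)\<^sup>2 / 2)) /\<^sub>R \<bar>s\<bar>))" .
 have 1: "cplx (sqrt (2 * pi)) * h (0 + s * x)
   = exp (- (\<i> * cplx (t * x))) * cplx (exp (- c * x\<^sup>2 / 2))" for x
 proof -
  have "std_normal_density (s * x) * sqrt (2 * pi) = exp (- c * x\<^sup>2 / 2)"
   using s by (simp add: normal_density_def power_mult_distrib)
  then have e: "cplx (std_normal_density (s * x)) * cplx (sqrt (2 * pi)) = cplx (exp (- c * x\<^sup>2 / 2))"
   by (metis of_real_mult)
  have "t / s * (s * x) = t * x" using s by simp
  then show ?thesis unfolding h_def add_0
   by (simp only:) (metis (no_types) mult.commute mult.left_commute e)
 qed
 have gen: "cplx A * (cplx E /\<^sub>R \<bar>s\<bar>) = cplx (A / s * E)" for A E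
  using s(1) by (simp add: scaleR_conv_of_real field_simps)
 have sq: "sqrt (2 * pi) / s = sqrt (2 * pi / c)" by (simp add: real_sqrt_divide s_def)
 have ex: "- (t / s)\<^sup>2 / 2 = - t\<^sup>2 / (2 * c)" using s by (simp add: power_divide)
 have 2: "cplx (sqrt (2 * pi)) * (cplx (exp (- (t / s)\<^sup>2 / 2)) /\<^sub>R \<bar>s\<bar>)
   = cplx (sqrt (2 * pi / c) * exp (- t\<^sup>2 / (2 * c)))"
  unfolding gen sq ex ..
 show ?thesis using * unfolding 1 2 .
qed

lemma exp_sum_inner_eq_prod:
 fixes x z :: "'a::euclidean_space"
 shows "exp (- (\<i> * cplx (z \<bullet> x))) * cplx (exp (- c * (norm x)^2 / 2))
  = (\<Prod>b\<in>Basis. exp (- (\<i> * cplx ((z \<bullet> b) * (x \<bullet> b)))) * cplx (exp (- c * (x \<bullet> b)^2 / 2)))"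
proof -
 have "exp (- (\<i> * cplx (z \<bullet> x))) = (\<Prod>b\<in>Basis. exp (- (\<i> * cplx ((z \<bullet> b) * (x \<bullet> b)))))"
  by (subst euclidean_inner) (simp add: exp_sum[symmetric] sum_distrib_left sum_negf)
 moreover have "(norm x)^2 = (\<Sum>b\<in>Basis. (x \<bullet> b)^2)"
  by (simp add: power2_norm_eq_inner) (subst euclidean_inner, simp add: power2_eq_square)
 then have "exp (- c * (norm x)^2 / 2) = (\<Prod>b\<in>Basis. exp (- c * (x \<bullet> b)^2 / 2))"
  by (simp add: exp_sum[symmetric] sum_distrib_left sum_negf sum_divide_distrib)
 ultimately show ?thesis by (simp add: prod.distrib)
qed

text \<open>The Gaussian is the one function whose transform is known explicitly; by Fubini the case of dimension three is a product of one-dimensional integrals.\<close>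

lemma gauss_fourier:
 fixes z :: "'a::euclidean_space"
 assumes c: "c > 0"
 shows "has_bochner_integral lborel (%x::'a. exp (- (\<i> * cplx (z \<bullet> x))) * cplx (exp (- c * (norm x)^2 / 2)))
   (cplx (sqrt (2 * pi / c) ^ DIM('a) * exp (- (norm z)\<^sup>2 / (2 * c))))"
proof -
 let ?f = "%b x. exp (- (\<i> * cplx ((z \<bullet> b) * x))) * cplx (exp (- c * x\<^sup>2 / 2))"
 interpret product_sigma_finite "%_::'a. lborel :: real measure" ..
 have int: "integrable lborel (?f b)" and val: "integral\<^sup>L lborel (?f b) = cplx (sqrt (2 * pi / c) * exp (- (z \<bullet> b)\<^sup>2 / (2 * c)))" for b
  using gauss_fourier_real[OF c, of "z \<bullet> b"] by (auto simp: has_bochner_integral_iff)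
 let ?T = "%f. \<Sum>b\<in>Basis. f b *\<^sub>R b :: 'a"
 have [measurable]: "?T \<in> (\<Pi>\<^sub>M b\<in>Basis. lborel) \<rightarrow>\<^sub>M borel" by measurable
 have Tb: "?T f \<bullet> b = f b" if "b \<in> Basis" for f b using that by (simp add: inner_sum_left inner_Basis if_distrib cong: if_cong)
 have eq: "exp (- (\<i> * cplx (z \<bullet> ?T f))) * cplx (exp (- c * (norm (?T f))^2 / 2))
   = (\<Prod>b\<in>Basis. ?f b (f b))" for f
  unfolding exp_sum_inner_eq_prod by (intro prod.cong refl) (simp only: Tb)
 have "has_bochner_integral (\<Pi>\<^sub>M b\<in>Basis. lborel) (%f. \<Prod>b\<in>Basis. ?f b (f b)) (\<Prod>b\<in>(Basis::'a set). integral\<^sup>L lborel (?f b))"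
  unfolding has_bochner_integral_iff
  using product_integrable_prod[of Basis ?f] product_integral_prod[of Basis ?f] int by simp
 moreover have "(\<Prod>b\<in>Basis. integral\<^sup>L lborel (?f b)) = cplx (sqrt (2 * pi / c) ^ DIM('a) * exp (- (norm z)\<^sup>2 / (2 * c)))"
 proof -
  have "(norm z)^2 = (\<Sum>b\<in>Basis. (z \<bullet> b)^2)"
   by (simp add: power2_norm_eq_inner) (subst euclidean_inner, simp add: power2_eq_square)
  then have "exp (- (norm z)\<^sup>2 / (2 * c)) = (\<Prod>b\<in>Basis. exp (- (z \<bullet> b)\<^sup>2 / (2 * c)))"
   by (simp add: exp_sum[symmetric] sum_negf sum_divide_distrib)
  then show ?thesis unfolding val by (simp add: prod.distrib)
 qed
 ultimately have "has_bochner_integral (\<Pi>\<^sub>M b\<in>Basis. lborel)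
   (%f. exp (- (\<i> * cplx (z \<bullet> ?T f))) * cplx (exp (- c * (norm (?T f))^2 / 2)))
   (cplx (sqrt (2 * pi / c) ^ DIM('a) * exp (- (norm z)\<^sup>2 / (2 * c))))"
  unfolding eq by simp
 then show ?thesis
 proof -
  define h where "h x = exp (- (\<i> * cplx (z \<bullet> x))) * cplx (exp (- c * (norm x)^2 / 2))" for x :: 'a
  have [measurable]: "h \<in> bmeas" unfolding h_def by measurable
  assume "has_bochner_integral (\<Pi>\<^sub>M b\<in>Basis. lborel)
   (%f. exp (- (\<i> * cplx (z \<bullet> ?T f))) * cplx (exp (- c * (norm (?T f))^2 / 2)))
   (cplx (sqrt (2 * pi / c) ^ DIM('a) * exp (- (norm z)\<^sup>2 / (2 * c))))"
  then have "has_bochner_integral (\<Pi>\<^sub>M b\<in>Basis. lborel) (%f. h (?T f)) (cplx (sqrt (2 * pi / c) ^ DIM('a) * exp (- (norm z)\<^sup>2 / (2 * c))))"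
   unfolding h_def .
  then have "has_bochner_integral (distr (\<Pi>\<^sub>M b\<in>Basis. lborel) borel ?T) h (cplx (sqrt (2 * pi / c) ^ DIM('a) * exp (- (norm z)\<^sup>2 / (2 * c))))"
   by (subst has_bochner_integral_distr) auto
  then show ?thesis unfolding lborel_eq[where 'a='a, symmetric] h_def .
 qed
qed

lemma gauss_real:
 assumes "c > 0"
 shows gauss_integrable: "integrable lborel (%x::'a::euclidean_space. exp (- c * (norm x)^2 / 2))"
  and gauss_integral: "(LI x. exp (- c * (norm (x::'a))^2 / 2)) = sqrt (2 * pi / c) ^ DIM('a)"
proof -
 have "has_bochner_integral lborel (%x::'a. cplx (exp (- c * (norm x)^2 / 2))) (cplx (sqrt (2 * pi / c) ^ DIM('a)))"
  using gauss_fourier[OF assms, of "0::'a"] by (simp del: of_real_power)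
 then have "has_bochner_integral lborel (%x::'a. exp (- c * (norm x)^2 / 2)) (sqrt (2 * pi / c) ^ DIM('a))"
  by (simp only: has_bochner_integral_iff complex_of_real_integrable_eq integral_complex_of_real of_real_eq_iff)
 then show "integrable lborel (%x::'a. exp (- c * (norm x)^2 / 2))"
  "(LI x. exp (- c * (norm (x::'a))^2 / 2)) = sqrt (2 * pi / c) ^ DIM('a)"
  by (simp_all only: has_bochner_integral_iff)
qed

section \<open>The Fourier transform\<close>

definition fint :: "(real^3 => complex) => real^3 => complex" where
 "fint f xi = (LI x. exp (- (\<i> * cplx (x \<bullet> xi))) * f x)"

lemma norm_exp_ii [simp]: "norm (exp (\<i> * cplx t)) = 1" "norm (exp (- (\<i> * cplx t))) = 1"
 by (simp_all add: norm_exp_eq_Re)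

lemma fint_integrable:
 assumes "integrable lborel f"
 shows "integrable lborel (%x. exp (- (\<i> * cplx (x \<bullet> xi))) * f x)"
 by (rule Bochner_Integration.integrable_bound[OF assms]) (use assms in \<open>auto simp: norm_mult\<close>)

lemma fint_measurable [measurable]:
 assumes [measurable]: "f \<in> bmeas"
 shows "fint f \<in> bmeas"
proof -
 have "(%xi. (LI x. exp (- (\<i> * cplx (x \<bullet> xi))) * f x)) \<in> bmeas"
  by (rule lborel.borel_measurable_lebesgue_integral) measurable
 then show ?thesis by (simp add: fint_def[abs_def])
qed

lemma norm_fint_le:
 assumes "integrable lborel f"
 shows "norm (fint f xi) <= (LI x. norm (f x))"
 unfolding fint_def using integral_norm_bound[of lborel "%x. exp (- (\<i> * cplx (x \<bullet> xi))) * f x"]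
 by (simp add: norm_mult)

lemma lborel_integral_translate:
 fixes f :: "'a::euclidean_space => 'b::{banach, second_countable_topology}"
 assumes [measurable]: "f \<in> bmeas"
 shows "(LI x. f (c + x)) = (LI x. f x)"
 by (subst (2) lborel_distr_plus[of c, symmetric]) (simp add: integral_distr)

lemma lborel_nn_integral_translate:
 fixes f :: "'a::euclidean_space => ennreal"
 assumes [measurable]: "f \<in> bmeas"
 shows "(NI x. f (c + x)) = (NI x. f x)"
 by (subst (2) lborel_distr_plus[of c, symmetric]) (simp add: nn_integral_distr)

lemma lborel_distr_uminus_euclidean:
 "distr lborel borel (uminus :: 'a::euclidean_space => 'a) = lborel"
proof -
 have "lborel = density (distr lborel borel (%x::'a. 0 + (-1) *\<^sub>R x)) (%_. \<bar>-1::real\<bar>^DIM('a))"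
  using lborel_affine[of "-1" "0::'a"] by simp
 then show ?thesis by (simp add: density_1 cong: distr_cong)
qed

lemma lborel_integral_reflect:
 fixes f :: "'a::euclidean_space => 'b::{banach, second_countable_topology}"
 assumes [measurable]: "f \<in> bmeas"
 shows "(LI x. f (- x)) = (LI x. f x)"
 by (subst (2) lborel_distr_uminus_euclidean[symmetric]) (simp add: integral_distr)

lemma lborel_nn_integral_reflect:
 fixes f :: "'a::euclidean_space => ennreal"
 assumes [measurable]: "f \<in> bmeas"
 shows "(NI x. f (- x)) = (NI x. f x)"
 by (subst (2) lborel_distr_uminus_euclidean[symmetric]) (simp add: nn_integral_distr)

lemma lborel_nn_integral_diff:
 fixes f :: "'a::euclidean_space => ennreal"
 assumes [measurable]: "f \<in> bmeas"
 shows "(NI x. f (c - x)) = (NI x. f x)"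
 using lborel_nn_integral_reflect[of "%x. f (c + x)"] lborel_nn_integral_translate[of f c] by simp

lemma lborel_integral_diff:
 fixes f :: "'a::euclidean_space => 'b::{banach, second_countable_topology}"
 assumes [measurable]: "f \<in> bmeas"
 shows "(LI x. f (c - x)) = (LI x. f x)"
 using lborel_integral_reflect[of "%x. f (c + x)"] lborel_integral_translate[of f c] by simp

text \<open>From \<open>f x * f y \<le> (f x ^ 2 + f y ^ 2) / 2\<close>. It bounds the quadratic form of a Gaussian regularisation in terms of the square norm of \<open>f\<close> alone.\<close>

lemma nn_integral_product_le:
 fixes f g :: "'a::euclidean_space => real" and K :: "'a => real"
 assumes [measurable]: "f \<in> bmeas" "K \<in> bmeas"
  and nonneg: "!!x. f x \<ge> 0" "!!x. K x \<ge> 0"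
 shows "(NI x. NI y. ennreal (f x * f y * K (x - y)))
   <= (NI x. ennreal ((f x)^2)) * (NI x. ennreal (K x))"
proof -
 let ?I = "(NI x. ennreal ((f x)^2)) * (NI x. ennreal (K x))"
 have em: "ennreal ((f x)^2 * K z) = ennreal ((f x)^2) * ennreal (K z)" for x z
  using nonneg(2) by (intro ennreal_mult) auto
 have K1: "(NI y. ennreal (K (x - y))) = (NI x. ennreal (K x))" for x
  by (rule lborel_nn_integral_diff) measurable
 have K2: "(NI x. ennreal (K (x - y))) = (NI x. ennreal (K x))" for y
  using lborel_nn_integral_translate[of "%x. ennreal (K x)" "- y"] by simp
 have 1: "(NI x. NI y. ennreal ((f x)^2 * K (x - y))) = ?I"
  unfolding em by (subst nn_integral_cmult, measurable) (simp only: K1, rule nn_integral_multc, measurable)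
 have "(NI x. NI y. ennreal ((f y)^2 * K (x - y)))
   = (NI y. NI x. ennreal ((f y)^2 * K (x - y)))"
  by (rule lborel_pair.Fubini') measurable
 also have "... = ?I"
  unfolding em by (subst nn_integral_cmult, measurable) (simp only: K2, rule nn_integral_multc, measurable)
 finally have 2: "(NI x. NI y. ennreal ((f y)^2 * K (x - y))) = ?I" .
 define P where "P x y = f x * f y * K (x - y)" for x y
 have [measurable]: "(%(x, y). P x y) \<in> borel_measurable (lborel \<Otimes>\<^sub>M lborel)" unfolding P_def by measurable
 have "2 * (NI x. NI y. ennreal (P x y))
   = (NI x. NI y. 2 * ennreal (P x y))"
  by (simp add: nn_integral_cmult)
 also have "... <= (NI x. NI y. ennreal ((f x)^2 * K (x - y)) + ennreal ((f y)^2 * K (x - y)))"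
 proof (intro nn_integral_mono)
  fix x y :: 'a
  have "2 * (f x * f y) * K (x - y) <= ((f x)^2 + (f y)^2) * K (x - y)"
   using sum_squares_bound[of "f x" "f y"] nonneg by (intro mult_right_mono) auto
  then have le: "2 * P x y <= (f x)^2 * K (x - y) + (f y)^2 * K (x - y)" by (simp add: P_def algebra_simps)
  have "2 * ennreal (P x y) = ennreal (2 * P x y)" using nonneg by (simp add: P_def ennreal_mult')
  also have "... <= ennreal ((f x)^2 * K (x - y) + (f y)^2 * K (x - y))" using le by (rule ennreal_leI)
  also have "... = ennreal ((f x)^2 * K (x - y)) + ennreal ((f y)^2 * K (x - y))"
   using nonneg by (intro ennreal_plus) auto
  finally show "2 * ennreal (P x y) <= ennreal ((f x)^2 * K (x - y)) + ennreal ((f y)^2 * K (x - y))" .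
 qed
 also have "... = (NI x. NI y. ennreal ((f x)^2 * K (x - y))) + (NI x. NI y. ennreal ((f y)^2 * K (x - y)))"
  by (simp add: nn_integral_add)
 also have "... = 2 * ?I" unfolding 1 2 by (rule mult_2[symmetric])
 finally show ?thesis unfolding P_def by (subst (asm) ennreal_mult_le_mult_iff) auto
qed

lemma ennreal_norm_integral_le:
 fixes f :: "'a => 'b::{banach, second_countable_topology}"
 shows "ennreal (norm (integral\<^sup>L M f)) <= (\<integral>\<^sup>+x. norm (f x) \<partial>M)"
 by (cases "integrable M f") (auto simp: integral_norm_bound_ennreal not_integrable_integral_eq)

lemma fint_mult_formula:
 assumes f: "integrable lborel f" and h: "integrable lborel h"
 shows "(LI xi. fint f xi * h xi) = (LI x. f x * fint h x)"
proof -
 have [measurable]: "f \<in> bmeas" "h \<in> bmeas" using f h by auto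
 define F where "F xi x = exp (- (\<i> * cplx (x \<bullet> xi))) * f x * h xi" for x xi :: "real^3"
 have [measurable]: "(%(xi, x). F xi x) \<in> borel_measurable (lborel \<Otimes>\<^sub>M lborel)" unfolding F_def by measurable
 have "(NI xi. NI x. norm (F xi x)) = (NI xi. (NI x. norm (f x)) * norm (h xi))"
  unfolding F_def by (simp add: norm_mult ennreal_mult nn_integral_multc)
 also have "... = (NI x. norm (f x)) * (NI xi. norm (h xi))"
  by (rule nn_integral_cmult) measurable
 also have "... < \<infinity>" using f h by (auto simp: integrable_iff_bounded ennreal_mult_less_top)
 finally have fin: "(NI xi. NI x. norm (F xi x)) < \<infinity>" .
 have "(LI xi. fint f xi * h xi) = (LI xi. LI x. F xi x)"
  unfolding fint_def F_def by simp
 also have "... = (LI x. LI xi. F xi x)"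
  by (rule lborel_Fubini_swap[OF _ fin]) measurable
 also have "... = (LI x. f x * fint h x)"
  unfolding fint_def F_def by (simp add: inner_commute mult.assoc mult.left_commute[of _ "f _"] integral_mult_right_zero)
 finally show ?thesis .
qed

lemma borel_measurable_cnj [measurable (raw)]:
 "f \<in> borel_measurable M ==> (%x. cnj (f x)) \<in> borel_measurable M"
 by (rule measurable_compose[OF _ borel_measurable_continuous_onI]) (auto intro: continuous_intros)

lemma fint_cnj: "fint (%x. cnj (f x)) xi = cnj (fint f (- xi))"
 unfolding fint_def by (subst Bochner_Integration.integral_cnj[symmetric]) (simp add: exp_cnj)

lemma fint_modulate: "fint (%x. exp (- (\<i> * cplx (x \<bullet> eta))) * f x) xi = fint f (xi + eta)"
proof -
 have "exp (- (\<i> * cplx (x \<bullet> xi))) * exp (- (\<i> * cplx (x \<bullet> eta))) = exp (- (\<i> * cplx (x \<bullet> (xi + eta))))" for x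
  by (simp add: exp_add[symmetric] inner_add_right distrib_left)
 then show ?thesis unfolding fint_def by (simp add: mult.assoc[symmetric])
qed

lemma fint_add: "integrable lborel f ==> integrable lborel g ==> fint (%x. f x + g x) xi = fint f xi + fint g xi"
 unfolding fint_def by (simp add: distrib_left fint_integrable)

lemma fint_diff: "integrable lborel f ==> integrable lborel g ==> fint (%x. f x - g x) xi = fint f xi - fint g xi"
 unfolding fint_def by (simp add: right_diff_distrib fint_integrable)

lemma fint_cmult: "fint (%x. c * f x) xi = c * fint f xi"
 unfolding fint_def by (simp add: mult.left_commute[of _ c])

lemma fint_gauss:
 assumes "c > 0"
 shows "fint (%x. exp (- (\<i> * cplx (x \<bullet> y))) * cplx (exp (- c * (norm x)^2 / 2))) xi
  = cplx (sqrt (2 * pi / c) ^ 3 * exp (- (norm (xi + y))\<^sup>2 / (2 * c)))"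
 unfolding fint_modulate using gauss_fourier[OF assms, of "xi + y"]
 by (simp add: fint_def has_bochner_integral_iff inner_commute)

text \<open>Half of Plancherel's theorem. Multiply \<open>fint f\<close> by a Gaussian of width tending to infinity: the square norm becomes a quadratic form in \<open>f\<close> with a kernel of fixed mass, so the bound is uniform in the width, and Fatou's lemma removes the Gaussian.\<close>

lemma fint_sqnorm_le:
 assumes int: "integrable lborel f" and L2: "f \<in> L2"
 shows "sqnorm (fint f) <= ennreal ((2 * pi)^3) * sqnorm f"
proof -
 have [measurable]: "f \<in> bmeas" using L2 by (rule L2_measurable)
 have main: "(NI xi. ennreal ((norm (fint f xi))^2 * exp (- c * (norm xi)^2 / 2))) <= ennreal ((2 * pi)^3) * sqnorm f"
  if c: "c > 0" for c
 proof -
  define G :: "real^3 => real" where "G xi = exp (- c * (norm xi)^2 / 2)" for xi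
  define K :: "real^3 => real" where "K z = sqrt (2 * pi / c) ^ 3 * exp (- (norm z)\<^sup>2 / (2 * c))" for z
  have [measurable]: "G \<in> bmeas" "K \<in> bmeas" unfolding G_def[abs_def] K_def[abs_def] by measurable
  have K0: "K z \<ge> 0" for z using c by (simp add: K_def)
  have Gint: "integrable lborel G" unfolding G_def by (rule gauss_integrable[OF c])
  define M where "M = (LI x. norm (f x))"
  have M: "norm (fint f xi) <= M" for xi unfolding M_def by (rule norm_fint_le[OF int])
  have M0: "M \<ge> 0" unfolding M_def by simp
  define h where "h xi = cplx (G xi) * cnj (fint f xi)" for xi
  have [measurable]: "h \<in> bmeas" unfolding h_def[abs_def] by measurable
  have hint: "integrable lborel h"
   by (rule Bochner_Integration.integrable_bound[OF integrable_mult_right[OF Gint, of M]])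
     (auto simp: h_def norm_mult M0 G_def intro!: mult_mono M)
  have fh: "fint h x = (LI y. cnj (f y) * cplx (K (y - x)))" for x
  proof -
   let ?E = "%xi. exp (- (\<i> * cplx (xi \<bullet> - x))) * cplx (G xi)"
   have E: "integrable lborel ?E"
    by (rule Bochner_Integration.integrable_bound[OF Gint]) (auto simp: norm_mult)
   have "fint h x = (LI xi. exp (- (\<i> * cplx (xi \<bullet> x))) * (cplx (G xi) * fint (%x. cnj (f x)) (- xi)))"
    by (simp add: fint_def[of h] h_def fint_cnj)
   also have "... = (LI xi. fint (%x. cnj (f x)) xi * ?E xi)"
    by (subst lborel_integral_reflect[symmetric]) (auto simp: G_def mult_ac)
   also have "... = (LI y. cnj (f y) * fint ?E y)"
    using int by (intro fint_mult_formula E) auto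
   also have "... = (LI y. cnj (f y) * cplx (K (y - x)))"
    unfolding G_def fint_gauss[OF c] K_def by simp
   finally show ?thesis .
  qed
  have "ennreal (norm (LI xi. fint f xi * h xi)) = ennreal (norm (LI x. f x * fint h x))"
   using fint_mult_formula[OF int hint] by simp
  also have "... <= (NI x. norm (f x * fint h x))" by (rule ennreal_norm_integral_le)
  also have "... <= (NI x. NI y. ennreal (norm (f x) * norm (f y) * K (x - y)))"
  proof (intro nn_integral_mono)
   fix x
   have "ennreal (norm (f x * fint h x)) = ennreal (norm (f x)) * ennreal (norm (fint h x))"
    by (simp add: norm_mult ennreal_mult)
   also have "... <= ennreal (norm (f x)) * (NI y. norm (cnj (f y) * cplx (K (y - x))))"
    unfolding fh by (intro mult_left_mono ennreal_norm_integral_le) auto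
   also have "... = (NI y. ennreal (norm (f x)) * norm (cnj (f y) * cplx (K (y - x))))"
    by (rule nn_integral_cmult[symmetric]) measurable
   also have "... = (NI y. ennreal (norm (f x) * norm (f y) * K (x - y)))"
   proof (intro nn_integral_cong)
    fix y
    have "K (y - x) = K (x - y)" by (simp add: K_def norm_minus_commute)
    then show "ennreal (norm (f x)) * ennreal (norm (cnj (f y) * cplx (K (y - x)))) = ennreal (norm (f x) * norm (f y) * K (x - y))"
     using K0[of "x - y"] by (simp add: norm_mult ennreal_mult mult.assoc)
   qed
   finally show "ennreal (norm (f x * fint h x)) <= (NI y. ennreal (norm (f x) * norm (f y) * K (x - y)))" .
  qed
  also have "... <= sqnorm f * (NI z. ennreal (K z))"
   unfolding sqnorm_def using K0 by (intro nn_integral_product_le) auto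
  also have "(NI z. ennreal (K z)) = ennreal ((2 * pi)^3)"
  proof -
   have KG: "K = (%z. sqrt (2 * pi / c) ^ 3 * exp (- (1 / c) * (norm z)^2 / 2))" unfolding K_def by (auto simp: fun_eq_iff)
   have "integrable lborel K" unfolding KG using c by (intro integrable_mult_right gauss_integrable) auto
   moreover have "integral\<^sup>L lborel K = (2 * pi)^3"
   proof -
    have "integral\<^sup>L lborel K = sqrt (2 * pi / c) ^ 3 * sqrt (2 * pi / (1 / c)) ^ 3"
     unfolding KG using c gauss_integral[of "1 / c", where 'a="real^3"] by (subst integral_mult_right_zero) simp
    also have "... = sqrt ((2 * pi / c) * (2 * pi / (1 / c))) ^ 3"
     by (simp only: real_sqrt_mult power_mult_distrib)
    also have "(2 * pi / c) * (2 * pi / (1 / c)) = (2 * pi)^2" using c by (simp add: power2_eq_square)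
    also have "sqrt ((2 * pi)^2) = 2 * pi" by (rule real_sqrt_unique) auto
    finally show ?thesis .
   qed
   ultimately show ?thesis using K0 by (simp add: nn_integral_eq_integral)
  qed
  finally have le: "ennreal (norm (LI xi. fint f xi * h xi)) <= ennreal ((2 * pi)^3) * sqnorm f" by (simp add: mult.commute)
  have eq: "fint f xi * h xi = cplx ((norm (fint f xi))^2 * G xi)" for xi
   using complex_norm_square[of "fint f xi"] by (simp add: h_def)
  have "integrable lborel (%xi. (norm (fint f xi))^2 * G xi)"
   by (rule Bochner_Integration.integrable_bound[OF integrable_mult_right[OF Gint, of "M\<^sup>2"]])
     (auto simp: G_def intro!: mult_mono power_mono M)
  then have "(NI xi. ennreal ((norm (fint f xi))^2 * G xi)) = ennreal (LI xi. (norm (fint f xi))^2 * G xi)"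
   by (rule nn_integral_eq_integral) (auto simp: G_def)
  also have "... <= ennreal (norm (LI xi. fint f xi * h xi))"
   unfolding eq integral_complex_of_real by (intro ennreal_leI) simp
  also note le
  finally show ?thesis unfolding G_def .
 qed
 define C where "C n xi = ennreal ((norm (fint f xi))^2 * exp (- (1 / real (Suc n)) * (norm xi)^2 / 2))" for n and xi :: "real^3"
 have [measurable]: "C n \<in> bmeas" for n unfolding C_def[abs_def] by measurable
 have "sqnorm (fint f) = (NI xi. liminf (%n. C n xi))"
  unfolding sqnorm_def
 proof (intro nn_integral_cong lim_imp_Liminf[symmetric])
  fix xi :: "real^3"
  have "(%n. - (1 / real (Suc n)) * (norm xi)^2 / 2) ---> - 0 * (norm xi)^2 / 2"
   by (intro tendsto_intros LIMSEQ_Suc[OF lim_1_over_n]) auto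
  then have "(%n. (norm (fint f xi))^2 * exp (- (1 / real (Suc n)) * (norm xi)^2 / 2)) ---> (norm (fint f xi))\<^sup>2 * exp (- 0 * (norm xi)^2 / 2)"
   by (intro tendsto_mult tendsto_const tendsto_exp)
  then show "(%n. C n xi) ---> ennreal ((norm (fint f xi))^2)"
   unfolding C_def by (intro tendsto_ennrealI) simp
 qed simp
 also have "... <= liminf (%n. (NI xi. C n xi))" by (intro nn_integral_liminf) measurable
 also have "... <= ennreal ((2 * pi)^3) * sqnorm f"
 proof (rule Liminf_le)
  have "(NI xi. C n xi) <= ennreal ((2 * pi)^3) * sqnorm f" for n
   unfolding C_def by (rule main) simp
  then show "\<forall>\<^sub>F n in sequentially. (NI xi. C n xi) <= ennreal ((2 * pi)^3) * sqnorm f" by simp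
 qed simp
 finally show ?thesis .
qed

definition trunc :: "nat => (real^3 => 'b::real_vector) => real^3 => 'b" where
 "trunc n f x = indicator (cball 0 (real n)) x *\<^sub>R f x"

lemma trunc_measurable [measurable]:
 fixes f :: "real^3 => 'b::euclidean_space"
 assumes [measurable]: "f \<in> bmeas"
 shows "trunc n f \<in> bmeas"
proof -
 have [measurable]: "cball (0 :: real^3) (real n) \<in> sets borel" by simp
 show ?thesis unfolding trunc_def[abs_def] by measurable
qed

lemma trunc_L2:
 fixes f :: "real^3 => 'b::euclidean_space"
 shows "f \<in> L2 ==> trunc n f \<in> L2"
 by (rule L2_bound[where f=f and C=1]) (auto simp: trunc_def L2_iff indicator_def)

lemma indicator_L2:
 assumes [measurable]: "A \<in> sets borel" and "emeasure lborel A < \<infinity>"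
 shows "(indicator A :: real^3 => complex) \<in> L2"
proof -
 have "sqnorm (indicator A :: real^3 => complex) = (NI x. indicator A x)"
  unfolding sqnorm_def by (intro nn_integral_cong) (auto simp: indicator_def)
 then show ?thesis using assms by (simp add: L2_iff)
qed

lemma trunc_integrable:
 fixes f :: "real^3 => complex"
 assumes "f \<in> L2" shows "integrable lborel (trunc n f)"
proof -
 have "integrable lborel (%x. indicator (cball 0 (real n)) x * f x)"
  using emeasure_lborel_cball_finite[of "0 :: real^3" "real n"]
  by (intro L2_mult_integrable[OF indicator_L2 assms]) auto
 then show ?thesis
  by (rule Bochner_Integration.integrable_cong[THEN iffD1, rotated 2]) (auto simp: trunc_def indicator_def)
qed

lemma trunc_tail_tendsto:
 fixes f :: "real^3 => 'b::euclidean_space"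
 assumes "f \<in> L2"
 shows "(%n. sqnorm (%x. trunc n f x - f x)) ---> 0"
proof -
 have [measurable]: "f \<in> bmeas" using assms by (rule L2_measurable)
 have "(%n. (NI x. ennreal ((norm (trunc n f x - f x))^2))) ---> (\<integral>\<^sup>+x. 0 \<partial>(lborel :: (real^3) measure))"
 proof (rule nn_integral_dominated_convergence[where w="%x. ennreal ((norm (f x))^2)" and u'="%x. 0" and u="%n x. ennreal ((norm (trunc n f x - f x))^2)"])
  show "(NI x. ennreal ((norm (f x))^2)) < \<infinity>" using assms by (simp add: L2_iff sqnorm_def)
  show "AL x. (%n. ennreal ((norm (trunc n f x - f x))^2)) ---> 0"
  proof (rule AE_I2, rule tendsto_eventually)
   fix x :: "real^3"
   obtain N where N: "norm x <= real N" using real_arch_simple by blast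
   show "\<forall>\<^sub>F n in sequentially. ennreal ((norm (trunc n f x - f x))^2) = 0"
    using eventually_ge_at_top[of N] by eventually_elim (use N in \<open>auto simp: trunc_def indicator_def\<close>)
  qed
 qed (auto simp: trunc_def indicator_def)
 then show ?thesis by (simp add: sqnorm_def)
qed

lemma trunc_diff_le:
 fixes f :: "real^3 => 'b::euclidean_space"
 assumes "n <= m"
 shows "sqnorm (%x. trunc m f x - trunc n f x) <= sqnorm (%x. trunc n f x - f x)"
 by (rule sqnorm_mono) (use assms in \<open>auto simp: trunc_def indicator_def\<close>)

text \<open>The relation between representatives, for one complex component: \<open>g\<close> is the \<open>L2\<close> limit of the Fourier integrals of the truncations of \<open>f\<close>.\<close>

definition ft :: "(real^3 => complex) => (real^3 => complex) => bool" where
 "ft f g \<longleftrightarrow> f \<in> L2 & g \<in> L2 & (%n. sqnorm (%xi. fint (trunc n f) xi - g xi)) ---> 0"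

lemma ft_L2: "ft f g ==> f \<in> L2" "ft f g ==> g \<in> L2"
 by (auto simp: ft_def)

lemma ft_measurable: "ft f g ==> f \<in> bmeas" "ft f g ==> g \<in> bmeas"
 by (auto simp: ft_def L2_iff)

lemma fint_L2: "integrable lborel f ==> f \<in> L2 ==> fint f \<in> L2"
 using fint_sqnorm_le[of f] by (auto simp: L2_iff ennreal_mult_less_top intro: le_less_trans)

text \<open>Truncations are integrable, so the Plancherel bound for Fourier integrals turns their \<open>L2\<close> convergence into a Cauchy property of the transforms.\<close>

lemma ft_exists:
 assumes "f \<in> L2" shows "\<exists>g. ft f g"
proof -
 have [measurable]: "f \<in> bmeas" using assms by (rule L2_measurable)
 have "\<exists>g\<in>L2. (%n. sqnorm (%xi. fint (trunc n f) xi - g xi)) ---> 0"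
 proof (rule L2_complete)
  show "fint (trunc n f) \<in> L2" for n by (intro fint_L2 trunc_integrable trunc_L2 assms)
  show "sqnorm (%x. fint (trunc m f) x - fint (trunc n f) x) <= ennreal ((2 * pi)^3) * sqnorm (%x. trunc n f x - f x)"
   if "n <= m" for n m
  proof -
   have "(%x. fint (trunc m f) x - fint (trunc n f) x) = fint (%x. trunc m f x - trunc n f x)"
    by (simp add: fun_eq_iff fint_diff trunc_integrable assms)
   then have "sqnorm (%x. fint (trunc m f) x - fint (trunc n f) x) <= ennreal ((2 * pi)^3) * sqnorm (%x. trunc m f x - trunc n f x)"
    using fint_sqnorm_le[of "%x. trunc m f x - trunc n f x"] assms
    by (simp only: trunc_integrable trunc_L2 L2_diff Bochner_Integration.integrable_diff)
   also have "... <= ennreal ((2 * pi)^3) * sqnorm (%x. trunc n f x - f x)"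
    by (intro mult_left_mono trunc_diff_le that) auto
   finally show ?thesis .
  qed
  show "(%n. ennreal ((2 * pi)^3) * sqnorm (%x. trunc n f x - f x)) ---> 0"
   using ennreal_tendsto_cmult[OF _ trunc_tail_tendsto[OF assms], of "ennreal ((2 * pi)^3)"] by simp
 qed
 then show ?thesis using assms by (auto simp: ft_def)
qed

lemma L2_limit_unique:
 fixes F :: "nat => real^3 => 'b::euclidean_space"
 assumes [measurable]: "!!n. F n \<in> bmeas" "g \<in> bmeas" "h \<in> bmeas"
  and "(%n. sqnorm (%x. F n x - g x)) ---> 0" "(%n. sqnorm (%x. F n x - h x)) ---> 0"
 shows "AL x. g x = h x"
proof -
 have "(%n. 2 * sqnorm (%x. F n x - g x) + 2 * sqnorm (%x. F n x - h x)) ---> 2 * 0 + 2 * 0"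
  by (intro tendsto_add ennreal_tendsto_cmult assms) auto
 moreover have "sqnorm (%x. g x - h x) <= 2 * sqnorm (%x. F n x - g x) + 2 * sqnorm (%x. F n x - h x)" for n
  using sqnorm_diff_triangle[of g "F n" h] sqnorm_minus_commute[of g "F n"] by simp
 ultimately have "sqnorm (%x. g x - h x) <= 2 * 0 + 2 * 0"
  by (intro LIMSEQ_le_const) auto
 then have "sqnorm (%x. g x - h x) = 0" by simp
 then have "AL x. g x - h x = 0" by (subst (asm) sqnorm_eq_0_iff) auto
 then show ?thesis by simp
qed

lemma ft_unique:
 assumes "ft f g" "ft f h" shows "AL x. g x = h x"
proof (rule L2_limit_unique)
 show "fint (trunc n f) \<in> bmeas" for n using ft_measurable[OF assms(1)] by measurable
qed (use assms in \<open>auto simp: ft_def L2_iff\<close>)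

lemma fint_cong_AE:
 assumes "AL x. f x = g x" "f \<in> bmeas" "g \<in> bmeas"
 shows "fint f = fint g"
 unfolding fint_def[abs_def]
proof (rule ext, rule integral_cong_AE)
 fix xi show "AL x. exp (- (\<i> * cplx (x \<bullet> xi))) * f x = exp (- (\<i> * cplx (x \<bullet> xi))) * g x"
  using assms(1) by eventually_elim simp
qed (use assms in measurable)

lemma ft_cong_AE:
 assumes "ft f g" "AL x. f x = f' x" "AL x. g x = g' x"
  and [measurable]: "f' \<in> bmeas" "g' \<in> bmeas"
 shows "ft f' g'"
proof -
 have [measurable]: "f \<in> bmeas" "g \<in> bmeas" using ft_measurable[OF assms(1)] .
 have 1: "fint (trunc n f) = fint (trunc n f')" for n
  by (rule fint_cong_AE) (use assms(2) in \<open>auto simp: trunc_def elim: eventually_mono\<close>)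
 have "sqnorm (%xi. fint (trunc n f) xi - g xi) = sqnorm (%xi. fint (trunc n f') xi - g' xi)" for n
  unfolding 1 by (rule sqnorm_cong_AE) (use assms(3) in \<open>auto elim: eventually_mono\<close>)
 then show ?thesis using assms L2_cong_AE[of f f'] L2_cong_AE[of g g'] by (auto simp: ft_def)
qed

lemma trunc_add: "trunc n (%x. f x + g x) = (%x. trunc n f x + trunc n g x)"
 by (simp add: trunc_def fun_eq_iff scaleR_add_right)

lemma trunc_cmult: "trunc n (%x. c * f x) = (%x. (c::complex) * trunc n f x)"
 by (simp add: trunc_def fun_eq_iff)

lemma ft_add:
 assumes "ft f g" "ft f' g'"
 shows "ft (%x. f x + f' x) (%x. g x + g' x)"
proof -
 have [measurable]: "f \<in> bmeas" "g \<in> bmeas" "f' \<in> bmeas" "g' \<in> bmeas"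
  using ft_measurable assms by auto
 have "(%n. 2 * sqnorm (%x. fint (trunc n f) x - g x) + 2 * sqnorm (%x. fint (trunc n f') x - g' x)) ---> 2 * 0 + 2 * 0"
  using assms by (intro tendsto_add ennreal_tendsto_cmult) (auto simp: ft_def)
 then have lim: "(%n. 2 * sqnorm (%x. fint (trunc n f) x - g x) + 2 * sqnorm (%x. fint (trunc n f') x - g' x)) ---> 0" by simp
 have "(%n. sqnorm (%xi. fint (trunc n (%x. f x + f' x)) xi - (g xi + g' xi))) ---> 0"
 proof (rule tendsto_sandwich[OF _ _ tendsto_const lim]; intro always_eventually allI)
  fix n
  have "(%xi. fint (trunc n (%x. f x + f' x)) xi - (g xi + g' xi)) = (%xi. (fint (trunc n f) xi - g xi) + (fint (trunc n f') xi - g' xi))"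
   using assms by (auto simp: trunc_add fint_add trunc_integrable ft_L2)
  then show "sqnorm (%xi. fint (trunc n (%x. f x + f' x)) xi - (g xi + g' xi)) <= 2 * sqnorm (%x. fint (trunc n f) x - g x) + 2 * sqnorm (%x. fint (trunc n f') x - g' x)"
   using sqnorm_add_le[of "%xi. fint (trunc n f) xi - g xi" "%xi. fint (trunc n f') xi - g' xi"] by simp
 qed simp
 then show ?thesis using assms by (auto simp: ft_def intro: L2_add)
qed

lemma sqnorm_cmult:
 assumes [measurable]: "f \<in> bmeas"
 shows "sqnorm (%x. c * f x :: complex) = ennreal ((norm c)^2) * sqnorm f"
 unfolding sqnorm_def by (subst nn_integral_cmult[symmetric]) (auto simp: norm_mult power_mult_distrib ennreal_mult)

lemma L2_cmult: "f \<in> L2 ==> (%x. c * f x :: complex) \<in> L2"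
 by (rule L2_bound[where f=f and C="norm c"]) (auto simp: L2_iff norm_mult)

lemma ft_cmult:
 assumes "ft f g" shows "ft (%x. c * f x) (%x. c * g x)"
proof -
 have [measurable]: "f \<in> bmeas" "g \<in> bmeas"
  using ft_measurable assms by auto
 have "(%n. ennreal ((norm c)^2) * sqnorm (%x. fint (trunc n f) x - g x)) ---> ennreal ((norm c)^2) * 0"
  using assms by (intro ennreal_tendsto_cmult) (auto simp: ft_def)
 moreover have "ennreal ((norm c)^2) * sqnorm (%x. fint (trunc n f) x - g x) = sqnorm (%xi. fint (trunc n (%x. c * f x)) xi - c * g xi)" for n
  by (subst sqnorm_cmult[symmetric]) (auto simp: trunc_cmult fint_cmult right_diff_distrib)
 ultimately show ?thesis using assms by (auto simp: ft_def intro: L2_cmult)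
qed

lemma ft_minus: "ft f g ==> ft (%x. - f x) (%x. - g x)"
 using ft_cmult[of f g "-1"] by simp

lemma ft_diff: "ft f g ==> ft f' g' ==> ft (%x. f x - f' x) (%x. g x - g' x)"
 using ft_add[of f g "%x. - f' x" "%x. - g' x"] ft_minus[of f' g'] by simp

lemma ft_fint:
 assumes int: "integrable lborel f" and L2: "f \<in> L2"
 shows "ft f (fint f)"
proof -
 have "(%n. ennreal ((2 * pi)^3) * sqnorm (%x. trunc n f x - f x)) ---> ennreal ((2 * pi)^3) * 0"
  by (intro ennreal_tendsto_cmult trunc_tail_tendsto L2) auto
 then have lim: "(%n. ennreal ((2 * pi)^3) * sqnorm (%x. trunc n f x - f x)) ---> 0" by simp
 have "(%n. sqnorm (%xi. fint (trunc n f) xi - fint f xi)) ---> 0"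
 proof (rule tendsto_sandwich[OF _ _ tendsto_const lim]; intro always_eventually allI)
  fix n
  have "(%xi. fint (trunc n f) xi - fint f xi) = fint (%x. trunc n f x - f x)"
   using assms by (auto simp: fint_diff trunc_integrable)
  then show "sqnorm (%xi. fint (trunc n f) xi - fint f xi) <= ennreal ((2 * pi)^3) * sqnorm (%x. trunc n f x - f x)"
   using fint_sqnorm_le[of "%x. trunc n f x - f x"] assms
   by (simp only: trunc_integrable trunc_L2 L2_diff Bochner_Integration.integrable_diff)
 qed simp
 then show ?thesis using assms by (auto simp: ft_def intro: fint_L2)
qed

lemma ft_cnj:
 assumes "ft f g" shows "ft (%x. cnj (f x)) (%xi. cnj (g (- xi)))"
proof -
 have [measurable]: "f \<in> bmeas" "g \<in> bmeas"
  using ft_measurable assms by auto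
 have tr: "trunc n (%x. cnj (f x)) = (%x. cnj (trunc n f x))" for n by (simp add: trunc_def fun_eq_iff)
 have "sqnorm (%xi. fint (trunc n (%x. cnj (f x))) xi - cnj (g (- xi))) = sqnorm (%xi. fint (trunc n f) xi - g xi)" for n
  unfolding sqnorm_def tr fint_cnj complex_cnj_diff[symmetric] complex_mod_cnj
  by (rule lborel_nn_integral_reflect[of "%xi. ennreal ((norm (fint (trunc n f) xi - g xi))^2)"]) measurable
 moreover have "(%x. cnj (f x)) \<in> L2" using ft_L2[OF assms] by (auto simp: L2_iff sqnorm_def)
 moreover have "(%xi. cnj (g (- xi))) \<in> L2"
  using ft_L2[OF assms] lborel_nn_integral_reflect[of "%xi. ennreal ((norm (g xi))^2)"] by (auto simp: L2_iff sqnorm_def)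
 ultimately show ?thesis using assms by (auto simp: ft_def)
qed

lemma ft_modulate:
 assumes "ft f g" shows "ft (%x. exp (- (\<i> * cplx (x \<bullet> eta))) * f x) (%xi. g (xi + eta))"
proof -
 have [measurable]: "f \<in> bmeas" "g \<in> bmeas"
  using ft_measurable assms by auto
 have tr: "trunc n (%x. exp (- (\<i> * cplx (x \<bullet> eta))) * f x) = (%x. exp (- (\<i> * cplx (x \<bullet> eta))) * trunc n f x)" for n
  by (simp add: trunc_def fun_eq_iff)
 have "sqnorm (%xi. fint (trunc n (%x. exp (- (\<i> * cplx (x \<bullet> eta))) * f x)) xi - g (xi + eta)) = sqnorm (%xi. fint (trunc n f) xi - g xi)" for n
  unfolding sqnorm_def tr fint_modulate
  using lborel_nn_integral_translate[of "%xi. ennreal ((norm (fint (trunc n f) xi - g xi))^2)" eta] by (simp add: add.commute)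
 moreover have "(%x. exp (- (\<i> * cplx (x \<bullet> eta))) * f x) \<in> L2" using ft_L2[OF assms] by (auto simp: L2_iff sqnorm_def norm_mult)
 moreover have "(%xi. g (xi + eta)) \<in> L2"
  using ft_L2[OF assms] lborel_nn_integral_translate[of "%xi. ennreal ((norm (g xi))^2)" eta] by (auto simp: L2_iff sqnorm_def add.commute)
 ultimately show ?thesis using assms by (auto simp: ft_def)
qed

text \<open>The pairing \<open>\<integral> g f' = \<integral> f g'\<close> is Fubini's theorem for truncations; both sides are \<open>L2\<close>-continuous.\<close>

lemma ft_mult_formula:
 assumes "ft f g" "ft f' g'"
 shows "(LI xi. g xi * f' xi) = (LI x. f x * g' x)"
proof -
 note L2 = ft_L2[OF assms(1)] ft_L2[OF assms(2)]
 have 1: "(LI xi. g xi * trunc m f' xi) = (LI x. f x * fint (trunc m f') x)" for m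
 proof (rule LIMSEQ_unique)
  show "(%n. (LI xi. fint (trunc n f) xi * trunc m f' xi)) ---> (LI xi. g xi * trunc m f' xi)"
   using assms by (intro L2_pairing_tendsto) (auto simp: ft_def intro: fint_L2 trunc_integrable trunc_L2)
  have "(LI xi. fint (trunc n f) xi * trunc m f' xi) = (LI x. trunc n f x * fint (trunc m f') x)" for n
   using L2 by (intro fint_mult_formula trunc_integrable)
  moreover have "(%n. (LI x. trunc n f x * fint (trunc m f') x)) ---> (LI x. f x * fint (trunc m f') x)"
   using L2 by (intro L2_pairing_tendsto trunc_tail_tendsto) (auto intro: fint_L2 trunc_integrable trunc_L2)
  ultimately show "(%n. (LI xi. fint (trunc n f) xi * trunc m f' xi)) ---> (LI x. f x * fint (trunc m f') x)"
   by simp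
 qed
 show ?thesis
 proof (rule LIMSEQ_unique)
  show "(%m. (LI xi. g xi * trunc m f' xi)) ---> (LI xi. g xi * f' xi)"
   using L2 L2_pairing_tendsto[of "%m. trunc m f'" f' g] by (simp add: mult.commute trunc_tail_tendsto trunc_L2)
  show "(%m. (LI xi. g xi * trunc m f' xi)) ---> (LI x. f x * g' x)"
   unfolding 1 using assms L2_pairing_tendsto[of "%m. fint (trunc m f')" g' f]
   by (simp add: mult.commute ft_def fint_L2 trunc_integrable trunc_L2)
 qed
qed

section \<open>Test functions\<close>

text \<open>The test functions against which weak divergences are defined.\<close>

definition C1 :: "('a::real_inner => real) => bool" where
 "C1 \<phi> \<longleftrightarrow> (\<exists>G. (\<forall>x. GDERIV \<phi> x :> G x) & continuous_on UNIV G)"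

lemma C1_continuous: "C1 \<phi> ==> continuous_on UNIV \<phi>"
 unfolding C1_def gderiv_def by (meson continuous_at_imp_continuous_on has_derivative_continuous)

lemma C1_const: "C1 (%x. c)"
 unfolding C1_def by (rule exI[of _ "%x. 0"]) (auto simp: GDERIV_const)

lemma C1_mult: assumes "C1 f" "C1 g" shows "C1 (%x. f x * g x)"
proof -
 from assms obtain F G where FG: "!!x. GDERIV f x :> F x" "!!x. GDERIV g x :> G x" "continuous_on UNIV F" "continuous_on UNIV G"
  unfolding C1_def by blast
 then have "GDERIV (%x. f x * g x) x :> f x *\<^sub>R G x + g x *\<^sub>R F x" for x by (intro GDERIV_mult)
 moreover have "continuous_on UNIV (%x. f x *\<^sub>R G x + g x *\<^sub>R F x)"
  by (intro continuous_intros FG C1_continuous assms)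
 ultimately show ?thesis unfolding C1_def by (intro exI[of _ "%x. f x *\<^sub>R G x + g x *\<^sub>R F x"]) auto
qed

lemma C1_prod: "finite I ==> (!!i. i \<in> I ==> C1 (f i)) ==> C1 (%x. \<Prod>i\<in>I. f i x)"
 by (induction I rule: finite_induct) (auto intro: C1_const C1_mult)

definition ramp :: "real => real" where
 "ramp t = (max 0 t)^2 / (1 + (max 0 t)^2)"

lemma ramp_bounds: "0 <= ramp t" "ramp t <= 1"
 by (auto simp: ramp_def divide_le_eq add_pos_nonneg)

lemma ramp_0: "t <= 0 ==> ramp t = 0" by (simp add: ramp_def)

lemma ramp_tendsto: assumes "t > 0" shows "(%n. ramp (real n * t)) ---> 1"
proof -
 have "filterlim (%n. (real n * t)^2) at_top sequentially"
  using assms by (intro filterlim_pow_at_top filterlim_at_top_mult_tendsto_pos[OF tendsto_const _ filterlim_real_sequentially, THEN filterlim_cong[THEN iffD1, OF refl refl, rotated]]) (auto simp: mult.commute)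
 then have "(%n. inverse (1 + (real n * t)^2)) ---> 0"
  by (intro tendsto_inverse_0_at_top filterlim_tendsto_add_at_top[OF tendsto_const])
 then have "(%n. 1 - inverse (1 + (real n * t)^2)) ---> 1 - 0" by (intro tendsto_intros)
 moreover have "1 - inverse (1 + (real n * t)^2) = ramp (real n * t)" for n
 proof -
  have m: "max 0 (real n * t) = real n * t" using assms by simp
  have nz: "1 + (real n * t)^2 \<noteq> 0" using zero_le_power2[of "real n * t"] by linarith
  have "1 - inverse (1 + y) = y / (1 + y)" if "1 + y \<noteq> 0" for y :: real using that by (simp add: field_simps)
  from this[OF nz] show ?thesis unfolding ramp_def m .
 qed
 ultimately show ?thesis by simp
qed

lemma ramp_DERIV: "(ramp has_real_derivative 2 * max 0 t / (1 + (max 0 t)^2)^2) (at t)"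
proof -
 have sq: "((%t::real. (max 0 t)^2) has_real_derivative 2 * max 0 t) (at t)" for t
 proof -
  consider "t > 0" | "t < 0" | "t = 0" by linarith
  then show ?thesis
  proof cases
   case 1
   have "((%t::real. t\<^sup>2) has_real_derivative 2 * t) (at t)" by (auto intro!: derivative_eq_intros)
   then have "((%t::real. (max 0 t)^2) has_real_derivative 2 * t) (at t)"
    by (rule DERIV_cong_ev[THEN iffD2, OF refl _ refl, rotated])
      (use 1 eventually_nhds_in_open[of "{0<..}" t] in \<open>auto elim: eventually_mono\<close>)
   then show ?thesis using 1 by simp
  next
   case 2
   have "((%t::real. 0) has_real_derivative 0) (at t)" by simp
   then have "((%t::real. (max 0 t)^2) has_real_derivative 0) (at t)"
    by (rule DERIV_cong_ev[THEN iffD2, OF refl _ refl, rotated])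
      (use 2 eventually_nhds_in_open[of "{..<0}" t] in \<open>auto elim: eventually_mono\<close>)
   then show ?thesis using 2 by simp
  next
   case 3
   have "((%h::real. (max 0 h)^2 / h) \<longlongrightarrow> 0) (at 0)"
   proof (rule Lim_null_comparison)
    show "\<forall>\<^sub>F h in at 0. norm ((max 0 h)^2 / h) <= \<bar>h::real\<bar>"
     by (intro always_eventually) (auto simp: max_def power2_eq_square)
    show "((%h. \<bar>h::real\<bar>) \<longlongrightarrow> 0) (at 0)" using tendsto_rabs[OF tendsto_ident_at[of "0::real"]] by simp
   qed
   then show ?thesis using 3 by (simp only: DERIV_def) simp
  qed
 qed
 have "1 + (max 0 t)^2 \<noteq> 0" using zero_le_power2[of "max 0 t"] by linarith
 then have "((%t. (max 0 t)^2 / (1 + (max 0 t)^2)) has_real_derivative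
   (2 * max 0 t * (1 + (max 0 t)^2) - (max 0 t)^2 * (0 + 2 * max 0 t)) / ((1 + (max 0 t)^2) * (1 + (max 0 t)^2))) (at t)"
  by (intro DERIV_divide DERIV_add DERIV_const sq)
 moreover have "(2 * max 0 t * (1 + (max 0 t)^2) - (max 0 t)^2 * (0 + 2 * max 0 t)) / ((1 + (max 0 t)^2) * (1 + (max 0 t)^2)) = 2 * max 0 t / (1 + (max 0 t)^2)^2"
  by (simp add: power2_eq_square algebra_simps)
 ultimately show ?thesis by (simp add: ramp_def[abs_def])
qed

lemma C1_ramp: "C1 (%x. ramp (a \<bullet> x + b))"
proof -
 let ?d = "%t. 2 * max 0 t / (1 + (max 0 t)^2)^2 :: real"
 have "GDERIV (%x. a \<bullet> x + b) x :> a" for x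
  unfolding gderiv_def by (auto intro!: derivative_eq_intros simp: inner_commute)
 then have "GDERIV (%x. ramp (a \<bullet> x + b)) x :> ?d (a \<bullet> x + b) *\<^sub>R a" for x
  by (rule GDERIV_DERIV_compose) (rule ramp_DERIV)
 moreover have "continuous_on UNIV (%x. ?d (a \<bullet> x + b) *\<^sub>R a)"
 proof (intro continuous_intros ballI)
  fix x show "(1 + (max 0 (a \<bullet> x + b))^2)^2 \<noteq> 0" using zero_le_power2[of "max 0 (a \<bullet> x + b)"] by (simp add: add_nonneg_eq_0_iff)
 qed
 ultimately show ?thesis unfolding C1_def by (intro exI[of _ "%x. ?d (a \<bullet> x + b) *\<^sub>R a"]) auto
qed

definition box_bump :: "'a::euclidean_space => 'a => nat => 'a => real" where
 "box_bump l u n x = (\<Prod>b\<in>Basis. ramp (real n * (x \<bullet> b - l \<bullet> b)) * ramp (real n * (u \<bullet> b - x \<bullet> b)))"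

lemma C1_box_bump: "C1 (box_bump l u n)"
proof -
 have "C1 (%x. ramp ((real n *\<^sub>R b) \<bullet> x + (- real n * (l \<bullet> b))) * ramp ((- real n *\<^sub>R b) \<bullet> x + real n * (u \<bullet> b)))" for b
  by (intro C1_mult C1_ramp)
 moreover have "ramp ((real n *\<^sub>R b) \<bullet> x + (- real n * (l \<bullet> b))) * ramp ((- real n *\<^sub>R b) \<bullet> x + real n * (u \<bullet> b))
   = ramp (real n * (x \<bullet> b - l \<bullet> b)) * ramp (real n * (u \<bullet> b - x \<bullet> b))" for b x
  by (simp add: inner_commute algebra_simps)
 ultimately show ?thesis unfolding box_bump_def[abs_def] by (intro C1_prod) simp_all
qed

lemma box_bump_outside: assumes "x \<notin> box l u" shows "box_bump l u n x = 0"
proof -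
 from assms obtain b where b: "b \<in> Basis" "x \<bullet> b <= l \<bullet> b \<or> u \<bullet> b <= x \<bullet> b" by (auto simp: box_def not_less)
 then have "ramp (real n * (x \<bullet> b - l \<bullet> b)) * ramp (real n * (u \<bullet> b - x \<bullet> b)) = 0"
  by (auto intro!: ramp_0 simp: mult_le_0_iff)
 then show ?thesis unfolding box_bump_def using b(1) by (auto intro: prod_zero)
qed

lemma box_bump_bounds: "0 <= box_bump l u n x" "box_bump l u n x <= 1"
 unfolding box_bump_def by (auto intro!: prod_nonneg prod_le_1 mult_le_one ramp_bounds mult_nonneg_nonneg)

lemma box_bump_tendsto: "(%n. box_bump l u n x) ---> indicator (box l u) x"
proof (cases "x \<in> box l u")
 case True
 have "(%n. box_bump l u n x) ---> (\<Prod>b\<in>(Basis::'a set). 1 * 1)"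
  unfolding box_bump_def using True by (intro tendsto_prod tendsto_mult ramp_tendsto) (auto simp: box_def)
 then show ?thesis using True by simp
qed (simp add: box_bump_outside)

lemma box_bump_measurable [measurable]: "box_bump l u n \<in> bmeas"
 by (intro borel_measurable_continuous_onI C1_continuous C1_box_bump)

text \<open>Boxes generate the Borel sets, so a density with vanishing integrals over boxes vanishes.\<close>

lemma integral_boxes_zero_imp_AE_zero:
 fixes g :: "'a::euclidean_space => real"
 assumes [measurable]: "g \<in> bmeas"
  and int: "!!l u. integrable lborel (%x. indicator (box l u) x * g x)"
  and zero: "!!l u. (LI x. indicator (box l u) x * g x) = 0"
 shows "AL x. g x = 0"
proof -
 let ?p = "%x. ennreal (g x)" and ?m = "%x. ennreal (- g x)"
 have p_eq: "(NI x. ?p x * indicator (box l u) x) = (NI x. ?m x * indicator (box l u) x)"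
  and p_fin: "(NI x. ?p x * indicator (box l u) x) < \<infinity>" for l u
 proof -
  let ?h = "%x. indicator (box l u) x * g x"
  have e: "?p x * indicator (box l u) x = ennreal (?h x)" "?m x * indicator (box l u) x = ennreal (- ?h x)" for x
   by (auto simp: indicator_def)
  have "integrable lborel ?h" by (rule int)
  then obtain r q where "0 <= r" "0 <= q" "(NI x. ennreal (?h x)) = ennreal r" "(NI x. ennreal (- ?h x)) = ennreal q" "integral\<^sup>L lborel ?h = r - q"
   by (rule integrableE)
  with zero[of l u] show "(NI x. ?p x * indicator (box l u) x) = (NI x. ?m x * indicator (box l u) x)"
   "(NI x. ?p x * indicator (box l u) x) < \<infinity>" unfolding e by auto
 qed
 have "density lborel ?p = density lborel ?m"
 proof (rule measure_eqI_generator_eq[where E="range (%(a, b). box a b :: 'a set)" and \<Omega>=UNIV and A="%n::nat. box (- real n *\<^sub>R One) (real n *\<^sub>R One)"])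
  show "Int_stable (range (%(a, b). box a b :: 'a set))" by (auto simp: Int_stable_def box_Int_box)
  show "(\<Union>n::nat. box (- real n *\<^sub>R One) (real n *\<^sub>R One) :: 'a set) = UNIV" using UN_box_eq_UNIV by simp
  show "emeasure (density lborel ?p) X = emeasure (density lborel ?m) X" if "X \<in> range (%(a, b). box a b :: 'a set)" for X
   using that p_eq by (auto simp: emeasure_density)
  show "emeasure (density lborel ?p) (box (- real n *\<^sub>R One) (real n *\<^sub>R One)) \<noteq> \<infinity>" for n
   using p_fin[of "- real n *\<^sub>R One" "real n *\<^sub>R One"] by (simp add: emeasure_density)
 qed (auto simp: borel_eq_box)
 then have "AL x. ?p x = ?m x" by (intro sigma_finite_measure.density_unique[OF sigma_finite_lborel]) auto
 then show ?thesis
 proof eventually_elim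
  fix x assume "ennreal (g x) = ennreal (- g x)"
  then show "g x = 0" by (cases "g x \<ge> 0") (auto simp: ennreal_neg ennreal_eq_0_iff)
 qed
qed

text \<open>Products of one-dimensional ramps are admissible test functions and converge to indicators of boxes.\<close>

lemma fundamental_lemma_real:
 fixes g :: "real^3 => real"
 assumes g: "g \<in> L2"
  and zero: "!!\<phi>. C1 \<phi> ==> bounded {x. \<phi> x \<noteq> 0} ==> (LI x. g x * \<phi> x) = 0"
 shows "AL x. g x = 0"
proof (rule integral_boxes_zero_imp_AE_zero)
 show [measurable]: "g \<in> bmeas" using g by (rule L2_measurable)
 fix l u :: "real^3"
 have ind: "(indicator (box l u) :: real^3 => real) \<in> L2"
 proof -
  have "sqnorm (indicator (box l u) :: real^3 => real) = (NI x. indicator (box l u) x)"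
   unfolding sqnorm_def by (intro nn_integral_cong) (auto simp: indicator_def)
  then show ?thesis using emeasure_lborel_box_finite[of l u] by (simp add: L2_iff)
 qed
 show int: "integrable lborel (%x. indicator (box l u) x * g x)"
  by (rule L2_mult_integrable[OF ind g])
 have "(%n. (LI x. g x * box_bump l u n x)) ---> (LI x. g x * indicator (box l u) x)"
 proof (rule integral_dominated_convergence[where w="%x. norm (indicator (box l u) x * g x)"])
  show "AL x. (%n. g x * box_bump l u n x) ---> g x * indicator (box l u) x"
   by (intro AE_I2 tendsto_mult tendsto_const box_bump_tendsto)
  show "AL x. norm (g x * box_bump l u n x) <= norm (indicator (box l u) x * g x)" for n
  proof (rule AE_I2)
   fix x show "norm (g x * box_bump l u n x) <= norm (indicator (box l u) x * g x)"
    using box_bump_bounds[of l u n x] box_bump_outside[of x l u n]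
    by (cases "x \<in> box l u") (auto simp: abs_mult mult_left_le)
  qed
 qed (use int in auto)
 moreover have "(LI x. g x * box_bump l u n x) = 0" for n
 proof (rule zero[OF C1_box_bump])
  show "bounded {x. box_bump l u n x \<noteq> 0}"
   by (rule bounded_subset[OF bounded_box[of l u]]) (use box_bump_outside in blast)
 qed
 ultimately have "(LI x. g x * indicator (box l u) x) = 0" by (simp add: LIMSEQ_const_iff)
 then show "(LI x. indicator (box l u) x * g x) = 0" by (simp add: mult.commute)
qed

lemma L2_Re_Im:
 fixes f :: "real^3 => complex"
 assumes "f \<in> L2" shows "(%x. Re (f x)) \<in> L2" "(%x. Im (f x)) \<in> L2"
proof -
 have [measurable]: "f \<in> bmeas" using assms by (rule L2_measurable)
 show "(%x. Re (f x)) \<in> L2" "(%x. Im (f x)) \<in> L2"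
  using abs_Re_le_cmod abs_Im_le_cmod by (auto intro!: L2_bound[OF assms, of _ 1])
qed

lemma L2_of_real:
 assumes "f \<in> L2" shows "(%x. cplx (f x)) \<in> L2"
 using assms by (auto simp: L2_iff sqnorm_def)

lemma C1_compact_bounded:
 fixes \<phi> :: "'a::euclidean_space => real"
 assumes "C1 \<phi>" "bounded {x. \<phi> x \<noteq> 0}"
 obtains M R where "!!x. \<bar>\<phi> x\<bar> <= M" "!!x. norm x > R ==> \<phi> x = 0" "M \<ge> 0"
proof -
 obtain R where R: "!!x. \<phi> x \<noteq> 0 ==> norm x <= R" using assms(2) by (auto simp: bounded_iff)
 have "compact (\<phi> ` cball 0 R)"
  by (intro compact_continuous_image compact_cball continuous_on_subset[OF C1_continuous[OF assms(1)]]) auto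
 then obtain M where M: "!!x. norm x <= R ==> \<bar>\<phi> x\<bar> <= M"
  using compact_imp_bounded by (fastforce simp: bounded_iff)
 have "\<bar>\<phi> x\<bar> <= max 0 M" for x using M[of x] R[of x] by (cases "\<phi> x = 0") auto
 then show ?thesis using that[of "max 0 M" R] R by force
qed

lemma C1_measurable: "C1 (\<phi> :: 'a::euclidean_space => real) ==> \<phi> \<in> bmeas"
 by (intro borel_measurable_continuous_onI C1_continuous)

lemma bounded_support_L2:
 fixes \<phi> :: "real^3 => 'b::euclidean_space"
 assumes [measurable]: "\<phi> \<in> bmeas" and M: "!!x. norm (\<phi> x) <= M" and R: "!!x. norm x > R ==> \<phi> x = 0"
 shows "\<phi> \<in> L2"
proof (rule L2_bound[where C=M])
 show "(indicator (cball 0 R) :: real^3 => complex) \<in> L2"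
  using emeasure_lborel_cball_finite[of "0 :: real^3" R] by (intro indicator_L2) auto
 show "AL x. norm (\<phi> x) <= M * norm (indicator (cball 0 R) x :: complex)"
  using M R by (auto simp: indicator_def not_le)
qed fact

lemma C1_compact_L2:
 fixes \<phi> :: "real^3 => real"
 assumes "C1 \<phi>" "bounded {x. \<phi> x \<noteq> 0}" shows "\<phi> \<in> L2"
 using C1_compact_bounded[OF assms] bounded_support_L2[OF C1_measurable[OF assms(1)]] by (metis real_norm_def)

lemma fundamental_lemma:
 fixes g :: "real^3 => complex"
 assumes g: "g \<in> L2"
  and zero: "!!\<phi>. C1 \<phi> ==> bounded {x. \<phi> x \<noteq> 0} ==> (LI x. g x * cplx (\<phi> x)) = 0"
 shows "AL x. g x = 0"
proof -
 have int: "integrable lborel (%x. g x * cplx (\<phi> x))" if "C1 \<phi>" "bounded {x. \<phi> x \<noteq> 0}" for \<phi>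
  by (intro L2_mult_integrable g L2_of_real C1_compact_L2 that)
 have "AL x. Re (g x) = 0"
 proof (rule fundamental_lemma_real[OF L2_Re_Im(1)[OF g]])
  fix \<phi> :: "real^3 => real" assume \<phi>: "C1 \<phi>" "bounded {x. \<phi> x \<noteq> 0}"
  show "(LI x. Re (g x) * \<phi> x) = 0"
   using zero[OF \<phi>] integral_Re[OF int[OF \<phi>]] by simp
 qed
 moreover have "AL x. Im (g x) = 0"
 proof (rule fundamental_lemma_real[OF L2_Re_Im(2)[OF g]])
  fix \<phi> :: "real^3 => real" assume \<phi>: "C1 \<phi>" "bounded {x. \<phi> x \<noteq> 0}"
  show "(LI x. Im (g x) * \<phi> x) = 0"
   using zero[OF \<phi>] integral_Im[OF int[OF \<phi>]] by simp
 qed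
 ultimately show ?thesis by eventually_elim (simp add: complex_eq_iff)
qed

lemma lborel_integral_scale:
 fixes f :: "'a::euclidean_space => complex"
 assumes [measurable]: "f \<in> bmeas" and c: "c > 0"
 shows "(LI x. f (c *\<^sub>R x)) = cplx (1 / c ^ DIM('a)) * (LI x. f x)"
proof -
 have "(LI x. f x) = (\<integral>x. f x \<partial>(density (distr lborel borel (%x::'a. 0 + c *\<^sub>R x)) (%_. \<bar>c\<bar>^DIM('a))))"
  using lborel_affine[of c "0::'a"] c by simp
 also have "... = (\<integral>x. (\<bar>c\<bar>^DIM('a)) *\<^sub>R f x \<partial>(distr lborel borel (%x::'a. 0 + c *\<^sub>R x)))"
  by (subst integral_density) auto
 also have "... = (LI x. (\<bar>c\<bar>^DIM('a)) *\<^sub>R f (c *\<^sub>R x))"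
  by (subst integral_distr) auto
 also have "... = cplx (c^DIM('a)) * (LI x. f (c *\<^sub>R x))"
  using c by (simp add: scaleR_conv_of_real)
 finally show ?thesis using c by simp
qed

definition gauss :: "real => real^3 => real^3 => complex" where
 "gauss c y x = cplx (exp (- c * (norm (x - y))^2 / 2))"

lemma gauss_measurable [measurable]: "(%(y, x). gauss c y x) \<in> bmeas2"
 "gauss c y \<in> bmeas"
 unfolding gauss_def[abs_def] by measurable

lemma gauss_props:
 assumes c: "c > 0"
 shows gauss_int: "integrable lborel (gauss c y)" and gauss_L2: "gauss c y \<in> L2"
  and gauss_value: "(LI x. gauss c y x) = cplx (sqrt (2 * pi / c) ^ 3)"
proof -
 have 0: "integrable lborel (%x::real^3. exp (- c * (norm x)^2 / 2))" if "c > 0" for c by (rule gauss_integrable[OF that])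
 have tr: "integrable lborel (%x::real^3. exp (- c * (norm (x - y))^2 / 2))" if "c > 0" for c
 proof -
  have "integrable (distr lborel borel ((+) y)) (%x::real^3. exp (- c * (norm (x - y))^2 / 2))"
   using 0[OF that] by (subst integrable_distr_eq) auto
  then show ?thesis by (simp add: lborel_distr_plus)
 qed
 show "integrable lborel (gauss c y)" unfolding gauss_def[abs_def] complex_of_real_integrable_eq by (rule tr[OF c])
 have "integrable lborel (%x. (norm (gauss c y x))^2)"
  using tr[of "2 * c"] c by (simp add: gauss_def exp_double[symmetric])
 then show "gauss c y \<in> L2" by (auto simp: L2_def)
 show "(LI x. gauss c y x) = cplx (sqrt (2 * pi / c) ^ 3)"
  using lborel_integral_translate[of "%x. gauss c 0 x" "- y"] gauss_integral[OF c, where 'a="real^3"]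
  by (simp add: gauss_def)
qed

lemma gauss_fint:
 assumes c: "c > 0"
 shows "fint (gauss c y) xi = cplx (sqrt (2 * pi / c) ^ 3) * (exp (- (\<i> * cplx (xi \<bullet> y))) * gauss (1 / c) 0 xi)"
proof -
 have "fint (gauss c y) xi = (LI x. exp (- (\<i> * cplx ((y + x) \<bullet> xi))) * gauss c y (y + x))"
  unfolding fint_def by (subst lborel_integral_translate) auto
 also have "... = (LI x. exp (- (\<i> * cplx (xi \<bullet> y))) * (exp (- (\<i> * cplx (xi \<bullet> x))) * cplx (exp (- c * (norm x)^2 / 2))))"
 proof (intro Bochner_Integration.integral_cong refl)
  fix x
  have "(y + x) \<bullet> xi = xi \<bullet> y + xi \<bullet> x" by (metis inner_add_left inner_commute)
  then have "exp (- (\<i> * cplx ((y + x) \<bullet> xi))) = exp (- (\<i> * cplx (xi \<bullet> y))) * exp (- (\<i> * cplx (xi \<bullet> x)))"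
   by (simp add: distrib_left exp_add[symmetric])
  then show "exp (- (\<i> * cplx ((y + x) \<bullet> xi))) * gauss c y (y + x) = exp (- (\<i> * cplx (xi \<bullet> y))) * (exp (- (\<i> * cplx (xi \<bullet> x))) * cplx (exp (- c * (norm x)^2 / 2)))"
   by (simp add: gauss_def mult.assoc)
 qed
 also have "... = exp (- (\<i> * cplx (xi \<bullet> y))) * cplx (sqrt (2 * pi / c) ^ 3 * exp (- (norm xi)\<^sup>2 / (2 * c)))"
  using gauss_fourier[OF c, of xi] by (subst integral_mult_right_zero) (simp add: has_bochner_integral_iff)
 also have "... = cplx (sqrt (2 * pi / c) ^ 3) * (exp (- (\<i> * cplx (xi \<bullet> y))) * gauss (1 / c) 0 xi)"
  by (simp add: gauss_def)
 finally show ?thesis .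
qed

lemma gauss_fint_fint:
 assumes c: "c > 0"
 shows "fint (fint (gauss c y)) x = cplx ((2 * pi)^3) * gauss c y (- x)"
proof -
 have "fint (fint (gauss c y)) x = cplx (sqrt (2 * pi / c) ^ 3) *
   fint (%xi. exp (- (\<i> * cplx (xi \<bullet> y))) * cplx (exp (- (1 / c) * (norm xi)^2 / 2))) x"
  unfolding gauss_fint[OF c] fint_cmult by (simp add: gauss_def)
 also have "... = cplx (sqrt (2 * pi / c) ^ 3) * cplx (sqrt (2 * pi / (1 / c)) ^ 3 * exp (- (norm (x + y))\<^sup>2 / (2 * (1 / c))))"
  using c by (subst fint_gauss) auto
 also have "... = cplx (sqrt (2 * pi / c) ^ 3 * sqrt (2 * pi / (1 / c)) ^ 3) * gauss c y (- x)"
 proof -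
  have "norm (- x - y) = norm (x + y)" by (metis minus_add_distrib norm_minus_cancel uminus_add_conv_diff add.commute)
  then show ?thesis by (simp add: gauss_def mult.commute)
 qed
 also have "sqrt (2 * pi / c) ^ 3 * sqrt (2 * pi / (1 / c)) ^ 3 = sqrt ((2 * pi / c) * (2 * pi / (1 / c))) ^ 3"
  by (simp only: real_sqrt_mult power_mult_distrib)
 also have "(2 * pi / c) * (2 * pi / (1 / c)) = (2 * pi)^2" using c by (simp add: power2_eq_square)
 also have "sqrt ((2 * pi)^2) = 2 * pi" by (rule real_sqrt_unique) auto
 finally show ?thesis .
qed

text \<open>Gaussians of width tending to zero, centred at all points, form an approximate identity: orthogonality to them is inherited by all compactly supported test functions.\<close>

lemma orthogonal_gauss_imp_zero:
 assumes f: "f \<in> L2" and orth: "!!c y. c > 0 ==> (LI x. f x * gauss c y x) = 0"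
 shows "AL x. f x = 0"
proof (rule fundamental_lemma[OF f])
 have [measurable]: "f \<in> bmeas" using f by (rule L2_measurable)
 fix \<phi> :: "real^3 => real" assume \<phi>: "C1 \<phi>" "bounded {x. \<phi> x \<noteq> 0}"
 note [measurable] = C1_measurable[OF \<phi>(1)]
 obtain M R where M: "!!x. \<bar>\<phi> x\<bar> <= M" "M \<ge> 0" and R: "!!x. norm x > R ==> \<phi> x = 0" by (rule C1_compact_bounded[OF \<phi>]) blast
 define P where "P x = cplx (\<phi> x)" for x
 have PL2: "P \<in> L2" unfolding P_def[abs_def] by (intro L2_of_real C1_compact_L2 \<phi>)
 have [measurable]: "P \<in> bmeas" unfolding P_def[abs_def] by measurable
 define A where "A h = (LI x. f x * P (x - h))" for h
 have PhL2: "(%x. P (x - h)) \<in> L2" and Phsq: "sqnorm (%x. P (x - h)) = sqnorm P" for h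
 proof -
  show "sqnorm (%x. P (x - h)) = sqnorm P" unfolding sqnorm_def
   using lborel_nn_integral_translate[of "%x. ennreal ((norm (P x))^2)" "- h"] by simp
  then show "(%x. P (x - h)) \<in> L2" using PL2 by (simp add: L2_iff)
 qed
 define C where "C = sqrt (enn2real (sqnorm f * sqnorm P))"
 have AC: "norm (A h) <= C" for h
 proof -
  have "ennreal ((norm (A h))^2) <= sqnorm f * sqnorm P"
   using L2_pairing_bound[OF f PhL2[of h]] unfolding A_def Phsq .
  also have "... = ennreal (enn2real (sqnorm f * sqnorm P))"
   using f PL2 by (simp add: L2_iff ennreal_mult_less_top)
  finally have "(norm (A h))^2 <= enn2real (sqnorm f * sqnorm P)" by simp
  then show ?thesis unfolding C_def by (rule real_le_rsqrt)
 qed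
 have zero: "(LI z. gauss 1 0 z * A ((1 / real (Suc n)) *\<^sub>R z)) = 0" for n
 proof -
  define N where "N = real (Suc n)"
  have N0: "N > 0" by (simp add: N_def)
  define F where "F z x = gauss (N\<^sup>2) 0 z * (f x * P (x - z))" for z x
  have [measurable]: "(%(z, x). F z x) \<in> borel_measurable (lborel \<Otimes>\<^sub>M lborel)" unfolding F_def by measurable
  have gn: "gauss (N\<^sup>2) 0 z = gauss 1 0 (N *\<^sub>R z)" for z by (simp add: gauss_def power_mult_distrib)
  have Ameas: "A \<in> bmeas" unfolding A_def[abs_def] by measurable
  have fin: "(NI z. NI x. norm (F z x)) < \<infinity>"
  proof -
   have "(NI z. NI x. norm (F z x)) <= (NI z. norm (gauss (N\<^sup>2) 0 z) * ennreal C)"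
   proof (intro nn_integral_mono)
    fix z
    have "(NI x. norm (F z x)) = norm (gauss (N\<^sup>2) 0 z) * (NI x. norm (f x) * norm (P (x - z)))"
     unfolding F_def by (subst nn_integral_cmult[symmetric]) (auto simp: norm_mult ennreal_mult)
    also have "(NI x. norm (f x) * norm (P (x - z))) <= ennreal C"
    proof -
     have i: "integrable lborel (%x. norm (f x) * norm (P (x - z)))" by (rule L2_norm_mult_integrable[OF f PhL2])
     have "(NI x. norm (f x) * norm (P (x - z)))^2 <= sqnorm f * sqnorm P"
      using nn_integral_norm_mult_le[of f "%x. P (x - z)"] by (simp add: Phsq)
     also have "... = ennreal (C\<^sup>2)" using f PL2 unfolding C_def by (simp add: L2_iff ennreal_mult_less_top)
     finally have "(ennreal (LI x. norm (f x) * norm (P (x - z))))^2 <= ennreal (C\<^sup>2)"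
      using i by (subst (asm) nn_integral_eq_integral) auto
     then have "(LI x. norm (f x) * norm (P (x - z)))^2 <= C\<^sup>2"
      by (subst (asm) ennreal_power) auto
     then have "(LI x. norm (f x) * norm (P (x - z))) <= C"
      by (rule power2_le_imp_le) (simp add: C_def)
     then show ?thesis using i by (subst nn_integral_eq_integral) (auto intro: ennreal_leI)
    qed
    finally show "(NI x. norm (F z x)) <= norm (gauss (N\<^sup>2) 0 z) * ennreal C" by (simp add: mult_left_mono)
   qed
   also have "... = (NI z. norm (gauss (N\<^sup>2) 0 z)) * ennreal C" by (rule nn_integral_multc) measurable
   also have "... < \<infinity>"
    using gauss_int[of "N\<^sup>2" 0] N0 by (auto simp: integrable_iff_bounded ennreal_mult_less_top)
   finally show ?thesis .
  qed
  have "(LI z. gauss 1 0 z * A ((1 / N) *\<^sub>R z)) = cplx (N ^ 3) * (LI z. gauss (N\<^sup>2) 0 z * A z)"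
   using lborel_integral_scale[of "%z. gauss 1 0 z * A ((1 / N) *\<^sub>R z)" N] Ameas N0 by (simp add: gn field_simps power3_eq_cube)
  also have "(LI z. gauss (N\<^sup>2) 0 z * A z) = (LI z. LI x. F z x)"
   unfolding F_def A_def by simp
  also have "... = (LI x. LI z. F z x)"
  proof (rule lborel_Fubini_swap)
   show "(NI z. NI x. norm (F z x)) < \<infinity>" by (rule fin)
  qed measurable
  also have "... = (LI x. LI y. P y * (f x * gauss (N\<^sup>2) y x))"
  proof (rule Bochner_Integration.integral_cong[OF refl])
   fix x
   show "(LI z. F z x) = (LI y. P y * (f x * gauss (N\<^sup>2) y x))"
    by (subst lborel_integral_diff[symmetric, of _ x]) (auto simp: F_def gauss_def mult_ac)
  qed
  also have "... = (LI y. LI x. P y * (f x * gauss (N\<^sup>2) y x))"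
  proof (rule lborel_Fubini_swap)
   have "(NI y. norm (P y * (f x * gauss (N\<^sup>2) y x))) = (NI z. norm (F z x))" for x
    by (subst lborel_nn_integral_diff[symmetric, of _ x]) (auto simp: F_def gauss_def norm_mult mult_ac)
   then have "(NI x. NI y. norm (P y * (f x * gauss (N\<^sup>2) y x))) = (NI x. NI z. norm (F z x))"
    by simp
   also have "... = (NI z. NI x. norm (F z x))"
    by (rule lborel_pair.Fubini') measurable
   finally show "(NI x. NI y. norm (P y * (f x * gauss (N\<^sup>2) y x))) < \<infinity>"
    using fin by simp
  qed (unfold gauss_def, measurable)
  also have "... = 0" using orth[of "N\<^sup>2"] N0 by simp
  finally show ?thesis by (simp add: N_def)
 qed
 have "(%n. (LI z. gauss 1 0 z * A ((1 / real (Suc n)) *\<^sub>R z))) ---> (LI z. gauss 1 0 z * A 0)"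
 proof (rule integral_dominated_convergence[where w="%z. norm (gauss 1 0 z) * C"])
  show "integrable lborel (%z. norm (gauss 1 0 z) * C)"
   using gauss_int[of 1 0] by (intro integrable_mult_left integrable_norm) auto
  have [measurable]: "A \<in> bmeas" unfolding A_def[abs_def] by measurable
  show "(%z. gauss 1 0 z * A 0) \<in> borel_measurable lborel" "(%z. gauss 1 0 z * A ((1 / real (Suc n)) *\<^sub>R z)) \<in> borel_measurable lborel" for n
   by measurable
  show "AL z. norm (gauss 1 0 z * A ((1 / real (Suc n)) *\<^sub>R z)) <= norm (gauss 1 0 z) * C" for n
   by (rule AE_I2) (simp add: norm_mult mult_left_mono AC del: of_nat_Suc)
  show "AL z. (%n. gauss 1 0 z * A ((1 / real (Suc n)) *\<^sub>R z)) ---> gauss 1 0 z * A 0"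
  proof (rule AE_I2, rule tendsto_mult[OF tendsto_const])
   fix z :: "real^3"
   let ?I = "indicator (cball 0 (R + norm z)) :: real^3 => complex"
   have IL2: "?I \<in> L2" using emeasure_lborel_cball_finite[of "0 :: real^3" "R + norm z"] by (intro indicator_L2) auto
   have lim: "(%n. (1 / real (Suc n)) *\<^sub>R z) ---> 0 *\<^sub>R z"
    by (intro tendsto_scaleR tendsto_const LIMSEQ_Suc[OF lim_1_over_n])
   have "(%n. (LI x. f x * P (x - (1 / real (Suc n)) *\<^sub>R z))) ---> (LI x. f x * P (x - 0))"
   proof (rule integral_dominated_convergence[where w="%x. norm (f x) * norm (?I x) * M"])
    show "integrable lborel (%x. norm (f x) * norm (?I x) * M)"
     by (intro integrable_mult_left L2_norm_mult_integrable f IL2)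
    show "AL x. (%n. f x * P (x - (1 / real (Suc n)) *\<^sub>R z)) ---> f x * P (x - 0)"
    proof (rule AE_I2, rule tendsto_mult[OF tendsto_const])
     fix x
     have "isCont P (x - 0)" unfolding P_def[abs_def]
      using C1_continuous[OF \<phi>(1)] by (auto intro!: continuous_intros simp: continuous_on_eq_continuous_at)
     moreover have "(%n. x - (1 / real (Suc n)) *\<^sub>R z) ---> x - 0"
      using lim by (intro tendsto_intros) simp
     ultimately show "(%n. P (x - (1 / real (Suc n)) *\<^sub>R z)) ---> P (x - 0)" by (rule isCont_tendsto_compose)
    qed
    show "AL x. norm (f x * P (x - (1 / real (Suc n)) *\<^sub>R z)) <= norm (f x) * norm (?I x) * M" for n
    proof (rule AE_I2)
     fix x
     have "norm (P (x - (1 / real (Suc n)) *\<^sub>R z)) <= norm (?I x) * M"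
     proof (cases "norm x <= R + norm z")
      case True then show ?thesis using M(1) by (simp add: P_def)
     next
      case False
      have "norm ((1 / real (Suc n)) *\<^sub>R z) <= norm z" by (simp add: divide_le_eq mult_left_le mult_le_cancel_left1 del: of_nat_Suc)
      then have "norm (x - (1 / real (Suc n)) *\<^sub>R z) > R" using False norm_triangle_ineq2[of x "(1 / real (Suc n)) *\<^sub>R z"] by linarith
      then have "\<phi> (x - (1 / real (Suc n)) *\<^sub>R z) = 0" by (rule R)
      then show ?thesis using M(2) by (simp add: P_def)
     qed
     then show "norm (f x * P (x - (1 / real (Suc n)) *\<^sub>R z)) <= norm (f x) * norm (?I x) * M"
      by (simp only: norm_mult mult.assoc) (rule mult_left_mono, auto)
    qed
   qed measurable
   then show "(%n. A ((1 / real (Suc n)) *\<^sub>R z)) ---> A 0" by (simp only: A_def)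
  qed
 qed
 then have "(LI z. gauss 1 0 z * A 0) = 0" unfolding zero by (simp add: LIMSEQ_const_iff)
 then have "A 0 = 0" using gauss_value[of 1 0] by simp
 then show "(LI x. f x * cplx (\<phi> x)) = 0" by (simp add: A_def P_def)
qed

section \<open>Inversion and Plancherel\<close>

text \<open>The difference of both sides is orthogonal to all translated Gaussians, because inversion is known for these and the multiplication formula transfers it.\<close>

lemma ft_inversion:
 assumes "ft f g"
 shows "ft g (%x. cplx ((2 * pi)^3) * f (- x))"
proof -
 have [measurable]: "f \<in> bmeas" "g \<in> bmeas" using ft_measurable[OF assms] .
 obtain h where h: "ft g h" using ft_exists ft_L2[OF assms] by blast
 define k where "k x = cplx ((2 * pi)^3) * f (- x)" for x
 have [measurable]: "k \<in> bmeas" unfolding k_def[abs_def] by measurable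
 have fr: "(%x. f (- x)) \<in> L2"
  using ft_L2(1)[OF assms] lborel_nn_integral_reflect[of "%x. ennreal ((norm (f x))^2)"] by (simp add: L2_iff sqnorm_def)
 have kL2: "k \<in> L2" unfolding k_def[abs_def] by (rule L2_cmult[OF fr])
 have "AL x. h x - k x = 0"
 proof (rule orthogonal_gauss_imp_zero)
  show "(%x. h x - k x) \<in> L2" using ft_L2[OF h] kL2 by (intro L2_diff)
  fix c :: real and y assume c: "c > 0"
  have g1: "ft (gauss c y) (fint (gauss c y))" by (rule ft_fint[OF gauss_int[OF c] gauss_L2[OF c]])
  have Gi: "integrable lborel (fint (gauss c y))"
  proof -
   have "integrable lborel (%xi. cplx (sqrt (2 * pi / c) ^ 3) * (exp (- (\<i> * cplx (xi \<bullet> y))) * gauss (1 / c) 0 xi))"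
    using gauss_int[of "1 / c" 0] c
    by (intro integrable_mult_right Bochner_Integration.integrable_bound[OF gauss_int[of "1 / c" 0]]) (auto simp: norm_mult)
   then show ?thesis unfolding gauss_fint[OF c, abs_def] .
  qed
  have g2: "ft (fint (gauss c y)) (%x. cplx ((2 * pi)^3) * gauss c y (- x))"
   using ft_fint[OF Gi ft_L2(2)[OF g1]] unfolding gauss_fint_fint[OF c, abs_def] .
  have "(LI x. h x * gauss c y x) = (LI x. g x * fint (gauss c y) x)"
   by (rule ft_mult_formula[OF h g1])
  also have "... = (LI x. f x * (cplx ((2 * pi)^3) * gauss c y (- x)))"
   by (rule ft_mult_formula[OF assms g2])
  also have "... = (LI x. k x * gauss c y x)"
   by (subst lborel_integral_reflect[symmetric]) (auto simp: k_def mult_ac)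
  finally have "(LI x. h x * gauss c y x) = (LI x. k x * gauss c y x)" .
  then show "(LI x. (h x - k x) * gauss c y x) = 0"
   using ft_L2[OF h] kL2 gauss_L2[OF c, of y] by (simp add: left_diff_distrib L2_mult_integrable)
 qed
 then show ?thesis
  by (intro ft_cong_AE[OF h]) (auto simp: k_def elim: eventually_mono)
qed

lemma L2_cnj: "f \<in> L2 ==> (%x. cnj (f x)) \<in> L2" by (auto simp: L2_iff sqnorm_def)

lemma ft_cnj_inversion:
 assumes "ft f g" shows "ft (%xi. cnj (g xi)) (%x. cplx ((2 * pi)^3) * cnj (f x))"
 using ft_cnj[OF ft_inversion[OF assms]] by simp

lemma ft_parseval:
 assumes "ft f g" "ft f' g'"
 shows "(LI xi. g xi * cnj (g' xi)) = cplx ((2 * pi)^3) * (LI x. f x * cnj (f' x))"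
 using ft_mult_formula[OF assms(1) ft_cnj_inversion[OF assms(2)]]
 by (simp only: mult.left_commute[of _ "cplx ((2 * pi)^3)"] integral_mult_right_zero)

lemma ft_parseval_bilinear:
 assumes "ft f g" "ft f' g'"
 shows "(LI xi. g xi * g' (- xi)) = cplx ((2 * pi)^3) * (LI x. f x * f' x)"
 using ft_parseval[OF assms(1) ft_cnj[OF assms(2)]] by simp

lemma sqnorm_eq_integral:
 assumes "f \<in> L2" shows "sqnorm f = ennreal (LI x. (norm (f x))^2)"
 unfolding sqnorm_def using assms by (intro nn_integral_eq_integral) (auto simp: L2_def)

lemma ft_plancherel:
 assumes "ft f g" shows "sqnorm g = ennreal ((2 * pi)^3) * sqnorm f"
proof -
 have "cplx (LI xi. (norm (g xi))^2) = cplx ((2 * pi)^3 * (LI xi. (norm (f xi))^2))"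
  using ft_parseval[OF assms assms] by (simp add: complex_norm_square[symmetric] del: of_real_power)
 then have "(LI xi. (norm (g xi))^2) = (2 * pi)^3 * (LI xi. (norm (f xi))^2)"
  by (simp only: of_real_eq_iff)
 then show ?thesis using ft_L2[OF assms] by (simp add: sqnorm_eq_integral ennreal_mult del: power_mult_distrib)
qed

text \<open>Inversion read backwards: conjugate, transform, conjugate.\<close>

lemma ft_surj:
 assumes "g \<in> L2" shows "\<exists>f. ft f g"
proof -
 obtain h where h: "ft (%xi. cnj (g xi)) h" using ft_exists[OF L2_cnj[OF assms]] by blast
 from ft_cnj_inversion[OF h] have "ft (%x. cplx (1 / (2 * pi)^3) * cnj (h x)) (%xi. cplx (1 / (2 * pi)^3) * (cplx ((2 * pi)^3) * g xi))"
  by (intro ft_cmult) simp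
 then show ?thesis by (auto simp: field_simps)
qed

lemma ft_inj:
 assumes "ft f g" "ft f' g" shows "AL x. f x = f' x"
proof -
 have "ft (%x. f x - f' x) (%x. g x - g x)" by (rule ft_diff[OF assms])
 then have *: "ft (%x. f x - f' x) (%x. 0)" by simp
 have "\<not> pi <= 0" using pi_gt_zero by linarith
 with ft_plancherel[OF *] have "sqnorm (%x. f x - f' x) = 0"
  by (auto simp: sqnorm_def[of "%x. 0"] ennreal_eq_0_iff)
 then show ?thesis using ft_measurable[OF *] by (subst (asm) sqnorm_eq_0_iff) auto
qed

section \<open>Products and derivatives\<close>

text \<open>At each \<open>xi\<close> the convolution is a pairing of \<open>U\<close> with the reflected translate of \<open>V\<close>, hence by Parseval a Fourier integral of \<open>u * v\<close>.\<close>

lemma ft_mult: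
 assumes u: "ft u U" and v: "ft v V" and uv: "(%x. u x * v x) \<in> L2"
 shows "ft (%x. u x * v x) (%xi. cplx (1 / (2 * pi)^3) * (LI eta. U (xi - eta) * V eta))"
proof -
 have [measurable]: "U \<in> bmeas" "V \<in> bmeas" using ft_measurable u v by auto
 have int: "integrable lborel (%x. u x * v x)" by (intro L2_mult_integrable ft_L2[OF u] ft_L2[OF v])
 have "fint (%x. u x * v x) xi = cplx (1 / (2 * pi)^3) * (LI eta. U (xi - eta) * V eta)" for xi
 proof -
  have "cplx ((2 * pi)^3) * fint (%x. u x * v x) xi = cplx ((2 * pi)^3) * (LI x. u x * (exp (- (\<i> * cplx (x \<bullet> xi))) * v x))"
   unfolding fint_def by (simp add: mult.left_commute)
  also have "... = (LI eta. U eta * V (- eta + xi))"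
   by (rule ft_parseval_bilinear[OF u ft_modulate[OF v], symmetric])
  also have "... = (LI eta. U (xi - eta) * V eta)"
   by (subst lborel_integral_diff[symmetric, of _ xi]) auto
  finally have e: "cplx ((2 * pi)^3) * fint (%x. u x * v x) xi = (LI eta. U (xi - eta) * V eta)" .
  have "cplx (1 / (2 * pi)^3) * cplx ((2 * pi)^3) = 1"
   by (simp only: of_real_mult[symmetric]) simp
  then show ?thesis unfolding e[symmetric] mult.assoc[symmetric] by simp
 qed
 then have "fint (%x. u x * v x) = (%xi. cplx (1 / (2 * pi)^3) * (LI eta. U (xi - eta) * V eta))" by (rule ext)
 then show ?thesis using ft_fint[OF int uv] by (simp only:)
qed

lemma AE_lborel_reflect:
 assumes "AL x. P (x :: 'a::euclidean_space)" shows "AL x. P (- x)"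
proof -
 obtain N where N: "N \<in> null_sets lborel" "{x. \<not> P x} \<subseteq> N"
  using assms by (auto simp: eventually_ae_filter)
 have "uminus -` N \<in> sets borel" using N(1) measurable_sets[of "uminus" borel borel N] by auto
 then have "uminus -` N \<in> null_sets lborel"
  using N(1) by (subst (asm) lborel_distr_uminus_euclidean[symmetric]) (auto simp: null_sets_def emeasure_distr)
 then show ?thesis using N(2) by (auto simp: eventually_ae_filter intro!: bexI[of _ "uminus -` N"])
qed

lemma ft_bounded:
 assumes u: "ft u U" and int: "integrable lborel U"
 shows "AL x. norm (u x) <= (LI xi. norm (U xi))"
proof -
 have "AL x. cplx ((2 * pi)^3) * u (- x) = fint U x"
  by (rule ft_unique[OF ft_inversion[OF u] ft_fint[OF int ft_L2(2)[OF u]]])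
 then have "AL x. norm (u (- x)) <= (LI xi. norm (U xi))"
 proof eventually_elim
  fix x assume "cplx ((2 * pi)^3) * u (- x) = fint U x"
  then have "(2 * pi)^3 * norm (u (- x)) = norm (fint U x)" by (metis abs_of_nonneg norm_mult norm_of_real pi_ge_zero zero_le_mult_iff zero_le_numeral zero_le_power)
  also have "... <= (LI xi. norm (U xi))" by (rule norm_fint_le[OF int])
  finally have "(2 * pi)^3 * norm (u (- x)) <= (LI xi. norm (U xi))" .
  moreover have "1 * norm (u (- x)) <= (2 * pi)^3 * norm (u (- x))"
   using pi_gt3 by (intro mult_right_mono one_le_power) auto
  ultimately show "norm (u (- x)) <= (LI xi. norm (U xi))" by simp
 qed
 from AE_lborel_reflect[OF this] show ?thesis by simp
qed

lemma ft_product_L2: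
 assumes u: "ft u U" and int: "integrable lborel U" and v: "v \<in> L2"
 shows "(%x. u x * v x) \<in> L2"
proof (rule L2_bound[OF v])
 show "(%x. u x * v x) \<in> bmeas" using ft_measurable[OF u] L2_measurable[OF v] by measurable
 show "AL x. norm (u x * v x) <= (LI xi. norm (U xi)) * norm (v x)"
  using ft_bounded[OF u int] by eventually_elim (simp add: norm_mult mult_right_mono)
qed

lemma ft_real_imp:
 assumes "ft (%x. cplx (u x)) U" shows "AL xi. U (- xi) = cnj (U xi)"
proof -
 have "AL xi. U xi = cnj (U (- xi))" using ft_unique[OF assms] ft_cnj[OF assms] by simp
 then show ?thesis by eventually_elim (metis complex_cnj_cnj)
qed

text \<open>Hermitian symmetry of the transform is equivalent to reality of the function; the imaginary part is null and may be dropped.\<close>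

lemma ft_real_exists:
 assumes U: "U \<in> L2" and sym: "AL xi. U (- xi) = cnj (U xi)"
 shows "\<exists>u. ft (%x. cplx (u x)) U & u \<in> bmeas"
proof -
 obtain f where f: "ft f U" using ft_surj[OF U] by blast
 note [measurable] = ft_measurable[OF f]
 have "ft (%x. cnj (f x)) U"
  by (rule ft_cong_AE[OF ft_cnj[OF f]]) (use sym in \<open>auto elim!: eventually_mono\<close>)
 from ft_inj[OF this f] have "AL x. f x = cplx (Re (f x))"
  by eventually_elim (metis complex_cnj_cancel_iff Reals_cnj_iff complex_is_Real_iff of_real_Re)
 then have "ft (%x. cplx (Re (f x))) U" by (intro ft_cong_AE[OF f]) auto
 then show ?thesis by (intro exI[of _ "%x. Re (f x)"]) auto
qed

lemma GDERIV_directional: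
 assumes "GDERIV \<phi> (x + t *\<^sub>R b) :> G"
 shows "((%t. \<phi> (x + t *\<^sub>R b)) has_real_derivative G \<bullet> b) (at t)"
proof -
 have "(\<phi> has_derivative (%h. h \<bullet> G)) (at (x + t *\<^sub>R b))" using assms by (simp add: gderiv_def)
 moreover have "((%t. x + t *\<^sub>R b) has_derivative (%t. t *\<^sub>R b)) (at t)" by (auto intro!: derivative_eq_intros)
 ultimately have "((%t. \<phi> (x + t *\<^sub>R b)) has_derivative (%t. (t *\<^sub>R b) \<bullet> G)) (at t)"
  using diff_chain_at[of "%t. x + t *\<^sub>R b" "%t. t *\<^sub>R b" t \<phi> "%h. h \<bullet> G"] by (simp add: o_def)
 then show ?thesis unfolding has_field_derivative_def
  by (rule has_derivative_eq_rhs) (auto simp: fun_eq_iff inner_commute mult.commute)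
qed

lemma fint_gradient:
 fixes \<phi> :: "real^3 => real"
 assumes G: "!!x. GDERIV \<phi> x :> G x" "continuous_on UNIV G" and bd: "bounded {x. \<phi> x \<noteq> 0}" and b: "norm b = 1"
 shows "fint (%x. cplx (G x \<bullet> b)) xi = \<i> * cplx (xi \<bullet> b) * fint (%x. cplx (\<phi> x)) xi"
  and "(%x. cplx (G x \<bullet> b)) \<in> L2" and "integrable lborel (%x. cplx (G x \<bullet> b))"
proof -
 have C1: "C1 \<phi>" unfolding C1_def using G by blast
 note [measurable] = C1_measurable[OF C1]
 have [measurable]: "G \<in> bmeas" by (intro borel_measurable_continuous_onI G)
 obtain M R where M: "!!x. \<bar>\<phi> x\<bar> <= M" "M \<ge> 0" and R: "!!x. norm x > R ==> \<phi> x = 0" by (rule C1_compact_bounded[OF C1 bd]) blast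
 define h where "h n = 1 / real (Suc n)" for n
 have h0: "h n > 0" "h n <= 1" for n by (auto simp: h_def)
 have hlim: "h ---> 0" unfolding h_def[abs_def] by (rule LIMSEQ_Suc[OF lim_1_over_n])
 define D where "D n x = (\<phi> (x + h n *\<^sub>R b) - \<phi> x) / h n" for n x
 have [measurable]: "D n \<in> bmeas" for n unfolding D_def[abs_def] by measurable
 have Dlim: "(%n. D n x) ---> G x \<bullet> b" for x
 proof -
  have "((%t. \<phi> (x + t *\<^sub>R b)) has_real_derivative G x \<bullet> b) (at 0)" using G(1)[of x] by (intro GDERIV_directional) simp
  then have "((%t. (\<phi> (x + t *\<^sub>R b) - \<phi> x) / t) \<longlongrightarrow> G x \<bullet> b) (at 0)" by (simp add: DERIV_def)
  moreover have "filterlim h (at 0) sequentially" using hlim h0(1) by (auto simp: filterlim_at intro!: always_eventually less_imp_neq[THEN not_sym])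
  ultimately show ?thesis unfolding D_def by (rule filterlim_compose)
 qed
 have "compact (G ` cball 0 (R + 2))" by (intro compact_continuous_image compact_cball continuous_on_subset[OF G(2)]) auto
 then obtain M' where M': "!!x. norm x <= R + 2 ==> norm (G x) <= M'" using compact_imp_bounded by (fastforce simp: bounded_iff)
 have Dbd: "\<bar>D n x\<bar> <= max 0 M' * indicator (cball 0 (R + 1)) x" for n x
 proof (cases "norm x <= R + 1")
  case True
  have "\<exists>z. 0 < z & z < h n & \<phi> (x + h n *\<^sub>R b) - \<phi> (x + 0 *\<^sub>R b) = (h n - 0) * (G (x + z *\<^sub>R b) \<bullet> b)"
   by (rule MVT2) (auto simp: h0 intro!: GDERIV_directional G)
  then obtain z where z: "0 < z" "z < h n" "\<phi> (x + h n *\<^sub>R b) - \<phi> x = h n * (G (x + z *\<^sub>R b) \<bullet> b)" by auto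
  then have "D n x = G (x + z *\<^sub>R b) \<bullet> b" using h0(1)[of n] by (simp add: D_def)
  also have "\<bar>...\<bar> <= norm (G (x + z *\<^sub>R b))" using Cauchy_Schwarz_ineq2[of "G (x + z *\<^sub>R b)" b] b by simp
  also have "... <= M'"
  proof (rule M')
   have "norm (x + z *\<^sub>R b) <= norm x + z" using norm_triangle_ineq[of x "z *\<^sub>R b"] b z(1) by simp
   then show "norm (x + z *\<^sub>R b) <= R + 2" using True z(2) h0(2)[of n] by linarith
  qed
  finally show ?thesis using True by (simp add: indicator_def)
 next
  case False
  have "norm (x + h n *\<^sub>R b) > R"
   using norm_triangle_ineq2[of x "- (h n *\<^sub>R b)"] b h0[of n] False by simp
  then show ?thesis using False R[of x] R[of "x + h n *\<^sub>R b"] by (simp add: D_def indicator_def)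
 qed
 have Gbd: "\<bar>G x \<bullet> b\<bar> <= max 0 M' * indicator (cball 0 (R + 1)) x" for x
  by (rule LIMSEQ_le_const2[OF tendsto_rabs[OF Dlim]]) (use Dbd in blast)
 have ballint: "integrable lborel (%x. max 0 M' * indicator (cball (0 :: real^3) (R + 1)) x :: real)"
  using emeasure_lborel_cball_finite[of "0 :: real^3" "R + 1"] by (intro integrable_mult_right) auto
 show GL2: "(%x. cplx (G x \<bullet> b)) \<in> L2"
 proof (rule bounded_support_L2[where M="max 0 M'" and R="R + 1"])
  show "norm (cplx (G x \<bullet> b)) <= max 0 M'" for x
   using Gbd[of x] by (cases "norm x <= R + 1") (auto simp: indicator_def)
  show "cplx (G x \<bullet> b) = 0" if "norm x > R + 1" for x
   using Gbd[of x] that by (auto simp: indicator_def)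
 qed measurable
 show "integrable lborel (%x. cplx (G x \<bullet> b))"
 proof (rule Bochner_Integration.integrable_bound[OF ballint])
  have "norm (cplx (G x \<bullet> b)) <= norm (max 0 M' * indicator (cball 0 (R + 1)) x)" for x
   unfolding norm_of_real real_norm_def by (rule order_trans[OF Gbd abs_ge_self])
  then show "AL x. norm (cplx (G x \<bullet> b)) <= norm (max 0 M' * indicator (cball 0 (R + 1)) x)" by simp
 qed measurable
 have phi_int: "integrable lborel (%x. cplx (\<phi> x))"
 proof (rule Bochner_Integration.integrable_bound)
  show "integrable lborel (%x. M * indicator (cball (0 :: real^3) R) x :: real)"
   using emeasure_lborel_cball_finite[of "0 :: real^3" R] by (intro integrable_mult_right) auto
 qed (use M R in \<open>auto simp: indicator_def not_le\<close>)
 have tr_int: "integrable lborel (%x. cplx (\<phi> (x + h n *\<^sub>R b)))" for n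
 proof -
  have "integrable (distr lborel borel ((+) (- h n *\<^sub>R b))) (%x. cplx (\<phi> (x + h n *\<^sub>R b)))"
   using phi_int by (subst integrable_distr_eq) auto
  then show ?thesis by (simp only: lborel_distr_plus)
 qed
 have "fint (%x. cplx (D n x)) xi = ((exp (\<i> * cplx (h n * (xi \<bullet> b))) - 1) / cplx (h n)) * fint (%x. cplx (\<phi> x)) xi" for n
 proof -
  have "fint (%x. cplx (\<phi> (x + h n *\<^sub>R b))) xi = exp (\<i> * cplx (h n * (xi \<bullet> b))) * fint (%x. cplx (\<phi> x)) xi"
  proof -
   have "fint (%x. cplx (\<phi> (x + h n *\<^sub>R b))) xi = (LI x. exp (- (\<i> * cplx ((- h n *\<^sub>R b + x) \<bullet> xi))) * cplx (\<phi> ((- h n *\<^sub>R b + x) + h n *\<^sub>R b)))"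
    unfolding fint_def by (rule lborel_integral_translate[symmetric]) measurable
   also have "... = (LI x. exp (\<i> * cplx (h n * (xi \<bullet> b))) * (exp (- (\<i> * cplx (x \<bullet> xi))) * cplx (\<phi> x)))"
   proof (rule Bochner_Integration.integral_cong[OF refl])
    fix x
    have "(- h n *\<^sub>R b + x) \<bullet> xi = - (h n * (xi \<bullet> b)) + x \<bullet> xi" by (simp add: inner_add_left inner_diff_left inner_commute[of b])
    then have "exp (- (\<i> * cplx ((- h n *\<^sub>R b + x) \<bullet> xi))) = exp (\<i> * cplx (h n * (xi \<bullet> b))) * exp (- (\<i> * cplx (x \<bullet> xi)))"
     by (simp only: exp_add[symmetric]) (simp add: algebra_simps)
    then show "exp (- (\<i> * cplx ((- h n *\<^sub>R b + x) \<bullet> xi))) * cplx (\<phi> ((- h n *\<^sub>R b + x) + h n *\<^sub>R b)) = exp (\<i> * cplx (h n * (xi \<bullet> b))) * (exp (- (\<i> * cplx (x \<bullet> xi))) * cplx (\<phi> x))"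
     by simp
   qed
   finally show ?thesis by (simp only: integral_mult_right_zero fint_def)
  qed
  moreover have "(%x. cplx (D n x)) = (%x. cplx (1 / h n) * (cplx (\<phi> (x + h n *\<^sub>R b)) - cplx (\<phi> x)))"
   by (simp add: D_def fun_eq_iff)
  ultimately show ?thesis by (simp only: fint_cmult fint_diff phi_int tr_int) (simp add: algebra_simps diff_divide_distrib)
 qed
 note e1 = this
 have l1: "(%n. ((exp (\<i> * cplx (h n * (xi \<bullet> b))) - 1) / cplx (h n)) * fint (%x. cplx (\<phi> x)) xi) ---> (\<i> * cplx (xi \<bullet> b)) * fint (%x. cplx (\<phi> x)) xi"
 proof (intro tendsto_mult tendsto_const)
  have "((%z. exp (\<i> * (z * cplx (xi \<bullet> b)))) has_field_derivative \<i> * cplx (xi \<bullet> b)) (at 0)"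
   by (auto intro!: derivative_eq_intros)
  then have A: "((%z. (exp (\<i> * (z * cplx (xi \<bullet> b))) - 1) / z) \<longlongrightarrow> \<i> * cplx (xi \<bullet> b)) (at 0)" by (simp add: DERIV_def)
  have "(%n. cplx (h n)) ---> cplx 0" using hlim by (rule tendsto_of_real)
  moreover have "cplx (h n) \<noteq> 0" for n using h0(1)[of n] by simp
  ultimately have "filterlim (%n. cplx (h n)) (at 0) sequentially" by (simp add: filterlim_at)
  from filterlim_compose[OF A this] show "(%n. (exp (\<i> * cplx (h n * (xi \<bullet> b))) - 1) / cplx (h n)) ---> \<i> * cplx (xi \<bullet> b)"
   by simp
 qed
 have l2: "(%n. fint (%x. cplx (D n x)) xi) ---> fint (%x. cplx (G x \<bullet> b)) xi"
  unfolding fint_def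
 proof (rule integral_dominated_convergence[OF _ _ ballint])
  show "AL x. (%n. exp (- (\<i> * cplx (x \<bullet> xi))) * cplx (D n x)) ---> exp (- (\<i> * cplx (x \<bullet> xi))) * cplx (G x \<bullet> b)"
   by (intro AE_I2 tendsto_mult tendsto_const tendsto_of_real Dlim)
  show "AL x. norm (exp (- (\<i> * cplx (x \<bullet> xi))) * cplx (D n x)) <= max 0 M' * indicator (cball 0 (R + 1)) x" for n
   using Dbd by (auto simp: norm_mult)
 qed measurable
 from l1 have "(%n. fint (%x. cplx (D n x)) xi) ---> \<i> * cplx (xi \<bullet> b) * fint (%x. cplx (\<phi> x)) xi"
  by (simp only: e1)
 with l2 show "fint (%x. cplx (G x \<bullet> b)) xi = \<i> * cplx (xi \<bullet> b) * fint (%x. cplx (\<phi> x)) xi"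
  by (rule LIMSEQ_unique)
qed

section \<open>Weak divergence\<close>

lemma borel_measurable_vec_iff:
 fixes f :: "'a => 'b::euclidean_space^'n"
 shows "f \<in> borel_measurable M \<longleftrightarrow> (\<forall>j. (%x. f x $ j) \<in> borel_measurable M)"
proof
 assume f: "f \<in> borel_measurable M"
 show "\<forall>j. (%x. f x $ j) \<in> borel_measurable M"
  by (intro allI measurable_compose[OF f] borel_measurable_continuous_onI continuous_intros)
next
 assume f: "\<forall>j. (%x. f x $ j) \<in> borel_measurable M"
 show "f \<in> borel_measurable M"
 proof (subst borel_measurable_euclidean_space, intro ballI)
  fix i :: "'b^'n" assume "i \<in> Basis"
  then obtain j b where i: "i = axis j b" by (auto simp: Basis_vec_def)
  have "(%x. f x $ j \<bullet> b) \<in> borel_measurable M" using f by (intro borel_measurable_inner) auto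
  then show "(%x. f x \<bullet> i) \<in> borel_measurable M" by (simp add: i inner_axis)
 qed
qed

lemma borel_measurable_vec_nth [measurable (raw)]:
 fixes f :: "'a => 'b::euclidean_space^'n"
 shows "f \<in> borel_measurable M ==> (%x. f x $ j) \<in> borel_measurable M"
 by (simp add: borel_measurable_vec_iff)

lemma sqnorm_vec:
 fixes v :: "real^3 => 'b::euclidean_space^'n"
 assumes [measurable]: "v \<in> bmeas"
 shows "sqnorm v = (\<Sum>k\<in>UNIV. sqnorm (%x. v x $ k))"
 unfolding sqnorm_def by (subst nn_integral_sum[symmetric]) (auto simp: norm_vec_def L2_set_def sum_nonneg sum_ennreal)

lemma L2_vec_iff:
 fixes v :: "real^3 => 'b::euclidean_space^'n"
 shows "v \<in> L2 \<longleftrightarrow> (\<forall>k. (%x. v x $ k) \<in> L2)"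
 by (auto simp: L2_iff borel_measurable_vec_iff[of v] sqnorm_vec)

text \<open>Parseval turns \<open>\<integral> w \<bullet> G\<close> into a pairing of transforms, and the gradient of a test function has transform \<open>i xi\<close> times that of the test function.\<close>

lemma has_weak_div_if_fourier:
 assumes w: "!!j. ft (%x. cplx (w x $ j)) (W j)" and h: "ft (%x. cplx (h x)) H"
  and eq: "AL xi. H xi = (\<Sum>j\<in>UNIV. \<i> * cplx (xi $ j) * W j xi)"
 shows "has_weak_div w h"
 unfolding has_weak_div_def
proof (intro allI impI)
 fix \<phi> :: "real^3 => real" and G
 assume a: "(\<forall>x. GDERIV \<phi> x :> G x) & continuous_on UNIV G & bounded {x. \<phi> x \<noteq> 0}"
 then have GD: "!!x. GDERIV \<phi> x :> G x" and Gc: "continuous_on UNIV G" and bd: "bounded {x. \<phi> x \<noteq> 0}" by auto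
 have C1: "C1 \<phi>" unfolding C1_def using GD Gc by blast
 have phiL2: "(%x. cplx (\<phi> x)) \<in> L2" by (intro L2_of_real C1_compact_L2 C1 bd)
 have phi_int: "integrable lborel (%x. cplx (\<phi> x))"
 proof -
  note [measurable] = C1_measurable[OF C1]
  obtain M R where M: "!!x. \<bar>\<phi> x\<bar> <= M" "M \<ge> 0" and R: "!!x. norm x > R ==> \<phi> x = 0" by (rule C1_compact_bounded[OF C1 bd]) blast
  show ?thesis
  proof (rule Bochner_Integration.integrable_bound)
   show "integrable lborel (%x. M * indicator (cball (0 :: real^3) R) x :: real)"
    using emeasure_lborel_cball_finite[of "0 :: real^3" R] by (intro integrable_mult_right) auto
  qed (use M R in \<open>auto simp: indicator_def not_le\<close>)
 qed
 define \<Phi> where "\<Phi> = fint (%x. cplx (\<phi> x))"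
 have phi: "ft (%x. cplx (\<phi> x)) \<Phi>" unfolding \<Phi>_def by (rule ft_fint[OF phi_int phiL2])
 have gj: "ft (%x. cplx (G x $ j)) (%xi. \<i> * cplx (xi $ j) * \<Phi> xi)" for j
  using ft_fint[OF fint_gradient(3,2)[OF GD Gc bd norm_axis_1[of j]]]
  unfolding \<Phi>_def fint_gradient(1)[OF GD Gc bd norm_axis_1[of j], abs_def] by (simp add: inner_axis)
 note wL2 = ft_L2(1)[OF w] and gL2 = ft_L2(1)[OF gj]
 have "cplx (LI x. w x \<bullet> G x) = (LI x. (\<Sum>j\<in>UNIV. cplx (w x $ j) * cplx (G x $ j)))"
  by (subst integral_complex_of_real[symmetric]) (simp add: inner_vec_def)
 also have "... = (\<Sum>j\<in>UNIV. (LI x. cplx (w x $ j) * cplx (G x $ j)))"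
  by (intro Bochner_Integration.integral_sum L2_mult_integrable wL2 gL2)
 finally have "cplx ((2 * pi)^3) * cplx (LI x. w x \<bullet> G x)
   = (\<Sum>j\<in>UNIV. (LI xi. W j xi * (\<i> * cplx ((- xi) $ j) * \<Phi> (- xi))))"
  unfolding sum_distrib_left by (simp only: sum_distrib_left ft_parseval_bilinear[OF w gj])
 also have "... = (LI xi. (\<Sum>j\<in>UNIV. W j xi * (\<i> * cplx ((- xi) $ j) * \<Phi> (- xi))))"
 proof (rule Bochner_Integration.integral_sum[symmetric])
  fix j
  show "integrable lborel (%xi. W j xi * (\<i> * cplx ((- xi) $ j) * \<Phi> (- xi)))"
   using ft_cnj[OF gj[of j]] by (intro L2_mult_integrable ft_L2(2)[OF w])
    (use L2_cnj[OF ft_L2(2)[OF ft_cnj[OF gj[of j]]]] in simp)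
 qed
 also have "... = (LI xi. - (H xi * \<Phi> (- xi)))"
 proof (rule integral_cong_AE)
  have [measurable]: "\<Phi> \<in> bmeas" "H \<in> bmeas" "!!j. W j \<in> bmeas"
   using ft_measurable phi h w by auto
  show "(%xi. \<Sum>j\<in>UNIV. W j xi * (\<i> * cplx ((- xi) $ j) * \<Phi> (- xi))) \<in> borel_measurable lborel"
   "(%xi. - (H xi * \<Phi> (- xi))) \<in> borel_measurable lborel" unfolding vector_uminus_component by measurable
  show "AL xi. (\<Sum>j\<in>UNIV. W j xi * (\<i> * cplx ((- xi) $ j) * \<Phi> (- xi))) = - (H xi * \<Phi> (- xi))"
   using eq
  proof eventually_elim
   case (elim xi)
   have "H xi * \<Phi> (- xi) = (\<Sum>j\<in>UNIV. \<i> * cplx (xi $ j) * W j xi * \<Phi> (- xi))"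
    unfolding elim by (rule sum_distrib_right)
   then have "- (H xi * \<Phi> (- xi)) = (\<Sum>j\<in>UNIV. - (\<i> * cplx (xi $ j) * W j xi * \<Phi> (- xi)))"
    by (simp only: sum_negf)
   moreover have "W j xi * (\<i> * cplx ((- xi) $ j) * \<Phi> (- xi)) = - (\<i> * cplx (xi $ j) * W j xi * \<Phi> (- xi))" for j
    by simp
   ultimately show ?case by (simp only:)
  qed
 qed
 also have "... = - (cplx ((2 * pi)^3) * (LI x. cplx (h x) * cplx (\<phi> x)))"
  using ft_parseval_bilinear[OF h phi] by simp
 also have "(LI x. cplx (h x) * cplx (\<phi> x)) = (LI x. cplx (h x * \<phi> x))"
  by (intro Bochner_Integration.integral_cong refl) (rule of_real_mult[symmetric])
 also have "... = cplx (LI x. h x * \<phi> x)" by (rule integral_complex_of_real)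
 finally have "cplx ((2 * pi)^3 * (LI x. w x \<bullet> G x)) = cplx ((2 * pi)^3 * (- (LI x. h x * \<phi> x)))"
  unfolding of_real_mult[of "(2 * pi)^3"] of_real_minus mult_minus_right .
 then have "(2 * pi)^3 * (LI x. w x \<bullet> G x) = (2 * pi)^3 * (- (LI x. h x * \<phi> x))"
  unfolding of_real_eq_iff .
 then show "(LI x. w x \<bullet> G x) = - (LI x. h x * \<phi> x)"
  by (subst (asm) mult_cancel_left) auto
qed

lemma has_weak_div_unique:
 assumes "has_weak_div w h" "has_weak_div w h'" "h \<in> L2" "h' \<in> L2"
 shows "AL x. h x = h' x"
proof -
 have "AL x. h x - h' x = 0"
 proof (rule fundamental_lemma_real[OF L2_diff[OF assms(3,4)]])
  fix \<phi> :: "real^3 => real" assume \<phi>: "C1 \<phi>" "bounded {x. \<phi> x \<noteq> 0}"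
  from \<phi>(1) obtain G where G: "\<forall>x. GDERIV \<phi> x :> G x" "continuous_on UNIV G" by (auto simp: C1_def)
  have "(LI x. w x \<bullet> G x) = - (LI x. k x * \<phi> x)" if "has_weak_div w k" for k
   using that G \<phi>(2) unfolding has_weak_div_def by blast
  from this[OF assms(1)] this[OF assms(2)]
  have "(LI x. h x * \<phi> x) = (LI x. h' x * \<phi> x)" by linarith
  moreover have "integrable lborel (%x. h x * \<phi> x)" "integrable lborel (%x. h' x * \<phi> x)"
   by (intro L2_mult_integrable assms C1_compact_L2 \<phi>)+
  ultimately show "(LI x. (h x - h' x) * \<phi> x) = 0" by (simp add: left_diff_distrib)
 qed
 then show ?thesis by simp
qed

lemma weak_div_zero_fourier:
 assumes w: "!!j. ft (%x. cplx (w x $ j)) (W j)" and div: "has_weak_div w (%x. 0)"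
  and L2: "(%xi. \<Sum>j\<in>UNIV. \<i> * cplx (xi $ j) * W j xi) \<in> L2"
 shows "AL xi. (\<Sum>j\<in>UNIV. \<i> * cplx (xi $ j) * W j xi) = 0"
proof -
 let ?H = "%xi. \<Sum>j\<in>UNIV. \<i> * cplx (xi $ j) * W j xi"
 have "AL xi. \<forall>j. W j (- xi) = cnj (W j xi)"
  using ft_real_imp[OF w] by (simp add: AE_all_countable)
 then have "AL xi. ?H (- xi) = cnj (?H xi)" by eventually_elim simp
 from ft_real_exists[OF L2 this] obtain h where h: "ft (%x. cplx (h x)) ?H" "h \<in> bmeas" by blast
 have "has_weak_div w h" by (rule has_weak_div_if_fourier[OF w h(1)]) simp
 moreover have "h \<in> L2" using ft_L2(1)[OF h(1)] h(2) by (auto simp: L2_iff sqnorm_def)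
 ultimately have "AL x. h x = 0" by (intro has_weak_div_unique[OF _ div]) auto
 then have "ft (%x. 0) ?H" using ft_measurable(2)[OF h(1)] by (intro ft_cong_AE[OF h(1)]) auto
 moreover have "ft (%x. 0) (%x. 0)" using ft_diff[OF h(1) h(1)] by simp
 ultimately show ?thesis by (rule ft_unique)
qed

definition conv :: "(real^3 => complex) => (real^3 => complex) => real^3 => complex" where
 "conv f g xi = (LI eta. f (xi - eta) * g eta)"

lemma conv_measurable [measurable]:
 assumes [measurable]: "f \<in> bmeas" "g \<in> bmeas"
 shows "conv f g \<in> bmeas"
 unfolding conv_def[abs_def] by measurable

lemma conv_reflect_cnj:
 assumes [measurable]: "f \<in> bmeas" "g \<in> bmeas"
  and f: "AL xi. f (- xi) = cnj (f xi)" and g: "AL xi. g (- xi) = cnj (g xi)"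
 shows "conv f g (- xi) = cnj (conv f g xi)"
proof -
 have "conv f g (- xi) = (LI eta. f (- (xi - eta)) * g (- eta))"
  using lborel_integral_reflect[of "%eta. f (- xi - eta) * g eta"] by (simp add: conv_def)
 also have "... = (LI eta. cnj (f (xi - eta) * g eta))"
 proof (rule integral_cong_AE)
  have "AL eta. f (- (xi - eta)) = cnj (f (xi - eta))"
  proof -
   have "AE eta in distr lborel borel ((+) xi). f (- eta) = cnj (f eta)" using f unfolding lborel_distr_plus .
   then have "AL eta. f (- (xi + eta)) = cnj (f (xi + eta))" by (subst (asm) AE_distr_iff) auto
   from AE_lborel_reflect[OF this] show ?thesis by simp
  qed
  with g show "AL eta. f (- (xi - eta)) * g (- eta) = cnj (f (xi - eta) * g eta)"
   by eventually_elim simp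
 qed measurable
 also have "... = cnj (conv f g xi)" unfolding conv_def by (rule Bochner_Integration.integral_cnj)
 finally show ?thesis .
qed

text \<open>The candidate given by the convolution theorem is real and has the right weak divergences, so it shows that the choice in \<open>div_tensor\<close> is realised; uniqueness of weak divergences identifies the chosen function.\<close>

lemma div_tensor_fourier:
 assumes u: "!!j. ft (%x. cplx (u x $ j)) (U j)" and int: "!!j. integrable lborel (U j)"
  and L2: "!!k. (%xi. \<Sum>j\<in>UNIV. \<i> * cplx (xi $ j) * (cplx (1 / (2 * pi)^3) * conv (U j) (U k) xi)) \<in> L2"
 shows "ft (%x. cplx (div_tensor u u x $ k)) (%xi. \<Sum>j\<in>UNIV. \<i> * cplx (xi $ j) * (cplx (1 / (2 * pi)^3) * conv (U j) (U k) xi))"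
  and "div_tensor u u \<in> L2"
proof -
 define T where "T j k xi = cplx (1 / (2 * pi)^3) * conv (U j) (U k) xi" for j k xi
 define D where "D k xi = (\<Sum>j\<in>UNIV. \<i> * cplx (xi $ j) * T j k xi)" for k xi
 have [measurable]: "U j \<in> bmeas" for j by (rule ft_measurable(2)[OF u])
 have T: "ft (%x. cplx (((u x $ k) *\<^sub>R u x) $ j)) (T j k)" for j k
 proof -
  have "(%x. cplx (u x $ j) * cplx (u x $ k)) \<in> L2"
   by (rule ft_product_L2[OF u int ft_L2(1)[OF u]])
  from ft_mult[OF u u this] show ?thesis by (simp add: T_def[abs_def] conv_def mult.commute)
 qed
 have sym: "AL xi. D k (- xi) = cnj (D k xi)" for k
  unfolding D_def T_def by (rule AE_I2) (simp add: conv_reflect_cnj ft_real_imp[OF u])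
 have DL2: "D k \<in> L2" for k unfolding D_def[abs_def] T_def by (rule L2)
 have "\<exists>h. ft (%x. cplx (h x)) (D k) & h \<in> bmeas" for k
  by (rule ft_real_exists[OF DL2 sym])
 then obtain h where h: "!!k. ft (%x. cplx (h k x)) (D k)" "!!k. h k \<in> bmeas" by metis
 have hL2: "h k \<in> L2" for k using ft_L2(1)[OF h(1)[of k]] h(2)[of k] by (auto simp: L2_iff sqnorm_def)
 define h' where "h' x = (\<chi> k. h k x)" for x
 have "h' \<in> L2 & (\<forall>k. has_weak_div (%x. (u x $ k) *\<^sub>R u x) (%x. h' x $ k))"
 proof (intro conjI allI)
  show "h' \<in> L2" unfolding L2_vec_iff by (simp add: h'_def hL2)
  fix k show "has_weak_div (%x. (u x $ k) *\<^sub>R u x) (%x. h' x $ k)"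
   by (rule has_weak_div_if_fourier[OF T, of _ "D k"]) (simp_all add: h'_def h D_def)
 qed
 then have dt: "div_tensor u u \<in> L2 & (\<forall>k. has_weak_div (%x. (u x $ k) *\<^sub>R u x) (%x. div_tensor u u x $ k))"
  unfolding div_tensor_def by (rule someI[where P="%h. h \<in> L2 & (\<forall>k. has_weak_div (%x. (u x $ k) *\<^sub>R u x) (%x. h x $ k))"])
 then show "div_tensor u u \<in> L2" by simp
 have ae: "AL x. h k x = div_tensor u u x $ k"
 proof (rule has_weak_div_unique)
  show "has_weak_div (%x. (u x $ k) *\<^sub>R u x) (h k)"
   by (rule has_weak_div_if_fourier[OF T h(1)]) (simp add: D_def)
 qed (use dt hL2 L2_vec_iff in auto)
 have "ft (%x. cplx (div_tensor u u x $ k)) (D k)"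
 proof (rule ft_cong_AE[OF h(1)])
  have "(%x. div_tensor u u x $ k) \<in> L2" using dt L2_vec_iff by blast
  then show "(%x. cplx (div_tensor u u x $ k)) \<in> bmeas" by (auto dest: L2_measurable)
 qed (use ae DL2 in \<open>auto dest: L2_measurable elim: eventually_mono\<close>)
 then show "ft (%x. cplx (div_tensor u u x $ k)) (%xi. \<Sum>j\<in>UNIV. \<i> * cplx (xi $ j) * (cplx (1 / (2 * pi)^3) * conv (U j) (U k) xi))"
  unfolding D_def[abs_def] T_def .
qed

section \<open>Convolution inequalities\<close>

definition nsq :: "('a::euclidean_space => ennreal) => ennreal" where
 "nsq F = (NI x. (F x)^2)"

definition nconv :: "('a::euclidean_space => ennreal) => ('a => ennreal) => 'a => ennreal" where
 "nconv F G xi = (NI eta. F (xi - eta) * G eta)"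

lemma nconv_measurable [measurable]:
 assumes [measurable]: "F \<in> bmeas" "G \<in> bmeas"
 shows "nconv F G \<in> bmeas"
 unfolding nconv_def[abs_def] by measurable

lemma nconv_mono: "(!!x. F x <= F' x) ==> (!!x. G x <= G' x) ==> nconv F G xi <= nconv F' G' xi"
 unfolding nconv_def by (intro nn_integral_mono mult_mono) auto

lemma nconv_commute:
 assumes [measurable]: "F \<in> bmeas" "G \<in> bmeas"
 shows "nconv F G xi = nconv G F xi"
 unfolding nconv_def using lborel_nn_integral_diff[of "%eta. F (xi - eta) * G eta" xi] by (simp add: mult.commute)

lemma nconv_add_left:
 assumes [measurable]: "F \<in> bmeas" "F' \<in> bmeas" "G \<in> bmeas"
 shows "nconv (%x. F x + F' x) G xi = nconv F G xi + nconv F' G xi"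
 unfolding nconv_def by (simp add: distrib_right nn_integral_add)

lemma nconv_add_right:
 assumes [measurable]: "F \<in> bmeas" "G' \<in> bmeas" "G \<in> bmeas"
 shows "nconv F (%x. G x + G' x) xi = nconv F G xi + nconv F G' xi"
 unfolding nconv_def by (simp add: distrib_left nn_integral_add)

lemma ennreal_sq_add_le: "((x::ennreal) + y)^2 <= 2 * x\<^sup>2 + 2 * y\<^sup>2"
proof -
 have 1: "(x + y) * (x + y) = x * x + y * y + 2 * (x * y)"
  by (simp only: distrib_left distrib_right mult_2) (simp only: ac_simps)
 have "2 * (x * y) <= x * x + y * y"
 proof (cases "x = top \<or> y = top")
  case True then show ?thesis by auto
 next
  case False
  then obtain a b where ab: "x = ennreal a" "y = ennreal b" "a \<ge> 0" "b \<ge> 0" by (metis ennreal_cases)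
  have "2 * (a * b) <= a * a + b * b" using sum_squares_bound[of a b] by (simp add: power2_eq_square)
  then have "ennreal (2 * (a * b)) <= ennreal (a * a + b * b)" by (rule ennreal_leI)
  then show ?thesis using ab by (simp add: ennreal_mult ennreal_plus)
 qed
 then have "x * x + y * y + 2 * (x * y) <= x * x + y * y + (x * x + y * y)" by (rule add_left_mono)
 also have "... = 2 * (x * x) + 2 * (y * y)" by (simp only: mult_2) (simp only: ac_simps)
 finally show ?thesis unfolding power2_eq_square 1 .
qed

lemma nsq_add_le:
 assumes [measurable]: "F \<in> bmeas" "G \<in> bmeas"
 shows "nsq (%x. F x + G x) <= 2 * nsq F + 2 * nsq G"
proof -
 have "nsq (%x. F x + G x) <= (NI x. 2 * (F x)^2 + 2 * (G x)^2)"
  unfolding nsq_def by (intro nn_integral_mono ennreal_sq_add_le)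
 also have "... = 2 * nsq F + 2 * nsq G" unfolding nsq_def by (simp add: nn_integral_add nn_integral_cmult)
 finally show ?thesis .
qed

lemma nsq_mono: "(!!x. F x <= G x) ==> nsq F <= nsq G"
 unfolding nsq_def by (intro nn_integral_mono power_mono) auto

lemma nsq_mono_AE: "AL x. F x <= G x ==> nsq F <= nsq G"
 unfolding nsq_def by (intro nn_integral_mono_AE) (auto elim!: eventually_mono intro: power_mono)

lemma nsq_cmult:
 assumes [measurable]: "F \<in> bmeas"
 shows "nsq (%x. c * F x) = c\<^sup>2 * nsq F"
 unfolding nsq_def by (simp add: power_mult_distrib nn_integral_cmult)

lemma young_L2_L1:
 assumes [measurable]: "F \<in> bmeas" "G \<in> bmeas"
 shows "nsq (nconv F G) <= nsq F * (NI x. G x)^2"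
proof -
 have em: "emeasure (density lborel G) UNIV = (NI x. G x)" by (simp add: emeasure_density)
 have pt: "(nconv F G xi)^2 <= (NI eta. (F (xi - eta))^2 * G eta) * (NI x. G x)" for xi
  using Cauchy_Schwarz_nn_integral[of "%eta. F (xi - eta)" "density lborel G" "%_. 1"]
  by (simp add: nconv_def nn_integral_density mult.commute em)
 have "nsq (nconv F G) <= (NI xi. (NI eta. (F (xi - eta))^2 * G eta) * (NI x. G x))"
  unfolding nsq_def by (intro nn_integral_mono pt)
 also have "... = (NI xi. NI eta. (F (xi - eta))^2 * G eta) * (NI x. G x)"
  by (rule nn_integral_multc) measurable
 also have "(NI xi. NI eta. (F (xi - eta))^2 * G eta) = (NI eta. NI xi. (F (xi - eta))^2 * G eta)"
  by (rule lborel_pair.Fubini') measurable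
 also have "... = (NI eta. nsq F * G eta)"
 proof (rule nn_integral_cong)
  fix eta :: 'a
  have "(NI xi. (F (xi - eta))^2 * G eta) = (NI xi. (F (xi - eta))^2) * G eta" by (rule nn_integral_multc) measurable
  also have "(NI xi. (F (xi - eta))^2) = nsq F"
   unfolding nsq_def using lborel_nn_integral_translate[of "%x. (F x)^2" "- eta"] by simp
  finally show "(NI xi. (F (xi - eta))^2 * G eta) = nsq F * G eta" .
 qed
 also have "... = nsq F * (NI x. G x)" by (rule nn_integral_cmult) measurable
 finally show ?thesis by (simp add: power2_eq_square mult.assoc)
qed

lemma nconv_le_nsq:
 assumes [measurable]: "F \<in> bmeas" "G \<in> bmeas"
 shows "(nconv F G xi)^2 <= nsq F * nsq G"
proof -
 have "(nconv F G xi)^2 <= nsq (%eta. F (xi - eta)) * nsq G"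
  unfolding nconv_def nsq_def by (rule Cauchy_Schwarz_nn_integral) measurable
 also have "nsq (%eta. F (xi - eta)) = nsq F"
  unfolding nsq_def by (rule lborel_nn_integral_diff) measurable
 finally show ?thesis .
qed

text \<open>A weight that is subadditive up to weaker weights \<open>w\<close> splits the convolution into two terms, each a convolution of an \<open>L2\<close> function with an \<open>L1\<close> one, to which Young's inequality applies.\<close>

lemma weighted_conv:
 assumes [measurable]: "F \<in> bmeas" "G \<in> bmeas" "W \<in> bmeas" "w \<in> bmeas"
  and sub: "!!eta zeta. W (eta + zeta) <= c * (W eta * w zeta + w eta * W zeta)"
 shows "nsq (%xi. W xi * nconv F G xi) <= 2 * c\<^sup>2 *
  (nsq (%xi. W xi * F xi) * (NI xi. w xi * G xi)^2 + (NI xi. w xi * F xi)^2 * nsq (%xi. W xi * G xi))"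
proof -
 let ?WF = "%xi. W xi * F xi" and ?wG = "%xi. w xi * G xi" and ?wF = "%xi. w xi * F xi" and ?WG = "%xi. W xi * G xi"
 have "W xi * nconv F G xi <= c * (nconv ?WF ?wG xi + nconv ?wF ?WG xi)" for xi
 proof -
  have "W xi * nconv F G xi = (NI eta. W ((xi - eta) + eta) * (F (xi - eta) * G eta))"
   unfolding nconv_def by (subst nn_integral_cmult[symmetric]) auto
  also have "... <= (NI eta. c * (W (xi - eta) * w eta + w (xi - eta) * W eta) * (F (xi - eta) * G eta))"
   by (intro nn_integral_mono mult_right_mono sub) auto
  also have "... = (NI eta. c * (?WF (xi - eta) * ?wG eta + ?wF (xi - eta) * ?WG eta))"
   by (intro nn_integral_cong) (simp add: distrib_left distrib_right mult_ac)
  also have "... = c * (nconv ?WF ?wG xi + nconv ?wF ?WG xi)"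
   unfolding nconv_def by (subst nn_integral_cmult) (auto simp: nn_integral_add)
  finally show ?thesis .
 qed
 then have "nsq (%xi. W xi * nconv F G xi) <= nsq (%xi. c * (nconv ?WF ?wG xi + nconv ?wF ?WG xi))" by (rule nsq_mono)
 also have "... = c\<^sup>2 * nsq (%xi. nconv ?WF ?wG xi + nconv ?wF ?WG xi)" by (rule nsq_cmult) measurable
 also have "... <= c\<^sup>2 * (2 * nsq (nconv ?WF ?wG) + 2 * nsq (nconv ?wF ?WG))" by (intro mult_left_mono nsq_add_le) auto
 also have "nsq (nconv ?wF ?WG) = nsq (nconv ?WG ?wF)" unfolding nsq_def by (intro nn_integral_cong) (subst nconv_commute, auto)
 also have "c\<^sup>2 * (2 * nsq (nconv ?WF ?wG) + 2 * nsq (nconv ?WG ?wF)) <=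
   c\<^sup>2 * (2 * (nsq ?WF * (NI xi. ?wG xi)^2) + 2 * (nsq ?WG * (NI xi. ?wF xi)^2))"
  by (intro mult_left_mono add_mono young_L2_L1) auto
 finally show ?thesis by (simp add: distrib_left mult_ac)
qed

lemma weighted_conv_self:
 assumes [measurable]: "F \<in> bmeas" "W \<in> bmeas" "w \<in> bmeas"
  and sub: "!!eta zeta. W (eta + zeta) <= c * (W eta * w zeta + w eta * W zeta)"
 shows "nsq (%xi. W xi * nconv F F xi) <= 4 * c\<^sup>2 * (nsq (%xi. W xi * F xi) * (NI xi. w xi * F xi)^2)"
proof -
 have "nsq (%xi. W xi * nconv F F xi) <= 2 * c\<^sup>2 *
  (nsq (%xi. W xi * F xi) * (NI xi. w xi * F xi)^2 + (NI xi. w xi * F xi)^2 * nsq (%xi. W xi * F xi))"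
  by (rule weighted_conv[OF _ _ _ _ sub]) measurable
 also have "... = 2 * c\<^sup>2 * (2 * (nsq (%xi. W xi * F xi) * (NI xi. w xi * F xi)^2))"
  by (simp add: mult_2 mult.commute)
 also have "... = 4 * c\<^sup>2 * (nsq (%xi. W xi * F xi) * (NI xi. w xi * F xi)^2)"
  by (simp add: mult_ac numeral_mult_ennreal[symmetric])
 finally show ?thesis .
qed

text \<open>Cauchy-Schwarz: a weighted \<open>L1\<close> norm is bounded by a stronger weighted \<open>L2\<close> norm when the quotient of the weights is square integrable.\<close>

lemma weighted_L1_le:
 assumes [measurable]: "F \<in> bmeas" "W \<in> bmeas" "v \<in> bmeas"
  and le: "!!xi. w xi <= v xi * W xi"
 shows "(NI xi. w xi * F xi)^2 <= nsq v * nsq (%xi. W xi * F xi)"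
proof -
 have "(NI xi. w xi * F xi) <= (NI xi. v xi * (W xi * F xi))"
  unfolding mult.assoc[symmetric] by (intro nn_integral_mono mult_right_mono le) auto
 then have "(NI xi. w xi * F xi)^2 <= (NI xi. v xi * (W xi * F xi))^2" by (intro power_mono) auto
 also have "... <= nsq v * nsq (%xi. W xi * F xi)" unfolding nsq_def by (rule Cauchy_Schwarz_nn_integral) measurable
 finally show ?thesis .
qed

section \<open>Time integrals\<close>

lemma heat_kernel_time_sq:
 assumes "\<nu> > 0" "x \<ge> 0" "s <= t"
 shows "(NI tau. ennreal ((exp (- \<nu> * (t - tau) * x\<^sup>2) * x)^2) * indicator {s..t} tau) <= ennreal (1 / (2 * \<nu>))"
proof -
 let ?F = "%tau. exp (- \<nu> * (t - tau) * x\<^sup>2 * 2) / (2 * \<nu>)"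
 have "(NI tau. ennreal ((exp (- \<nu> * (t - tau) * x\<^sup>2) * x)^2) * indicator {s..t} tau) = ennreal (?F t - ?F s)"
 proof (rule nn_integral_FTC_Icc)
  fix tau assume "tau \<in> {s..t}"
  show "(?F has_real_derivative (exp (- \<nu> * (t - tau) * x\<^sup>2) * x)\<^sup>2) (at tau)"
  proof -
   have "(exp (- \<nu> * (t - tau) * x\<^sup>2) * x)^2 = exp (- \<nu> * (t - tau) * x\<^sup>2 * 2) * x\<^sup>2"
    by (simp add: power_mult_distrib exp_double[symmetric] mult.commute)
   then show ?thesis using assms by (auto intro!: derivative_eq_intros simp: field_simps)
  qed
 qed (use assms in auto)
 also have "... <= ennreal (1 / (2 * \<nu>))" using assms by (intro ennreal_leI) (simp add: field_simps)
 finally show ?thesis .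
qed

text \<open>The smoothing of the heat equation: the square of \<open>|xi| exp (- \<nu> r |xi|^2)\<close> has time integral at most \<open>1 / (2 \<nu>)\<close> for every \<open>xi\<close>. Cauchy-Schwarz in time thus absorbs the derivative of the nonlinearity.\<close>

lemma heat_kernel_CS:
 assumes "\<nu> > 0" "x \<ge> 0" "s <= t" and [measurable]: "F \<in> bmeas"
 shows "(NI tau. indicator {s..t} tau * (ennreal (exp (- \<nu> * (t - tau) * x\<^sup>2) * x) * F tau))^2
  <= ennreal (1 / (2 * \<nu>)) * (NI tau. indicator {s..t} tau * (F tau)^2)"
proof -
 let ?k = "%tau. ennreal (exp (- \<nu> * (t - tau) * x\<^sup>2) * x) * indicator {s..t} tau"
 have "(NI tau. indicator {s..t} tau * (ennreal (exp (- \<nu> * (t - tau) * x\<^sup>2) * x) * F tau))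
   = (NI tau. ?k tau * (indicator {s..t} tau * F tau))"
  by (intro nn_integral_cong) (simp add: indicator_def)
 then have "(NI tau. indicator {s..t} tau * (ennreal (exp (- \<nu> * (t - tau) * x\<^sup>2) * x) * F tau))^2
   = (NI tau. ?k tau * (indicator {s..t} tau * F tau))^2" by simp
 also have "... <= (NI tau. (?k tau)^2) * (NI tau. (indicator {s..t} tau * F tau)^2)"
  by (rule Cauchy_Schwarz_nn_integral) measurable
 also have "(NI tau. (?k tau)^2) = (NI tau. ennreal ((exp (- \<nu> * (t - tau) * x\<^sup>2) * x)^2) * indicator {s..t} tau)"
 proof (intro nn_integral_cong)
  fix tau
  have "(ennreal (exp (- \<nu> * (t - tau) * x\<^sup>2) * x))^2 = ennreal ((exp (- \<nu> * (t - tau) * x\<^sup>2) * x)^2)"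
   using assms(2) by (intro ennreal_power) auto
  then show "(?k tau)^2 = ennreal ((exp (- \<nu> * (t - tau) * x\<^sup>2) * x)^2) * indicator {s..t} tau"
   by (cases "tau \<in> {s..t}") (simp_all add: indicator_def)
 qed
 also have "(NI tau. (indicator {s..t} tau * F tau)^2) = (NI tau. indicator {s..t} tau * (F tau)^2)"
  by (intro nn_integral_cong) (simp add: indicator_def)
 also have "(NI tau. ennreal ((exp (- \<nu> * (t - tau) * x\<^sup>2) * x)^2) * indicator {s..t} tau) * (NI tau. indicator {s..t} tau * (F tau)^2)
   <= ennreal (1 / (2 * \<nu>)) * (NI tau. indicator {s..t} tau * (F tau)^2)"
  by (intro mult_right_mono heat_kernel_time_sq assms) auto
 finally show ?thesis .
qed

text \<open>Iteration of the integral inequality; the a priori bound \<open>B\<close> only makes the remainder tend to zero.\<close>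

lemma gronwall:
 fixes y :: "real => ennreal"
 assumes [measurable]: "y \<in> bmeas"
  and B: "!!t. t \<in> {s..T} ==> y t <= ennreal B" "B \<ge> 0" and A: "A \<ge> 0" and C: "C \<ge> 0"
  and step: "!!t. t \<in> {s..T} ==> y t <= ennreal A + ennreal C * (NI tau. indicator {s..t} tau * y tau)"
  and t: "t \<in> {s..T}"
 shows "y t <= ennreal (A * exp (C * (t - s)))"
proof -
 define P where "P n t = A * (\<Sum>k<n. (C * (t - s))^k / fact k) + B * ((C * (t - s))^n / fact n)" for n t
 have P: "y t <= ennreal (P n t)" if "t \<in> {s..T}" for n t
  using that
 proof (induction n arbitrary: t)
  case 0 then show ?case using B by (simp add: P_def)
 next
  case (Suc n)
  define Q where "Q t = A * (\<Sum>k<n. C^k * (t - s)^Suc k / fact (Suc k)) + B * (C^n * (t - s)^Suc n / fact (Suc n))" for t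
  have der: "(Q has_real_derivative P n tau) (at tau within X)" for tau X
  proof -
   have *: "((%t. C^k * (t - s)^Suc k / fact (Suc k)) has_real_derivative (C * (tau - s))^k / fact k) (at tau within X)" for k
   proof -
    have "((%t. C^k * (t - s)^Suc k / fact (Suc k)) has_real_derivative C^k * (real (Suc k) * (tau - s)^k * 1) / fact (Suc k)) (at tau within X)"
     by (auto intro!: derivative_eq_intros simp del: power_Suc)
    also have "C^k * (real (Suc k) * (tau - s)^k * 1) / fact (Suc k) = (C * (tau - s))^k / fact k"
     by (simp add: power_mult_distrib del: of_nat_Suc)
    finally show ?thesis .
   qed
   show ?thesis unfolding Q_def[abs_def] P_def by (intro DERIV_add DERIV_cmult DERIV_sum *)
  qed
  have P0: "P n tau \<ge> 0" if "s <= tau" for tau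
   unfolding P_def using that A B C by (intro add_nonneg_nonneg mult_nonneg_nonneg sum_nonneg divide_nonneg_nonneg zero_le_power) auto
  have Pm: "(%tau. P n tau) \<in> bmeas" unfolding P_def by measurable
  have "(NI tau. indicator {s..t} tau * y tau) <= (NI tau. ennreal (P n tau) * indicator {s..t} tau)"
   using Suc by (intro nn_integral_mono) (auto simp: indicator_def)
  also have "... = ennreal (Q t - Q s)"
   using Suc.prems by (intro nn_integral_FTC_Icc Pm der P0) auto
  also have "Q s = 0" by (simp add: Q_def)
  finally have "y t <= ennreal A + ennreal C * ennreal (Q t)"
   by (intro order_trans[OF step[OF Suc.prems]] add_left_mono mult_left_mono) auto
  also have "... = ennreal (A + C * Q t)"
  proof -
   have "Q t \<ge> 0" using Suc.prems A B C unfolding Q_def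
    by (intro add_nonneg_nonneg mult_nonneg_nonneg sum_nonneg divide_nonneg_nonneg zero_le_power) auto
   then show ?thesis using A C by (simp add: ennreal_mult ennreal_plus)
  qed
  also have "A + C * Q t = P (Suc n) t"
  proof -
   have "C * Q t = A * (\<Sum>k<n. (C * (t - s))^Suc k / fact (Suc k)) + B * ((C * (t - s))^Suc n / fact (Suc n))"
    unfolding Q_def by (simp add: distrib_left sum_distrib_left power_mult_distrib mult_ac del: fact_Suc)
   then show ?thesis unfolding P_def by (simp add: sum.lessThan_Suc_shift distrib_left del: sum.lessThan_Suc fact_Suc power_Suc)
  qed
  finally show ?case .
 qed
 have "(%n. P n t) ---> A * exp (C * (t - s)) + B * 0"
  unfolding P_def
 proof (intro tendsto_add tendsto_mult tendsto_const)
  show "(%n. \<Sum>k<n. (C * (t - s))^k / fact k) ---> exp (C * (t - s))"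
   using exp_converges[of "C * (t - s)"] by (simp add: sums_def divide_inverse mult.commute)
  show "(%n. (C * (t - s))^n / fact n) ---> 0"
   using summable_LIMSEQ_zero[OF summable_exp[of "C * (t - s)"]] by (simp add: divide_inverse mult.commute)
 qed
 then have "(%n. ennreal (P n t)) ---> ennreal (A * exp (C * (t - s)))" by (intro tendsto_ennrealI) simp
 then show ?thesis using P[OF t] by (intro LIMSEQ_le_const) auto
qed

section \<open>The nonlinearity on the Fourier side\<close>

text \<open>The transform of the Leray projection of \<open>div (f \<otimes> g)\<close> in terms of the transforms of \<open>f\<close> and \<open>g\<close>.\<close>

definition nonlin :: "(real^3 => complex^3) => (real^3 => complex^3) => real^3 => complex^3" where
 "nonlin f g xi = leray_symbol xi (\<chi> k. \<Sum>j\<in>UNIV. \<i> * cplx (xi $ j) *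
   (cplx (1 / (2 * pi)^3) * conv (%eta. f eta $ j) (%eta. g eta $ k) xi))"

abbreviation enorm :: "('a => 'b::real_normed_vector) => 'a => ennreal" where
 "enorm f \<equiv> (%x. ennreal (norm (f x)))"

lemma nsq_enorm: "nsq (enorm f) = sqnorm f"
 by (simp add: nsq_def sqnorm_def ennreal_power)

lemma norm_cvec [simp]: "norm (cvec v) = norm v"
 by (simp add: cvec_def norm_vec_def L2_set_def)

lemma norm_leray_le: "norm (leray_symbol xi v) <= 4 * norm v"
proof -
 have 1: "norm (\<Sum>j\<in>UNIV. v $ j * cplx (xi $ j)) <= 3 * (norm v * norm xi)"
 proof -
  have "norm (\<Sum>j\<in>UNIV. v $ j * cplx (xi $ j)) <= (\<Sum>j\<in>(UNIV::3 set). norm v * norm xi)"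
   using component_le_norm_cart[of xi] Finite_Cartesian_Product.norm_nth_le[of v]
   by (intro order_trans[OF norm_sum] sum_mono) (auto simp: norm_mult intro!: mult_mono)
  then show ?thesis by simp
 qed
 have "norm (((\<Sum>j\<in>UNIV. v $ j * cplx (xi $ j)) / cplx ((norm xi)^2)) *s cvec xi) <= 3 * norm v"
 proof (cases "xi = 0")
  case False
  have sm: "norm (c *s w) = norm c * norm w" for c :: complex and w :: "complex^3"
   by (simp add: norm_vec_def L2_set_def norm_mult power_mult_distrib sum_distrib_left[symmetric] real_sqrt_mult)
  have "norm (((\<Sum>j\<in>UNIV. v $ j * cplx (xi $ j)) / cplx ((norm xi)^2)) *s cvec xi)
    = norm (\<Sum>j\<in>UNIV. v $ j * cplx (xi $ j)) / (norm xi)^2 * norm xi"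
   unfolding sm by (simp add: norm_divide norm_power)
  also have "... <= 3 * (norm v * norm xi) / (norm xi)^2 * norm xi"
   using 1 by (intro mult_right_mono divide_right_mono) auto
  also have "... = 3 * norm v" using False by (simp add: power2_eq_square)
  finally show ?thesis .
 qed (simp add: cvec_def vec_eq_iff)
 then show ?thesis unfolding leray_symbol_def using norm_triangle_ineq4[of v] by (smt (verit))
qed

lemma leray_linear: "leray_symbol xi (v + w) = leray_symbol xi v + leray_symbol xi w"
 "leray_symbol xi (v - w) = leray_symbol xi v - leray_symbol xi w"
 by (simp_all add: leray_symbol_def vec_eq_iff sum.distrib sum_subtractf algebra_simps add_divide_distrib diff_divide_distrib)

lemma norm_conv_le:
 assumes "!!x. ennreal (norm (f x)) <= F x" "!!x. ennreal (norm (g x)) <= G x"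
 shows "ennreal (norm (conv f g xi)) <= nconv F G xi"
proof -
 have "ennreal (norm (conv f g xi)) <= (NI eta. norm (f (xi - eta) * g eta))"
  unfolding conv_def by (rule ennreal_norm_integral_le)
 also have "... <= nconv F G xi"
  unfolding nconv_def using assms by (intro nn_integral_mono) (auto simp: norm_mult ennreal_mult intro!: mult_mono)
 finally show ?thesis .
qed

lemma norm_vec_le_sum: "norm (v :: complex^3) <= (\<Sum>k\<in>UNIV. norm (v $ k))"
 unfolding norm_vec_def by (rule L2_set_le_sum) auto

lemma norm_nonlin_le:
 assumes "!!x. ennreal (norm (f x)) <= F x" "!!x. ennreal (norm (g x)) <= G x"
 shows "ennreal (norm (nonlin f g xi)) <= 36 * (ennreal (norm xi) * nconv F G xi)"
proof -
 define N where "N = nconv F G xi"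
 have c: "ennreal (norm (conv (%eta. f eta $ j) (%eta. g eta $ k) xi)) <= N" for j k
  unfolding N_def using assms
  by (intro norm_conv_le) (auto intro: order_trans[OF ennreal_leI[OF Finite_Cartesian_Product.norm_nth_le]])
 show ?thesis
 proof (cases "N = \<infinity>")
  case True
  show ?thesis
  proof (cases "xi = 0")
   case True
   then show ?thesis by (simp add: nonlin_def leray_symbol_def cvec_def vec_eq_iff zero_vec_def[symmetric])
  next
   case False
   then have "36 * (ennreal (norm xi) * nconv F G xi) = \<infinity>" using \<open>N = \<infinity>\<close> by (simp add: N_def ennreal_mult_eq_top_iff)
   then show ?thesis by simp
  qed
 next
  case False
  then obtain n where n: "N = ennreal n" "n \<ge> 0" by (cases N) auto
  have c': "norm (conv (%eta. f eta $ j) (%eta. g eta $ k) xi) <= n" for j k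
   using c[of j k] n by simp
  have "1 <= (2 * pi)^3" using pi_gt3 by (intro one_le_power) auto
  moreover have "1 / X <= 1" if "1 <= X" for X :: real using that by simp
  ultimately have pi1: "1 / (2 * pi)^3 <= 1" by blast
  have pi0: "0 <= 1 / (2 * pi)^3" by simp
  have tm: "norm (\<i> * cplx (xi $ j) * (cplx (1 / (2 * pi)^3) * conv (%eta. f eta $ j) (%eta. g eta $ k) xi)) <= norm xi * n" for j k
  proof -
   have "norm (\<i> * cplx (xi $ j) * (cplx (1 / (2 * pi)^3) * conv (%eta. f eta $ j) (%eta. g eta $ k) xi))
    = \<bar>xi $ j\<bar> * (1 / (2 * pi)^3 * norm (conv (%eta. f eta $ j) (%eta. g eta $ k) xi))"
    by (simp only: norm_mult norm_of_real norm_ii mult_1 abs_of_nonneg[OF pi0])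
   also have "... <= norm xi * (1 * n)"
    using n(2) by (intro mult_mono component_le_norm_cart pi1 c' mult_nonneg_nonneg) auto
   finally show ?thesis by simp
  qed
  have comp: "norm (\<Sum>j\<in>UNIV. \<i> * cplx (xi $ j) * (cplx (1 / (2 * pi)^3) * conv (%eta. f eta $ j) (%eta. g eta $ k) xi)) <= 3 * (norm xi * n)" for k
  proof -
   have "norm (\<Sum>j\<in>UNIV. \<i> * cplx (xi $ j) * (cplx (1 / (2 * pi)^3) * conv (%eta. f eta $ j) (%eta. g eta $ k) xi)) <= (\<Sum>j\<in>(UNIV::3 set). norm xi * n)"
    by (intro order_trans[OF norm_sum] sum_mono tm)
   then show ?thesis by simp
  qed
  define V where "V = (\<chi> k. \<Sum>j\<in>UNIV. \<i> * cplx (xi $ j) * (cplx (1 / (2 * pi)^3) * conv (%eta. f eta $ j) (%eta. g eta $ k) xi) :: complex^3)"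
  have "norm (V $ k) <= 3 * (norm xi * n)" for k unfolding V_def vec_lambda_beta by (rule comp)
  then have "norm V <= (\<Sum>k\<in>(UNIV::3 set). 3 * (norm xi * n))"
   by (intro order_trans[OF norm_vec_le_sum] sum_mono)
  moreover have "norm (nonlin f g xi) <= 4 * norm V" unfolding nonlin_def V_def by (rule norm_leray_le)
  ultimately have "norm (nonlin f g xi) <= 4 * (\<Sum>k\<in>(UNIV::3 set). 3 * (norm xi * n))" by linarith
  then have "norm (nonlin f g xi) <= 36 * (norm xi * n)" by simp
  then have "ennreal (norm (nonlin f g xi)) <= ennreal (36 * (norm xi * n))" by (rule ennreal_leI)
  also have "... = 36 * (ennreal (norm xi) * nconv F G xi)" using n by (simp add: N_def ennreal_mult)
  finally show ?thesis .
 qed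
qed

lemma L2_translate_reflect:
 fixes f :: "real^3 => 'b::euclidean_space"
 assumes "f \<in> L2" shows "(%eta. f (xi - eta)) \<in> L2"
 using assms lborel_nn_integral_diff[of "%x. ennreal ((norm (f x))^2)" xi] by (auto simp: L2_iff sqnorm_def)

lemma conv_integrable: "f \<in> L2 ==> g \<in> L2 ==> integrable lborel (%eta. f (xi - eta) * g eta :: complex)"
 by (intro L2_mult_integrable L2_translate_reflect)

lemma conv_diff_left: "f \<in> L2 ==> f' \<in> L2 ==> g \<in> L2 ==> conv (%x. f x - f' x) g xi = conv f g xi - conv f' g xi"
 unfolding conv_def by (simp add: left_diff_distrib conv_integrable)

lemma conv_diff_right: "f \<in> L2 ==> g' \<in> L2 ==> g \<in> L2 ==> conv f (%x. g x - g' x) xi = conv f g xi - conv f g' xi"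
 unfolding conv_def by (simp add: right_diff_distrib conv_integrable)

lemma nonlin_diff_left:
 assumes "f \<in> L2" "f' \<in> L2" "g \<in> L2"
 shows "nonlin (%x. f x - f' x) g xi = nonlin f g xi - nonlin f' g xi"
 using assms unfolding L2_vec_iff nonlin_def leray_linear(2)[symmetric]
 by (intro arg_cong[where f="leray_symbol xi"]) (simp add: vec_eq_iff conv_diff_left sum_subtractf right_diff_distrib)

lemma nonlin_diff_right:
 assumes "f \<in> L2" "g' \<in> L2" "g \<in> L2"
 shows "nonlin f (%x. g x - g' x) xi = nonlin f g xi - nonlin f g' xi"
 using assms unfolding L2_vec_iff nonlin_def leray_linear(2)[symmetric]
 by (intro arg_cong[where f="leray_symbol xi"]) (simp add: vec_eq_iff conv_diff_right sum_subtractf right_diff_distrib)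

lemma nonlin_diff:
 assumes "f \<in> L2" "g \<in> L2"
 shows "nonlin f f xi - nonlin g g xi = nonlin (%x. f x - g x) f xi + nonlin g (%x. f x - g x) xi"
 using nonlin_diff_left[of f g f] nonlin_diff_right[of g g f] assms by simp

lemma nonlin_cong_AE:
 assumes [measurable]: "f \<in> bmeas" "g \<in> bmeas"
  and ae: "AL x. f x = g x"
 shows "nonlin f f xi = nonlin g g xi"
proof -
 have "AL eta. f (xi - eta) = g (xi - eta)"
 proof -
  have "AE eta in distr lborel borel ((+) xi). f eta = g eta" using ae unfolding lborel_distr_plus .
  then have "AL eta. f (xi + eta) = g (xi + eta)" by (subst (asm) AE_distr_iff) auto
  from AE_lborel_reflect[OF this] show ?thesis by simp
 qed
 then have "conv (%eta. f eta $ j) (%eta. f eta $ k) xi = conv (%eta. g eta $ j) (%eta. g eta $ k) xi" for j k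
  unfolding conv_def using ae by (intro integral_cong_AE) auto
 then show ?thesis by (simp add: nonlin_def)
qed

lemma leray_measurable [measurable]:
 assumes [measurable]: "f \<in> borel_measurable M" "v \<in> borel_measurable M"
 shows "(%x. leray_symbol (f x) (v x)) \<in> borel_measurable M"
 unfolding borel_measurable_vec_iff
proof
 fix j
 have [measurable]: "(%x. cvec (f x) $ j) \<in> borel_measurable M" unfolding cvec_def vec_lambda_beta by measurable
 show "(%x. leray_symbol (f x) (v x) $ j) \<in> borel_measurable M"
  unfolding leray_symbol_def vector_minus_component vector_smult_component by measurable
qed

lemma nonlin_measurable:
 assumes [measurable]: "(%(t, xi). f t xi) \<in> bmeas2" "(%(t, xi). g t xi) \<in> bmeas2"
 shows "(%(t::real, xi). nonlin (f t) (g t) xi) \<in> bmeas2"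
proof -
 have conv: "(%p. conv (%eta. f (fst p) eta $ j) (%eta. g (fst p) eta $ k) (snd p)) \<in> bmeas2" for j k
  unfolding conv_def by (rule lborel.borel_measurable_lebesgue_integral) measurable
 have "(%p. (\<chi> k. \<Sum>j\<in>UNIV. \<i> * cplx (snd p $ j) *
   (cplx (1 / (2 * pi)^3) * conv (%eta. f (fst p) eta $ j) (%eta. g (fst p) eta $ k) (snd p))) :: complex^3) \<in> bmeas2"
  unfolding borel_measurable_vec_iff vec_lambda_beta using conv by (intro allI) measurable
 then have "(%p. nonlin (f (fst p)) (g (fst p)) (snd p)) \<in> bmeas2"
  unfolding nonlin_def by (intro leray_measurable) measurable
 then show ?thesis by (simp add: split_beta')
qed

section \<open>The Duhamel term\<close>

lemma ennreal_le_of_sq: assumes "x\<^sup>2 <= (y::ennreal)^2" shows "x <= y"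
proof (cases y)
 case (real b)
 show ?thesis
 proof (cases x)
  case (real a)
  have "a\<^sup>2 <= b\<^sup>2" using assms real \<open>y = ennreal b\<close> \<open>0 <= b\<close> by (simp add: ennreal_power)
  then show ?thesis using real \<open>y = ennreal b\<close> \<open>0 <= b\<close> by (auto intro!: ennreal_leI dest: power2_le_imp_le)
 next
  case top
  then show ?thesis using assms real by (simp add: ennreal_power top_unique power2_eq_square ennreal_mult_top[symmetric] flip: ennreal_mult)
 qed
qed simp

abbreviation (input) dker :: "real => real => real => (real => real^3 => complex^3) => (real => real^3 => complex^3) => real^3 => real => complex^3"
 where "dker \<nu> s t f g xi tau \<equiv> (if s <= tau & tau <= t then hk \<nu> (t - tau) xi *\<^sub>R nonlin (f tau) (g tau) xi else 0)"

definition duh :: "real => real => (real => real^3 => complex^3) => (real => real^3 => complex^3) => real => real^3 => complex^3" where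
 "duh \<nu> s f g t xi = (LI tau. (dker \<nu> s t f g xi tau))"

lemma duh_measurable_nonlin:
 assumes "(%(tau, xi). nonlin (f tau) (g tau) xi) \<in> bmeas2"
 shows "(%(t, xi). duh \<nu> s f g t xi) \<in> bmeas2"
proof -
 have n: "(%q. nonlin (f (snd q)) (g (snd q)) (snd (fst q))) \<in> borel_measurable (((borel :: real measure) \<Otimes>\<^sub>M (borel :: (real^3) measure)) \<Otimes>\<^sub>M (borel :: real measure))"
 proof -
  have "(%q. (snd q, snd (fst q))) \<in> ((borel :: real measure) \<Otimes>\<^sub>M (borel :: (real^3) measure)) \<Otimes>\<^sub>M (borel :: real measure) \<rightarrow>\<^sub>M borel \<Otimes>\<^sub>M borel"
   by measurable
  from measurable_compose[OF this assms] show ?thesis by simp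
 qed
 have "(%p. (LI tau. (if s <= tau & tau <= fst p then hk \<nu> (fst p - tau) (snd p) *\<^sub>R nonlin (f tau) (g tau) (snd p) else 0)))
   \<in> bmeas2"
 proof (rule lborel.borel_measurable_lebesgue_integral)
  have "(%q. (if s <= snd q & snd q <= fst (fst q) then hk \<nu> (fst (fst q) - snd q) (snd (fst q)) *\<^sub>R nonlin (f (snd q)) (g (snd q)) (snd (fst q)) else 0))
   \<in> borel_measurable ((borel \<Otimes>\<^sub>M borel) \<Otimes>\<^sub>M borel)" using n by measurable
  then show "(%(p, tau). (if s <= tau & tau <= fst p then hk \<nu> (fst p - tau) (snd p) *\<^sub>R nonlin (f tau) (g tau) (snd p) else 0))
   \<in> borel_measurable ((borel \<Otimes>\<^sub>M borel) \<Otimes>\<^sub>M lborel)" by (simp add: split_beta' cong: measurable_cong_sets)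
 qed
 then show ?thesis by (simp add: duh_def split_beta')
qed

lemma duh_measurable:
 assumes "(%(t, xi). f t xi) \<in> bmeas2" "(%(t, xi). g t xi) \<in> bmeas2"
 shows "(%(t, xi). duh \<nu> s f g t xi) \<in> bmeas2"
 by (rule duh_measurable_nonlin[OF nonlin_measurable[OF assms]])

lemma duh_integrand_le:
 assumes \<nu>: "\<nu> > 0"
  and F: "!!tau x. s <= tau ==> tau <= t ==> ennreal (norm (f tau x)) <= F tau x"
  and G: "!!tau x. s <= tau ==> tau <= t ==> ennreal (norm (g tau x)) <= G tau x"
 shows "ennreal (norm (dker \<nu> s t f g xi tau))
  <= 36 * (indicator {s..t} tau * (ennreal (hk \<nu> (t - tau) xi * norm xi) * nconv (F tau) (G tau) xi))"
proof (cases "s <= tau & tau <= t")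
 case True
 then have "ennreal (norm (nonlin (f tau) (g tau) xi)) <= 36 * (ennreal (norm xi) * nconv (F tau) (G tau) xi)"
  using F G by (intro norm_nonlin_le) auto
 then have "ennreal (hk \<nu> (t - tau) xi) * ennreal (norm (nonlin (f tau) (g tau) xi))
   <= ennreal (hk \<nu> (t - tau) xi) * (36 * (ennreal (norm xi) * nconv (F tau) (G tau) xi))" by (intro mult_left_mono) auto
 then show ?thesis using True by (simp add: ennreal_mult mult_ac)
next
 case False
 then have "(dker \<nu> s t f g xi tau) = 0" by (rule if_not_P)
 then show ?thesis by (simp only: norm_zero ennreal_0 zero_le)
qed

text \<open>The constant is \<open>36^2 / (2 \<nu>)\<close>, from the pointwise bound of the nonlinearity and the heat kernel.\<close>

lemma duh_bound:
 assumes \<nu>: "\<nu> > 0" and st: "s <= t"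
  and F: "!!tau x. s <= tau ==> tau <= t ==> ennreal (norm (f tau x)) <= F tau x"
  and G: "!!tau x. s <= tau ==> tau <= t ==> ennreal (norm (g tau x)) <= G tau x"
  and m [measurable]: "(%tau. nconv (F tau) (G tau) xi) \<in> bmeas"
 shows "(ennreal (norm (duh \<nu> s f g t xi)))^2 <= ennreal (648 / \<nu>) * (NI tau. indicator {s..t} tau * (nconv (F tau) (G tau) xi)^2)"
proof -
 let ?k = "%tau. indicator {s..t} tau * (ennreal (hk \<nu> (t - tau) xi * norm xi) * nconv (F tau) (G tau) xi)"
 have "ennreal (norm (duh \<nu> s f g t xi)) <= (NI tau. norm (dker \<nu> s t f g xi tau))"
  unfolding duh_def by (rule ennreal_norm_integral_le)
 also have "... <= (NI tau. 36 * ?k tau)"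
  by (intro nn_integral_mono duh_integrand_le \<nu> F G)
 also have "... = 36 * (NI tau. ?k tau)" by (rule nn_integral_cmult) measurable
 finally have "(ennreal (norm (duh \<nu> s f g t xi)))^2 <= (36 * (NI tau. ?k tau))^2" by (intro power_mono) auto
 also have "... = 36\<^sup>2 * (NI tau. ?k tau)^2" by (rule power_mult_distrib)
 also have "... <= 36\<^sup>2 * (ennreal (1 / (2 * \<nu>)) * (NI tau. indicator {s..t} tau * (nconv (F tau) (G tau) xi)^2))"
  by (intro mult_left_mono heat_kernel_CS \<nu> st m) auto
 also have "... = (36\<^sup>2 * ennreal (1 / (2 * \<nu>))) * (NI tau. indicator {s..t} tau * (nconv (F tau) (G tau) xi)^2)"
  by (simp only: mult.assoc)
 also have "36\<^sup>2 * ennreal (1 / (2 * \<nu>)) = ennreal (648 / \<nu>)"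
 proof -
  have "(36::ennreal)^2 = ennreal 1296" by (simp add: power2_eq_square flip: ennreal_numeral ennreal_mult)
  then have "36\<^sup>2 * ennreal (1 / (2 * \<nu>)) = ennreal 1296 * ennreal (1 / (2 * \<nu>))" by (rule arg_cong)
  also have "... = ennreal (1296 * (1 / (2 * \<nu>)))" using \<nu> by (intro ennreal_mult[symmetric]) auto
  finally show ?thesis by simp
 qed
 finally show ?thesis .
qed

lemma duh_bound_const:
 assumes \<nu>: "\<nu> > 0" and st: "s <= t" "t - s <= T"
  and F: "!!tau x. s <= tau ==> tau <= t ==> ennreal (norm (f tau x)) <= F x"
  and G: "!!tau x. s <= tau ==> tau <= t ==> ennreal (norm (g tau x)) <= G x"
 shows "ennreal (norm (duh \<nu> s f g t xi)) <= ennreal (sqrt (648 / \<nu> * T)) * nconv F G xi"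
proof -
 have "(ennreal (norm (duh \<nu> s f g t xi)))^2 <= ennreal (648 / \<nu>) * (NI tau. indicator {s..t} tau * (nconv F G xi)^2)"
  by (rule duh_bound[OF \<nu> st(1) F G]) auto
 also have "... = ennreal (648 / \<nu>) * (ennreal (t - s) * (nconv F G xi)^2)"
  using st by (subst nn_integral_multc) auto
 also have "... <= ennreal (648 / \<nu>) * (ennreal T * (nconv F G xi)^2)"
  using st by (intro mult_left_mono mult_right_mono ennreal_leI) auto
 also have "... = (ennreal (sqrt (648 / \<nu> * T)) * nconv F G xi)^2"
  using \<nu> st by (simp add: power_mult_distrib ennreal_power ennreal_mult[symmetric] mult.assoc[symmetric])
 finally show ?thesis by (rule ennreal_le_of_sq)
qed

text \<open>What the well-posedness theory requires of a weight: the weighted \<open>L2\<close> space consists of integrable functions and is closed under convolution.\<close>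

definition conv_weight :: "real => (real^3 => ennreal) => bool" where
 "conv_weight C W \<longleftrightarrow> C > 0 & W \<in> bmeas & (\<forall>xi. 1 <= W xi) &
   (\<forall>F\<in>bmeas. nsq (%xi. W xi * nconv F F xi) <= ennreal C * (nsq (%xi. W xi * F xi))^2) &
   (\<exists>L::real. \<forall>F\<in>bmeas. (NI xi. F xi)^2 <= ennreal L * nsq (%xi. W xi * F xi))"

lemma nsq_le_weighted:
 assumes "conv_weight C W" shows "nsq F <= nsq (%xi. W xi * F xi)"
 using assms mult_right_mono[of 1 "W _" "F _"] by (intro nsq_mono) (auto simp: conv_weight_def)

lemma nsq_incseq:
 assumes [measurable]: "!!n. F n \<in> bmeas" and inc: "incseq F"
 shows "nsq (%x. SUP n. F n x) = (SUP n. nsq (F n))"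
proof -
 have "(SUP n. F n x)^2 = (SUP n. (F n x)^2)" for x
 proof (rule LIMSEQ_unique)
  have i: "incseq (%n. F n x)" using inc by (auto simp: incseq_def le_fun_def)
  define S where "S = (SUP n. F n x)"
  have "(%n. F n x) ---> S" unfolding S_def by (rule LIMSEQ_SUP[OF i])
  then have "(%n. (F n x)^2) ---> S\<^sup>2" unfolding power2_eq_square by (intro tendsto_mult_ennreal) auto
  then show "(%n. (F n x)^2) ---> (SUP n. F n x)\<^sup>2" unfolding S_def .
  show "(%n. (F n x)^2) ---> (SUP n. (F n x)^2)" by (intro LIMSEQ_SUP) (use i in \<open>auto simp: incseq_def intro: power_mono\<close>)
 qed
 then show ?thesis unfolding nsq_def
  by (simp, subst nn_integral_monotone_convergence_SUP) (use inc in \<open>auto simp: incseq_def le_fun_def intro: power_mono\<close>)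
qed

section \<open>Local existence\<close>

lemma duh_integrand_integrable:
 assumes \<nu>: "\<nu> > 0" and [measurable]: "(%(t, xi). f t xi) \<in> bmeas2" "(%(t, xi). g t xi) \<in> bmeas2"
  and f: "!!tau x. s <= tau ==> tau <= t ==> ennreal (norm (f tau x)) <= F x" and g: "!!tau x. s <= tau ==> tau <= t ==> ennreal (norm (g tau x)) <= G x"
  and fin: "nconv F G xi < \<infinity>"
 shows "integrable lborel (%tau. (dker \<nu> s t f g xi tau))"
proof (rule integrableI_bounded)
 have [measurable]: "(%tau. nonlin (f tau) (g tau) xi) \<in> bmeas"
  using measurable_compose[OF _ nonlin_measurable[OF assms(2,3)], of "%tau. (tau, xi)" borel] by simp
 show "(%tau. (dker \<nu> s t f g xi tau)) \<in> borel_measurable lborel"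
  by measurable
 have "(NI tau. norm (dker \<nu> s t f g xi tau))
  <= (NI tau. (36 * (ennreal (norm xi) * nconv F G xi)) * indicator {s..t} tau)"
 proof (rule nn_integral_mono)
  fix tau
  show "ennreal (norm (dker \<nu> s t f g xi tau)) <= (36 * (ennreal (norm xi) * nconv F G xi)) * indicator {s..t} tau"
  proof (cases "s <= tau & tau <= t")
   case True
   then have "hk \<nu> (t - tau) xi * norm (nonlin (f tau) (g tau) xi) <= 1 * norm (nonlin (f tau) (g tau) xi)"
    using \<nu> by (intro mult_right_mono) auto
   then have "ennreal (norm (hk \<nu> (t - tau) xi *\<^sub>R nonlin (f tau) (g tau) xi)) <= ennreal (norm (nonlin (f tau) (g tau) xi))"
    by (intro ennreal_leI) simp
   also have "... <= 36 * (ennreal (norm xi) * nconv F G xi)" using True by (intro norm_nonlin_le f g) auto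
   finally show ?thesis using True by simp
  qed auto
 qed
 also have "... = (36 * (ennreal (norm xi) * nconv F G xi)) * emeasure lborel {s..t}" by (rule nn_integral_cmult_indicator) simp
 also have "... < \<infinity>" using fin by (auto simp: ennreal_mult_less_top emeasure_lborel_Icc_eq)
 finally show "(NI tau. norm (dker \<nu> s t f g xi tau)) < \<infinity>" .
qed

lemma leray_tendsto:
 assumes "v ---> w" shows "(%n. leray_symbol xi (v n)) ---> leray_symbol xi w"
proof -
 have bd: "norm (leray_symbol xi (v n) - leray_symbol xi w) <= 4 * norm (v n - w)" for n
  unfolding leray_linear(2)[symmetric] by (rule norm_leray_le)
 have "(%n. norm (v n - w)) ---> 0" using assms by (simp add: tendsto_norm_zero_iff LIM_zero_iff)
 then have "(%n. 4 * norm (v n - w)) ---> 0" using tendsto_mult_right_zero by blast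
 then have "(%n. leray_symbol xi (v n) - leray_symbol xi w) ---> 0"
  by (rule Lim_null_comparison[rotated]) (intro always_eventually allI bd)
 then show ?thesis by (rule LIM_zero_cancel)
qed

lemma nonlin_tendsto:
 assumes [measurable]: "!!n. f n \<in> bmeas" "g \<in> bmeas" "F \<in> bmeas"
  and F: "!!n x. ennreal (norm (f n x)) <= F x" and lim: "AL x. (%n. f n x) ---> g x"
  and fin: "AL x. F x < \<infinity>" and conv: "nconv F F xi < \<infinity>"
 shows "(%n. nonlin (f n) (f n) xi) ---> nonlin g g xi"
proof -
 have refl: "AL eta. P (xi - eta)" if "AL eta. P eta" for P :: "real^3 => bool"
 proof -
  have "AE eta in distr lborel borel ((+) xi). P eta" using that unfolding lborel_distr_plus .
  then have "AL eta. P (xi + eta)" by (rule AE_distrD[rotated]) simp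
  from AE_lborel_reflect[OF this] show ?thesis by simp
 qed
 define w where "w eta = enn2real (F (xi - eta) * F eta)" for eta
 have [measurable]: "w \<in> bmeas" unfolding w_def[abs_def] by measurable
 have wF: "AL eta. ennreal (w eta) = F (xi - eta) * F eta"
  using fin refl[OF fin] by eventually_elim (auto simp: w_def ennreal_enn2real_if ennreal_mult_eq_top_iff)
 have wint: "integrable lborel w"
 proof (rule integrableI_bounded)
  have "(NI eta. ennreal (norm (w eta))) = nconv F F xi"
   unfolding nconv_def using wF by (intro nn_integral_cong_AE) (auto simp: w_def elim: eventually_mono)
  then show "(NI eta. ennreal (norm (w eta))) < \<infinity>" using conv by simp
 qed simp
 have c: "(%n. conv (%eta. f n eta $ j) (%eta. f n eta $ k) xi) ---> conv (%eta. g eta $ j) (%eta. g eta $ k) xi" for j k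
  unfolding conv_def
 proof (rule integral_dominated_convergence[OF _ _ wint])
  show "AL eta. (%n. f n (xi - eta) $ j * f n eta $ k) ---> g (xi - eta) $ j * g eta $ k"
   using lim refl[OF lim] by eventually_elim (intro tendsto_intros)
  show "AL eta. norm (f n (xi - eta) $ j * f n eta $ k) <= w eta" for n
   using wF
  proof eventually_elim
   case (elim eta)
   have "ennreal (norm (f n (xi - eta) $ j * f n eta $ k)) = ennreal (norm (f n (xi - eta) $ j)) * ennreal (norm (f n eta $ k))"
    by (simp add: norm_mult ennreal_mult)
   also have "... <= F (xi - eta) * F eta"
    by (intro mult_mono order_trans[OF ennreal_leI[OF Finite_Cartesian_Product.norm_nth_le] F]) auto
   finally show ?case unfolding elim[symmetric] by (simp add: w_def)
  qed
 qed measurable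
 show ?thesis unfolding nonlin_def
  by (intro leray_tendsto vec_tendstoI) (simp only: vec_lambda_beta, intro tendsto_intros c)
qed

lemma nonlin_time_measurable:
 fixes f g :: "real => real^3 => complex^3"
 assumes "(%(t, xi). f t xi) \<in> bmeas2" "(%(t, xi). g t xi) \<in> bmeas2"
 shows "(%tau. nonlin (f tau) (g tau) xi) \<in> bmeas"
 using measurable_compose[OF _ nonlin_measurable[OF assms], of "%tau. (tau, xi)" borel] by simp

lemma duh_diff:
 assumes \<nu>: "\<nu> > 0" and [measurable]: "(%(t, xi). f t xi) \<in> bmeas2" "(%(t, xi). g t xi) \<in> bmeas2"
  and f: "!!tau x. s <= tau ==> tau <= t ==> ennreal (norm (f tau x)) <= F x" and g: "!!tau x. s <= tau ==> tau <= t ==> ennreal (norm (g tau x)) <= F x"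
  and fL2: "!!tau. s <= tau ==> tau <= t ==> f tau \<in> L2" and gL2: "!!tau. s <= tau ==> tau <= t ==> g tau \<in> L2"
  and [measurable]: "F \<in> bmeas" and fin: "nconv F F xi < \<infinity>"
 shows "duh \<nu> s f f t xi - duh \<nu> s g g t xi = duh \<nu> s (%tau x. f tau x - g tau x) f t xi + duh \<nu> s g (%tau x. f tau x - g tau x) t xi"
proof -
 have d: "ennreal (norm (f tau x - g tau x)) <= F x + F x" if "s <= tau" "tau <= t" for tau x
 proof -
  have "ennreal (norm (f tau x - g tau x)) <= ennreal (norm (f tau x) + norm (g tau x))" by (intro ennreal_leI norm_triangle_ineq4)
  also have "... <= F x + F x" using f[OF that] g[OF that] by (simp add: add_mono)
  finally show ?thesis .
 qed
 have fin2: "nconv (%x. F x + F x) F xi < \<infinity>" "nconv F (%x. F x + F x) xi < \<infinity>"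
  using fin by (simp_all add: nconv_add_left nconv_add_right)
 note [measurable] = nonlin_time_measurable
 have dm: "(%(t, xi). f t xi - g t xi) \<in> bmeas2" by measurable
 note i1 = duh_integrand_integrable[OF \<nu> assms(2,2) f f fin] and i2 = duh_integrand_integrable[OF \<nu> assms(3,3) g g fin]
  and i3 = duh_integrand_integrable[OF \<nu> dm assms(2) d f fin2(1)] and i4 = duh_integrand_integrable[OF \<nu> assms(3) dm g d fin2(2)]
 show ?thesis
  unfolding duh_def
  apply (subst Bochner_Integration.integral_diff[OF i1 i2, symmetric], assumption+)
  apply (subst Bochner_Integration.integral_add[OF i3 i4, symmetric], assumption+)
  apply (rule Bochner_Integration.integral_cong[OF refl])
  apply (auto simp: scaleR_diff_right[symmetric] scaleR_add_right[symmetric] nonlin_diff fL2 gL2)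
  done
qed

context
 fixes \<nu> T K C :: real and W :: "real^3 => ennreal" and A :: "real^3 => complex^3"
 assumes \<nu>: "\<nu> > 0" and T: "T > 0" and K: "K \<ge> 0" and W: "conv_weight C W"
  and A [measurable]: "A \<in> bmeas" and AK: "nsq (%xi. W xi * enorm A xi) <= ennreal K"
  and small: "16 * (648 / \<nu> * T) * C * K <= 1"
begin

text \<open>The Picard iteration is dominated, at all times at once, by an iteration of nonnegative functions of \<open>xi\<close> alone. Under the smallness assumption the latter stays in a ball of the weighted space and increases to a finite limit.\<close>

definition picard_const :: ennreal where "picard_const = ennreal (sqrt (648 / \<nu> * T))"

primrec majorant :: "nat => real^3 => ennreal" where
 "majorant 0 = enorm A"
| "majorant (Suc n) = (%xi. enorm A xi + picard_const * nconv (majorant n) (majorant n) xi)"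

primrec picard :: "nat => real => real^3 => complex^3" where
 "picard 0 = (%t xi. hk \<nu> t xi *\<^sub>R A xi)"
| "picard (Suc n) = (%t xi. hk \<nu> t xi *\<^sub>R A xi - duh \<nu> 0 (picard n) (picard n) t xi)"

lemma Wm: "W \<in> bmeas" using W by (simp add: conv_weight_def)
lemma C0: "C > 0" using W by (simp add: conv_weight_def)

lemma majorant_measurable [measurable]: "majorant n \<in> bmeas"
 by (induction n) auto

lemma majorant_bound: "nsq (%xi. W xi * majorant n xi) <= ennreal (4 * K)"
proof (induction n)
 case 0 then show ?case using AK K by (auto intro: order_trans ennreal_leI)
next
 case (Suc n)
 note [measurable] = Wm
 have "nsq (%xi. W xi * majorant (Suc n) xi) = nsq (%xi. W xi * enorm A xi + picard_const * (W xi * nconv (majorant n) (majorant n) xi))"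
  by (simp add: distrib_left mult_ac)
 also have "... <= 2 * nsq (%xi. W xi * enorm A xi) + 2 * nsq (%xi. picard_const * (W xi * nconv (majorant n) (majorant n) xi))"
  by (rule nsq_add_le) measurable
 also have "nsq (%xi. picard_const * (W xi * nconv (majorant n) (majorant n) xi)) = picard_const\<^sup>2 * nsq (%xi. W xi * nconv (majorant n) (majorant n) xi)"
  by (rule nsq_cmult) measurable
 also have "2 * nsq (%xi. W xi * enorm A xi) + 2 * (picard_const\<^sup>2 * nsq (%xi. W xi * nconv (majorant n) (majorant n) xi))
  <= 2 * ennreal K + 2 * (picard_const\<^sup>2 * (ennreal C * (ennreal (4 * K))^2))"
 proof (intro add_mono mult_left_mono AK)
  have "nsq (%xi. W xi * nconv (majorant n) (majorant n) xi) <= ennreal C * (nsq (%xi. W xi * majorant n xi))^2"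
   using W by (simp add: conv_weight_def)
  also have "... <= ennreal C * (ennreal (4 * K))^2" by (intro mult_left_mono power_mono Suc) auto
  finally show "nsq (%xi. W xi * nconv (majorant n) (majorant n) xi) <= ennreal C * (ennreal (4 * K))^2" .
 qed auto
 also have "... = ennreal (2 * K + 2 * (648 / \<nu> * T * (C * (4 * K)^2)))"
 proof -
  have "picard_const\<^sup>2 = ennreal (648 / \<nu> * T)" unfolding picard_const_def using \<nu> T by (simp add: ennreal_power)
  moreover have "2 = ennreal 2" by simp
  moreover have "0 <= 648 / \<nu> * T" using \<nu> T by simp
  ultimately show ?thesis using K C0
   by (simp only: ennreal_power[of "4 * K"] ennreal_mult[symmetric] ennreal_plus[symmetric] mult_nonneg_nonneg zero_le_power zero_le_numeral less_imp_le)
 qed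
 also have "... <= ennreal (4 * K)"
 proof (rule ennreal_leI)
  have "16 * (648 / \<nu> * T) * C * K * K <= 1 * K" by (rule mult_right_mono[OF small K])
  moreover have "2 * (648 / \<nu> * T * (C * (4 * K)^2)) = 2 * (16 * (648 / \<nu> * T) * C * K * K)"
   by (simp add: power2_eq_square mult_ac)
  ultimately show "2 * K + 2 * (648 / \<nu> * T * (C * (4 * K)^2)) <= 4 * K" by linarith
 qed
 finally show ?case .
qed

lemma majorant_step: "majorant n xi <= majorant (Suc n) xi"
proof (induction n arbitrary: xi)
 case (Suc n)
 have "nconv (majorant n) (majorant n) xi <= nconv (majorant (Suc n)) (majorant (Suc n)) xi"
  by (rule nconv_mono) (rule Suc)+
 then show ?case unfolding majorant.simps(2)[of "Suc n"] by (subst majorant.simps(2)) (intro add_left_mono mult_left_mono, auto)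
qed simp

lemma majorant_incseq: "incseq majorant"
 by (rule incseq_SucI) (auto simp: le_fun_def simp del: majorant.simps intro: majorant_step)

definition majorant_sup :: "real^3 => ennreal" where "majorant_sup xi = (SUP n. majorant n xi)"

lemma majorant_sup_measurable [measurable]: "majorant_sup \<in> bmeas"
 unfolding majorant_sup_def[abs_def] by measurable

lemma majorant_le_sup: "majorant n xi <= majorant_sup xi" unfolding majorant_sup_def by (rule SUP_upper) auto

lemma majorant_sup_bound: "nsq (%xi. W xi * majorant_sup xi) <= ennreal (4 * K)"
proof -
 note [measurable] = Wm
 have "nsq (%xi. W xi * majorant_sup xi) = nsq (%xi. SUP n. W xi * majorant n xi)"
  by (simp add: majorant_sup_def SUP_mult_left_ennreal)
 also have "... = (SUP n. nsq (%xi. W xi * majorant n xi))"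
  using majorant_incseq by (intro nsq_incseq) (auto simp: incseq_def le_fun_def intro: mult_left_mono)
 also have "... <= ennreal (4 * K)" by (rule SUP_least) (rule majorant_bound)
 finally show ?thesis .
qed

lemma majorant_sup_nsq: "nsq majorant_sup < \<infinity>"
 using nsq_le_weighted[OF W, of majorant_sup] majorant_sup_bound
 by (metis ennreal_less_top infinity_ennreal_def order_le_less_trans order_trans)

lemma majorant_sup_finite: "AL xi. majorant_sup xi < \<infinity>"
proof -
 have "AL xi. (majorant_sup xi)^2 \<noteq> \<infinity>"
  using majorant_sup_nsq by (intro nn_integral_PInf_AE) (auto simp: nsq_def)
 then show ?thesis by eventually_elim (auto simp: power_eq_top_ennreal less_top)
qed

lemma nconv_majorant_sup_finite: "nconv majorant_sup majorant_sup xi < \<infinity>"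
proof -
 have "(nconv majorant_sup majorant_sup xi)^2 <= nsq majorant_sup * nsq majorant_sup" by (rule nconv_le_nsq) auto
 also have "... < \<infinity>" using majorant_sup_nsq by (auto simp: ennreal_mult_less_top)
 finally show ?thesis by (auto simp: power_less_top_ennreal)
qed

lemma picard_measurable [measurable]: "(%(t, xi). picard n t xi) \<in> bmeas2"
proof (induction n)
 case (Suc n)
 note [measurable] = duh_measurable[OF Suc Suc, of \<nu> 0]
 show ?case by simp
qed simp

lemma picard_measurable_t [measurable]: "picard n t \<in> bmeas"
 using measurable_compose[OF _ picard_measurable[of n], of "%xi. (t, xi)" borel] by simp

lemma picard_0_le: "0 <= t ==> ennreal (norm (hk \<nu> t xi *\<^sub>R A xi)) <= enorm A xi"
 using \<nu> by (intro ennreal_leI) (simp add: mult_left_le_one_le)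

lemma picard_le: "t \<in> {0..T} ==> ennreal (norm (picard n t xi)) <= majorant n xi"
proof (induction n arbitrary: t xi)
 case 0 then show ?case using picard_0_le by simp
next
 case (Suc n)
 have "ennreal (norm (picard (Suc n) t xi)) <= ennreal (norm (hk \<nu> t xi *\<^sub>R A xi) + norm (duh \<nu> 0 (picard n) (picard n) t xi))"
  unfolding picard.simps by (intro ennreal_leI norm_triangle_ineq4)
 also have "... = ennreal (norm (hk \<nu> t xi *\<^sub>R A xi)) + ennreal (norm (duh \<nu> 0 (picard n) (picard n) t xi))"
  by (intro ennreal_plus) auto
 also have "... <= majorant (Suc n) xi"
  unfolding majorant.simps picard_const_def using Suc.prems
  by (intro add_mono picard_0_le duh_bound_const \<nu> Suc.IH) auto
 finally show ?case .
qed

lemma picard_L2: "t \<in> {0..T} ==> picard n t \<in> L2"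
proof -
 assume t: "t \<in> {0..T}"
 have "sqnorm (picard n t) <= nsq majorant_sup"
  unfolding nsq_enorm[symmetric] by (intro nsq_mono order_trans[OF picard_le[OF t] majorant_le_sup])
 then show ?thesis using majorant_sup_nsq by (auto simp: L2_iff)
qed


text \<open>Successive differences are bounded by the increments of the majorant, whose sum is finite; this yields pointwise convergence of the iteration.\<close>

lemma picard_diff: "t \<in> {0..T} ==> ennreal (norm (picard (Suc n) t xi - picard n t xi)) + majorant n xi <= majorant (Suc n) xi"
proof (induction n arbitrary: t xi)
 case 0
 have "ennreal (norm (duh \<nu> 0 (picard 0) (picard 0) t xi)) <= picard_const * nconv (enorm A) (enorm A) xi"
  unfolding picard_const_def using 0 picard_le[of _ 0] by (intro duh_bound_const \<nu>) auto
 then show ?case by (simp add: add.commute add_left_mono del: picard.simps(1)) (simp add: norm_minus_commute)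
next
 case (Suc n)
 let ?p = "picard n" and ?q = "picard (Suc n)"
 define D where "D x = majorant (Suc n) x - majorant n x" for x
 have [measurable]: "D \<in> bmeas" unfolding D_def[abs_def] by (simp del: majorant.simps)
 have Dadd: "D x + majorant n x = majorant (Suc n) x" for x
  unfolding D_def by (rule diff_add_cancel_ennreal[OF majorant_step])
 have dD: "ennreal (norm (?q tau x - ?p tau x)) <= D x" if "tau \<in> {0..T}" for tau x
  unfolding D_def ennreal_le_minus_iff using Suc.IH[OF that] by blast
 have ms: "ennreal (norm (picard k tau x)) <= majorant_sup x" if "0 <= tau" "tau <= t" for tau x k
  using that Suc.prems by (intro order_trans[OF picard_le majorant_le_sup]) auto
 have "?q t xi - picard (Suc (Suc n)) t xi = duh \<nu> 0 ?q ?q t xi - duh \<nu> 0 ?p ?p t xi"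
  unfolding picard.simps(2)[of "Suc n"] by (subst (1) picard.simps(2)) simp
 also have "... = duh \<nu> 0 (%tau x. ?q tau x - ?p tau x) ?q t xi + duh \<nu> 0 ?p (%tau x. ?q tau x - ?p tau x) t xi"
  using Suc.prems by (intro duh_diff[where F=majorant_sup] \<nu> picard_measurable ms picard_L2 nconv_majorant_sup_finite majorant_sup_measurable) auto
 finally have "ennreal (norm (picard (Suc (Suc n)) t xi - ?q t xi)) = ennreal (norm (duh \<nu> 0 (%tau x. ?q tau x - ?p tau x) ?q t xi + duh \<nu> 0 ?p (%tau x. ?q tau x - ?p tau x) t xi))"
  by (simp only: norm_minus_commute)
 also have "... <= ennreal (norm (duh \<nu> 0 (%tau x. ?q tau x - ?p tau x) ?q t xi) + norm (duh \<nu> 0 ?p (%tau x. ?q tau x - ?p tau x) t xi))"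
  by (intro ennreal_leI norm_triangle_ineq)
 also have "... = ennreal (norm (duh \<nu> 0 (%tau x. ?q tau x - ?p tau x) ?q t xi)) + ennreal (norm (duh \<nu> 0 ?p (%tau x. ?q tau x - ?p tau x) t xi))"
  by (intro ennreal_plus) auto
 also have "... <= picard_const * nconv D (majorant (Suc n)) xi + picard_const * nconv (majorant n) D xi"
  unfolding picard_const_def using Suc.prems
  by (intro add_mono duh_bound_const \<nu> dD picard_le) auto
 finally have "ennreal (norm (picard (Suc (Suc n)) t xi - ?q t xi)) + majorant (Suc n) xi
   <= picard_const * nconv D (majorant (Suc n)) xi + picard_const * nconv (majorant n) D xi + majorant (Suc n) xi" by (rule add_right_mono)
 also have "... = enorm A xi + picard_const * (nconv D (majorant (Suc n)) xi + (nconv (majorant n) D xi + nconv (majorant n) (majorant n) xi))"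
  by (subst (2) majorant.simps(2)) (simp only: distrib_left ac_simps)
 also have "nconv (majorant n) D xi + nconv (majorant n) (majorant n) xi = nconv (majorant n) (majorant (Suc n)) xi"
  by (subst nconv_add_right[symmetric]) (simp_all only: Dadd majorant_measurable \<open>D \<in> bmeas\<close>)
 also have "nconv D (majorant (Suc n)) xi + nconv (majorant n) (majorant (Suc n)) xi = nconv (majorant (Suc n)) (majorant (Suc n)) xi"
  by (subst nconv_add_left[symmetric]) (simp_all only: Dadd majorant_measurable \<open>D \<in> bmeas\<close>)
 also have "enorm A xi + picard_const * nconv (majorant (Suc n)) (majorant (Suc n)) xi = majorant (Suc (Suc n)) xi"
  unfolding majorant.simps(2)[of "Suc n"] ..
 finally show ?case .
qed

lemma picard_convergent:
 assumes t: "t \<in> {0..T}" and fin: "majorant_sup xi < \<infinity>"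
 shows "convergent (%n. picard n t xi)"
proof -
 let ?d = "%n. norm (picard (Suc n) t xi - picard n t xi)"
 have "ennreal (\<Sum>k<n. ?d k) <= majorant n xi" for n
 proof (induction n)
  case (Suc n)
  have "ennreal (\<Sum>k<Suc n. ?d k) = ennreal (\<Sum>k<n. ?d k) + ennreal (?d n)"
   by (simp only: sum.lessThan_Suc) (intro ennreal_plus sum_nonneg, auto)
  also have "... <= ennreal (?d n) + majorant n xi" using Suc by (subst add.commute) (intro add_left_mono)
  also have "... <= majorant (Suc n) xi" by (rule picard_diff[OF t])
  finally show ?case .
 qed simp
 then have "ennreal (\<Sum>k<n. ?d k) <= ennreal (enn2real (majorant_sup xi))" for n
  using majorant_le_sup[of n xi] fin by (simp add: ennreal_enn2real_if less_top) (meson order_trans)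
 then have "(\<Sum>k<n. ?d k) <= enn2real (majorant_sup xi)" for n by (subst (asm) ennreal_le_iff) auto
 then have "summable ?d" by (intro summableI_nonneg_bounded) auto
 then have "summable (%n. picard (Suc n) t xi - picard n t xi)" by (rule summable_norm_cancel)
 then have "convergent (%n. \<Sum>k<n. picard (Suc k) t xi - picard k t xi)" by (simp only: summable_iff_convergent)
 then have "convergent (%n. (picard n t xi - picard 0 t xi) + picard 0 t xi)"
  by (intro convergent_add convergent_const) (simp only: sum_lessThan_telescope[of "%k. picard k t xi"])
 then show ?thesis by simp
qed

definition picard_lim :: "real => real^3 => complex^3" where
 "picard_lim t xi = (if 0 <= t & t <= T & majorant_sup xi < \<infinity> then lim (%n. picard n t xi) else 0)"

lemma picard_tendsto: "t \<in> {0..T} ==> majorant_sup xi < \<infinity> ==> (%n. picard n t xi) ---> picard_lim t xi"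
 using picard_convergent[of t xi] by (simp add: picard_lim_def convergent_LIMSEQ_iff)

lemma picard_lim_measurable: "(%(t, xi). picard_lim t xi) \<in> bmeas2"
proof -
 have 1: "(%p. lim (%n. picard n (fst p) (snd p))) \<in> bmeas2"
  using picard_measurable by (intro borel_measurable_lim_metric) (simp add: split_beta')
 have "(%p. if 0 <= fst p & fst p <= T & majorant_sup (snd p) < \<infinity> then lim (%n. picard n (fst p) (snd p)) else 0) \<in> bmeas2"
  by (intro measurable_If 1) measurable
 then show ?thesis by (simp add: picard_lim_def split_beta')
qed

lemma picard_lim_le: "ennreal (norm (picard_lim t xi)) <= majorant_sup xi"
proof (cases "0 <= t & t <= T & majorant_sup xi < \<infinity>")
 case True
 then have "(%n. ennreal (norm (picard n t xi))) ---> ennreal (norm (picard_lim t xi))"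
  by (intro tendsto_ennrealI tendsto_norm picard_tendsto) auto
 then show ?thesis
  by (rule LIMSEQ_le_const2) (use True in \<open>auto intro!: exI[of _ 0] order_trans[OF picard_le majorant_le_sup]\<close>)
qed (auto simp: picard_lim_def)

lemma picard_lim_eq:
 assumes t: "t \<in> {0..T}" and fin: "majorant_sup xi < \<infinity>"
 shows "picard_lim t xi = hk \<nu> t xi *\<^sub>R A xi - duh \<nu> 0 picard_lim picard_lim t xi"
proof (rule LIMSEQ_unique)
 show "(%n. picard (Suc n) t xi) ---> picard_lim t xi" by (rule LIMSEQ_Suc[OF picard_tendsto[OF t fin]])
 define c where "c = enn2real (36 * (ennreal (norm xi) * nconv majorant_sup majorant_sup xi))"
 have c: "ennreal c = 36 * (ennreal (norm xi) * nconv majorant_sup majorant_sup xi)"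
  unfolding c_def using nconv_majorant_sup_finite[of xi] by (intro ennreal_enn2real) (auto simp: ennreal_mult_less_top)
 have "(%n. duh \<nu> 0 (picard n) (picard n) t xi) ---> duh \<nu> 0 picard_lim picard_lim t xi"
  unfolding duh_def
 proof (rule integral_dominated_convergence[where w="%tau. c * indicator {0..t} tau"])
  note [measurable] = nonlin_time_measurable[OF picard_lim_measurable picard_lim_measurable] nonlin_time_measurable[OF picard_measurable picard_measurable]
  show "(%tau. if 0 <= tau & tau <= t then hk \<nu> (t - tau) xi *\<^sub>R nonlin (picard_lim tau) (picard_lim tau) xi else 0) \<in> borel_measurable lborel"
   "(%tau. if 0 <= tau & tau <= t then hk \<nu> (t - tau) xi *\<^sub>R nonlin (picard n tau) (picard n tau) xi else 0) \<in> borel_measurable lborel" for n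
   by measurable
  show "integrable lborel (%tau. c * indicator {0..t} tau :: real)" by (intro integrable_mult_right) (simp add: emeasure_lborel_Icc_eq)
  show "AL tau. (%n. if 0 <= tau & tau <= t then hk \<nu> (t - tau) xi *\<^sub>R nonlin (picard n tau) (picard n tau) xi else 0)
    ---> (dker \<nu> 0 t picard_lim picard_lim xi tau)"
  proof (rule AE_I2)
   fix tau
   have "(%n. nonlin (picard n tau) (picard n tau) xi) ---> nonlin (picard_lim tau) (picard_lim tau) xi" if "tau \<in> {0..T}"
   proof (rule nonlin_tendsto[where F=majorant_sup])
    show "picard_lim tau \<in> bmeas"
     using measurable_compose[OF _ picard_lim_measurable, of "%xi. (tau, xi)" borel] by simp
    show "AL x. (%n. picard n tau x) ---> picard_lim tau x"
     using majorant_sup_finite by eventually_elim (rule picard_tendsto[OF that])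
    show "ennreal (norm (picard n tau x)) <= majorant_sup x" for n x by (rule order_trans[OF picard_le[OF that] majorant_le_sup])
   qed (use majorant_sup_finite nconv_majorant_sup_finite in auto)
   then show "(%n. if 0 <= tau & tau <= t then hk \<nu> (t - tau) xi *\<^sub>R nonlin (picard n tau) (picard n tau) xi else 0)
    ---> (dker \<nu> 0 t picard_lim picard_lim xi tau)"
    using t by (auto intro!: tendsto_scaleR)
  qed
  show "AL tau. norm (if 0 <= tau & tau <= t then hk \<nu> (t - tau) xi *\<^sub>R nonlin (picard n tau) (picard n tau) xi else 0) <= c * indicator {0..t} tau" for n
  proof (rule AE_I2)
   fix tau
   have "norm (hk \<nu> (t - tau) xi *\<^sub>R nonlin (picard n tau) (picard n tau) xi) <= c" if tau: "0 <= tau" "tau <= t"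
   proof -
    have "ennreal (norm (nonlin (picard n tau) (picard n tau) xi)) <= ennreal c"
     unfolding c using tau t by (intro norm_nonlin_le order_trans[OF picard_le majorant_le_sup]) auto
    then have "norm (nonlin (picard n tau) (picard n tau) xi) <= c" by (subst (asm) ennreal_le_iff) (auto simp: c_def)
    moreover have "hk \<nu> (t - tau) xi <= 1" using \<nu> tau by simp
    ultimately have "hk \<nu> (t - tau) xi * norm (nonlin (picard n tau) (picard n tau) xi) <= 1 * c"
     by (intro mult_mono) auto
    then show ?thesis by simp
   qed
   then show "norm (if 0 <= tau & tau <= t then hk \<nu> (t - tau) xi *\<^sub>R nonlin (picard n tau) (picard n tau) xi else 0) <= c * indicator {0..t} tau"
    by simp
  qed
 qed
 then show "(%n. picard (Suc n) t xi) ---> hk \<nu> t xi *\<^sub>R A xi - duh \<nu> 0 picard_lim picard_lim t xi"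
  unfolding picard.simps by (intro tendsto_diff tendsto_const)
qed

lemma local_existence_majorant:
 "\<exists>U m. (%(t, xi). U t xi) \<in> bmeas2 & m \<in> bmeas &
   nsq (%xi. W xi * m xi) <= ennreal (4 * K) & (\<forall>t xi. ennreal (norm (U t xi)) <= m xi) &
   (AL xi. \<forall>t\<in>{0..T}. U t xi = hk \<nu> t xi *\<^sub>R A xi - duh \<nu> 0 U U t xi)"
proof (intro exI conjI allI)
 show "(%(t, xi). picard_lim t xi) \<in> bmeas2" by (rule picard_lim_measurable)
 show "AL xi. \<forall>t\<in>{0..T}. picard_lim t xi = hk \<nu> t xi *\<^sub>R A xi - duh \<nu> 0 picard_lim picard_lim t xi"
  using majorant_sup_finite by eventually_elim (blast intro: picard_lim_eq)
qed (rule majorant_sup_measurable majorant_sup_bound picard_lim_le)+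

end

section \<open>Solutions on the Fourier side\<close>

text \<open>Solutions are required to have a time-independent majorant in the weighted space, and to satisfy Duhamel's formula for all times simultaneously off one null set. The majorant serves dominated convergence; the single null set gives pointwise continuity in time.\<close>

definition fsol :: "real => (real^3 => ennreal) => (real^3 => complex^3) => real => (real => real^3 => complex^3) => bool" where
 "fsol \<nu> W A T U \<longleftrightarrow>
   (%(t, xi). U t xi) \<in> bmeas2 &
   (\<exists>M\<in>bmeas. nsq (%xi. W xi * M xi) < \<infinity> & (\<forall>t\<in>{0..T}. \<forall>xi. ennreal (norm (U t xi)) <= M xi)) &
   (AL xi. \<forall>t\<in>{0..T}. U t xi = hk \<nu> t xi *\<^sub>R A xi - duh \<nu> 0 U U t xi)"

lemma measurable_slice:
 assumes "(%(t, xi). U t xi) \<in> bmeas2"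
 shows "U (t :: real) \<in> bmeas"
 using measurable_compose[OF _ assms, of "%xi. (t, xi)" borel] by simp

lemma nconv_joint_measurable:
 assumes "(%(t, xi). F t xi) \<in> bmeas2" "(%(t, xi). G t xi) \<in> bmeas2"
 shows "(%(t::real, xi::real^3). nconv (F t) (G t) xi) \<in> bmeas2"
proof -
 note [measurable] = assms
 have "(%p. (NI eta. F (fst p) (snd p - eta) * G (fst p) eta)) \<in> borel_measurable ((borel :: real measure) \<Otimes>\<^sub>M (borel :: (real^3) measure))"
  by (rule lborel.borel_measurable_nn_integral) measurable
 then show ?thesis by (simp add: nconv_def split_beta')
qed

lemma enorm_joint_measurable:
 fixes U :: "real => real^3 => complex^3"
 assumes "(%(t, xi). U t xi) \<in> bmeas2"
 shows "(%(t, xi). enorm (U t) xi) \<in> bmeas2"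
proof -
 note [measurable] = assms
 have "(%p. ennreal (norm (case p of (t, xi) => U t xi))) \<in> bmeas2" by measurable
 then show ?thesis by (simp add: split_beta')
qed

lemma slice_fix_measurable:
 assumes "(%(t::real, xi::real^3). F t xi) \<in> bmeas2"
 shows "(%t. F t xi) \<in> bmeas"
 using measurable_compose[OF _ assms, of "%t. (t, xi)" borel] by simp

lemma duh_split:
 assumes \<nu>: "\<nu> > 0" and m: "(%(t, xi). f t xi) \<in> bmeas2"
  and f: "!!tau x. s <= tau ==> tau <= t ==> ennreal (norm (f tau x)) <= F x"
  and fin: "nconv F F xi < \<infinity>" and r: "s <= r" "r <= t"
 shows "duh \<nu> s f f t xi = hk \<nu> (t - r) xi *\<^sub>R duh \<nu> s f f r xi + duh \<nu> r f f t xi"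
proof -
 let ?I = "%s t tau. (dker \<nu> s t f f xi tau)"
 let ?e = "hk \<nu> (t - r) xi"
 note [measurable] = nonlin_time_measurable[OF m m]
 have i1: "integrable lborel (?I s r)" by (rule duh_integrand_integrable[OF \<nu> m m _ _ fin]) (use f r in auto)
 have i2: "integrable lborel (?I r t)" by (rule duh_integrand_integrable[OF \<nu> m m _ _ fin]) (use f r in auto)
 have "?e *\<^sub>R duh \<nu> s f f r xi + duh \<nu> r f f t xi = (LI tau. ?e *\<^sub>R ?I s r tau + ?I r t tau)"
  unfolding duh_def using i1 i2 by (subst Bochner_Integration.integral_add) (auto intro!: integrable_scaleR_right simp: integral_scaleR_right)
 also have "... = (LI tau. ?I s t tau)"
 proof (rule integral_cong_AE)
  show "AL tau. ?e *\<^sub>R ?I s r tau + ?I r t tau = ?I s t tau"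
   using AE_lborel_singleton[of r]
  proof eventually_elim
   case (elim tau)
   have "?e * hk \<nu> (r - tau) xi = hk \<nu> (t - tau) xi"
    by (simp add: exp_add[symmetric] algebra_simps)
   then show ?case using elim r by auto
  qed
 qed measurable
 finally show ?thesis by (simp add: duh_def)
qed

lemma duh_cong:
 assumes "!!tau. s < tau ==> tau <= t ==> f tau = g tau"
  and "(%(t, xi). f t xi) \<in> bmeas2" "(%(t, xi). g t xi) \<in> bmeas2"
 shows "duh \<nu> s f f t xi = duh \<nu> s g g t xi"
proof -
 note [measurable] = nonlin_time_measurable[OF assms(2,2)] nonlin_time_measurable[OF assms(3,3)]
 show ?thesis unfolding duh_def
 proof (rule integral_cong_AE)
  show "AL tau. (dker \<nu> s t f f xi tau) =
    (dker \<nu> s t g g xi tau)"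
   using AE_lborel_singleton[of s] by eventually_elim (use assms(1) in auto)
 qed measurable
qed

lemma duh_shift:
 fixes f :: "real => real^3 => complex^3"
 assumes "(%(t, xi). f t xi) \<in> bmeas2"
 shows "duh \<nu> 0 (%tau. f (s + tau)) (%tau. f (s + tau)) t xi = duh \<nu> s f f (s + t) xi"
proof -
 note [measurable] = nonlin_time_measurable[OF assms assms]
 have "duh \<nu> s f f (s + t) xi = (LI tau. (if s <= s + tau & s + tau <= s + t then exp (- \<nu> * (s + t - (s + tau)) * (norm xi)^2) *\<^sub>R nonlin (f (s + tau)) (f (s + tau)) xi else 0))"
  unfolding duh_def by (rule lborel_integral_translate[symmetric]) measurable
 moreover have "(s <= s + tau & s + tau <= s + t) = (0 <= tau & tau <= t)" "s + t - (s + tau) = t - tau" for tau by auto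
 ultimately show ?thesis by (simp only: duh_def)
qed

lemma fsolD:
 assumes "fsol \<nu> W A T U"
 shows fsol_measurable: "(%(t, xi). U t xi) \<in> bmeas2"
  and fsol_eq: "AL xi. \<forall>t\<in>{0..T}. U t xi = hk \<nu> t xi *\<^sub>R A xi - duh \<nu> 0 U U t xi"
 using assms by (auto simp: fsol_def)

lemma fsol_majorant:
 assumes "fsol \<nu> W A T U"
 obtains M where "M \<in> bmeas" "nsq (%xi. W xi * M xi) < \<infinity>" "!!t xi. t \<in> {0..T} ==> ennreal (norm (U t xi)) <= M xi"
 using assms by (auto simp: fsol_def)

lemma fsol_restrict: "fsol \<nu> W A T U ==> T' <= T ==> fsol \<nu> W A T' U"
 unfolding fsol_def by (auto elim!: eventually_mono)

lemma nconv_finite: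
 assumes W: "conv_weight C W" and [measurable]: "M \<in> bmeas" and fin: "nsq (%xi. W xi * M xi) < \<infinity>"
 shows "nconv M M xi < \<infinity>" "nsq M < \<infinity>"
proof -
 show n: "nsq M < \<infinity>" using nsq_le_weighted[OF W, of M] fin by (rule le_less_trans)
 have "(nconv M M xi)^2 <= nsq M * nsq M" by (rule nconv_le_nsq) auto
 also have "... < \<infinity>" using n by (auto simp: ennreal_mult_less_top)
 finally show "nconv M M xi < \<infinity>" by (auto simp: power_less_top_ennreal)
qed

lemma fsol_restart:
 assumes \<nu>: "\<nu> > 0" and W: "conv_weight C W" and U: "fsol \<nu> W A T U" and s: "0 <= s"
 shows "AL xi. \<forall>t\<in>{s..T}. U t xi = hk \<nu> (t - s) xi *\<^sub>R U s xi - duh \<nu> s U U t xi"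
 using fsol_eq[OF U]
proof eventually_elim
 case (elim xi)
 obtain M where [measurable]: "M \<in> bmeas" and fin: "nsq (%xi. W xi * M xi) < \<infinity>"
  and M: "!!t xi. t \<in> {0..T} ==> ennreal (norm (U t xi)) <= M xi" using fsol_majorant[OF U] by blast
 show ?case
 proof
  fix t assume t: "t \<in> {s..T}"
  have sp: "duh \<nu> 0 U U t xi = hk \<nu> (t - s) xi *\<^sub>R duh \<nu> 0 U U s xi + duh \<nu> s U U t xi"
   by (rule duh_split[OF \<nu> fsol_measurable[OF U] M nconv_finite(1)[OF W _ fin]]) (use t s in auto)
  have e: "hk \<nu> t xi *\<^sub>R A xi = hk \<nu> (t - s) xi *\<^sub>R hk \<nu> s xi *\<^sub>R A xi"
   by (simp add: exp_add[symmetric] algebra_simps)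
  have "U t xi = hk \<nu> t xi *\<^sub>R A xi - duh \<nu> 0 U U t xi" using elim t s by auto
  also have "... = hk \<nu> (t - s) xi *\<^sub>R (hk \<nu> s xi *\<^sub>R A xi - duh \<nu> 0 U U s xi) - duh \<nu> s U U t xi"
   unfolding sp e by (simp add: scaleR_diff_right)
  also have "hk \<nu> s xi *\<^sub>R A xi - duh \<nu> 0 U U s xi = U s xi" using elim t s by auto
  finally show "U t xi = hk \<nu> (t - s) xi *\<^sub>R U s xi - duh \<nu> s U U t xi" .
 qed
qed

lemma time_Tonelli:
 assumes [measurable]: "(%(t::real, xi::real^3). H t xi) \<in> bmeas2"
 shows "(NI xi. NI tau. indicator {s..t} tau * H tau xi) = (NI tau. indicator {s..t} tau * (NI xi. H tau xi))"
proof -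
 have "(NI xi. NI tau. indicator {s..t} tau * H tau xi) = (NI tau. NI xi. indicator {s..t} tau * H tau xi)"
  by (rule lborel_pair.Fubini') measurable
 also have "... = (NI tau. indicator {s..t} tau * (NI xi. H tau xi))"
  by (intro nn_integral_cong nn_integral_cmult) measurable
 finally show ?thesis .
qed

text \<open>Restarting at time \<open>s\<close> and using the heat kernel gain; the weight \<open>V\<close> is arbitrary and may be unrelated to the one in which the solution is known.\<close>

lemma fsol_energy_type_ineq:
 assumes \<nu>: "\<nu> > 0" and W: "conv_weight C W" and U: "fsol \<nu> W A T U" and st: "0 <= s" "s <= t" "t <= T"
  and [measurable]: "V \<in> bmeas"
 shows "nsq (%xi. V xi * enorm (U t) xi) <= 2 * nsq (%xi. V xi * enorm (U s) xi) +
  2 * (ennreal (648 / \<nu>) * (NI tau. indicator {s..t} tau * nsq (%xi. V xi * nconv (enorm (U tau)) (enorm (U tau)) xi)))"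
proof -
 note [measurable] = fsol_measurable[OF U] enorm_joint_measurable[OF fsol_measurable[OF U]] measurable_slice[OF fsol_measurable[OF U]]
 note nm [measurable] = nconv_joint_measurable[OF enorm_joint_measurable[OF fsol_measurable[OF U]] enorm_joint_measurable[OF fsol_measurable[OF U]]]
 note [measurable] = slice_fix_measurable[OF nm]
 define Q where "Q xi = (NI tau. indicator {s..t} tau * (nconv (enorm (U tau)) (enorm (U tau)) xi)^2)" for xi
 have [measurable]: "Q \<in> bmeas" unfolding Q_def[abs_def] by measurable
 have "AL xi. (V xi * enorm (U t) xi)^2 <= 2 * (V xi * enorm (U s) xi)^2 + 2 * (ennreal (648 / \<nu>) * ((V xi)^2 * Q xi))"
  using fsol_restart[OF \<nu> W U st(1)]
 proof eventually_elim
  case (elim xi)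
  have e: "U t xi = hk \<nu> (t - s) xi *\<^sub>R U s xi - duh \<nu> s U U t xi"
   using bspec[OF elim, of t] st by simp
  have "enorm (U t) xi <= ennreal (norm (hk \<nu> (t - s) xi *\<^sub>R U s xi) + norm (duh \<nu> s U U t xi))"
   by (subst e) (intro ennreal_leI norm_triangle_ineq4)
  also have "... = ennreal (norm (hk \<nu> (t - s) xi *\<^sub>R U s xi)) + ennreal (norm (duh \<nu> s U U t xi))"
   by (intro ennreal_plus) auto
  also have "... <= enorm (U s) xi + ennreal (norm (duh \<nu> s U U t xi))"
  proof (intro add_right_mono ennreal_leI)
   have "hk \<nu> (t - s) xi <= 1" using \<nu> st by simp
   then have "hk \<nu> (t - s) xi * norm (U s xi) <= 1 * norm (U s xi)" by (intro mult_right_mono) auto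
   then show "norm (hk \<nu> (t - s) xi *\<^sub>R U s xi) <= norm (U s xi)" by simp
  qed
  finally have "(enorm (U t) xi)^2 <= (enorm (U s) xi + ennreal (norm (duh \<nu> s U U t xi)))^2" by (intro power_mono) auto
  also have "... <= 2 * (enorm (U s) xi)^2 + 2 * (ennreal (norm (duh \<nu> s U U t xi)))^2" by (rule ennreal_sq_add_le)
  also have "... <= 2 * (enorm (U s) xi)^2 + 2 * (ennreal (648 / \<nu>) * Q xi)"
   unfolding Q_def by (intro add_left_mono mult_left_mono duh_bound \<nu> st) auto
  finally have "(V xi)^2 * (enorm (U t) xi)^2 <= (V xi)^2 * (2 * (enorm (U s) xi)^2 + 2 * (ennreal (648 / \<nu>) * Q xi))" by (intro mult_left_mono) auto
  then show ?case by (simp add: power_mult_distrib distrib_left mult_ac)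
 qed
 then have "nsq (%xi. V xi * enorm (U t) xi) <= (NI xi. 2 * (V xi * enorm (U s) xi)^2 + 2 * (ennreal (648 / \<nu>) * ((V xi)^2 * Q xi)))"
  unfolding nsq_def by (rule nn_integral_mono_AE)
 also have "... = 2 * nsq (%xi. V xi * enorm (U s) xi) + 2 * (ennreal (648 / \<nu>) * (NI xi. (V xi)^2 * Q xi))"
  unfolding nsq_def by (simp add: nn_integral_add nn_integral_cmult)
 also have "(NI xi. (V xi)^2 * Q xi) = (NI xi. NI tau. indicator {s..t} tau * (V xi * nconv (enorm (U tau)) (enorm (U tau)) xi)^2)"
  unfolding Q_def by (intro nn_integral_cong, subst nn_integral_cmult[symmetric]) (auto simp: power_mult_distrib mult_ac)
 also have "... = (NI tau. indicator {s..t} tau * nsq (%xi. V xi * nconv (enorm (U tau)) (enorm (U tau)) xi))"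
  unfolding nsq_def by (rule time_Tonelli) measurable
 finally show ?thesis .
qed

text \<open>Local existence from time \<open>T\<close>, glued to the given solution.\<close>

lemma fsol_extend:
 assumes \<nu>: "\<nu> > 0" and W: "conv_weight C W" and U: "fsol \<nu> W A T U" and T: "0 <= T" and K: "nsq (%xi. W xi * enorm (U T) xi) <= ennreal K" "K \<ge> 0"
  and T': "T' > 0" and small: "16 * (648 / \<nu> * T') * C * K <= 1"
 shows "\<exists>U'. fsol \<nu> W A (T + T') U'"
proof -
 note Um = fsol_measurable[OF U]
 obtain M where Mm [measurable]: "M \<in> bmeas" and fin: "nsq (%xi. W xi * M xi) < \<infinity>"
  and M: "!!t xi. t \<in> {0..T} ==> ennreal (norm (U t xi)) <= M xi" using fsol_majorant[OF U] by blast
 obtain U1 m where U1m: "(%(t, xi). U1 t xi) \<in> bmeas2" and mm [measurable]: "m \<in> bmeas"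
  and mK: "nsq (%xi. W xi * m xi) <= ennreal (4 * K)" and m: "!!t xi. ennreal (norm (U1 t xi)) <= m xi"
  and eq: "AL xi. \<forall>t\<in>{0..T'}. U1 t xi = hk \<nu> t xi *\<^sub>R U T xi - duh \<nu> 0 U1 U1 t xi"
  using local_existence_majorant[OF \<nu> T' K(2) W measurable_slice[OF Um] K(1) small] by auto
 have [measurable]: "W \<in> bmeas" using W by (simp add: conv_weight_def)
 define V where "V t = (if t <= T then U t else U1 (t - T))" for t
 have Vm: "(%(t, xi). V t xi) \<in> bmeas2"
 proof -
  have a: "(%p. U (fst p) (snd p)) \<in> bmeas2" using Um by (simp add: split_beta')
  have "(%p. (fst p - T, snd p)) \<in> (borel :: real measure) \<Otimes>\<^sub>M (borel :: (real^3) measure) \<rightarrow>\<^sub>M borel \<Otimes>\<^sub>M borel" by measurable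
  from measurable_compose[OF this U1m] have b: "(%p. U1 (fst p - T) (snd p)) \<in> bmeas2" by simp
  have "(%p. if fst p <= T then U (fst p) (snd p) else U1 (fst p - T) (snd p)) \<in> bmeas2"
   by (intro measurable_If a b) measurable
  then show ?thesis by (rule measurable_cong[THEN iffD1, rotated]) (auto simp: V_def)
 qed
 define M' where "M' x = M x + m x" for x
 have M'm [measurable]: "M' \<in> bmeas" unfolding M'_def[abs_def] by measurable
 have VM: "ennreal (norm (V t xi)) <= M' xi" if "t \<in> {0..T + T'}" for t xi
  using M[of t xi] m[of "t - T" xi] that by (auto simp: V_def M'_def intro: order_trans add_increasing add_increasing2)
 have fin': "nsq (%xi. W xi * M' xi) < \<infinity>"
 proof -
  have "nsq (%xi. W xi * M' xi) <= 2 * nsq (%xi. W xi * M xi) + 2 * nsq (%xi. W xi * m xi)"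
   unfolding M'_def distrib_left by (rule nsq_add_le) measurable
  also have "... < \<infinity>" using fin mK by (auto simp: ennreal_mult_less_top ennreal_add_less_top intro: le_less_trans)
  finally show ?thesis .
 qed
 have "AL xi. \<forall>t\<in>{0..T + T'}. V t xi = hk \<nu> t xi *\<^sub>R A xi - duh \<nu> 0 V V t xi"
  using fsol_eq[OF U] eq
 proof eventually_elim
  case (elim xi)
  have V1: "duh \<nu> 0 V V t xi = duh \<nu> 0 U U t xi" if "t <= T" for t
   by (rule duh_cong[OF _ Vm Um]) (use that in \<open>auto simp: V_def\<close>)
  show ?case
  proof
   fix t assume t: "t \<in> {0..T + T'}"
   show "V t xi = hk \<nu> t xi *\<^sub>R A xi - duh \<nu> 0 V V t xi"
   proof (cases "t <= T")
    case True then show ?thesis using elim(1) t V1 by (auto simp: V_def)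
   next
    case False
    define r where "r = t - T"
    have r: "t = T + r" "0 < r" "r <= T'" using False t by (auto simp: r_def)
    have "duh \<nu> 0 (%tau. V (T + tau)) (%tau. V (T + tau)) r xi = duh \<nu> 0 U1 U1 r xi"
    proof (rule duh_cong[OF _ _ U1m])
     have "(%p. (T + fst p, snd p)) \<in> (borel :: real measure) \<Otimes>\<^sub>M (borel :: (real^3) measure) \<rightarrow>\<^sub>M borel \<Otimes>\<^sub>M borel" by measurable
     from measurable_compose[OF this Vm] show "(%(t, xi). V (T + t) xi) \<in> bmeas2"
      by (simp add: split_beta')
    qed (auto simp: V_def)
    then have d: "duh \<nu> T V V t xi = duh \<nu> 0 U1 U1 r xi" using duh_shift[OF Vm, of \<nu> T r xi] by (simp add: r)
    have sp: "duh \<nu> 0 V V t xi = hk \<nu> (t - T) xi *\<^sub>R duh \<nu> 0 V V T xi + duh \<nu> T V V t xi"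
     by (rule duh_split[OF \<nu> Vm VM nconv_finite(1)[OF W M'm fin']]) (use t False T in auto)
    have e: "hk \<nu> t xi *\<^sub>R A xi = hk \<nu> r xi *\<^sub>R hk \<nu> T xi *\<^sub>R A xi"
     by (simp add: r exp_add[symmetric] algebra_simps)
    have "V t xi = hk \<nu> r xi *\<^sub>R U T xi - duh \<nu> 0 U1 U1 r xi"
     using elim(2) r by (auto simp: V_def)
    also have "U T xi = hk \<nu> T xi *\<^sub>R A xi - duh \<nu> 0 U U T xi" using elim(1) T by auto
    finally show ?thesis unfolding sp d V1[OF order_refl] e by (simp add: r scaleR_diff_right)
   qed
  qed
 qed
 then show ?thesis unfolding fsol_def using Vm M'm fin' VM by blast
qed

lemma duh_continuous:
 assumes \<nu>: "\<nu> > 0" and m: "(%(t, xi). f t xi) \<in> bmeas2"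
  and f: "!!tau x. tau \<in> {0..T} ==> ennreal (norm (f tau x)) <= F x" and fin: "nconv F F xi < \<infinity>"
 shows "continuous_on {0..T} (%t. duh \<nu> 0 f f t xi)"
 unfolding continuous_on_sequentially comp_def
proof (intro allI ballI impI, elim conjE)
 fix X t assume t: "t \<in> {0..T}" and X: "\<forall>n. X n \<in> {0..T}" and lim: "X ---> t"
 note [measurable] = nonlin_time_measurable[OF m m]
 define c where "c = enn2real (36 * (ennreal (norm xi) * nconv F F xi))"
 have c: "ennreal c = 36 * (ennreal (norm xi) * nconv F F xi)"
  unfolding c_def using fin by (intro ennreal_enn2real) (auto simp: ennreal_mult_less_top)
 have c0: "c \<ge> 0" by (simp add: c_def)
 have nb: "norm (nonlin (f tau) (f tau) xi) <= c" if "tau \<in> {0..T}" for tau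
 proof -
  have "ennreal (norm (nonlin (f tau) (f tau) xi)) <= ennreal c" unfolding c using that by (intro norm_nonlin_le f)
  then show ?thesis using c0 by (subst (asm) ennreal_le_iff) auto
 qed
 show "(%n. duh \<nu> 0 f f (X n) xi) ---> duh \<nu> 0 f f t xi"
  unfolding duh_def
 proof (rule integral_dominated_convergence[where w="%tau. c * indicator {0..T} tau"])
  show "integrable lborel (%tau. c * indicator {0..T} tau :: real)" by (intro integrable_mult_right) (simp add: emeasure_lborel_Icc_eq)
  show "AL tau. (%n. if 0 <= tau & tau <= X n then hk \<nu> (X n - tau) xi *\<^sub>R nonlin (f tau) (f tau) xi else 0)
   ---> (dker \<nu> 0 t f f xi tau)"
   using AE_lborel_singleton[of t]
  proof eventually_elim
   case (elim tau)
   have e: "(%n. hk \<nu> (X n - tau) xi *\<^sub>R nonlin (f tau) (f tau) xi) ---> hk \<nu> (t - tau) xi *\<^sub>R nonlin (f tau) (f tau) xi"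
    by (intro tendsto_intros lim)
   show ?case
   proof (cases "tau < t")
    case True
    have "eventually (%n. tau < X n) sequentially" using order_tendstoD(1)[OF lim True] .
    then have "eventually (%n. (if 0 <= tau then hk \<nu> (X n - tau) xi *\<^sub>R nonlin (f tau) (f tau) xi else 0) = (if 0 <= tau & tau <= X n then hk \<nu> (X n - tau) xi *\<^sub>R nonlin (f tau) (f tau) xi else 0)) sequentially"
     by eventually_elim auto
    note A = this
    have B: "(%n. if 0 <= tau then hk \<nu> (X n - tau) xi *\<^sub>R nonlin (f tau) (f tau) xi else 0) ---> (dker \<nu> 0 t f f xi tau)"
    proof (cases "0 <= tau")
     case True
     then have c: "(0 <= tau) = True" "(tau <= t) = True" using \<open>tau < t\<close> by auto
     show ?thesis unfolding c simp_thms if_True by (rule e)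
    next
     case False
     then have c: "(0 <= tau) = False" by auto
     show ?thesis unfolding c simp_thms if_False by (rule tendsto_const)
    qed
    from Lim_transform_eventually[OF B A] show ?thesis .
   next
    case False
    then have "t < tau" using elim by auto
    have "eventually (%n. X n < tau) sequentially" using order_tendstoD(2)[OF lim \<open>t < tau\<close>] .
    then have "eventually (%n. 0 = (if 0 <= tau & tau <= X n then hk \<nu> (X n - tau) xi *\<^sub>R nonlin (f tau) (f tau) xi else 0)) sequentially"
     by eventually_elim auto
    from Lim_transform_eventually[OF tendsto_const this] show ?thesis
     using \<open>t < tau\<close> by (subst (2) if_not_P) (simp, assumption)
   qed
  qed
  show "AL tau. norm (if 0 <= tau & tau <= X n then hk \<nu> (X n - tau) xi *\<^sub>R nonlin (f tau) (f tau) xi else 0) <= c * indicator {0..T} tau" for n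
  proof (rule AE_I2)
   fix tau
   show "norm (if 0 <= tau & tau <= X n then hk \<nu> (X n - tau) xi *\<^sub>R nonlin (f tau) (f tau) xi else 0) <= c * indicator {0..T} tau"
   proof (cases "0 <= tau & tau <= X n")
    case True
    then have tau: "tau \<in> {0..T}" using X by (meson atLeastAtMost_iff order_trans)
    have "hk \<nu> (X n - tau) xi * norm (nonlin (f tau) (f tau) xi) <= 1 * c"
     using \<nu> True by (intro mult_mono nb tau) auto
    then show ?thesis using True tau by simp
   next
    case False
    then have "(if 0 <= tau & tau <= X n then hk \<nu> (X n - tau) xi *\<^sub>R nonlin (f tau) (f tau) xi else 0) = 0" by (rule if_not_P)
    then show ?thesis using c0 by simp
   qed
  qed
 qed measurable
qed

lemma fsol_continuous:
 assumes \<nu>: "\<nu> > 0" and W: "conv_weight C W" and U: "fsol \<nu> W A T U"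
 shows "AL xi. continuous_on {0..T} (%t. U t xi)"
proof -
 obtain M where Mm: "M \<in> bmeas" and fin: "nsq (%xi. W xi * M xi) < \<infinity>"
  and M: "!!t xi. t \<in> {0..T} ==> ennreal (norm (U t xi)) <= M xi" using fsol_majorant[OF U] by blast
 show ?thesis using fsol_eq[OF U]
 proof eventually_elim
  case (elim xi)
  have "continuous_on {0..T} (%t. hk \<nu> t xi *\<^sub>R A xi - duh \<nu> 0 U U t xi)"
   by (intro continuous_intros duh_continuous[OF \<nu> fsol_measurable[OF U] M nconv_finite(1)[OF W Mm fin]])
  then show ?case by (rule continuous_on_eq) (use elim in auto)
 qed
qed

lemma fsol_norm_diff_tendsto:
 fixes V :: "real^3 => real"
 assumes \<nu>: "\<nu> > 0" and W: "conv_weight C W" and U: "fsol \<nu> W A T U"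
  and [measurable]: "V \<in> bmeas" and V0: "!!xi. V xi \<ge> 0" and VW: "!!xi. ennreal (V xi) <= ennreal c * W xi"
  and X: "!!n. X n \<in> {0..T}" and t: "t \<in> {0..T}" and lim: "X ---> t"
 shows "(%n. nsq (%xi. ennreal (V xi) * ennreal (norm (U (X n) xi - U t xi)))) ---> 0"
  and "(%n. nsq (%xi. ennreal (V xi) * enorm (U (X n)) xi)) ---> nsq (%xi. ennreal (V xi) * enorm (U t) xi)"
proof -
 obtain M where Mm [measurable]: "M \<in> bmeas" and fin: "nsq (%xi. W xi * M xi) < \<infinity>"
  and M: "!!t xi. t \<in> {0..T} ==> ennreal (norm (U t xi)) <= M xi" using fsol_majorant[OF U] by blast
 note [measurable] = measurable_slice[OF fsol_measurable[OF U]]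
 have [measurable]: "W \<in> bmeas" using W by (simp add: conv_weight_def)
 have VM: "nsq (%xi. ennreal (V xi) * M xi) < \<infinity>"
 proof -
  have "nsq (%xi. ennreal (V xi) * M xi) <= nsq (%xi. ennreal c * (W xi * M xi))"
   unfolding mult.assoc[symmetric] by (intro nsq_mono mult_right_mono VW) auto
  also have "... = (ennreal c)^2 * nsq (%xi. W xi * M xi)" by (rule nsq_cmult) measurable
  also have "... < \<infinity>" using fin by (auto simp: ennreal_mult_less_top power_less_top_ennreal)
  finally show ?thesis .
 qed
 have cont: "AL xi. (%n. U (X n) xi) ---> U t xi"
  using fsol_continuous[OF \<nu> W U] by eventually_elim (use X t lim in \<open>auto simp: continuous_on_sequentially comp_def\<close>)
 have sq: "(ennreal (V xi) * ennreal (norm v))^2 = ennreal ((V xi * norm v)^2)" for xi and v :: "complex^3"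
  using V0[of xi] by (simp add: ennreal_mult[symmetric] ennreal_power)
 have "(%n. (NI xi. ennreal ((V xi * norm (U (X n) xi - U t xi))^2))) ---> (\<integral>\<^sup>+xi. ennreal 0 \<partial>(lborel :: (real^3) measure))"
 proof (rule nn_integral_dominated_convergence[where w="%xi. 4 * (ennreal (V xi) * M xi)^2"])
  show "(NI xi. 4 * (ennreal (V xi) * M xi)^2) < \<infinity>"
   using VM by (subst nn_integral_cmult) (auto simp: nsq_def ennreal_mult_less_top)
  show "AL xi. (%n. ennreal ((V xi * norm (U (X n) xi - U t xi))^2)) ---> ennreal 0"
   using cont
  proof eventually_elim
   case (elim xi)
   have "(%n. (V xi * norm (U (X n) xi - U t xi))^2) ---> (V xi * norm (U t xi - U t xi))\<^sup>2" by (intro tendsto_intros elim)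
   then show ?case by (intro tendsto_ennrealI) simp
  qed
  show "AL xi. ennreal ((V xi * norm (U (X n) xi - U t xi))^2) <= 4 * (ennreal (V xi) * M xi)^2" for n
  proof (rule AE_I2)
   fix xi
   have "ennreal (norm (U (X n) xi - U t xi)) <= ennreal (norm (U (X n) xi) + norm (U t xi))" by (intro ennreal_leI norm_triangle_ineq4)
   also have "... <= M xi + M xi" using M[OF X[of n], of xi] M[OF t, of xi] by (simp add: add_mono)
   finally have "(ennreal (V xi) * ennreal (norm (U (X n) xi - U t xi)))^2 <= (ennreal (V xi) * (2 * M xi))^2"
    by (intro power_mono mult_left_mono) (auto simp: mult_2)
   also have "... = 4 * (ennreal (V xi) * M xi)^2" by (simp add: power_mult_distrib mult_ac)
   finally show "ennreal ((V xi * norm (U (X n) xi - U t xi))^2) <= 4 * (ennreal (V xi) * M xi)^2" unfolding sq .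
  qed
 qed measurable
 then show "(%n. nsq (%xi. ennreal (V xi) * ennreal (norm (U (X n) xi - U t xi)))) ---> 0"
  unfolding nsq_def sq by simp
 show "(%n. nsq (%xi. ennreal (V xi) * enorm (U (X n)) xi)) ---> nsq (%xi. ennreal (V xi) * enorm (U t) xi)"
  unfolding nsq_def sq
 proof (rule nn_integral_dominated_convergence[where w="%xi. (ennreal (V xi) * M xi)^2"])
  show "(NI xi. (ennreal (V xi) * M xi)^2) < \<infinity>" using VM by (simp add: nsq_def)
  show "AL xi. (%n. ennreal ((V xi * norm (U (X n) xi))^2)) ---> ennreal ((V xi * norm (U t xi))^2)"
   using cont by eventually_elim (intro tendsto_ennrealI tendsto_intros)
  show "AL xi. ennreal ((V xi * norm (U (X n) xi))^2) <= (ennreal (V xi) * M xi)^2" for n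
   unfolding sq[symmetric] by (intro AE_I2 power_mono mult_left_mono M X) auto
 qed measurable
qed

text \<open>The difference satisfies a linear integral inequality in plain \<open>L2\<close>, since both solutions have transforms bounded in \<open>L1\<close>; Gronwall concludes.\<close>

lemma fsol_unique:
 assumes \<nu>: "\<nu> > 0" and W: "conv_weight C W" and U: "fsol \<nu> W A T U" and V: "fsol \<nu> W A T V"
 shows "AL xi. \<forall>t\<in>{0..T}. U t xi = V t xi"
proof -
 obtain M1 where M1m: "M1 \<in> bmeas" "nsq (%xi. W xi * M1 xi) < \<infinity>"
  and M1: "!!t xi. t \<in> {0..T} ==> ennreal (norm (U t xi)) <= M1 xi" using fsol_majorant[OF U] by blast
 obtain M2 where M2m: "M2 \<in> bmeas" "nsq (%xi. W xi * M2 xi) < \<infinity>"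
  and M2: "!!t xi. t \<in> {0..T} ==> ennreal (norm (V t xi)) <= M2 xi" using fsol_majorant[OF V] by blast
 have Wm [measurable]: "W \<in> bmeas" using W by (simp add: conv_weight_def)
 define M where "M xi = M1 xi + M2 xi" for xi
 note [measurable] = M1m(1) M2m(1)
 have Mm [measurable]: "M \<in> bmeas" unfolding M_def[abs_def] by measurable
 have MU: "ennreal (norm (U t xi)) <= M xi" and MV: "ennreal (norm (V t xi)) <= M xi" if "t \<in> {0..T}" for t xi
  using M1[OF that, of xi] M2[OF that, of xi] by (auto simp: M_def intro: add_increasing add_increasing2)
 have Mfin: "nsq (%xi. W xi * M xi) < \<infinity>"
 proof -
  have "nsq (%xi. W xi * M xi) <= 2 * nsq (%xi. W xi * M1 xi) + 2 * nsq (%xi. W xi * M2 xi)"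
   unfolding M_def distrib_left by (rule nsq_add_le) measurable
  also have "... < \<infinity>" using M1m M2m by (auto simp: ennreal_mult_less_top ennreal_add_less_top)
  finally show ?thesis .
 qed
 note Mc = nconv_finite[OF W Mm Mfin]
 obtain L where L: "!!F. F \<in> bmeas ==> (NI xi. F xi)^2 <= ennreal L * nsq (%xi. W xi * F xi)"
  using W unfolding conv_weight_def by blast
 have "(NI xi. M xi)^2 < \<infinity>" using L[OF Mm] Mfin by (auto simp: ennreal_mult_less_top intro: le_less_trans)
 then obtain N where N: "(NI xi. M xi)^2 = ennreal N" "N \<ge> 0" by (cases "(NI xi. M xi)^2") auto
 note Um = fsol_measurable[OF U] and Vm = fsol_measurable[OF V]
 note [measurable] = Um Vm measurable_slice[OF Um] measurable_slice[OF Vm]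
 have Dm: "(%(t, xi). U t xi - V t xi) \<in> bmeas2" by measurable
 define D where "D t xi = U t xi - V t xi" for t xi
 have Dm [measurable]: "(%(t, xi). D t xi) \<in> bmeas2" unfolding D_def by (rule Dm)
 note eD = enorm_joint_measurable[OF Dm] and eU = enorm_joint_measurable[OF Um] and eV = enorm_joint_measurable[OF Vm]
 note [measurable] = measurable_slice[OF Dm] eD eU eV
 note n1 = nconv_joint_measurable[OF eD eU] and n2 = nconv_joint_measurable[OF eV eD]
 note [measurable] = n1 n2 slice_fix_measurable[OF n1] slice_fix_measurable[OF n2]
 define y where "y t = nsq (enorm (D t))" for t
 have ym [measurable]: "y \<in> bmeas"
 proof -
  have "(%t. (NI xi. (case (t, xi) of (t, xi) => enorm (D t) xi)^2)) \<in> bmeas"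
   by (rule lborel.borel_measurable_nn_integral) (use eD in measurable)
  then show ?thesis unfolding y_def[abs_def] nsq_def by simp
 qed
 obtain B where B: "nsq M = ennreal B" "B \<ge> 0" using Mc(2) by (cases "nsq M") auto
 have yB: "y t <= ennreal (4 * B)" if "t \<in> {0..T}" for t
 proof -
  have "y t <= nsq (%xi. 2 * M xi)" unfolding y_def
  proof (rule nsq_mono)
   fix xi
   have "ennreal (norm (D t xi)) <= ennreal (norm (U t xi) + norm (V t xi))" unfolding D_def by (intro ennreal_leI norm_triangle_ineq4)
   also have "... <= M xi + M xi" using MU[OF that, of xi] MV[OF that, of xi] by (simp add: add_mono)
   finally show "ennreal (norm (D t xi)) <= 2 * M xi" by (simp add: mult_2)
  qed
  also have "... = 2\<^sup>2 * nsq M" by (rule nsq_cmult) measurable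
  also have "... = ennreal (4 * B)" using B by (simp add: ennreal_mult)
  finally show ?thesis .
 qed
 define C' where "C' = 4 * (648 / \<nu>) * N"
 have C'0: "C' \<ge> 0" using \<nu> N by (simp add: C'_def)
 have step: "y t <= ennreal 0 + ennreal C' * (NI tau. indicator {0..t} tau * y tau)" if t: "t \<in> {0..T}" for t
 proof -
  define Q1 where "Q1 xi = (NI tau. indicator {0..t} tau * (nconv (enorm (D tau)) (enorm (U tau)) xi)^2)" for xi
  define Q2 where "Q2 xi = (NI tau. indicator {0..t} tau * (nconv (enorm (V tau)) (enorm (D tau)) xi)^2)" for xi
  have [measurable]: "Q1 \<in> bmeas" "Q2 \<in> bmeas" unfolding Q1_def[abs_def] Q2_def[abs_def] by measurable
  have L2: "U tau \<in> L2" "V tau \<in> L2" if "0 <= tau" "tau <= t" for tau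
  proof -
   have tau: "tau \<in> {0..T}" using that t by auto
   have "sqnorm (U tau) <= nsq M" "sqnorm (V tau) <= nsq M" unfolding nsq_enorm[symmetric] by (intro nsq_mono MU MV tau)+
   then show "U tau \<in> L2" "V tau \<in> L2" using Mc(2) by (auto simp: L2_iff)
  qed
  have "AL xi. (enorm (D t) xi)^2 <= 2 * (ennreal (648 / \<nu>) * Q1 xi) + 2 * (ennreal (648 / \<nu>) * Q2 xi)"
   using fsol_eq[OF U] fsol_eq[OF V]
  proof eventually_elim
   case (elim xi)
   have "V t xi - U t xi = duh \<nu> 0 U U t xi - duh \<nu> 0 V V t xi" using bspec[OF elim(1) t] bspec[OF elim(2) t] by simp
   also have "... = duh \<nu> 0 D U t xi + duh \<nu> 0 V D t xi"
    unfolding D_def[abs_def] using t by (intro duh_diff[OF \<nu> Um Vm MU MV L2 Mm Mc(1)]) auto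
   finally have "norm (D t xi) = norm (duh \<nu> 0 D U t xi + duh \<nu> 0 V D t xi)" unfolding D_def[of t xi] by (metis norm_minus_commute)
   then have "enorm (D t) xi <= ennreal (norm (duh \<nu> 0 D U t xi) + norm (duh \<nu> 0 V D t xi))"
    using norm_triangle_ineq[of "duh \<nu> 0 D U t xi" "duh \<nu> 0 V D t xi"] by (intro ennreal_leI) simp
   also have "... = ennreal (norm (duh \<nu> 0 D U t xi)) + ennreal (norm (duh \<nu> 0 V D t xi))" by (intro ennreal_plus) auto
   finally have "(enorm (D t) xi)^2 <= (ennreal (norm (duh \<nu> 0 D U t xi)) + ennreal (norm (duh \<nu> 0 V D t xi)))^2" by (intro power_mono) auto
   also have "... <= 2 * (ennreal (norm (duh \<nu> 0 D U t xi)))^2 + 2 * (ennreal (norm (duh \<nu> 0 V D t xi)))^2" by (rule ennreal_sq_add_le)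
   also have "... <= 2 * (ennreal (648 / \<nu>) * Q1 xi) + 2 * (ennreal (648 / \<nu>) * Q2 xi)"
    unfolding Q1_def Q2_def using t by (intro add_mono mult_left_mono duh_bound \<nu>) auto
   finally show ?case .
  qed
  then have "y t <= (NI xi. 2 * (ennreal (648 / \<nu>) * Q1 xi) + 2 * (ennreal (648 / \<nu>) * Q2 xi))"
   unfolding y_def nsq_def by (rule nn_integral_mono_AE)
  also have "... = 2 * (ennreal (648 / \<nu>) * (NI xi. Q1 xi)) + 2 * (ennreal (648 / \<nu>) * (NI xi. Q2 xi))"
   by (simp add: nn_integral_add nn_integral_cmult)
  also have "(NI xi. Q1 xi) = (NI tau. indicator {0..t} tau * nsq (nconv (enorm (D tau)) (enorm (U tau))))"
   unfolding Q1_def nsq_def by (rule time_Tonelli) measurable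
  also have "(NI xi. Q2 xi) = (NI tau. indicator {0..t} tau * nsq (nconv (enorm (V tau)) (enorm (D tau))))"
   unfolding Q2_def nsq_def by (rule time_Tonelli) measurable
  also have "2 * (ennreal (648 / \<nu>) * (NI tau. indicator {0..t} tau * nsq (nconv (enorm (D tau)) (enorm (U tau))))) + 2 * (ennreal (648 / \<nu>) * (NI tau. indicator {0..t} tau * nsq (nconv (enorm (V tau)) (enorm (D tau)))))
   <= 2 * (ennreal (648 / \<nu>) * (NI tau. indicator {0..t} tau * (y tau * ennreal N))) + 2 * (ennreal (648 / \<nu>) * (NI tau. indicator {0..t} tau * (y tau * ennreal N)))"
  proof -
   have k: "nsq (nconv (enorm (D tau)) F) <= y tau * ennreal N" if F: "F \<in> bmeas" "!!xi. F xi <= M xi" for F tau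
   proof -
    have "nsq (nconv (enorm (D tau)) F) <= nsq (enorm (D tau)) * (NI xi. F xi)^2" using F(1) by (intro young_L2_L1) measurable
    also have "... <= nsq (enorm (D tau)) * (NI xi. M xi)^2" by (intro mult_left_mono power_mono nn_integral_mono F(2)) auto
    finally show ?thesis by (simp add: y_def N)
   qed
   have i1: "indicator {0..t} tau * nsq (nconv (enorm (D tau)) (enorm (U tau))) <= indicator {0..t} tau * (y tau * ennreal N)" for tau
    using k[of "enorm (U tau)" tau] MU[of tau] t by (auto simp: indicator_def)
   have "nsq (nconv (enorm (V tau)) (enorm (D tau))) = nsq (nconv (enorm (D tau)) (enorm (V tau)))" for tau
    unfolding nsq_def by (intro nn_integral_cong) (subst nconv_commute, auto)
   then have i2: "indicator {0..t} tau * nsq (nconv (enorm (V tau)) (enorm (D tau))) <= indicator {0..t} tau * (y tau * ennreal N)" for tau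
    using k[of "enorm (V tau)" tau] MV[of tau] t by (auto simp: indicator_def)
   show ?thesis
    by (intro add_mono mult_left_mono nn_integral_mono[OF i1] nn_integral_mono[OF i2]) auto
  qed
  also have "(NI tau. indicator {0..t} tau * (y tau * ennreal N)) = (NI tau. indicator {0..t} tau * y tau) * ennreal N"
   unfolding mult.assoc[symmetric] by (rule nn_integral_multc) measurable
  also have "2 * (ennreal (648 / \<nu>) * ((NI tau. indicator {0..t} tau * y tau) * ennreal N)) + 2 * (ennreal (648 / \<nu>) * ((NI tau. indicator {0..t} tau * y tau) * ennreal N))
   = ennreal C' * (NI tau. indicator {0..t} tau * y tau)"
  proof -
   have n0: "0 <= 648 / \<nu>" using \<nu> by simp
   have c': "ennreal C' = 4 * (ennreal (648 / \<nu>) * ennreal N)"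
    unfolding C'_def mult.assoc
    by (simp only: ennreal_mult[OF _ mult_nonneg_nonneg[OF n0 N(2)]] ennreal_mult[OF n0 N(2)] zero_le_numeral ennreal_numeral)
   have "2 * (a * (Y * n)) + 2 * (a * (Y * n)) = 4 * (a * n) * Y" for a Y n :: ennreal
    by (simp add: mult_2[symmetric] mult_ac numeral_mult_ennreal[symmetric] flip: distrib_right)
   then show ?thesis unfolding c' .
  qed
  finally show ?thesis by simp
 qed
 have y0: "y t = 0" if "t \<in> {0..T}" for t
  using gronwall[OF ym yB _ order_refl C'0 step that] B(2) by simp
 have ae: "AL xi. U t xi = V t xi" if "t \<in> {0..T}" for t
 proof -
  have "sqnorm (D t) = 0" using y0[OF that] by (simp add: y_def nsq_enorm)
  then have "AL xi. D t xi = 0" by (subst (asm) sqnorm_eq_0_iff) auto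
  then show ?thesis by eventually_elim (simp add: D_def)
 qed
 have nl: "nonlin (U tau) (U tau) xi = nonlin (V tau) (V tau) xi" if "tau \<in> {0..T}" for tau xi
  by (rule nonlin_cong_AE[OF _ _ ae[OF that]]) measurable
 show ?thesis using fsol_eq[OF U] fsol_eq[OF V]
 proof eventually_elim
  case (elim xi)
  show ?case
  proof
   fix t assume t: "t \<in> {0..T}"
   have "duh \<nu> 0 U U t xi = duh \<nu> 0 V V t xi"
    unfolding duh_def using t nl by (intro Bochner_Integration.integral_cong refl) auto
   then show "U t xi = V t xi" using elim t by simp
  qed
 qed
qed

lemma duh_cong_AE:
 fixes f g :: "real => real^3 => complex^3"
 assumes "!!tau. s <= tau ==> tau <= t ==> AL x. f tau x = g tau x"
  and "!!tau. f tau \<in> bmeas" "!!tau. g tau \<in> bmeas"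
 shows "duh \<nu> s f f t xi = duh \<nu> s g g t xi"
proof -
 have "nonlin (f tau) (f tau) xi = nonlin (g tau) (g tau) xi" if "s <= tau" "tau <= t" for tau
  by (rule nonlin_cong_AE[OF assms(2,3) assms(1)[OF that]])
 then show ?thesis unfolding duh_def by (intro Bochner_Integration.integral_cong refl) auto
qed

lemma local_existence:
 assumes \<nu>: "\<nu> > 0" and T: "T > 0" and K: "K \<ge> 0" and W: "conv_weight C W"
  and A: "A \<in> bmeas" and AK: "nsq (%xi. W xi * enorm A xi) <= ennreal K"
  and small: "16 * (648 / \<nu> * T) * C * K <= 1"
 shows "\<exists>U. fsol \<nu> W A T U"
proof -
 obtain U m where "(%(t, xi). U t xi) \<in> bmeas2" "m \<in> bmeas"
  "nsq (%xi. W xi * m xi) <= ennreal (4 * K)" "!!t xi. ennreal (norm (U t xi)) <= m xi"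
  "AL xi. \<forall>t\<in>{0..T}. U t xi = hk \<nu> t xi *\<^sub>R A xi - duh \<nu> 0 U U t xi"
  using local_existence_majorant[OF \<nu> T K W A AK small] by auto
 moreover have "nsq (%xi. W xi * m xi) < \<infinity>" using calculation(3) by (rule le_less_trans) simp
 ultimately show ?thesis unfolding fsol_def by blast
qed

lemma fsol_cong:
 assumes U: "fsol \<nu> W A T U" and Vm: "(%(t, xi). V t xi) \<in> bmeas2"
  and Mm: "M \<in> bmeas" "nsq (%xi. W xi * M xi) < \<infinity>" and M: "!!t xi. t \<in> {0..T} ==> ennreal (norm (V t xi)) <= M xi"
  and eq: "AL xi. \<forall>t\<in>{0..T}. V t xi = U t xi"
 shows "fsol \<nu> W A T V"
proof -
 have "AL xi. \<forall>t\<in>{0..T}. V t xi = hk \<nu> t xi *\<^sub>R A xi - duh \<nu> 0 V V t xi"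
  using eq fsol_eq[OF U]
 proof eventually_elim
  case (elim xi)
  show ?case
  proof
   fix t assume t: "t \<in> {0..T}"
   have "duh \<nu> 0 V V t xi = duh \<nu> 0 U U t xi"
   proof (rule duh_cong_AE[OF _ measurable_slice[OF Vm] measurable_slice[OF fsol_measurable[OF U]]])
    fix tau assume "0 <= tau" "tau <= t"
    with eq t show "AL x. V tau x = U tau x" by (auto elim!: eventually_mono)
   qed
   then show "V t xi = hk \<nu> t xi *\<^sub>R A xi - duh \<nu> 0 V V t xi" using elim t by simp
  qed
 qed
 then show ?thesis unfolding fsol_def using Vm Mm M by blast
qed

lemma nsq_sum_finite:
 assumes [measurable]: "!!k. M k \<in> bmeas" "W \<in> bmeas" and "!!k. nsq (%xi. W xi * M k xi) < \<infinity>"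
 shows "nsq (%xi. W xi * (\<Sum>k<(n::nat). M k xi)) < \<infinity>"
proof (induction n)
 case 0 show ?case by (simp add: nsq_def)
next
 case (Suc n)
 have "nsq (%xi. W xi * (\<Sum>k<Suc n. M k xi)) <= 2 * nsq (%xi. W xi * (\<Sum>k<n. M k xi)) + 2 * nsq (%xi. W xi * M n xi)"
  unfolding sum.lessThan_Suc distrib_left by (rule nsq_add_le) measurable
 also have "... < \<infinity>" using Suc assms(3)[of n] by (auto simp: ennreal_mult_less_top ennreal_add_less_top)
 finally show ?case .
qed

text \<open>The time of existence depends only on the size of the datum, so a solution bounded up to a finite maximal time could be continued past it. Solutions on different intervals agree almost everywhere only, and are patched along a sequence of times.\<close>

lemma fsol_maximal:
 assumes \<nu>: "\<nu> > 0" and W: "conv_weight C W" and A: "A \<in> bmeas" and AK: "nsq (%xi. W xi * enorm A xi) < \<infinity>"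
 obtains Tm U where "0 < Tm" "!!T. ereal T < Tm ==> fsol \<nu> W A T U"
  "!!K. Tm < \<infinity> ==> \<exists>t. 0 <= t & ereal t < Tm & ennreal K < nsq (%xi. W xi * enorm (U t) xi)"
proof -
 have C: "C > 0" and Wm [measurable]: "W \<in> bmeas" using W by (auto simp: conv_weight_def)
 have step: "\<exists>T>0. 16 * (648 / \<nu> * T) * C * K <= 1" if "K \<ge> 0" for K
 proof (intro exI conjI)
  define D where "D = 16 * 648 * C"
  have D: "D > 0" using C by (simp add: D_def)
  define T where "T = \<nu> / (D * (K + 1))"
  show "T > 0" using \<nu> D that by (simp add: T_def)
  have "16 * (648 / \<nu> * T) * C * K = (D / (D * (K + 1))) * K" using \<nu> by (simp add: T_def D_def)
  also have "D / (D * (K + 1)) = 1 / (K + 1)" using D by simp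
  also have "1 / (K + 1) * K = K / (K + 1)" by simp
  also have "... <= 1" using that by simp
  finally show "16 * (648 / \<nu> * T) * C * K <= 1" .
 qed
 define S where "S = {T. 0 < T & (\<exists>U. fsol \<nu> W A T U)}"
 obtain K0 where K0: "nsq (%xi. W xi * enorm A xi) = ennreal K0" "K0 \<ge> 0" using AK by (cases "nsq (%xi. W xi * enorm A xi)") auto
 obtain T0 where T0: "T0 > 0" "16 * (648 / \<nu> * T0) * C * K0 <= 1" using step[OF K0(2)] by blast
 then have "T0 \<in> S" unfolding S_def using local_existence[OF \<nu> T0(1) K0(2) W A _ T0(2)] K0(1) by simp
 define Tm where "Tm = (SUP T\<in>S. ereal T)"
 have Tm_upper: "ereal T <= Tm" if "T \<in> S" for T unfolding Tm_def by (rule SUP_upper[OF that])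
 have Tm_pos: "0 < Tm" using Tm_upper[OF \<open>T0 \<in> S\<close>] T0(1) by (metis ereal_less(2) less_le_trans)
 obtain f' :: "nat => ereal" where f': "range f' \<subseteq> ereal ` S" "Tm = Sup (range f')"
  unfolding Tm_def using SUP_countable_SUP[of S ereal] \<open>T0 \<in> S\<close> by blast
 have "\<forall>n. \<exists>T. T \<in> S & f' n = ereal T" using f'(1) by blast
 then obtain f where f: "!!n. f n \<in> S" "!!n. f' n = ereal (f n)" by metis
 have ex: "\<exists>n. T < f n" if "ereal T < Tm" for T using that unfolding f'(2) less_Sup_iff by (auto simp: f(2))
 have "\<forall>n. \<exists>U. fsol \<nu> W A (f n) U" using f(1) by (auto simp: S_def)
 from choice[OF this] obtain V where V: "!!n. fsol \<nu> W A (f n) (V n)" by blast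
 have Vm: "(%(t, xi). V n t xi) \<in> bmeas2" for n by (rule fsol_measurable[OF V])
 have "\<forall>n. \<exists>M. M \<in> bmeas & nsq (%xi. W xi * M xi) < \<infinity> & (\<forall>t xi. t \<in> {0..f n} --> ennreal (norm (V n t xi)) <= M xi)"
  using fsol_majorant[OF V] by metis
 then obtain M where M: "!!n. M n \<in> bmeas" "!!n. nsq (%xi. W xi * M n xi) < \<infinity>"
  "!!n t xi. t \<in> {0..f n} ==> ennreal (norm (V n t xi)) <= M n xi" by metis
 \<comment> \<open>Choosing the first interval that contains \<open>t\<close> makes the patched function jointly measurable.\<close>
 define k where "k t = (LEAST n. t <= f n)" for t
 have k: "t <= f (k t)" "k t <= n" if "t <= f n" for t n unfolding k_def using that by (auto intro: LeastI Least_le)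
 define U where "U t = V (k t) t" for t
 have Um: "(%(t, xi). U t xi) \<in> bmeas2"
 proof -
  have "(%p. (%(t, xi). V (k (fst p)) t xi) p) \<in> borel_measurable ((borel :: real measure) \<Otimes>\<^sub>M (borel :: (real^3) measure))"
  proof (rule measurable_compose_countable[where g="%p. k (fst p)"])
   show "(%p. k (fst p)) \<in> (borel :: real measure) \<Otimes>\<^sub>M (borel :: (real^3) measure) \<rightarrow>\<^sub>M count_space UNIV"
    unfolding k_def by (rule measurable_Least) measurable
  qed (rule Vm)
  then show ?thesis by (simp add: U_def split_beta')
 qed
 have sol: "fsol \<nu> W A T U" if lt: "ereal T < Tm" for T
 proof -
  obtain n where n: "T < f n" using ex[OF lt] by blast
  have eq: "AL xi. \<forall>m. \<forall>t\<in>{0..min (f n) (f m)}. V n t xi = V m t xi"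
   unfolding AE_all_countable
  proof
   fix m
   show "AL xi. \<forall>t\<in>{0..min (f n) (f m)}. V n t xi = V m t xi"
    by (rule fsol_unique[OF \<nu> W fsol_restrict[OF V] fsol_restrict[OF V]]) auto
  qed
  show ?thesis
  proof (rule fsol_cong[OF fsol_restrict[OF V[of n] less_imp_le[OF n]] Um])
   show "(%xi. \<Sum>j<Suc n. M j xi) \<in> bmeas" using M(1) by measurable
   show "nsq (%xi. W xi * (\<Sum>j<Suc n. M j xi)) < \<infinity>" by (rule nsq_sum_finite[OF M(1) Wm M(2)])
   show "ennreal (norm (U t xi)) <= (\<Sum>j<Suc n. M j xi)" if t: "t \<in> {0..T}" for t xi
   proof -
    have tn: "t <= f n" using t n by simp
    have "ennreal (norm (U t xi)) <= M (k t) xi" unfolding U_def using k(1)[OF tn] t by (intro M(3)) auto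
    also have "... <= (\<Sum>j<Suc n. M j xi)" using k(2)[OF tn] by (intro member_le_sum) auto
    finally show ?thesis .
   qed
   show "AL xi. \<forall>t\<in>{0..T}. U t xi = V n t xi"
    using eq
   proof eventually_elim
    case (elim xi)
    show ?case
    proof
     fix t assume t: "t \<in> {0..T}"
     then have "t <= f n" using n by simp
     then have "V n t xi = V (k t) t xi"
      using bspec[OF spec[OF elim, of "k t"], of t] k(1)[OF \<open>t <= f n\<close>] t by simp
     then show "U t xi = V n t xi" by (simp add: U_def)
    qed
   qed
  qed
 qed
 have blowup: "\<exists>t. 0 <= t & ereal t < Tm & ennreal K < nsq (%xi. W xi * enorm (U t) xi)" if fin: "Tm < \<infinity>" for K
 proof (rule ccontr)
  assume no: "\<not> ?thesis"
  have le: "nsq (%xi. W xi * enorm (U t) xi) <= ennreal (max 0 K)" if "0 <= t" "ereal t < Tm" for t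
  proof -
   have "\<not> ennreal K < nsq (%xi. W xi * enorm (U t) xi)" using no that by blast
   then have "nsq (%xi. W xi * enorm (U t) xi) <= ennreal K" by (rule leI)
   also have "... <= ennreal (max 0 K)" by (intro ennreal_leI) simp
   finally show ?thesis .
  qed
  obtain R where R: "Tm = ereal R" using fin Tm_pos by (cases Tm) auto
  have R0: "R > 0" using Tm_pos R by simp
  obtain T' where T': "T' > 0" "16 * (648 / \<nu> * T') * C * (max 0 K) <= 1" using step[of "max 0 K"] by auto
  define T where "T = max 0 (R - T' / 2)"
  have T: "0 <= T" "T < R" "R < T + T'" using T'(1) R0 by (auto simp: T_def)
  have "\<exists>U'. fsol \<nu> W A (T + T') U'"
   by (rule fsol_extend[OF \<nu> W sol T(1) le]) (use T T' R in auto)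
  then have "T + T' \<in> S" using T T' by (auto simp: S_def)
  from Tm_upper[OF this] show False using T R by simp
 qed
 show ?thesis using that[OF Tm_pos sol blowup] by blast
qed

section \<open>Symmetry, incompressibility and the energy inequality\<close>

definition vcnj :: "complex^3 => complex^3" where "vcnj v = (\<chi> j. cnj (v $ j))"

definition vdot :: "real^3 => complex^3 => complex" where
 "vdot xi v = (\<Sum>j\<in>UNIV. cplx (xi $ j) * v $ j)"

lemma vcnj_nth [simp]: "vcnj v $ j = cnj (v $ j)" by (simp add: vcnj_def)

lemma norm_vcnj [simp]: "norm (vcnj v) = norm v" by (simp add: norm_vec_def)

lemma vcnj_vcnj [simp]: "vcnj (vcnj v) = v" by (simp add: vec_eq_iff)

lemma bounded_linear_vcnj: "bounded_linear vcnj"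
 by (rule bounded_linear_intro[where K=1]) (auto simp: vec_eq_iff complex_eq_iff)

lemma bounded_linear_vdot: "bounded_linear (vdot xi)"
proof -
 have "bounded_linear (%v :: complex^3. \<Sum>j\<in>UNIV. cplx (xi $ j) * v $ j)"
  by (intro bounded_linear_sum bounded_linear_const_mult bounded_linear_vec_nth)
 then show ?thesis by (simp add: vdot_def[abs_def])
qed

lemma vdot_leray: "vdot xi (leray_symbol xi v) = 0"
proof (cases "xi = 0")
 case False
 have s: "(\<Sum>j\<in>UNIV. cplx (xi $ j) * cplx (xi $ j)) = cplx ((norm xi)^2)"
  by (simp add: norm_vec_def L2_set_def sum_nonneg power2_eq_square[symmetric])
 define c where "c = (\<Sum>j\<in>UNIV. v $ j * cplx (xi $ j))"
 have "vdot xi (leray_symbol xi v) = (\<Sum>j\<in>UNIV. v $ j * cplx (xi $ j)) - c / cplx ((norm xi)^2) * (\<Sum>j\<in>UNIV. cplx (xi $ j) * cplx (xi $ j))"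
  unfolding vdot_def leray_symbol_def c_def[symmetric]
  by (simp add: cvec_def right_diff_distrib sum_subtractf sum_distrib_left mult_ac) (simp add: c_def)
 also have "... = 0" unfolding s c_def using False by simp
 finally show ?thesis .
qed (simp add: vdot_def)

lemma vdot_nonlin: "vdot xi (nonlin f g xi) = 0" by (simp add: nonlin_def vdot_leray)

lemma inner_complex_Re: "z \<bullet> w = Re (cnj z * w)" for z w :: complex
 by (simp add: inner_complex_def)

lemma inner_vec_Re: "v \<bullet> w = Re (\<Sum>k\<in>UNIV. cnj (v $ k) * w $ k)" for v w :: "complex^3"
 by (simp add: inner_vec_def inner_complex_Re)

lemma inner_leray:
 assumes "vdot xi v = 0" shows "v \<bullet> leray_symbol xi w = v \<bullet> w"
proof -
 define c where "c = (\<Sum>j\<in>UNIV. w $ j * cplx (xi $ j)) / cplx ((norm xi)^2)"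
 have "(\<Sum>k\<in>UNIV. cnj (v $ k) * leray_symbol xi w $ k) = (\<Sum>k\<in>UNIV. cnj (v $ k) * w $ k) - c * cnj (vdot xi v)"
  unfolding leray_symbol_def c_def[symmetric] vdot_def
  by (simp add: cvec_def right_diff_distrib sum_subtractf sum_distrib_left mult_ac)
 then show ?thesis unfolding inner_vec_Re assms by simp
qed

lemma AE_lborel_diff:
 assumes "AL eta. P (eta :: 'a::euclidean_space)" shows "AL eta. P (xi - eta)"
proof -
 have "AE eta in distr lborel borel ((+) xi). P eta" using assms unfolding lborel_distr_plus .
 then have "AL eta. P (xi + eta)" by (rule AE_distrD[rotated]) simp
 from AE_lborel_reflect[OF this] show ?thesis by simp
qed

text \<open>The cancellation \<open>\<integral> (u \<cdot> \<nabla> u) \<bullet> u = 0\<close> on the Fourier side: exchanging \<open>xi\<close> and \<open>eta\<close> in the double integral and using \<open>xi \<bullet> f xi = 0\<close> shows that it equals its own negative.\<close>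

lemma nonlin_cancel:
 assumes fL2: "f \<in> L2" and M: "!!x. ennreal (norm (f x)) <= M x" and Mm [measurable]: "M \<in> bmeas"
  and fin: "(NI xi. M xi * (ennreal (norm xi) * nconv M M xi)) < \<infinity>"
  and sym: "AL xi. f (- xi) = vcnj (f xi)" and div: "AL xi. vdot xi (f xi) = 0"
 shows "(LI xi. f xi \<bullet> nonlin f f xi) = 0"
proof -
 have fm [measurable]: "f \<in> bmeas" using fL2 by (rule L2_measurable)
 define c0 where "c0 = 1 / (2 * pi)^3"
 define H where "H xi eta = vdot xi (f (xi - eta)) * (\<Sum>k\<in>UNIV. f eta $ k * cnj (f xi $ k))" for xi eta
 have Hm: "(%(xi, eta). H xi eta) \<in> borel_measurable (lborel \<Otimes>\<^sub>M lborel)" unfolding H_def vdot_def by measurable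
 have fjL2: "(%eta. f eta $ j) \<in> L2" for j using fL2 by (simp add: L2_vec_iff)
 have pt: "f xi \<bullet> nonlin f f xi = - (c0 * (LI eta. Im (H xi eta)))" if d: "vdot xi (f xi) = 0" for xi
 proof -
  have Hi: "integrable lborel (%eta. cplx (xi $ j) * (f (xi - eta) $ j * f eta $ k) * cnj (f xi $ k))" for j k
   by (intro integrable_mult_left integrable_mult_right conv_integrable fjL2)
  have Hsum: "H xi eta = (\<Sum>k\<in>UNIV. \<Sum>j\<in>UNIV. cplx (xi $ j) * (f (xi - eta) $ j * f eta $ k) * cnj (f xi $ k))" for eta
   unfolding H_def vdot_def by (simp only: sum_distrib_left sum_distrib_right mult.assoc)
  have Hint: "integrable lborel (H xi)" unfolding Hsum[abs_def] by (intro Bochner_Integration.integrable_sum Hi)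
  have "(LI eta. H xi eta) = (\<Sum>k\<in>UNIV. \<Sum>j\<in>UNIV. cplx (xi $ j) * conv (%eta. f eta $ j) (%eta. f eta $ k) xi * cnj (f xi $ k))"
   unfolding Hsum conv_def by (simp only: Bochner_Integration.integral_sum Bochner_Integration.integrable_sum Hi integral_mult_left_zero integral_mult_right_zero)
  then have I: "\<i> * cplx c0 * (LI eta. H xi eta) = (\<Sum>k\<in>UNIV. cnj (f xi $ k) * (\<Sum>j\<in>UNIV. \<i> * cplx (xi $ j) * (cplx c0 * conv (%eta. f eta $ j) (%eta. f eta $ k) xi)))"
   by (simp only: sum_distrib_left) (simp only: mult_ac)
  have "f xi \<bullet> nonlin f f xi = Re (\<i> * cplx c0 * (LI eta. H xi eta))"
  proof -
   have "f xi \<bullet> nonlin f f xi = f xi \<bullet> (\<chi> k. \<Sum>j\<in>UNIV. \<i> * cplx (xi $ j) * (cplx c0 * conv (%eta. f eta $ j) (%eta. f eta $ k) xi))"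
    unfolding nonlin_def c0_def by (rule inner_leray[OF d])
   then show ?thesis unfolding inner_vec_Re vec_lambda_beta I .
  qed
  also have "... = - (c0 * Im (LI eta. H xi eta))" by simp
  also have "Im (LI eta. H xi eta) = (LI eta. Im (H xi eta))" using integral_Im[OF Hint] by simp
  finally show ?thesis .
 qed
 have "(LI xi. f xi \<bullet> nonlin f f xi) = (LI xi. - (c0 * (LI eta. Im (H xi eta))))"
 proof (rule integral_cong_AE)
  have "(%xi. nonlin f f xi) \<in> bmeas"
   using measurable_slice[OF nonlin_measurable[of "%_. f" "%_. f"]] by simp
  then show "(%xi. f xi \<bullet> nonlin f f xi) \<in> borel_measurable lborel" by measurable
  have "(%xi. (LI eta. Im (H xi eta))) \<in> borel_measurable lborel"
   by (rule lborel.borel_measurable_lebesgue_integral) (use Hm in measurable)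
  then show "(%xi. - (c0 * (LI eta. Im (H xi eta)))) \<in> borel_measurable lborel" by measurable
  show "AL xi. f xi \<bullet> nonlin f f xi = - (c0 * (LI eta. Im (H xi eta)))"
   using div by eventually_elim (rule pt)
 qed
 also have "... = - (c0 * (LI xi. LI eta. Im (H xi eta)))" by simp
 also have "(LI xi. LI eta. Im (H xi eta)) = 0"
 proof -
  let ?I = "(LI xi. LI eta. Im (H xi eta))"
  have Hb: "ennreal (norm (H xi eta)) <= 9 * (M xi * (ennreal (norm xi) * (M (xi - eta) * M eta)))" for xi eta
  proof -
   have a: "norm (vdot xi (f (xi - eta))) <= 3 * (norm xi * norm (f (xi - eta)))"
   proof -
    have "norm (vdot xi (f (xi - eta))) <= (\<Sum>j\<in>(UNIV::3 set). norm xi * norm (f (xi - eta)))"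
     unfolding vdot_def using component_le_norm_cart[of xi] Finite_Cartesian_Product.norm_nth_le[of "f (xi - eta)"]
     by (intro order_trans[OF norm_sum] sum_mono) (auto simp: norm_mult intro!: mult_mono)
    then show ?thesis by simp
   qed
   have b: "norm (\<Sum>k\<in>UNIV. f eta $ k * cnj (f xi $ k)) <= 3 * (norm (f eta) * norm (f xi))"
   proof -
    have "norm (\<Sum>k\<in>UNIV. f eta $ k * cnj (f xi $ k)) <= (\<Sum>j\<in>(UNIV::3 set). norm (f eta) * norm (f xi))"
     using Finite_Cartesian_Product.norm_nth_le[of "f xi"] Finite_Cartesian_Product.norm_nth_le[of "f eta"]
     by (intro order_trans[OF norm_sum] sum_mono) (auto simp: norm_mult intro!: mult_mono)
    then show ?thesis by simp
   qed
   have "norm (H xi eta) <= (3 * (norm xi * norm (f (xi - eta)))) * (3 * (norm (f eta) * norm (f xi)))"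
    unfolding H_def norm_mult by (intro mult_mono a b) auto
   also have "... = 9 * (norm (f xi) * (norm xi * (norm (f (xi - eta)) * norm (f eta))))" by simp
   finally have "ennreal (norm (H xi eta)) <= ennreal (9 * (norm (f xi) * (norm xi * (norm (f (xi - eta)) * norm (f eta)))))" by (rule ennreal_leI)
   also have "... = 9 * (enorm f xi * (ennreal (norm xi) * (enorm f (xi - eta) * enorm f eta)))" by (simp add: ennreal_mult)
   also have "... <= 9 * (M xi * (ennreal (norm xi) * (M (xi - eta) * M eta)))" by (intro mult_left_mono mult_mono M) auto
   finally show ?thesis .
  qed
  have "(NI xi. NI eta. norm (Im (H xi eta))) <= (NI xi. NI eta. 9 * (M xi * (ennreal (norm xi) * (M (xi - eta) * M eta))))"
   by (intro nn_integral_mono order_trans[OF ennreal_leI Hb]) (simp add: abs_Im_le_cmod)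
  also have "... = (NI xi. 9 * (M xi * (ennreal (norm xi) * nconv M M xi)))"
   unfolding nconv_def by (intro nn_integral_cong) (simp add: nn_integral_cmult)
  also have "... = 9 * (NI xi. M xi * (ennreal (norm xi) * nconv M M xi))"
   by (rule nn_integral_cmult) measurable
  also have "... < \<infinity>" using fin by (auto simp: ennreal_mult_less_top)
  finally have "?I = (LI eta. LI xi. Im (H xi eta))"
   by (intro lborel_Fubini_swap) (use Hm in measurable)
  also have "... = (LI eta. LI xi. - Im (H eta xi))"
  proof (rule Bochner_Integration.integral_cong[OF refl], rule integral_cong_AE)
   fix eta
   have Hs: "(%xi. H xi eta) \<in> bmeas" "(%xi. H eta xi) \<in> bmeas"
    unfolding H_def vdot_def by measurable
   then show "(%xi. Im (H xi eta)) \<in> borel_measurable lborel" "(%xi. - Im (H eta xi)) \<in> borel_measurable lborel" by measurable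
   show "AL xi. Im (H xi eta) = - Im (H eta xi)"
    using AE_lborel_diff[OF sym, of eta] AE_lborel_diff[OF div, of eta]
   proof eventually_elim
    case (elim xi)
    have e: "vdot xi (f (xi - eta)) = cnj (vdot eta (f (eta - xi)))"
    proof -
     have "f (xi - eta) = vcnj (f (eta - xi))" using elim(1) by simp
     then have "vdot xi (f (xi - eta)) = cnj (vdot xi (f (eta - xi)))" by (simp add: vdot_def)
     also have "vdot xi (f (eta - xi)) = vdot eta (f (eta - xi))"
      using elim(2) by (simp add: vdot_def left_diff_distrib sum_subtractf)
     finally show ?thesis .
    qed
    have "H xi eta = cnj (H eta xi)" unfolding H_def e by (simp add: mult.commute)
    then show ?case by simp
   qed
  qed
  also have "... = - ?I" by simp
  finally show ?thesis by linarith
 qed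
 finally show ?thesis by simp
qed

lemma leray_vcnj: "leray_symbol xi (vcnj v) = vcnj (leray_symbol (- xi) v)"
 by (simp add: leray_symbol_def vec_eq_iff cvec_def sum_negf)

lemma nonlin_vcnj:
 assumes [measurable]: "f \<in> bmeas"
 shows "nonlin (%eta. vcnj (f (- eta))) (%eta. vcnj (f (- eta))) xi = vcnj (nonlin f f (- xi))"
proof -
 have c: "conv (%eta. cnj (f (- eta) $ j)) (%eta. cnj (f (- eta) $ k)) xi = cnj (conv (%eta. f eta $ j) (%eta. f eta $ k) (- xi))" for j k
 proof -
  have "conv (%eta. cnj (f (- eta) $ j)) (%eta. cnj (f (- eta) $ k)) xi = (LI eta. cnj (f (- xi - eta) $ j * f eta $ k))"
   unfolding conv_def using lborel_integral_reflect[of "%eta. cnj (f (- xi - eta) $ j * f eta $ k)"] by simp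
  also have "... = cnj (conv (%eta. f eta $ j) (%eta. f eta $ k) (- xi))" unfolding conv_def by (rule Bochner_Integration.integral_cnj)
  finally show ?thesis .
 qed
 show ?thesis unfolding nonlin_def leray_vcnj[symmetric]
  by (rule arg_cong[where f="leray_symbol xi"]) (simp add: vec_eq_iff c)
qed

lemma duh_vcnj:
 fixes U :: "real => real^3 => complex^3"
 assumes "!!t. U t \<in> bmeas"
 shows "duh \<nu> s (%t eta. vcnj (U t (- eta))) (%t eta. vcnj (U t (- eta))) t xi = vcnj (duh \<nu> s U U t (- xi))"
proof -
 have "duh \<nu> s (%t eta. vcnj (U t (- eta))) (%t eta. vcnj (U t (- eta))) t xi
  = (LI tau. vcnj (if s <= tau & tau <= t then hk \<nu> (t - tau) (- xi) *\<^sub>R nonlin (U tau) (U tau) (- xi) else 0))"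
  unfolding duh_def nonlin_vcnj[OF assms]
  by (intro Bochner_Integration.integral_cong refl) (simp add: linear_simps[OF bounded_linear_vcnj])
 also have "... = vcnj (duh \<nu> s U U t (- xi))"
  unfolding duh_def by (rule integral_bounded_linear'[OF bounded_linear_vcnj bounded_linear_vcnj]) simp
 finally show ?thesis .
qed

text \<open>The reflected conjugate of a solution solves the same problem; uniqueness identifies both.\<close>

lemma fsol_reality:
 assumes \<nu>: "\<nu> > 0" and W: "conv_weight C W" and U: "fsol \<nu> W A T U" and even: "!!xi. W (- xi) = W xi"
  and A: "AL xi. A (- xi) = vcnj (A xi)"
 shows "AL xi. \<forall>t\<in>{0..T}. U t (- xi) = vcnj (U t xi)"
proof -
 obtain M where Mm [measurable]: "M \<in> bmeas" and fin: "nsq (%xi. W xi * M xi) < \<infinity>"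
  and M: "!!t xi. t \<in> {0..T} ==> ennreal (norm (U t xi)) <= M xi" using fsol_majorant[OF U] by blast
 have Wm [measurable]: "W \<in> bmeas" using W by (simp add: conv_weight_def)
 note Um = fsol_measurable[OF U]
 define V where "V t xi = vcnj (U t (- xi))" for t xi
 have "fsol \<nu> W A T V"
  unfolding fsol_def
 proof (intro conjI bexI ballI allI)
  have "(%p. (fst p, - snd p)) \<in> (borel :: real measure) \<Otimes>\<^sub>M (borel :: (real^3) measure) \<rightarrow>\<^sub>M borel \<Otimes>\<^sub>M borel" by measurable
  from measurable_compose[OF this Um] have a: "(%p. U (fst p) (- snd p)) \<in> bmeas2" by simp
  have "vcnj \<in> bmeas"
   by (intro borel_measurable_continuous_onI linear_continuous_on bounded_linear_vcnj)
  from measurable_compose[OF a this] show "(%(t, xi). V t xi) \<in> bmeas2"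
   by (simp add: V_def split_beta')
  show "(%xi. M (- xi)) \<in> bmeas" by measurable
  have "nsq (%xi. W xi * M (- xi)) = nsq (%xi. W xi * M xi)"
   unfolding nsq_def using lborel_nn_integral_reflect[of "%xi. (W xi * M xi)^2"] by (simp add: even)
  then show "nsq (%xi. W xi * M (- xi)) < \<infinity>" using fin by simp
  show "ennreal (norm (V t xi)) <= M (- xi)" if "t \<in> {0..T}" for t xi unfolding V_def using M[OF that] by simp
  show "AL xi. \<forall>t\<in>{0..T}. V t xi = hk \<nu> t xi *\<^sub>R A xi - duh \<nu> 0 V V t xi"
   using AE_lborel_reflect[OF fsol_eq[OF U]] A
  proof eventually_elim
   case (elim xi)
   show ?case
   proof
    fix t assume t: "t \<in> {0..T}"
    have "V t xi = vcnj (hk \<nu> t xi *\<^sub>R A (- xi) - duh \<nu> 0 U U t (- xi))"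
     unfolding V_def using bspec[OF elim(1) t] by simp
    also have "... = hk \<nu> t xi *\<^sub>R vcnj (A (- xi)) - vcnj (duh \<nu> 0 U U t (- xi))"
     by (simp add: linear_simps[OF bounded_linear_vcnj])
    also have "vcnj (A (- xi)) = A xi" using elim(2) by simp
    also have "vcnj (duh \<nu> 0 U U t (- xi)) = duh \<nu> 0 V V t xi"
     unfolding V_def[abs_def] by (rule duh_vcnj[symmetric, OF measurable_slice[OF Um]])
    finally show "V t xi = hk \<nu> t xi *\<^sub>R A xi - duh \<nu> 0 V V t xi" .
   qed
  qed
 qed
 from fsol_unique[OF \<nu> W U this] show ?thesis
  by eventually_elim (metis V_def vcnj_vcnj)
qed

lemma fsol_divfree:
 assumes \<nu>: "\<nu> > 0" and W: "conv_weight C W" and U: "fsol \<nu> W A T U"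
  and A: "AL xi. vdot xi (A xi) = 0"
 shows "AL xi. \<forall>t\<in>{0..T}. vdot xi (U t xi) = 0"
proof -
 obtain M where Mm [measurable]: "M \<in> bmeas" and fin: "nsq (%xi. W xi * M xi) < \<infinity>"
  and M: "!!t xi. t \<in> {0..T} ==> ennreal (norm (U t xi)) <= M xi" using fsol_majorant[OF U] by blast
 show ?thesis using fsol_eq[OF U] A
 proof eventually_elim
  case (elim xi)
  show ?case
  proof
   fix t assume t: "t \<in> {0..T}"
   have "vdot xi (duh \<nu> 0 U U t xi) = (LI tau. vdot xi (dker \<nu> 0 t U U xi tau))"
    unfolding duh_def
    by (rule integral_bounded_linear[OF bounded_linear_vdot, symmetric], rule duh_integrand_integrable[OF \<nu> fsol_measurable[OF U] fsol_measurable[OF U] M M nconv_finite(1)[OF W Mm fin]])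
      (use t in auto)
   also have "... = (\<integral>tau. 0 \<partial>(lborel :: real measure))"
    by (intro Bochner_Integration.integral_cong refl) (simp add: linear_simps[OF bounded_linear_vdot] vdot_nonlin)
   finally have "vdot xi (duh \<nu> 0 U U t xi) = 0" by simp
   then show "vdot xi (U t xi) = 0" using bspec[OF elim(1) t] elim(2) by (simp add: linear_simps[OF bounded_linear_vdot])
  qed
 qed
qed

text \<open>For fixed \<open>xi\<close> Duhamel's formula is an ordinary differential equation with damping \<open>x = \<nu> |xi|^2\<close>; the damping term in the derivative of the squared norm has a good sign.\<close>

lemma damped_ode_energy:
 fixes N u :: "real => 'b::euclidean_space"
 assumes x: "x \<ge> 0" and N: "continuous_on {0..T} N"
  and u: "!!t. t \<in> {0..T} ==> u t = exp (- x * t) *\<^sub>R a - (LI tau. (if 0 <= tau & tau <= t then exp (- x * (t - tau)) *\<^sub>R N tau else 0))"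
  and t: "t \<in> {0..T}"
 shows "(norm (u t))^2 <= (norm a)^2 - 2 * (LI tau. (if 0 <= tau & tau <= t then u tau \<bullet> N tau else 0))"
proof -
 \<comment> \<open>Integrating factor: \<open>u s = exp (- x * s) *\<^sub>R Z s\<close>.\<close>
 define G where "G tau = exp (x * tau) *\<^sub>R N tau" for tau
 define Z where "Z s = a - integral {0..s} G" for s
 have Gc: "continuous_on {0..T} G" unfolding G_def by (intro continuous_intros N)
 have conv: "(LI tau. (if 0 <= tau & tau <= s then h tau else 0)) = integral {0..s} h"
  if h: "continuous_on {0..T} h" and s: "s \<in> {0..T}" for h :: "real => 'c::euclidean_space" and s
 proof -
  have "set_integrable lborel {0..s} h"
   by (rule borel_integrable_compact[unfolded set_integrable_def[symmetric]]) (use s in \<open>auto intro: continuous_on_subset[OF h]\<close>)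
  from set_borel_integral_eq_integral(2)[OF this] have "(LI tau. indicator {0..s} tau *\<^sub>R h tau) = integral {0..s} h"
   unfolding set_lebesgue_integral_def .
  moreover have "(if 0 <= tau & tau <= s then h tau else 0) = indicator {0..s} tau *\<^sub>R h tau" for tau by (auto simp: indicator_def)
  ultimately show ?thesis by (simp only:)
 qed
 have uZ: "u s = exp (- x * s) *\<^sub>R Z s" if s: "s \<in> {0..T}" for s
 proof -
  have "(LI tau. (if 0 <= tau & tau <= s then exp (- x * (s - tau)) *\<^sub>R N tau else 0)) = integral {0..s} (%tau. exp (- x * (s - tau)) *\<^sub>R N tau)"
   by (rule conv[OF _ s]) (intro continuous_intros N)
  also have "... = integral {0..s} (%tau. exp (- x * s) *\<^sub>R G tau)"
   by (rule Henstock_Kurzweil_Integration.integral_cong) (simp add: G_def exp_add[symmetric] algebra_simps)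
  also have "... = exp (- x * s) *\<^sub>R integral {0..s} G" by simp
  finally show ?thesis unfolding u[OF s] Z_def by (simp add: scaleR_diff_right)
 qed
 have Zd: "(Z has_vector_derivative - G s) (at s within {0..T})" if s: "s \<in> {0..T}" for s
  unfolding Z_def[abs_def] using integral_has_vector_derivative[OF Gc s] by (auto intro!: derivative_eq_intros)
 define p where "p s = exp (- 2 * x * s) * (Z s \<bullet> Z s)" for s
 have pu: "p s = (norm (u s))^2" if "s \<in> {0..T}" for s
  unfolding uZ[OF that] p_def by (simp add: power_mult_distrib power2_norm_eq_inner exp_double[symmetric])
 define r where "r s = u s \<bullet> N s" for s
 have rG: "exp (- 2 * x * s) * (Z s \<bullet> G s) = r s" if "s \<in> {0..T}" for s
  unfolding r_def uZ[OF that] G_def by (simp add: exp_add[symmetric] mult.assoc[symmetric])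
 have pd: "(p has_vector_derivative (- 2 * x * p s - 2 * r s)) (at s within {0..T})" if s: "s \<in> {0..T}" for s
 proof -
  have "((%s. Z s \<bullet> Z s) has_vector_derivative (Z s \<bullet> (- G s) + (- G s) \<bullet> Z s)) (at s within {0..T})"
   by (rule bounded_bilinear.has_vector_derivative[OF bounded_bilinear_inner Zd[OF s] Zd[OF s]])
  moreover have "((%s. exp (- 2 * x * s)) has_vector_derivative (- 2 * x * exp (- 2 * x * s))) (at s within {0..T})"
   by (auto intro!: derivative_eq_intros simp: has_real_derivative_iff_has_vector_derivative[symmetric])
  ultimately have "(p has_vector_derivative (exp (- 2 * x * s) * (Z s \<bullet> (- G s) + (- G s) \<bullet> Z s) + - 2 * x * exp (- 2 * x * s) * (Z s \<bullet> Z s))) (at s within {0..T})"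
   unfolding p_def[abs_def] by (intro has_vector_derivative_mult)
  also have "exp (- 2 * x * s) * (Z s \<bullet> (- G s) + (- G s) \<bullet> Z s) + - 2 * x * exp (- 2 * x * s) * (Z s \<bullet> Z s) = - 2 * x * p s - 2 * r s"
   unfolding p_def rG[OF s, symmetric] by (simp add: inner_commute algebra_simps)
  finally show ?thesis .
 qed
 have rc: "continuous_on {0..T} r"
 proof -
  have Zc: "continuous_on {0..T} Z" using Zd has_vector_derivative_continuous continuous_on_eq_continuous_within by blast
  have "continuous_on {0..T} (%s. exp (- 2 * x * s) * (Z s \<bullet> G s))" by (intro continuous_intros Zc Gc)
  then show ?thesis by (rule continuous_on_eq) (rule rG)
 qed
 have pc: "continuous_on {0..T} p" using pd has_vector_derivative_continuous continuous_on_eq_continuous_within by blast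
 have sub: "{0..t} \<subseteq> {0..T}" using t by auto
 have "((%s. - 2 * x * p s - 2 * r s) has_integral (p t - p 0)) {0..t}"
 proof (rule fundamental_theorem_of_calculus)
  fix s assume s: "s \<in> {0..t}"
  with sub have "s \<in> {0..T}" by blast
  from has_vector_derivative_within_subset[OF pd[OF this] sub]
  show "(p has_vector_derivative (- 2 * x * p s - 2 * r s)) (at s within {0..t})" .
 qed (use t in auto)
 moreover have "((%s. - 2 * r s) has_integral (- 2 * integral {0..t} r)) {0..t}"
  by (intro has_integral_mult_right integrable_integral integrable_continuous_real continuous_on_subset[OF rc sub])
 ultimately have "p t - p 0 <= - 2 * integral {0..t} r"
  by (rule has_integral_le) (use x in \<open>auto simp: p_def\<close>)
 moreover have "p 0 = (norm a)^2" by (simp add: p_def Z_def power2_norm_eq_inner)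
 moreover have "(LI tau. (if 0 <= tau & tau <= t then u tau \<bullet> N tau else 0)) = integral {0..t} r"
  unfolding r_def[symmetric] by (rule conv[OF rc t])
 ultimately show ?thesis using pu[OF t] by simp
qed

text \<open>Integrate the pointwise energy identity over \<open>xi\<close>: the nonlinear contribution cancels at each time.\<close>

lemma fsol_energy:
 assumes \<nu>: "\<nu> > 0" and W: "conv_weight C W" and U: "fsol \<nu> W A T U" and even: "!!xi. W (- xi) = W xi"
  and Wn: "!!xi. ennreal (norm xi) <= W xi" and AL2: "A \<in> L2"
  and sym: "AL xi. A (- xi) = vcnj (A xi)" and div: "AL xi. vdot xi (A xi) = 0" and t: "t \<in> {0..T}"
 shows "sqnorm (U t) <= sqnorm A"
proof -
 obtain M where Mm [measurable]: "M \<in> bmeas" and Mfin: "nsq (%xi. W xi * M xi) < \<infinity>"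
  and M: "!!t xi. t \<in> {0..T} ==> ennreal (norm (U t xi)) <= M xi" using fsol_majorant[OF U] by blast
 have Wm [measurable]: "W \<in> bmeas" using W by (simp add: conv_weight_def)
 note Um [measurable] = fsol_measurable[OF U]
 note Us [measurable] = measurable_slice[OF Um]
 note Mc = nconv_finite[OF W Mm Mfin]
 have UL2: "U tau \<in> L2" if "tau \<in> {0..T}" for tau
 proof -
  have "sqnorm (U tau) <= nsq M" unfolding nsq_enorm[symmetric] by (intro nsq_mono M that)
  then show ?thesis using Mc(2) Us by (auto simp: L2_iff)
 qed
 let ?N = "%tau xi. nonlin (U tau) (U tau) xi"
 have Nm [measurable]: "(%(tau, xi). ?N tau xi) \<in> bmeas2" by (rule nonlin_measurable[OF Um Um])
 have fin: "(NI xi. M xi * (ennreal (norm xi) * nconv M M xi)) < \<infinity>"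
 proof -
  have "(NI xi. M xi * (ennreal (norm xi) * nconv M M xi))^2 <= nsq M * nsq (%xi. ennreal (norm xi) * nconv M M xi)"
   unfolding nsq_def by (rule Cauchy_Schwarz_nn_integral) measurable
  also have "... <= nsq M * nsq (%xi. W xi * nconv M M xi)" by (intro mult_left_mono nsq_mono mult_right_mono Wn) auto
  also have "... <= nsq M * (ennreal C * (nsq (%xi. W xi * M xi))^2)" using W by (intro mult_left_mono) (auto simp: conv_weight_def)
  also have "... < \<infinity>" using Mc(2) Mfin by (auto simp: ennreal_mult_less_top power_less_top_ennreal)
  finally show ?thesis by (auto simp: power_less_top_ennreal)
 qed
 have cancel: "(LI xi. U tau xi \<bullet> ?N tau xi) = 0" if tau: "tau \<in> {0..T}" for tau
 proof (rule nonlin_cancel[OF UL2[OF tau] M[OF tau] Mm fin])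
  show "AL xi. U tau (- xi) = vcnj (U tau xi)" using fsol_reality[OF \<nu> W U even sym] by eventually_elim (use tau in blast)
  show "AL xi. vdot xi (U tau xi) = 0" using fsol_divfree[OF \<nu> W U div] by eventually_elim (use tau in blast)
 qed
 define F where "F xi tau = (if 0 <= tau & tau <= t then U tau xi \<bullet> ?N tau xi else 0)" for xi tau
 have Fm: "(%(xi, tau). F xi tau) \<in> borel_measurable (lborel \<Otimes>\<^sub>M lborel)"
 proof -
  have sw: "(%p. (snd p, fst p)) \<in> (borel :: (real^3) measure) \<Otimes>\<^sub>M (borel :: real measure) \<rightarrow>\<^sub>M borel \<Otimes>\<^sub>M borel" by measurable
  have a: "(%p. U (snd p) (fst p)) \<in> bmeas2" "(%p. ?N (snd p) (fst p)) \<in> bmeas2"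
   using measurable_compose[OF sw Um] measurable_compose[OF sw Nm] by simp_all
  have "(%p. if 0 <= snd p & snd p <= t then U (snd p) (fst p) \<bullet> ?N (snd p) (fst p) else 0) \<in> borel_measurable ((borel :: (real^3) measure) \<Otimes>\<^sub>M (borel :: real measure))"
   by (intro measurable_If borel_measurable_inner a borel_measurable_const) measurable
  then show ?thesis by (simp add: F_def split_beta' cong: measurable_cong_sets)
 qed
 have Fb: "ennreal (norm (F xi tau)) <= (36 * (M xi * (ennreal (norm xi) * nconv M M xi))) * indicator {0..t} tau" for xi tau
 proof (cases "0 <= tau & tau <= t")
  case True
  then have tau: "tau \<in> {0..T}" using t by auto
  have "ennreal (norm (U tau xi \<bullet> ?N tau xi)) <= ennreal (norm (U tau xi) * norm (?N tau xi))" by (intro ennreal_leI) (simp add: Cauchy_Schwarz_ineq2)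
  also have "... = enorm (U tau) xi * ennreal (norm (?N tau xi))" by (simp add: ennreal_mult)
  also have "... <= M xi * (36 * (ennreal (norm xi) * nconv M M xi))" by (intro mult_mono norm_nonlin_le M tau) auto
  finally show ?thesis using True by (simp add: F_def mult.left_commute)
 next
  case False then have "F xi tau = 0" unfolding F_def by (rule if_not_P)
  then show ?thesis by simp
 qed
 have Ffin: "(NI xi. NI tau. norm (F xi tau)) < \<infinity>"
 proof -
  have "(NI xi. NI tau. norm (F xi tau)) <= (NI xi. NI tau. (36 * (M xi * (ennreal (norm xi) * nconv M M xi))) * indicator {0..t} tau)"
   by (intro nn_integral_mono Fb)
  also have "... = (NI xi. (36 * ennreal t) * (M xi * (ennreal (norm xi) * nconv M M xi)))"
   using t by (intro nn_integral_cong) (subst nn_integral_cmult_indicator, auto simp: mult_ac)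
  also have "... = (36 * ennreal t) * (NI xi. M xi * (ennreal (norm xi) * nconv M M xi))" by (rule nn_integral_cmult) measurable
  also have "... < \<infinity>" using fin by (auto simp: ennreal_mult_less_top)
  finally show ?thesis .
 qed
 define R where "R xi = (LI tau. F xi tau)" for xi
 have Rint: "integrable lborel R"
 proof (rule integrableI_bounded)
  show "R \<in> borel_measurable lborel" unfolding R_def[abs_def] by (rule lborel.borel_measurable_lebesgue_integral[OF Fm])
  have "(NI xi. norm (R xi)) <= (NI xi. NI tau. norm (F xi tau))"
   unfolding R_def by (intro nn_integral_mono ennreal_norm_integral_le)
  then show "(NI xi. norm (R xi)) < \<infinity>" using Ffin by (rule le_less_trans)
 qed
 have R0: "(LI xi. R xi) = 0"
 proof -
  have "(LI xi. R xi) = (LI tau. LI xi. F xi tau)"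
   unfolding R_def by (rule lborel_Fubini_swap[OF Fm Ffin])
  also have "... = (\<integral>tau. 0 \<partial>(lborel :: real measure))"
  proof (rule Bochner_Integration.integral_cong[OF refl])
   fix tau
   show "(LI xi. F xi tau) = 0"
   proof (cases "0 <= tau & tau <= t")
    case True
    then have "tau \<in> {0..T}" using t by auto
    from cancel[OF this] show ?thesis using True by (simp add: F_def)
   next
    case False then have "F xi tau = 0" for xi unfolding F_def by (rule if_not_P)
    then show ?thesis by simp
   qed
  qed
  finally show ?thesis by simp
 qed
 have Mae: "AL xi. M xi < \<infinity>"
 proof -
  have "AL xi. (M xi)^2 \<noteq> \<infinity>" using Mc(2) by (intro nn_integral_PInf_AE) (auto simp: nsq_def)
  then show ?thesis by eventually_elim (auto simp: power_eq_top_ennreal less_top)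
 qed
 have Ncont: "continuous_on {0..T} (%tau. ?N tau xi)" for xi
  unfolding continuous_on_sequentially comp_def
 proof (intro allI ballI impI, elim conjE)
  fix X s assume s: "s \<in> {0..T}" and X: "\<forall>n. X n \<in> {0..T}" and lim: "X ---> s"
  show "(%n. ?N (X n) xi) ---> ?N s xi"
  proof (rule nonlin_tendsto[OF Us Us Mm _ _ Mae Mc(1)])
   show "ennreal (norm (U (X n) x)) <= M x" for n x using X M by blast
   show "AL x. (%n. U (X n) x) ---> U s x"
    using fsol_continuous[OF \<nu> W U] by eventually_elim (use X s lim in \<open>auto simp: continuous_on_sequentially comp_def\<close>)
  qed
 qed
 have pt: "AL xi. (norm (U t xi))^2 <= (norm (A xi))^2 - 2 * R xi"
  using fsol_eq[OF U]
 proof eventually_elim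
  case (elim xi)
  have e: "- (\<nu> * (norm xi)^2) * s = - \<nu> * s * (norm xi)^2" for s by simp
  show ?case unfolding R_def F_def
  proof (rule damped_ode_energy[where x="\<nu> * (norm xi)^2" and u="%tau. U tau xi" and N="%tau. ?N tau xi" and T=T])
   show "U s xi = exp (- (\<nu> * (norm xi)^2) * s) *\<^sub>R A xi - (LI tau. (if 0 <= tau & tau <= s then exp (- (\<nu> * (norm xi)^2) * (s - tau)) *\<^sub>R ?N tau xi else 0))"
    if "s \<in> {0..T}" for s
    unfolding e using bspec[OF elim that] by (simp only: duh_def)
  qed (use \<nu> Ncont t in auto)
 qed
 have "(LI xi. (norm (U t xi))^2) <= (LI xi. (norm (A xi))^2 - 2 * R xi)"
  using UL2[OF t] AL2 Rint by (intro integral_mono_AE pt) (auto simp: L2_def)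
 also have "... = (LI xi. (norm (A xi))^2) - 2 * (LI xi. R xi)"
  using AL2 Rint by (subst Bochner_Integration.integral_diff) (auto simp: L2_def)
 finally have "(LI xi. (norm (U t xi))^2) <= (LI xi. (norm (A xi))^2)" using R0 by simp
 then show ?thesis unfolding sqnorm_eq_integral[OF UL2[OF t]] sqnorm_eq_integral[OF AL2] by (rule ennreal_leI)
qed

section \<open>Gevrey weights\<close>

text \<open>Bernoulli's inequality. The factor \<open>th < 1\<close> in front of the smaller term is the source of all gains below: in a product, the lower frequency is measured with a strictly weaker Gevrey weight.\<close>

lemma powr_add_le_gain:
 fixes x y th :: real
 assumes th: "0 < th" "th <= 1" and y: "0 <= y" and yx: "y <= x"
 shows "(x + y) powr th <= x powr th + th * y powr th"
proof (cases "y = 0")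
 case False
 then have pos: "x > 0" "y > 0" using y yx by auto
 define r where "r = y / x"
 have r: "0 < r" "r <= 1" using pos yx by (auto simp: r_def)
 have "(1 + r) powr th * 1 powr (1 - th) <= th * (1 + r) + (1 - th) * 1"
  by (rule Youngs_inequality_0) (use th r in auto)
 then have 1: "(1 + r) powr th <= 1 + th * r" by (simp add: algebra_simps)
 have "r powr 1 <= r powr th" using r th by (intro powr_mono') auto
 then have 2: "r <= r powr th" using r by simp
 have "x + y = x * (1 + r)" using pos by (simp add: r_def field_simps)
 then have "(x + y) powr th = x powr th * (1 + r) powr th"
  using pos r by (simp add: powr_mult)
 also have "... <= x powr th * (1 + th * r powr th)"
  using 1 2 th by (intro mult_left_mono order_trans[OF 1]) auto
 also have "... = x powr th + th * (x powr th * r powr th)" by (simp add: algebra_simps)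
 also have "x powr th * r powr th = y powr th"
  using pos r by (subst powr_mult[symmetric]) (auto simp: r_def)
 finally show ?thesis .
qed simp

text \<open>The symbol of \<open>exp (b |D| powr th)\<close>; throughout \<open>th = 1 / \<sigma>\<close>.\<close>

definition gw :: "real => real => real^3 => real" where
 "gw th b xi = exp (b * norm xi powr th)"

lemma gw_measurable [measurable]: "gw th b \<in> bmeas"
 unfolding gw_def[abs_def] by measurable

lemma gw_pos [simp]: "gw th b xi > 0" "gw th b xi \<ge> 0" by (auto simp: gw_def)

lemma gw_ge_1: "b \<ge> 0 ==> gw th b xi \<ge> 1" by (auto simp: gw_def)

lemma gw_mono: "b <= c ==> gw th b xi <= gw th c xi"
 by (auto simp: gw_def intro!: mult_right_mono)

lemma gw_add: "gw th b xi * gw th c xi = gw th (b + c) xi"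
 by (simp add: gw_def exp_add[symmetric] algebra_simps)

text \<open>The doubling condition treats the polynomial factor: the larger of two frequencies is at least half of their sum.\<close>

lemma radial_gevrey_subadditive:
 fixes p :: "real => real"
 assumes th: "0 < th" "th <= 1" and b: "b \<ge> 0" and p0: "!!r. p r \<ge> 0"
  and pm: "!!r s. 0 <= r ==> r <= s ==> p r <= p s" and p2: "!!r. r \<ge> 0 ==> p (2 * r) <= c * p r" and c: "c \<ge> 0"
 defines "V \<equiv> %xi. p (norm xi) * gw th b xi"
 shows "V (eta + zeta) <= c * (V eta * gw th (th * b) zeta + gw th (th * b) eta * V zeta)"
proof -
 have V0: "V xi \<ge> 0" for xi using p0 by (simp add: V_def)
 have main: "V (eta + zeta) <= c * (V eta * gw th (th * b) zeta)" if le: "norm zeta <= norm eta" for eta zeta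
 proof -
  have n: "norm (eta + zeta) <= norm eta + norm zeta" by (rule norm_triangle_ineq)
  have "p (norm (eta + zeta)) <= p (2 * norm eta)" using n le by (intro pm) auto
  also have "... <= c * p (norm eta)" by (rule p2) simp
  finally have 1: "p (norm (eta + zeta)) <= c * p (norm eta)" .
  have "norm (eta + zeta) powr th <= (norm eta + norm zeta) powr th" using n th by (intro powr_mono2) auto
  also have "... <= norm eta powr th + th * norm zeta powr th" using le by (intro powr_add_le_gain th) auto
  finally have "b * norm (eta + zeta) powr th <= b * (norm eta powr th + th * norm zeta powr th)"
   using b by (rule mult_left_mono)
  then have 2: "gw th b (eta + zeta) <= gw th b eta * gw th (th * b) zeta"
   by (simp add: gw_def exp_add[symmetric] algebra_simps)
  have "V (eta + zeta) <= (c * p (norm eta)) * (gw th b eta * gw th (th * b) zeta)"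
   unfolding V_def using 1 2 c p0 by (intro mult_mono) auto
  then show ?thesis by (simp add: V_def mult_ac)
 qed
 show ?thesis
 proof (cases "norm zeta <= norm eta")
  case True
  have "V (eta + zeta) <= c * (V eta * gw th (th * b) zeta)" by (rule main[OF True])
  also have "... <= c * (V eta * gw th (th * b) zeta + gw th (th * b) eta * V zeta)"
   using c V0 by (intro mult_left_mono) auto
  finally show ?thesis .
 next
  case False
  have "V (eta + zeta) <= c * (V zeta * gw th (th * b) eta)" using main[of eta zeta] False by (simp add: add.commute)
  also have "... <= c * (V eta * gw th (th * b) zeta + gw th (th * b) eta * V zeta)"
   using c V0 by (intro mult_left_mono) (auto simp: mult.commute)
  finally show ?thesis .
 qed
qed

text \<open>From \<open>ln z \<le> z - 1\<close>, which also covers real exponents.\<close>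

lemma powr_le_exp_powr:
 fixes q \<delta> th :: real
 assumes "q > 0" "\<delta> > 0" "th > 0"
 obtains C where "C > 0" "!!x. x \<ge> 0 ==> x powr q <= C * exp (\<delta> * x powr th)"
proof
 define k where "k = q / th"
 have k: "k > 0" using assms by (simp add: k_def)
 show "(k / \<delta>) powr k > 0" using k assms by simp
 fix x :: real assume "x \<ge> 0"
 show "x powr q <= (k / \<delta>) powr k * exp (\<delta> * x powr th)"
 proof (cases "x = 0")
  case False
  then have x: "x > 0" using \<open>x \<ge> 0\<close> by simp
  define z where "z = \<delta> * x powr th"
  have z: "z > 0" using x assms by (simp add: z_def)
  have "k * ln (z / k) <= k * (z / k - 1)" using z k by (intro mult_left_mono ln_le_minus_one) auto
  also have "... <= z" using k by (simp add: algebra_simps)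
  finally have "(z / k) powr k <= exp z" using z k by (simp add: powr_def)
  then have "(k / \<delta>) powr k * (z / k) powr k <= (k / \<delta>) powr k * exp z" by (intro mult_left_mono) auto
  moreover have "(k / \<delta>) powr k * (z / k) powr k = x powr q"
   using k z assms x by (subst powr_mult[symmetric]) (auto simp: z_def powr_powr k_def)
  ultimately show ?thesis by (simp add: z_def)
 qed (use assms in simp)
qed

lemma nn_integral_cauchy_density:
 assumes \<rho>: "\<rho> > 0"
 shows "(\<integral>\<^sup>+x. ennreal (1 / (1 + (x / \<rho>)^2)) \<partial>(lborel :: real measure)) <= ennreal (pi * \<rho>)"
proof -
 define f where "f x = 1 / (1 + (x / \<rho>)^2)" for x :: real
 have f0: "f x \<ge> 0" for x by (simp add: f_def)
 have [measurable]: "f \<in> bmeas" unfolding f_def[abs_def] by measurable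
 have half: "(NI x. ennreal (f x) * indicator {0..} x) = ennreal (\<rho> * (pi / 2) - \<rho> * arctan (0 / \<rho>))"
 proof (rule nn_integral_FTC_atLeast)
  fix x :: real
  show "DERIV (%x. \<rho> * arctan (x / \<rho>)) x :> f x"
   unfolding f_def using \<rho> by (auto intro!: derivative_eq_intros simp: inverse_eq_divide)
  show "0 <= f x" by (rule f0)
 next
  have "filterlim (%x. x / \<rho>) at_top at_top"
   using \<rho> filterlim_tendsto_pos_mult_at_top[OF tendsto_const _ filterlim_ident, of "1 / \<rho>"] by simp
  then show "((%x. \<rho> * arctan (x / \<rho>)) \<longlongrightarrow> \<rho> * (pi / 2)) at_top"
   by (intro tendsto_mult tendsto_const filterlim_compose[OF tendsto_arctan_at_top])
 qed measurable
 have "(NI x. ennreal (f x)) <= (NI x. ennreal (f x) * indicator {0..} x + ennreal (f (-x)) * indicator {0..} (-x))"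
  by (intro nn_integral_mono) (auto simp: indicator_def f_def)
 also have "... = (NI x. ennreal (f x) * indicator {0..} x) + (NI x. ennreal (f (-x)) * indicator {0..} (-x))"
  by (rule nn_integral_add) measurable
 also have "(NI x. ennreal (f (-x)) * indicator {0..} (-x)) = (NI x. ennreal (f x) * indicator {0..} x)"
  by (subst lborel_nn_integral_reflect[of "%x. ennreal (f x) * indicator {0..} x"]) auto
 also have "(NI x. ennreal (f x) * indicator {0..} x) + (NI x. ennreal (f x) * indicator {0..} x) = ennreal (pi * \<rho>)"
  unfolding half using \<rho> by (subst ennreal_plus[symmetric]) (auto simp: field_simps)
 finally show ?thesis by (simp add: f_def)
qed

text \<open>Compare \<open>(1 + r^3)^2\<close> with \<open>(1 + r^2)^3\<close>, which dominates a product of one-dimensional Cauchy densities. The scaling \<open>\<rho>^3\<close> of the bound determines the exponent of the blow-up rate.\<close>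

lemma nsq_inverse_cubic:
 assumes \<rho>: "\<rho> > 0"
 shows "nsq (%xi::real^3. ennreal (1 / (1 + (norm xi / \<rho>)^3))) <= ennreal (4 * (pi * \<rho>)^3)"
proof -
 define g where "g x = ennreal (1 / (1 + (x / \<rho>)^2))" for x :: real
 have [measurable]: "g \<in> bmeas" unfolding g_def[abs_def] by measurable
 have pt: "(ennreal (1 / (1 + (norm xi / \<rho>)^3)))^2 <= 4 * (\<Prod>b\<in>Basis. g (xi \<bullet> b))" for xi :: "real^3"
 proof -
  define r where "r = norm xi / \<rho>"
  have r: "r \<ge> 0" using \<rho> by (simp add: r_def)
  have "(\<Prod>b\<in>Basis. 1 + ((xi \<bullet> b) / \<rho>)^2) <= (\<Prod>b\<in>(Basis::(real^3) set). 1 + r\<^sup>2)"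
   using \<rho> by (intro prod_mono) (auto simp: r_def power_divide intro!: divide_right_mono power2_le_iff_abs_le[THEN iffD2] Basis_le_norm)
  also have "... = (1 + r\<^sup>2)^3" by simp
  also have "... <= 4 * (1 + (r\<^sup>2)^3)"
  proof -
   define s where "s = r\<^sup>2"
   have "4 * (1 + s^3) - (1 + s)^3 = 3 * ((1 - s)^2 * (1 + s))" by (simp add: power2_eq_square power3_eq_cube algebra_simps)
   moreover have "... \<ge> 0" by (simp add: s_def)
   ultimately show ?thesis unfolding s_def[symmetric] by linarith
  qed
  also have "(r\<^sup>2)^3 = (r^3)^2" by (simp add: power_mult[symmetric] mult.commute)
  also have "4 * (1 + (r^3)^2) <= 4 * (1 + r^3)^2" using r by (simp add: power2_sum)
  finally have le: "(\<Prod>b\<in>Basis. 1 + ((xi \<bullet> b) / \<rho>)^2) <= 4 * (1 + r^3)^2" .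
  have pos: "(\<Prod>b\<in>Basis. 1 + ((xi \<bullet> b) / \<rho>)^2) > 0" by (intro prod_pos) (auto intro: add_pos_nonneg)
  have "1 + r^3 > 0" using r by (intro add_pos_nonneg) auto
  then have "1 / (1 + r^3)^2 <= 4 * (1 / (\<Prod>b\<in>Basis. 1 + ((xi \<bullet> b) / \<rho>)^2))"
   using le pos by (simp add: field_simps)
  also have "1 / (\<Prod>b\<in>Basis. 1 + ((xi \<bullet> b) / \<rho>)^2) = (\<Prod>b\<in>Basis. 1 / (1 + ((xi \<bullet> b) / \<rho>)^2))"
   by (simp add: prod_dividef)
  finally have "(1 / (1 + r^3))^2 <= 4 * (\<Prod>b\<in>Basis. 1 / (1 + ((xi \<bullet> b) / \<rho>)^2))" by (simp add: power_divide)
  then have "ennreal ((1 / (1 + r^3))^2) <= ennreal (4 * (\<Prod>b\<in>Basis. 1 / (1 + ((xi \<bullet> b) / \<rho>)^2)))"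
   by (rule ennreal_leI)
  also have "... = 4 * (\<Prod>b\<in>Basis. g (xi \<bullet> b))"
   unfolding g_def by (subst ennreal_mult, simp, intro prod_nonneg, simp) (subst prod_ennreal, auto)
  finally show ?thesis using r by (simp add: r_def ennreal_power)
 qed
 have "nsq (%xi::real^3. ennreal (1 / (1 + (norm xi / \<rho>)^3))) <= (\<integral>\<^sup>+xi. 4 * (\<Prod>b\<in>Basis. g (xi \<bullet> b)) \<partial>(lborel :: (real^3) measure))"
  unfolding nsq_def by (intro nn_integral_mono pt)
 also have "... = 4 * (\<integral>\<^sup>+xi. (\<Prod>b\<in>Basis. g (xi \<bullet> b)) \<partial>(lborel :: (real^3) measure))"
  by (rule nn_integral_cmult) measurable
 also have "(\<integral>\<^sup>+xi. (\<Prod>b\<in>Basis. g (xi \<bullet> b)) \<partial>(lborel :: (real^3) measure)) = (\<Prod>b\<in>(Basis :: (real^3) set). (NI x. g x))"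
  by (rule nn_integral_lborel_prod) auto
 also have "... = (NI x. g x)^3" by simp
 also have "4 * (NI x. g x)^3 <= 4 * (ennreal (pi * \<rho>))^3"
  unfolding g_def by (intro mult_left_mono power_mono nn_integral_cauchy_density \<rho>) auto
 also have "... = ennreal (4 * (pi * \<rho>)^3)" using \<rho> by (subst ennreal_mult) (auto simp: ennreal_power)
 finally show ?thesis .
qed

lemma nsq_gw_decay:
 assumes "\<delta> > 0" "th > 0"
 obtains L where "L \<ge> 0" "nsq (%xi. ennreal (gw th (- \<delta>) xi)) <= ennreal L"
proof -
 obtain C where C: "C > 0" "!!x. x \<ge> 0 ==> x powr 3 <= C * exp (\<delta> * x powr th)"
  using powr_le_exp_powr[of 3 \<delta> th] assms by auto
 have pt: "gw th (- \<delta>) xi <= (1 + C) * (1 / (1 + (norm xi / 1)^3))" for xi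
 proof -
  have e: "exp (\<delta> * norm xi powr th) \<ge> 1" using assms by simp
  have "1 + (norm xi)^3 <= (1 + C) * exp (\<delta> * norm xi powr th)"
  proof -
   have "norm xi powr 3 = (norm xi)^3" by (rule powr_numeral) simp
   then show ?thesis using C(2)[of "norm xi"] add_mono[OF e C(2)[of "norm xi"]] by (simp add: distrib_right)
  qed
  then have "(1 + (norm xi)^3) * gw th (- \<delta>) xi <= (1 + C) * exp (\<delta> * norm xi powr th) * gw th (- \<delta>) xi"
   by (intro mult_right_mono) auto
  also have "... = 1 + C" by (simp add: gw_def exp_minus)
  finally show ?thesis using add_pos_nonneg[of 1 "(norm xi)^3"] by (simp add: field_simps)
 qed
 have "nsq (%xi. ennreal (gw th (- \<delta>) xi)) <= nsq (%xi::real^3. ennreal (1 + C) * ennreal (1 / (1 + (norm xi / 1)^3)))"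
 proof (rule nsq_mono)
  fix xi :: "real^3"
  show "ennreal (gw th (- \<delta>) xi) <= ennreal (1 + C) * ennreal (1 / (1 + (norm xi / 1)^3))"
   using C(1) ennreal_leI[OF pt[of xi]] by (subst (asm) ennreal_mult) auto
 qed
 also have "... = (ennreal (1 + C))^2 * nsq (%xi::real^3. ennreal (1 / (1 + (norm xi / 1)^3)))" by (rule nsq_cmult) measurable
 also have "... <= (ennreal (1 + C))^2 * ennreal (4 * (pi * 1)^3)" by (intro mult_left_mono nsq_inverse_cubic) auto
 also have "(ennreal (1 + C))^2 = ennreal ((1 + C)^2)" using C(1) by (intro ennreal_power) auto
 also have "... * ennreal (4 * (pi * 1)^3) = ennreal ((1 + C)^2 * (4 * (pi * 1)^3))" by (rule ennreal_mult[symmetric]) auto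
 finally show ?thesis using that[of "(1 + C)^2 * (4 * (pi * 1)^3)"] by simp
qed

lemma conv_weight_radial:
 fixes p :: "real => real" and V :: "real^3 => real"
 assumes th: "0 < th" "th <= 1" and b: "b \<ge> 0" and p1: "!!r. r \<ge> 0 ==> p r \<ge> 1" and p0: "!!r. p r \<ge> 0" and [measurable]: "p \<in> bmeas"
  and pm: "!!r s. 0 <= r ==> r <= s ==> p r <= p s" and p2: "!!r. r \<ge> 0 ==> p (2 * r) <= c * p r" and c: "c > 0"
  and V: "!!xi. V xi = p (norm xi) * gw th b xi"
  and [measurable]: "v \<in> bmeas" and v0: "!!xi. v xi \<ge> 0" and wv: "!!xi. gw th (th * b) xi <= v xi * V xi"
  and L: "nsq (%xi. ennreal (v xi)) <= ennreal L" "L > 0"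
 shows "conv_weight (4 * c\<^sup>2 * L) (%xi. ennreal (V xi))"
proof -
 have Vm [measurable]: "V \<in> bmeas" unfolding V[abs_def] by measurable
 have V1: "V xi \<ge> 1" for xi unfolding V using mult_mono[of 1 "p (norm xi)" 1 "gw th b xi"] p1 p0 gw_ge_1[OF b] by simp
 have V0: "V xi \<ge> 0" for xi using V1[of xi] by simp
 have L1: "(NI xi. ennreal (gw th (th * b) xi) * F xi)^2 <= ennreal L * nsq (%xi. ennreal (V xi) * F xi)"
  if [measurable]: "F \<in> bmeas" for F
 proof -
  have "(NI xi. ennreal (gw th (th * b) xi) * F xi)^2 <= nsq (%xi. ennreal (v xi)) * nsq (%xi. ennreal (V xi) * F xi)"
   by (rule weighted_L1_le) (auto simp: ennreal_mult[symmetric] v0 V0 intro!: ennreal_leI wv)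
  also have "... <= ennreal L * nsq (%xi. ennreal (V xi) * F xi)" using L by (intro mult_right_mono) auto
  finally show ?thesis .
 qed
 show ?thesis
  unfolding conv_weight_def
 proof (intro conjI ballI allI exI)
  show "4 * c\<^sup>2 * L > 0" using c L by simp
  show "(%xi. ennreal (V xi)) \<in> bmeas" by measurable
  show "1 <= ennreal (V xi)" for xi using V1[of xi] by (metis ennreal_1 ennreal_leI)
  fix F :: "real^3 => ennreal" assume [measurable]: "F \<in> bmeas"
  have "nsq (%xi. ennreal (V xi) * nconv F F xi) <= 4 * (ennreal c)^2 * (nsq (%xi. ennreal (V xi) * F xi) * (NI xi. ennreal (gw th (th * b) xi) * F xi)^2)"
  proof (rule weighted_conv_self)
   fix eta zeta
   have "V (eta + zeta) <= c * (V eta * gw th (th * b) zeta + gw th (th * b) eta * V zeta)"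
    unfolding V by (rule radial_gevrey_subadditive[where p = p, OF th b]) (use c p0 pm p2 in auto)
   then have "ennreal (V (eta + zeta)) <= ennreal (c * (V eta * gw th (th * b) zeta + gw th (th * b) eta * V zeta))" by (rule ennreal_leI)
   also have "... = ennreal c * (ennreal (V eta) * ennreal (gw th (th * b) zeta) + ennreal (gw th (th * b) eta) * ennreal (V zeta))"
    using c V0 by (simp add: ennreal_mult ennreal_plus)
   finally show "ennreal (V (eta + zeta)) <= ennreal c * (ennreal (V eta) * ennreal (gw th (th * b) zeta) + ennreal (gw th (th * b) eta) * ennreal (V zeta))" .
  qed measurable
  also have "... <= 4 * (ennreal c)^2 * (nsq (%xi. ennreal (V xi) * F xi) * (ennreal L * nsq (%xi. ennreal (V xi) * F xi)))"
   by (intro mult_left_mono L1) auto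
  also have "... = (4 * (ennreal c)^2 * ennreal L) * (nsq (%xi. ennreal (V xi) * F xi))^2" by (simp add: power2_eq_square mult_ac)
  also have "4 * (ennreal c)^2 * ennreal L = ennreal (4 * c\<^sup>2 * L)" using c L by (simp add: ennreal_mult ennreal_power)
  finally show "nsq (%xi. ennreal (V xi) * nconv F F xi) <= ennreal (4 * c\<^sup>2 * L) * (nsq (%xi. ennreal (V xi) * F xi))^2" .
  have "(NI xi. F xi) <= (NI xi. ennreal (gw th (th * b) xi) * F xi)"
   using th b mult_right_mono[OF ennreal_leI[OF gw_ge_1[of "th * b" th]], of "F _"] by (intro nn_integral_mono) auto
  then have "(NI xi. F xi)^2 <= (NI xi. ennreal (gw th (th * b) xi) * F xi)^2" by (intro power_mono) auto
  also have "... <= ennreal L * nsq (%xi. ennreal (V xi) * F xi)" by (rule L1) measurable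
  finally show "(NI xi. F xi)^2 <= ennreal L * nsq (%xi. ennreal (V xi) * F xi)" .
 qed
qed

text \<open>The weight of the space \<open>H\<^sup>1\<^sub>a\<^sub>,\<^sub>\<sigma>\<close>.\<close>

definition gev :: "real => real => real^3 => real" where
 "gev th a xi = sqrt (1 + (norm xi)^2) * gw th a xi"

text \<open>A weight that detects frequencies above \<open>\<rho>\<close>; its convolution constant is proportional to \<open>\<rho>^3\<close> uniformly in \<open>b\<close>.\<close>

definition cub :: "real => real => real => real^3 => real" where
 "cub th b \<rho> xi = (1 + (norm xi / \<rho>)^3) * gw th b xi"

abbreviation (input) egev :: "real => real => real^3 => ennreal"
 where "egev th a xi \<equiv> ennreal (gev th a xi)"

lemma gev_measurable [measurable]: "gev th a \<in> bmeas" unfolding gev_def[abs_def] by measurable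
lemma cub_measurable [measurable]: "cub th b \<rho> \<in> bmeas" unfolding cub_def[abs_def] by measurable

lemma gw_le_gev: "gw th a xi <= gev th a xi"
 unfolding gev_def using mult_right_mono[of 1 "sqrt (1 + (norm xi)^2)" "gw th a xi"] by simp

lemma gev_nonneg [simp]: "gev th a xi \<ge> 0" by (simp add: gev_def)

lemma norm_le_gev: "a \<ge> 0 ==> norm xi <= gev th a xi"
 unfolding gev_def using mult_mono[of "norm xi" "sqrt (1 + (norm xi)^2)" 1 "gw th a xi"] gw_ge_1[of a th xi]
 by (simp add: real_le_rsqrt)

lemma gev_conv_weight:
 assumes th: "0 < th" "th < 1" and a: "a > 0"
 obtains C where "conv_weight C (%xi. egev th a xi)"
proof -
 obtain L where L: "L \<ge> 0" "nsq (%xi. ennreal (gw th (- ((1 - th) * a)) xi)) <= ennreal L"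
  using nsq_gw_decay[of "(1 - th) * a" th] th a by auto
 have "conv_weight (4 * 2\<^sup>2 * (L + 1)) (%xi. egev th a xi)"
 proof (rule conv_weight_radial[where p = "%r. sqrt (1 + r\<^sup>2)" and th = th and b = a])
  fix r :: real assume "r \<ge> 0"
  have "sqrt (1 + (2 * r)^2) <= sqrt (2\<^sup>2 * (1 + r\<^sup>2))" by (intro real_sqrt_le_mono) (simp add: power_mult_distrib)
  also have "... = 2 * sqrt (1 + r\<^sup>2)" unfolding real_sqrt_mult by simp
  finally show "sqrt (1 + (2 * r)^2) <= 2 * sqrt (1 + r\<^sup>2)" .
 next
  fix xi
  have "gw th (th * a) xi = gw th (- ((1 - th) * a)) xi * gw th a xi" unfolding gw_add by (simp add: algebra_simps)
  also have "... <= gw th (- ((1 - th) * a)) xi * gev th a xi" by (intro mult_left_mono gw_le_gev) auto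
  finally show "gw th (th * a) xi <= gw th (- ((1 - th) * a)) xi * gev th a xi" .
 next
  show "nsq (%xi. ennreal (gw th (- ((1 - th) * a)) xi)) <= ennreal (L + 1)"
   using L(2) by (rule order_trans) (auto intro: ennreal_leI)
 qed (use th a L in \<open>auto simp: gev_def intro!: power_mono\<close>)
 then show ?thesis by (rule that)
qed

lemma cub_conv_weight:
 assumes th: "0 < th" "th < 1" and b: "b \<ge> 0" and \<rho>: "\<rho> > 0"
 shows "conv_weight (4 * 8\<^sup>2 * (4 * (pi * \<rho>)^3)) (%xi. ennreal (cub th b \<rho> xi))"
proof (rule conv_weight_radial[where p = "%r. 1 + (max 0 r / \<rho>)^3" and th = th and b = b])
 fix r :: real assume "r \<ge> 0"
 then show "1 + (max 0 (2 * r) / \<rho>)^3 <= 8 * (1 + (max 0 r / \<rho>)^3)" by (simp add: power_mult_distrib power_divide)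
next
 fix xi
 have "gw th (th * b) xi <= gw th b xi" using th b mult_right_mono[of th 1 b] by (intro gw_mono) auto
 moreover have "1 + (norm xi / \<rho>)^3 > 0" using \<rho> by (intro add_pos_nonneg) auto
 ultimately show "gw th (th * b) xi <= 1 / (1 + (norm xi / \<rho>)^3) * cub th b \<rho> xi" by (simp add: cub_def)
next
 show "nsq (%xi::real^3. ennreal (1 / (1 + (norm xi / \<rho>)^3))) <= ennreal (4 * (pi * \<rho>)^3)" using \<rho> by (rule nsq_inverse_cubic)
qed (use th b \<rho> in \<open>auto simp: cub_def intro!: power_mono divide_right_mono\<close>)

section \<open>Blow-up\<close>

lemma fsol_weaken:
 assumes U: "fsol \<nu> W A T U" and [measurable]: "W \<in> bmeas" and le: "!!xi. W' xi <= ennreal c * W xi"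
 shows "fsol \<nu> W' A T U"
proof -
 obtain M where [measurable]: "M \<in> bmeas" and fin: "nsq (%xi. W xi * M xi) < \<infinity>"
  and M: "!!t xi. t \<in> {0..T} ==> ennreal (norm (U t xi)) <= M xi" using fsol_majorant[OF U] by blast
 have "nsq (%xi. W' xi * M xi) <= nsq (%xi. ennreal c * (W xi * M xi))"
  unfolding mult.assoc[symmetric] by (intro nsq_mono mult_right_mono le) auto
 also have "... = (ennreal c)^2 * nsq (%xi. W xi * M xi)" by (rule nsq_cmult) measurable
 also have "... < \<infinity>" using fin by (auto simp: ennreal_mult_less_top power_less_top_ennreal)
 finally show ?thesis using U M unfolding fsol_def by (intro conjI bexI[of _ M]) auto
qed

lemma cub_le_gev:
 assumes th: "0 < th" and ba: "b < a" and \<rho>: "\<rho> > 0"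
 obtains C where "C > 0" "!!xi. cub th b \<rho> xi <= C * gev th a xi"
proof -
 obtain C where C: "C > 0" "!!x. x \<ge> 0 ==> x powr 3 <= C * exp ((a - b) * x powr th)"
  using powr_le_exp_powr[of 3 "a - b" th] assms by auto
 have "cub th b \<rho> xi <= (1 + C / \<rho>^3) * gev th a xi" for xi
 proof -
  have "(norm xi)^3 = norm xi powr 3" by (rule powr_numeral[symmetric]) simp
  then have "(norm xi)^3 <= C * gw th (a - b) xi" using C(2)[of "norm xi"] by (simp add: gw_def)
  then have "(norm xi / \<rho>)^3 <= C / \<rho>^3 * gw th (a - b) xi" using \<rho> by (simp add: power_divide field_simps)
  moreover have "1 <= gw th (a - b) xi" using ba by (intro gw_ge_1) simp
  ultimately have "1 + (norm xi / \<rho>)^3 <= (1 + C / \<rho>^3) * gw th (a - b) xi" by (simp add: distrib_right)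
  then have "cub th b \<rho> xi <= (1 + C / \<rho>^3) * gw th (a - b) xi * gw th b xi"
   unfolding cub_def by (intro mult_right_mono) auto
  also have "... = (1 + C / \<rho>^3) * gw th a xi" by (simp add: mult.assoc gw_add)
  also have "... <= (1 + C / \<rho>^3) * gev th a xi" using C \<rho> by (intro mult_left_mono gw_le_gev) auto
  finally show ?thesis .
 qed
 moreover have "1 + C / \<rho>^3 > 0" using C \<rho> by (simp add: add_pos_pos)
 ultimately show ?thesis by (rule that[rotated])
qed

lemma gev_le_cub:
 assumes \<rho>: "\<rho> > 0"
 shows "gev th b xi <= (2 + \<rho>) * cub th b \<rho> xi"
proof -
 define z where "z = norm xi / \<rho>"
 have z: "z \<ge> 0" "norm xi = \<rho> * z" using \<rho> by (auto simp: z_def)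
 have "z <= 1 + z^3"
 proof (cases "z <= 1")
  case False
  then have "z^1 <= z^3" by (intro power_increasing) auto
  then show ?thesis by simp
 qed (use z in \<open>auto intro: order_trans\<close>)
 have "sqrt (1 + (norm xi)^2) <= 1 + norm xi" by (rule real_le_lsqrt) (auto simp: power2_sum)
 also have "... <= (1 + z^3) + \<rho> * (1 + z^3)"
  using z(1) mult_left_mono[OF \<open>z <= 1 + z^3\<close>, of \<rho>] \<rho> unfolding z(2) by (intro add_mono) auto
 also have "... <= (2 + \<rho>) * (1 + z^3)" using z(1) by (simp add: algebra_simps)
 finally have "sqrt (1 + (norm xi)^2) * gw th b xi <= (2 + \<rho>) * (1 + z^3) * gw th b xi" by (intro mult_right_mono) auto
 then show ?thesis by (simp add: gev_def cub_def z_def mult.assoc)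
qed

lemma gev_subadditive:
 assumes th: "0 < th" "th <= 1" and b: "b \<ge> 0"
 shows "gev th b (eta + zeta) <= 2 * (gev th b eta * gw th (th * b) zeta + gw th (th * b) eta * gev th b zeta)"
 unfolding gev_def
proof (rule radial_gevrey_subadditive[where p = "%r. sqrt (1 + r\<^sup>2)", OF assms])
 fix r :: real
 have "sqrt (1 + (2 * r)^2) <= sqrt (2\<^sup>2 * (1 + r\<^sup>2))" by (intro real_sqrt_le_mono) (simp add: power_mult_distrib)
 also have "... = 2 * sqrt (1 + r\<^sup>2)" unfolding real_sqrt_mult by simp
 finally show "sqrt (1 + (2 * r)^2) <= 2 * sqrt (1 + r\<^sup>2)" .
qed (auto intro!: power_mono)

text \<open>A bound in the Gevrey weight \<open>b\<close> up to time \<open>Tm\<close> propagates to any \<open>b'\<close> with \<open>th * b' < b\<close>: by the subadditivity with gain the quadratic term is at most a bounded factor, the norm with exponent \<open>th * b'\<close>, times the quantity itself, and Gronwall applies.\<close>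

lemma gevrey_bootstrap:
 assumes \<nu>: "\<nu> > 0" and th: "0 < th" "th < 1" and W: "conv_weight C0 (%xi. egev th a xi)"
  and U: "!!T. T < Tm ==> fsol \<nu> (%xi. egev th a xi) A T U" and s: "0 <= s" "s < Tm"
  and b: "0 < b" "b' <= a" "th * b' < b" "b' \<ge> 0"
  and B: "!!t. t \<in> {s..<Tm} ==> nsq (%xi. egev th b xi * enorm (U t) xi) <= ennreal B" "B \<ge> 0"
 obtains B' where "B' \<ge> 0" "!!t. t \<in> {s..<Tm} ==> nsq (%xi. ennreal (gev th b' xi) * enorm (U t) xi) <= ennreal B'"
proof -
 note [measurable] = fsol_measurable[OF U] measurable_slice[OF fsol_measurable[OF U]]
 have Um [measurable]: "(%(t, xi). U t xi) \<in> bmeas2" using U[OF s(2)] by (rule fsol_measurable)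
 have [measurable]: "U t \<in> bmeas" for t using Um by (rule measurable_slice)
 define y where "y t = nsq (%xi. ennreal (gev th b' xi) * enorm (U t) xi)" for t
 have ym [measurable]: "y \<in> bmeas"
 proof -
  have [measurable]: "(%p. U (fst p) (snd p)) \<in> bmeas2" using Um by (simp add: split_beta')
  show ?thesis unfolding y_def[abs_def] nsq_def by measurable
 qed
 have yfin: "\<exists>K\<ge>0. \<forall>t\<in>{0..T}. y t <= ennreal K" if T: "T < Tm" for T
 proof -
  obtain M where "M \<in> bmeas" and fin: "nsq (%xi. egev th a xi * M xi) < \<infinity>"
   and M: "!!t xi. t \<in> {0..T} ==> ennreal (norm (U t xi)) <= M xi" using fsol_majorant[OF U[OF T]] by blast
  have "y t <= nsq (%xi. egev th a xi * M xi)" if "t \<in> {0..T}" for t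
   unfolding y_def
   by (intro nsq_mono mult_mono ennreal_leI) (auto simp: gev_def M[OF that] intro!: mult_left_mono gw_mono b)
  moreover have "nsq (%xi. egev th a xi * M xi) = ennreal (enn2real (nsq (%xi. egev th a xi * M xi)))"
   using fin by simp
  ultimately show ?thesis by (intro exI[of _ "enn2real (nsq (%xi. egev th a xi * M xi))"]) auto
 qed
 obtain L where L: "L \<ge> 0" "nsq (%xi. ennreal (gw th (- (b - th * b')) xi)) <= ennreal L"
  using nsq_gw_decay[of "b - th * b'" th] th b by auto
 define D where "D = 2 * (648 / \<nu>) * (16 * (L * B))"
 have D: "D \<ge> 0" using \<nu> L B(2) by (simp add: D_def)
 have quad: "nsq (%xi. ennreal (gev th b' xi) * nconv (enorm (U tau)) (enorm (U tau)) xi) <= ennreal (16 * (L * B)) * y tau"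
  if tau: "tau \<in> {s..<Tm}" for tau
 proof -
  have l1: "(NI xi. ennreal (gw th (th * b') xi) * enorm (U tau) xi)^2 <= ennreal (L * B)"
  proof -
   have "(NI xi. ennreal (gw th (th * b') xi) * enorm (U tau) xi)^2 <=
    nsq (%xi. ennreal (gw th (- (b - th * b')) xi)) * nsq (%xi. egev th b xi * enorm (U tau) xi)"
   proof (rule weighted_L1_le)
    fix xi
    have "gw th (th * b') xi = gw th (- (b - th * b')) xi * gw th b xi" unfolding gw_add by simp
    also have "... <= gw th (- (b - th * b')) xi * gev th b xi" by (intro mult_left_mono gw_le_gev) auto
    finally show "ennreal (gw th (th * b') xi) <= ennreal (gw th (- (b - th * b')) xi) * egev th b xi"
     by (subst ennreal_mult[symmetric]) (auto intro: ennreal_leI)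
   qed measurable
   also have "... <= ennreal L * ennreal B" by (intro mult_mono L B tau) auto
   also have "... = ennreal (L * B)" using L B by (intro ennreal_mult[symmetric])
   finally show ?thesis .
  qed
  have "nsq (%xi. ennreal (gev th b' xi) * nconv (enorm (U tau)) (enorm (U tau)) xi)
   <= 4 * 2\<^sup>2 * (nsq (%xi. ennreal (gev th b' xi) * enorm (U tau) xi) * (NI xi. ennreal (gw th (th * b') xi) * enorm (U tau) xi)^2)"
  proof (rule weighted_conv_self)
   fix eta zeta
   have "ennreal (gev th b' (eta + zeta)) <= ennreal (2 * (gev th b' eta * gw th (th * b') zeta + gw th (th * b') eta * gev th b' zeta))"
    using th b by (intro ennreal_leI gev_subadditive) auto
   also have "... = 2 * (ennreal (gev th b' eta) * ennreal (gw th (th * b') zeta) + ennreal (gw th (th * b') eta) * ennreal (gev th b' zeta))"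
    by (simp add: ennreal_mult ennreal_plus)
   finally show "ennreal (gev th b' (eta + zeta)) <= 2 * (ennreal (gev th b' eta) * ennreal (gw th (th * b') zeta) + ennreal (gw th (th * b') eta) * ennreal (gev th b' zeta))" .
  qed measurable
  also have "... <= 4 * 2\<^sup>2 * (y tau * ennreal (L * B))" unfolding y_def by (intro mult_left_mono l1) auto
  also have "... = 16 * ennreal (L * B) * y tau" by (simp add: mult_ac)
  also have "16 * ennreal (L * B) = ennreal (16 * (L * B))" using L B by (subst (2) ennreal_mult) auto
  finally show ?thesis .
 qed
 have ineq: "y t <= 2 * y s + ennreal D * (NI tau. indicator {s..t} tau * y tau)" if t: "t \<in> {s..<Tm}" for t
 proof -
  have "y t <= 2 * y s + 2 * (ennreal (648 / \<nu>) * (NI tau. indicator {s..t} tau * nsq (%xi. ennreal (gev th b' xi) * nconv (enorm (U tau)) (enorm (U tau)) xi)))"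
   unfolding y_def by (rule fsol_energy_type_ineq[OF \<nu> W U]) (use t s in auto)
  also have "(NI tau. indicator {s..t} tau * nsq (%xi. ennreal (gev th b' xi) * nconv (enorm (U tau)) (enorm (U tau)) xi))
   <= (NI tau. ennreal (16 * (L * B)) * (indicator {s..t} tau * y tau))"
   using quad t by (intro nn_integral_mono) (auto split: split_indicator)
  also have "... = ennreal (16 * (L * B)) * (NI tau. indicator {s..t} tau * y tau)" by (rule nn_integral_cmult) measurable
  also have "2 * (ennreal (648 / \<nu>) * (ennreal (16 * (L * B)) * (NI tau. indicator {s..t} tau * y tau))) = ennreal D * (NI tau. indicator {s..t} tau * y tau)"
  proof -
   have "ennreal D = ennreal (2 * (648 / \<nu>)) * ennreal (16 * (L * B))" unfolding D_def using \<nu> L B by (intro ennreal_mult) auto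
   also have "ennreal (2 * (648 / \<nu>)) = 2 * ennreal (648 / \<nu>)" using \<nu> by (subst ennreal_mult) auto
   finally show ?thesis by (simp add: mult.assoc)
  qed
  finally show ?thesis by this (intro add_left_mono mult_left_mono; simp)
 qed
 obtain K0 where K0: "K0 \<ge> 0" "y s <= ennreal K0" using yfin[OF s(2)] s by auto
 have "y t <= ennreal (2 * K0 * exp (D * (Tm - s)))" if t: "t \<in> {s..<Tm}" for t
 proof -
  obtain K where K: "K \<ge> 0" "!!r. r \<in> {0..t} ==> y r <= ennreal K" using yfin[of t] t by auto
  have "2 * y s <= 2 * ennreal K0" by (intro mult_left_mono K0) auto
  also have "... = ennreal (2 * K0)" using K0 by (subst ennreal_mult) auto
  finally have k: "2 * y s <= ennreal (2 * K0)" .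
  have "y t <= ennreal (2 * K0 * exp (D * (t - s)))"
  proof (rule gronwall[where B = K and T = t, OF ym])
   fix r assume r: "r \<in> {s..t}"
   show "y r <= ennreal K" using K(2) r s by auto
   show "y r <= ennreal (2 * K0) + ennreal D * (NI tau. indicator {s..r} tau * y tau)"
    using ineq[of r] r t k by (auto intro: order_trans[OF _ add_right_mono])
  qed (use K K0 D t in auto)
  also have "... <= ennreal (2 * K0 * exp (D * (Tm - s)))"
   using K0 D t by (intro ennreal_leI mult_left_mono) (auto intro: mult_left_mono)
  finally show ?thesis .
 qed
 then show ?thesis using K0 by (intro that[of "2 * K0 * exp (D * (Tm - s))"]) (auto simp: y_def)
qed

text \<open>If the sixth moment were smaller, local existence with weight \<open>cub\<close> would carry the solution from \<open>s\<close> to \<open>Tm\<close>, with a Gevrey exponent \<open>a * q ^ n\<close> small enough not to enlarge the norm noticeably. The bootstrap, applied \<open>n\<close> times with \<open>q^2 = th\<close>, would then bound the full Gevrey norm up to \<open>Tm\<close>.\<close>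

lemma cubic_weight_blowup:
 assumes \<nu>: "\<nu> > 0" and th: "0 < th" "th < 1" and a: "a > 0" and W: "conv_weight C0 (%xi. egev th a xi)"
  and U: "!!T. T < Tm ==> fsol \<nu> (%xi. egev th a xi) A T U" and s: "0 <= s" "s < Tm"
  and unb: "!!K. \<exists>t. 0 <= t & t < Tm & ennreal K < nsq (%xi. egev th a xi * enorm (U t) xi)"
  and E: "E > 0" "sqnorm (U s) <= ennreal E" and \<rho>: "\<rho> > 0"
  and small: "16 * (648 / \<nu> * (Tm - s)) * (4 * 8\<^sup>2 * (4 * (pi * \<rho>)^3)) * (6 * E) <= 1"
 shows "ennreal (E * \<rho>^6) < nsq (%xi. ennreal ((norm xi)^3) * enorm (U s) xi)"
proof (rule ccontr)
 assume "\<not> ?thesis"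
 then have y: "nsq (%xi. ennreal ((norm xi)^3) * enorm (U s) xi) <= ennreal (E * \<rho>^6)" by simp
 have [measurable]: "U t \<in> bmeas" for t using fsol_measurable[OF U[OF s(2)]] by (rule measurable_slice)
 have cub0: "cub th b \<rho> xi \<ge> 0" for b xi using \<rho> by (simp add: cub_def)
 have "nsq (%xi. ennreal (cub th 0 \<rho> xi) * enorm (U s) xi) <= 2 * nsq (enorm (U s)) + 2 * nsq (%xi. ennreal (1 / \<rho>^3) * (ennreal ((norm xi)^3) * enorm (U s) xi))"
 proof -
  have "ennreal (cub th 0 \<rho> xi) * enorm (U s) xi = enorm (U s) xi + ennreal (1 / \<rho>^3) * (ennreal ((norm xi)^3) * enorm (U s) xi)" for xi
  proof -
   have "cub th 0 \<rho> xi = 1 + 1 / \<rho>^3 * (norm xi)^3" by (simp add: cub_def gw_def power_divide)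
   then have "ennreal (cub th 0 \<rho> xi) = 1 + ennreal (1 / \<rho>^3) * ennreal ((norm xi)^3)"
    using \<rho> by (simp add: ennreal_mult[symmetric] del: times_divide_eq_left)
   then show ?thesis by (simp add: distrib_right mult.assoc)
  qed
  then show ?thesis by (simp only:) (rule nsq_add_le, measurable)
 qed
 also have "nsq (%xi. ennreal (1 / \<rho>^3) * (ennreal ((norm xi)^3) * enorm (U s) xi)) = (ennreal (1 / \<rho>^3))^2 * nsq (%xi. ennreal ((norm xi)^3) * enorm (U s) xi)"
  by (rule nsq_cmult) measurable
 also have "(ennreal (1 / \<rho>^3))^2 * nsq (%xi. ennreal ((norm xi)^3) * enorm (U s) xi) <= (ennreal (1 / \<rho>^3))^2 * ennreal (E * \<rho>^6)"
  by (intro mult_left_mono y) auto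
 also have "... = ennreal ((1 / \<rho>^3)^2 * (E * \<rho>^6))" using \<rho> E by (simp add: ennreal_power ennreal_mult[symmetric])
 also have "(1 / \<rho>^3)^2 * (E * \<rho>^6) = E" using \<rho> by (simp add: power_divide power_mult[symmetric])
 also have "2 * nsq (enorm (U s)) + 2 * ennreal E <= 2 * ennreal E + 2 * ennreal E"
  unfolding nsq_enorm by (intro add_right_mono mult_left_mono E) auto
 also have "... = ennreal (4 * E)" using E by (simp add: ennreal_mult distrib_right[symmetric] numeral_eq_Suc)
 finally have base: "nsq (%xi. ennreal (cub th 0 \<rho> xi) * enorm (U s) xi) <= ennreal (4 * E)"
  by this (intro add_left_mono mult_left_mono; simp)
 \<comment> \<open>With \<open>q\<^sup>2 = th\<close> one bootstrap step leads from the exponent \<open>a * q ^ Suc m\<close> to \<open>a * q ^ m\<close>.\<close>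
 define q where "q = sqrt th"
 have q: "0 < q" "q < 1" "q * q = th" using th by (auto simp: q_def)
 have aq: "0 < a * q^n" "a * q^n <= a" "n \<ge> 1 ==> a * q^n <= a * q" for n
  using a q power_decreasing[of 1 n q] by (auto simp: power_le_one)
 obtain n where n: "n \<ge> 1" "nsq (%xi. ennreal (cub th (a * q^n) \<rho> xi) * enorm (U s) xi) <= ennreal (6 * E)"
 proof -
  obtain C where C: "C > 0" "!!xi. cub th (a * q) \<rho> xi <= C * gev th a xi"
   using cub_le_gev[of th "a * q" a \<rho>] th a q \<rho> by auto
  have fin: "nsq (%xi. ennreal (cub th (a * q) \<rho> xi) * enorm (U s) xi) < \<infinity>"
  proof -
   have "fsol \<nu> (%xi. ennreal (cub th (a * q) \<rho> xi)) A s U"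
    by (rule fsol_weaken[OF U[OF s(2)], of _ C]) (use C in \<open>auto simp: ennreal_mult[symmetric] intro!: ennreal_leI\<close>)
   then obtain M where fin: "nsq (%xi. ennreal (cub th (a * q) \<rho> xi) * M xi) < \<infinity>" and M: "!!xi. ennreal (norm (U s xi)) <= M xi"
    by (rule fsol_majorant) (use s in auto)
   have "nsq (%xi. ennreal (cub th (a * q) \<rho> xi) * enorm (U s) xi) <= nsq (%xi. ennreal (cub th (a * q) \<rho> xi) * M xi)"
    by (intro nsq_mono mult_left_mono M) auto
   then show ?thesis using fin by (rule le_less_trans)
  qed
  have "(%n. nsq (%xi. ennreal (cub th (a * q^(Suc n)) \<rho> xi) * enorm (U s) xi)) ---> nsq (%xi. ennreal (cub th 0 \<rho> xi) * enorm (U s) xi)"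
   unfolding nsq_def
  proof (rule nn_integral_dominated_convergence[where w = "%xi. (ennreal (cub th (a * q) \<rho> xi) * enorm (U s) xi)^2"])
   show "(NI xi. (ennreal (cub th (a * q) \<rho> xi) * enorm (U s) xi)^2) < \<infinity>" using fin by (simp add: nsq_def)
   show "AL xi. (ennreal (cub th (a * q^(Suc n)) \<rho> xi) * enorm (U s) xi)^2 <= (ennreal (cub th (a * q) \<rho> xi) * enorm (U s) xi)^2" for n
    using aq(3)[of "Suc n", OF le_add1[of 1 n, unfolded plus_1_eq_Suc]] \<rho> unfolding cub_def
    by (intro AE_I2 power_mono mult_right_mono ennreal_leI) (auto intro!: mult_left_mono gw_mono simp del: power_Suc)
   have "(%n. a * q^(Suc n)) ---> a * 0" using q by (intro tendsto_mult tendsto_const LIMSEQ_Suc LIMSEQ_realpow_zero) auto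
   then have lim: "(%n. cub th (a * q^(Suc n)) \<rho> xi) ---> cub th 0 \<rho> xi" for xi
    unfolding cub_def gw_def by (intro tendsto_intros) simp
   show "AL xi. (%n. (ennreal (cub th (a * q^(Suc n)) \<rho> xi) * enorm (U s) xi)^2) ---> (ennreal (cub th 0 \<rho> xi) * enorm (U s) xi)\<^sup>2"
   proof (rule AE_I2)
    fix xi
    have "(%n. ennreal ((cub th (a * q^(Suc n)) \<rho> xi * norm (U s xi))^2)) ---> ennreal ((cub th 0 \<rho> xi * norm (U s xi))^2)"
     by (intro tendsto_ennrealI tendsto_intros lim)
    then show "(%n. (ennreal (cub th (a * q^(Suc n)) \<rho> xi) * enorm (U s) xi)^2) ---> (ennreal (cub th 0 \<rho> xi) * enorm (U s) xi)\<^sup>2"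
     using cub0 by (simp add: ennreal_mult[symmetric] ennreal_power)
   qed
  qed measurable
  moreover have "nsq (%xi. ennreal (cub th 0 \<rho> xi) * enorm (U s) xi) < ennreal (6 * E)"
   using base by (rule le_less_trans) (use E in \<open>simp add: ennreal_lessI\<close>)
  ultimately have "eventually (%n. nsq (%xi. ennreal (cub th (a * q^(Suc n)) \<rho> xi) * enorm (U s) xi) < ennreal (6 * E)) sequentially"
   by (rule order_tendstoD(2))
  then obtain n where "nsq (%xi. ennreal (cub th (a * q^(Suc n)) \<rho> xi) * enorm (U s) xi) < ennreal (6 * E)"
   by (auto simp: eventually_sequentially)
  then show ?thesis by (intro that[of "Suc n"]) auto
 qed
 define V where "V xi = ennreal (cub th (a * q^n) \<rho> xi)" for xi
 have VW: "conv_weight (4 * 8\<^sup>2 * (4 * (pi * \<rho>)^3)) V" unfolding V_def by (rule cub_conv_weight) (use th aq(1)[of n] \<rho> in auto)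
 have fs: "fsol \<nu> V A T U" if T: "T < Tm" for T
 proof -
  have "a * q^n <= a * q" by (rule aq(3)[OF n(1)])
  also have "... < a" using a q by simp
  finally obtain C where C: "C > 0" "!!xi. cub th (a * q^n) \<rho> xi <= C * gev th a xi"
   using cub_le_gev[of th "a * q^n" a \<rho>] th \<rho> by auto
  show ?thesis unfolding V_def
   by (rule fsol_weaken[OF U[OF T], of _ C]) (use C in \<open>auto simp: ennreal_mult[symmetric] intro!: ennreal_leI\<close>)
 qed
 obtain U' where "fsol \<nu> V A (s + (Tm - s)) U'"
  using fsol_extend[OF \<nu> VW fs[OF s(2)] s(1), of "6 * E" "Tm - s"] n(2) E s small by (auto simp: V_def)
 then have U': "fsol \<nu> V A Tm U'" by simp
 obtain M where [measurable]: "M \<in> bmeas" and fin: "nsq (%xi. V xi * M xi) < \<infinity>"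
  and M: "!!t xi. t \<in> {0..Tm} ==> ennreal (norm (U' t xi)) <= M xi" using fsol_majorant[OF U'] by blast
 define B where "B = enn2real (nsq (%xi. V xi * M xi))"
 have Mb: "nsq (%xi. V xi * enorm (U t) xi) <= ennreal B" if t: "t \<in> {0..<Tm}" for t
 proof -
  have "AL xi. \<forall>r\<in>{0..t}. U r xi = U' r xi"
   by (rule fsol_unique[OF \<nu> VW fs fsol_restrict[OF U']]) (use t in auto)
  then have "nsq (%xi. V xi * enorm (U t) xi) <= nsq (%xi. V xi * M xi)"
   using t M[of t] by (intro nsq_mono_AE) (auto elim!: eventually_mono intro!: mult_left_mono)
  then show ?thesis using fin by (simp add: B_def)
 qed
 have "\<exists>B\<ge>0. \<forall>t\<in>{0..<Tm}. nsq (%xi. ennreal (gev th (a * q^(n - k)) xi) * enorm (U t) xi) <= ennreal B" for k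
 proof (induction k)
  case 0
  have "nsq (%xi. egev th (a * q^n) xi * enorm (U t) xi) <= ennreal ((2 + \<rho>)^2 * B)" if t: "t \<in> {0..<Tm}" for t
  proof -
   have "nsq (%xi. egev th (a * q^n) xi * enorm (U t) xi) <= nsq (%xi. ennreal (2 + \<rho>) * (V xi * enorm (U t) xi))"
   proof (rule nsq_mono)
    fix xi
    have "egev th (a * q^n) xi <= ennreal (2 + \<rho>) * V xi"
     unfolding V_def using \<rho> cub0 by (subst ennreal_mult[symmetric]) (auto intro!: ennreal_leI gev_le_cub)
    then show "egev th (a * q^n) xi * enorm (U t) xi <= ennreal (2 + \<rho>) * (V xi * enorm (U t) xi)"
     unfolding mult.assoc[symmetric] by (rule mult_right_mono) simp
   qed
   also have "... = (ennreal (2 + \<rho>))^2 * nsq (%xi. V xi * enorm (U t) xi)" by (rule nsq_cmult) (unfold V_def, measurable)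
   also have "... <= (ennreal (2 + \<rho>))^2 * ennreal B" by (intro mult_left_mono Mb t) auto
   also have "(ennreal (2 + \<rho>))^2 = ennreal ((2 + \<rho>)^2)" using \<rho> by (intro ennreal_power) auto
   also have "... * ennreal B = ennreal ((2 + \<rho>)^2 * B)" by (rule ennreal_mult[symmetric]) (auto simp: B_def)
   finally show ?thesis .
  qed
  then show ?case by (intro exI[of _ "(2 + \<rho>)^2 * B"]) (auto simp: B_def)
 next
  case (Suc k)
  show ?case
  proof (cases "k < n")
   case False
   then have "n - Suc k = n - k" by simp
   then show ?thesis using Suc.IH by simp
  next
   case True
   define m where "m = n - Suc k"
   have m: "n - k = Suc m" using True by (simp add: m_def)
   obtain B1 where B1: "B1 \<ge> 0" "!!t. t \<in> {0..<Tm} ==> nsq (%xi. ennreal (gev th (a * q^(Suc m)) xi) * enorm (U t) xi) <= ennreal B1"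
    using Suc.IH unfolding m by blast
   have "th * (a * q^m) = q * (a * q^(Suc m))" unfolding q(3)[symmetric] by simp
   also have "... < 1 * (a * q^(Suc m))" by (rule mult_strict_right_mono[OF q(2) aq(1)])
   also have "... = a * q^(Suc m)" by simp
   finally have lt: "th * (a * q^m) < a * q^(Suc m)" .
   have "0 < Tm" using s by simp
   obtain B' where "B' \<ge> 0" "!!t. t \<in> {0..<Tm} ==> nsq (%xi. egev th (a * q^m) xi * enorm (U t) xi) <= ennreal B'"
    using gevrey_bootstrap[OF \<nu> th W U order.refl \<open>0 < Tm\<close> aq(1) aq(2) lt less_imp_le[OF aq(1)] B1(2) B1(1)] by blast
   then show ?thesis unfolding m_def by blast
  qed
 qed
 from this[of n] obtain B where "B \<ge> 0" "!!t. t \<in> {0..<Tm} ==> nsq (%xi. egev th a xi * enorm (U t) xi) <= ennreal B" by auto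
 then show False using unb[of B] by (meson atLeastLessThan_iff leD)
qed

text \<open>Frequencies below \<open>\<rho> / 2\<close> contribute at most \<open>E (\<rho> / 2)^6\<close> to the sixth moment; above \<open>\<rho> / 2\<close> half of the exponent of the Gevrey weight controls \<open>|xi|^6\<close> and the other half is at least \<open>exp (a (\<rho> / 2) powr th)\<close>.\<close>

lemma gevrey_norm_lower_bound:
 fixes f :: "real^3 => complex^3"
 assumes [measurable]: "f \<in> bmeas" and a: "a > 0" and th: "th > 0" and E: "E > 0" "sqnorm f <= ennreal E" and \<rho>: "\<rho> > 0"
  and y: "ennreal (E * \<rho>^6) <= nsq (%xi. ennreal ((norm xi)^3) * enorm f xi)"
  and C: "C > 0" "!!x. x \<ge> 0 ==> x powr 6 <= C * exp (a * x powr th)"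
  and N: "nsq (%xi. egev th a xi * enorm f xi) <= ennreal N" "N \<ge> 0"
 shows "E * \<rho>^6 / (2 * C) * exp (a * (\<rho> / 2) powr th) <= N"
proof -
 define X where "X = C * exp (- a * (\<rho> / 2) powr th)"
 have X: "X > 0" using C by (simp add: X_def)
 have pt: "((norm xi)^3)^2 <= (\<rho> / 2)^6 + X * (gev th a xi)^2" for xi :: "real^3"
 proof (cases "norm xi <= \<rho> / 2")
  case True
  then have "(norm xi)^6 <= (\<rho> / 2)^6" by (intro power_mono) auto
  moreover have "X * (gev th a xi)^2 \<ge> 0" using X by simp
  ultimately show ?thesis by (simp add: power_mult[symmetric])
 next
  case False
  have "((norm xi)^3)^2 = norm xi powr 6" by (simp add: power_mult[symmetric])
  also have "... <= C * exp (a * norm xi powr th)" by (rule C) simp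
  also have "... <= C * exp (a * norm xi powr th + (a * norm xi powr th - a * (\<rho> / 2) powr th))"
   using False a C \<rho> th by (intro mult_left_mono) (auto intro!: powr_mono2)
  also have "... = X * (gw th a xi)^2" by (simp add: X_def gw_def exp_add[symmetric] power2_eq_square)
  also have "... <= X * (gev th a xi)^2" using X gw_le_gev by (intro mult_left_mono power_mono) auto
  finally show ?thesis using \<rho> by (simp add: add_increasing)
 qed
 have "ennreal (E * \<rho>^6) <= (NI xi. ennreal ((\<rho> / 2)^6) * ennreal ((norm (f xi))^2) + ennreal X * (egev th a xi * enorm f xi)^2)"
 proof (rule order_trans[OF y], unfold nsq_def, rule nn_integral_mono)
  fix xi :: "real^3"
  have "((norm xi)^3 * norm (f xi))^2 <= ((\<rho> / 2)^6 + X * (gev th a xi)^2) * (norm (f xi))^2"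
   unfolding power_mult_distrib by (intro mult_right_mono pt) auto
  also have "... = (\<rho> / 2)^6 * (norm (f xi))^2 + X * (gev th a xi * norm (f xi))^2" by (simp add: power_mult_distrib distrib_right)
  finally have "ennreal (((norm xi)^3 * norm (f xi))^2) <= ennreal ((\<rho> / 2)^6 * (norm (f xi))^2 + X * (gev th a xi * norm (f xi))^2)" by (rule ennreal_leI)
  also have "... = ennreal ((\<rho> / 2)^6) * ennreal ((norm (f xi))^2) + ennreal X * ennreal ((gev th a xi * norm (f xi))^2)"
   using X \<rho> by (subst ennreal_plus) (auto simp: ennreal_mult simp del: times_divide_eq_left)
  finally show "(ennreal ((norm xi)^3) * enorm f xi)^2 <= ennreal ((\<rho> / 2)^6) * ennreal ((norm (f xi))^2) + ennreal X * (egev th a xi * enorm f xi)^2"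
   by (simp add: ennreal_mult[symmetric] ennreal_power)
 qed
 also have "... = ennreal ((\<rho> / 2)^6) * sqnorm f + ennreal X * nsq (%xi. egev th a xi * enorm f xi)"
  unfolding sqnorm_def nsq_def by (subst nn_integral_add) (auto simp: nn_integral_cmult)
 also have "... <= ennreal ((\<rho> / 2)^6) * ennreal E + ennreal X * ennreal N" by (intro add_mono mult_left_mono E N) auto
 also have "... = ennreal ((\<rho> / 2)^6 * E + X * N)" using \<rho> E X N by (subst ennreal_plus) (auto simp: ennreal_mult)
 finally have "E * \<rho>^6 <= (\<rho> / 2)^6 * E + X * N" using \<rho> E X N by (subst (asm) ennreal_le_iff) auto
 moreover have "(\<rho> / 2)^6 * E <= E * \<rho>^6 / 2" using \<rho> E by (simp add: power_divide)
 ultimately have "E * \<rho>^6 / 2 <= X * N" by simp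
 then have "E * \<rho>^6 / 2 * (exp (a * (\<rho> / 2) powr th) / C) <= X * N * (exp (a * (\<rho> / 2) powr th) / C)"
  using C by (intro mult_right_mono) auto
 also have "... = N" using C by (simp add: X_def exp_minus)
 finally show ?thesis by (simp add: mult_ac)
qed

text \<open>The radius \<open>\<rho>\<close> is chosen with \<open>\<rho>^3\<close> proportional to \<open>\<nu> / (E (Tm - t))\<close>, the largest for which the smallness condition holds. The constant \<open>c2\<close> is half of what the estimate allows, so that the other half absorbs the power of \<open>Tm - t\<close>; it depends on \<open>\<nu>\<close>, \<open>th\<close> and \<open>E\<close> only.\<close>

lemma blowup_rate:
 assumes \<nu>: "\<nu> > 0" and th: "0 < th" "th < 1" and p: "p > 1" and E: "E > 0"
 obtains c2 where "c2 > 0"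
  "!!a C0 A U Tm. a > 0 ==> conv_weight C0 (%xi. egev th a xi) ==>
   (!!T. T < Tm ==> fsol \<nu> (%xi. egev th a xi) A T U) ==>
   (!!K. \<exists>t. 0 <= t & t < Tm & ennreal K < nsq (%xi. egev th a xi * enorm (U t) xi)) ==>
   (!!t. 0 <= t ==> t < Tm ==> sqnorm (U t) <= ennreal E) ==>
   \<exists>c1>0. \<forall>t. 0 <= t & t < Tm --> c1 / (Tm - t) powr p * exp (a * c2 / (Tm - t) powr (th / 3))
    <= sqrt (1 / (2 * pi)^3 * enn2real (nsq (%xi. egev th a xi * enorm (U t) xi)))"
proof -
 \<comment> \<open>The factor \<open>16 * 648\<close> is that of local existence, \<open>1024 * pi^3\<close> belongs to the convolution constant of \<open>cub\<close>, and \<open>6 * E\<close> bounds the weighted norm at the restarting time.\<close>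
 define D where "D = 16 * 648 * 1024 * pi^3 * 6"
 have D: "D > 0" by (simp add: D_def)
 define \<kappa> where "\<kappa> = \<nu> / (D * E)"
 have \<kappa>: "\<kappa> > 0" using \<nu> D E by (simp add: \<kappa>_def)
 define c2 where "c2 = (\<kappa> powr (1 / 3) / 2) powr th / 4"
 have c2: "c2 > 0" using \<kappa> by (simp add: c2_def)
 show ?thesis
 proof (rule that[OF c2])
  fix a C0 A U and Tm :: real
  assume a: "a > 0" and W: "conv_weight C0 (%xi. egev th a xi)"
   and U: "!!T. T < Tm ==> fsol \<nu> (%xi. egev th a xi) A T U"
   and unb: "!!K. \<exists>t. 0 <= t & t < Tm & ennreal K < nsq (%xi. egev th a xi * enorm (U t) xi)"
   and en: "!!t. 0 <= t ==> t < Tm ==> sqnorm (U t) <= ennreal E"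
  obtain C where C: "C > 0" "!!x. x \<ge> 0 ==> x powr 6 <= C * exp (a * x powr th)"
   using powr_le_exp_powr[of 6 a th] a th by auto
  obtain C' where C': "C' > 0" "!!x. x \<ge> 0 ==> x powr (p - 1) <= C' * exp (a * c2 * x powr (th / 3))"
   using powr_le_exp_powr[of "p - 1" "a * c2" "th / 3"] a c2 th p by auto
  define K where "K = sqrt (E / (2 * C * (2 * pi)^3)) * \<kappa>"
  have K: "K > 0" using E C \<kappa> by (simp add: K_def)
  show "\<exists>c1>0. \<forall>t. 0 <= t & t < Tm --> c1 / (Tm - t) powr p * exp (a * c2 / (Tm - t) powr (th / 3))
    <= sqrt (1 / (2 * pi)^3 * enn2real (nsq (%xi. egev th a xi * enorm (U t) xi)))"
  proof (intro exI conjI allI impI)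
   show "K / C' > 0" using K C' by simp
   fix t assume "0 <= t & t < Tm"
   then have t: "0 <= t" "t < Tm" by auto
   define z where "z = 1 / (Tm - t)"
   have z: "z > 0" using t by (simp add: z_def)
   define \<rho> where "\<rho> = (\<kappa> * z) powr (1 / 3)"
   have \<rho>: "\<rho> > 0" using \<kappa> z by (simp add: \<rho>_def)
   have \<rho>3: "\<rho>^3 = \<kappa> * z" using \<kappa> z by (simp add: \<rho>_def powr_realpow[symmetric] powr_powr)
   have small: "16 * (648 / \<nu> * (Tm - t)) * (4 * 8\<^sup>2 * (4 * (pi * \<rho>)^3)) * (6 * E) <= 1"
   proof -
    have "16 * (648 / \<nu> * (Tm - t)) * (4 * 8\<^sup>2 * (4 * (pi * \<rho>)^3)) * (6 * E) = D * E / \<nu> * (Tm - t) * \<rho>^3"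
     by (simp add: D_def power_mult_distrib)
    also have "... = (D * E / \<nu> * \<kappa>) * ((Tm - t) * z)" unfolding \<rho>3 by simp
    also have "... = 1" using \<nu> D E t by (simp add: \<kappa>_def z_def)
    finally show ?thesis by simp
   qed
   obtain M where M: "nsq (%xi. egev th a xi * M xi) < \<infinity>" "!!xi. ennreal (norm (U t xi)) <= M xi"
    by (rule fsol_majorant[OF U[OF t(2)]]) (use t in auto)
   define N where "N = enn2real (nsq (%xi. egev th a xi * enorm (U t) xi))"
   have "nsq (%xi. egev th a xi * enorm (U t) xi) <= nsq (%xi. egev th a xi * M xi)"
    by (intro nsq_mono mult_left_mono M) auto
   then have Nle: "nsq (%xi. egev th a xi * enorm (U t) xi) <= ennreal N" using M(1) by (simp add: N_def)
   have N0: "N \<ge> 0" unfolding N_def by (rule enn2real_nonneg)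
   have "E * \<rho>^6 / (2 * C) * exp (a * (\<rho> / 2) powr th) <= N"
    by (rule gevrey_norm_lower_bound[OF measurable_slice[OF fsol_measurable[OF U[OF t(2)]]] a th(1) E en[OF t] \<rho>
       less_imp_le[OF cubic_weight_blowup[OF \<nu> th a W U t unb E en[OF t] \<rho> small]] C Nle N0])
   then have "1 / (2 * pi)^3 * (E * \<rho>^6 / (2 * C) * exp (a * (\<rho> / 2) powr th)) <= 1 / (2 * pi)^3 * N"
    by (intro mult_left_mono) auto
   moreover have "1 / (2 * pi)^3 * (E * \<rho>^6 / (2 * C) * exp (a * (\<rho> / 2) powr th)) = (K * z * exp (2 * a * c2 * z powr (th / 3)))^2"
   proof -
    have "(\<rho> / 2) powr th = 4 * c2 * z powr (th / 3)"
     using \<kappa> z by (simp add: \<rho>_def c2_def powr_mult powr_divide powr_powr)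
    then have e: "exp (a * (\<rho> / 2) powr th) = (exp (2 * a * c2 * z powr (th / 3)))^2"
     by (simp add: power2_eq_square exp_add[symmetric])
    have r: "\<rho>^6 = (\<kappa> * z)^2" unfolding \<rho>3[symmetric] by (simp add: power_mult[symmetric])
    have "(K * z * exp (2 * a * c2 * z powr (th / 3)))^2 = E / (2 * C * (2 * pi)^3) * (\<kappa> * z)^2 * (exp (2 * a * c2 * z powr (th / 3)))^2"
     using E C by (simp add: K_def power_mult_distrib)
    then show ?thesis unfolding e r by (simp add: mult_ac)
   qed
   ultimately have "(K * z * exp (2 * a * c2 * z powr (th / 3)))^2 <= 1 / (2 * pi)^3 * N" by simp
   then have lower: "K * z * exp (2 * a * c2 * z powr (th / 3)) <= sqrt (1 / (2 * pi)^3 * N)" by (rule real_le_rsqrt)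
   have zp: "1 / (Tm - t) powr r = z powr r" for r using t by (simp add: z_def powr_divide)
   have "K / C' / (Tm - t) powr p * exp (a * c2 / (Tm - t) powr (th / 3)) = K / C' * (1 / (Tm - t) powr p) * exp (a * c2 * (1 / (Tm - t) powr (th / 3)))"
    by simp
   also have "... = K / C' * z powr (1 + (p - 1)) * exp (a * c2 * z powr (th / 3))" unfolding zp by simp
   also have "z powr (1 + (p - 1)) = z * z powr (p - 1)" using z by (subst powr_add) simp
   also have "K / C' * (z * z powr (p - 1)) * exp (a * c2 * z powr (th / 3)) <= K / C' * (z * (C' * exp (a * c2 * z powr (th / 3)))) * exp (a * c2 * z powr (th / 3))"
    using K C' z by (intro mult_right_mono mult_left_mono C'(2)) auto
   also have "... = K * z * (exp (a * c2 * z powr (th / 3)) * exp (a * c2 * z powr (th / 3)))" using C' by simp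
   also have "... = K * z * exp (2 * a * c2 * z powr (th / 3))" by (simp add: exp_add[symmetric])
   also have "... <= sqrt (1 / (2 * pi)^3 * N)" by (rule lower)
   finally show "K / C' / (Tm - t) powr p * exp (a * c2 / (Tm - t) powr (th / 3))
    <= sqrt (1 / (2 * pi)^3 * enn2real (nsq (%xi. egev th a xi * enorm (U t) xi)))" by (simp add: N_def)
  qed
 qed
qed

section \<open>The Fourier transform of vector fields and the function spaces\<close>

definition vft :: "(real^3 => complex^3) => (real^3 => complex^3) => bool" where
 "vft f g \<longleftrightarrow> (\<forall>j. ft (%x. f x $ j) (%xi. g xi $ j))"

lemma vftD: "vft f g ==> ft (%x. f x $ j) (%xi. g xi $ j)"
 unfolding vft_def by (erule spec)

lemma vft_L2: assumes "vft f g" shows "f \<in> L2" "g \<in> L2"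
proof -
 show "f \<in> L2" unfolding L2_vec_iff[of f] by (rule allI, rule ft_L2(1)[OF vftD[OF assms]])
 show "g \<in> L2" unfolding L2_vec_iff[of g] by (rule allI, rule ft_L2(2)[OF vftD[OF assms]])
qed

lemma fourier_integral_nth:
 assumes "f \<in> L2"
 shows "fourier_integral (%x. indicator (cball 0 (real n)) x *\<^sub>R f x) xi $ j = fint (trunc n (%x. f x $ j)) xi"
proof -
 let ?h = "%x. exp (- (\<i> * cplx (x \<bullet> xi))) *s (indicator (cball 0 (real n)) x *\<^sub>R f x)"
 have nth: "?h x $ k = exp (- (\<i> * cplx (x \<bullet> xi))) * trunc n (%x. f x $ k) x" for x k
  by (simp add: trunc_def)
 have [measurable]: "f \<in> bmeas" using assms by (rule L2_measurable)
 have int: "integrable lborel (%x. ?h x $ k)" for k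
 proof (rule Bochner_Integration.integrable_bound[OF trunc_integrable])
  show "(%x. f x $ k) \<in> L2" using assms by (simp add: L2_vec_iff)
  show "(%x. ?h x $ k) \<in> borel_measurable lborel" unfolding nth by measurable
  show "AL x. norm (?h x $ k) <= norm (trunc n (%x. f x $ k) x)"
   unfolding nth norm_mult by simp
 qed
 have "integrable lborel ?h"
 proof (rule Bochner_Integration.integrable_bound)
  show "integrable lborel (%x. \<Sum>k\<in>UNIV. norm (?h x $ k))" using int by (intro Bochner_Integration.integrable_sum integrable_norm)
  show "?h \<in> borel_measurable lborel" using int by (simp add: borel_measurable_vec_iff[of ?h] integrable_iff_bounded)
  have "norm v <= norm (\<Sum>k\<in>UNIV. norm (v $ k))" for v :: "complex^3"
   unfolding norm_vec_def real_norm_def by (intro order_trans[OF L2_set_le_sum abs_ge_self]) simp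
  then show "AL x. norm (?h x) <= norm (\<Sum>k\<in>UNIV. norm (?h x $ k))" by (intro AE_I2)
 qed
 then have "(LI x. ?h x) $ j = (LI x. ?h x $ j)"
  by (rule integral_bounded_linear[OF bounded_linear_vec_nth, symmetric])
 then show ?thesis unfolding fourier_integral_def fint_def nth .
qed

text \<open>Norms of vectors are compared with those of the components, so that the scalar theory determines the vectorial choice in \<open>fourier\<close>.\<close>

lemma vft_iff_limit:
 assumes f: "f \<in> L2"
 shows "vft f g \<longleftrightarrow> g \<in> L2 & (%n::nat. (NI xi. ennreal ((norm
    (fourier_integral (%x. indicator (cball 0 (real n)) x *\<^sub>R f x) xi - g xi))^2))) ---> 0"
proof (cases "g \<in> L2")
 case True
 have m: "(%x. f x $ j) \<in> bmeas" "(%x. g x $ j) \<in> bmeas" for j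
  using L2_measurable[OF f] L2_measurable[OF True] by measurable
 let ?d = "%n j. sqnorm (%xi. fint (trunc n (%x. f x $ j)) xi - g xi $ j)"
 let ?D = "%n xi. fourier_integral (%x. indicator (cball 0 (real n)) x *\<^sub>R f x) xi - g xi"
 have eq: "(NI xi. ennreal ((norm (?D n xi))^2)) = (\<Sum>j\<in>UNIV. ?d n j)" for n
 proof -
  have nth: "?D n xi $ j = fint (trunc n (%x. f x $ j)) xi - g xi $ j" for xi j by (simp add: fourier_integral_nth[OF f])
  have Dm: "?D n \<in> bmeas" unfolding borel_measurable_vec_iff[of "?D n"] nth by (intro allI borel_measurable_diff fint_measurable trunc_measurable m)
  show ?thesis using sqnorm_vec[OF Dm] unfolding nth by (simp add: sqnorm_def)
 qed
 have "(%n. \<Sum>j\<in>UNIV. ?d n j) ---> 0 \<longleftrightarrow> (\<forall>j. (%n. ?d n j) ---> 0)"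
 proof
  assume l: "(%n. \<Sum>j\<in>UNIV. ?d n j) ---> 0"
  show "\<forall>j. (%n. ?d n j) ---> 0"
  proof
   fix j
   have "?d n j <= (\<Sum>j\<in>UNIV. ?d n j)" for n by (rule member_le_sum) auto
   then show "(%n. ?d n j) ---> 0" by (intro tendsto_sandwich[OF _ _ tendsto_const l]) auto
  qed
 next
  assume "\<forall>j. (%n. ?d n j) ---> 0"
  then have "(%n. \<Sum>j\<in>UNIV. ?d n j) ---> (\<Sum>j\<in>(UNIV::3 set). 0)" by (intro tendsto_sum) auto
  then show "(%n. \<Sum>j\<in>UNIV. ?d n j) ---> 0" by simp
 qed
 then show ?thesis unfolding eq vft_def ft_def using f True by (simp add: L2_vec_iff)
qed (auto dest: vft_L2(2))

lemma vft_fourier: assumes f: "f \<in> L2" shows "vft f (fourier f)"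
proof -
 have "\<forall>j. \<exists>g. ft (%x. f x $ j) g" using f by (auto simp: L2_vec_iff intro: ft_exists)
 then obtain g where "!!j. ft (%x. f x $ j) (g j)" by metis
 then have "vft f (%xi. \<chi> j. g j xi)" by (simp add: vft_def)
 moreover have "fourier f = (SOME g. vft f g)" unfolding fourier_def vft_iff_limit[OF f] ..
 ultimately show ?thesis by (simp only: someI[of "vft f"])
qed

lemma vft_unique:
 assumes "vft f g" "vft f h" shows "AL xi. g xi = h xi"
 unfolding vec_eq_iff AE_all_countable by (rule allI, rule ft_unique[OF vftD[OF assms(1)] vftD[OF assms(2)]])

lemma vft_fourier_eq:
 assumes "vft f g" shows "AL xi. fourier f xi = g xi"
 by (rule vft_unique[OF vft_fourier[OF vft_L2(1)[OF assms]] assms])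

lemma vft_cong_AE:
 assumes "vft f g" "AL x. f x = f' x" "AL xi. g xi = g' xi" "f' \<in> bmeas" "g' \<in> bmeas"
 shows "vft f' g'"
 unfolding vft_def
proof
 fix j
 have "ft (%x. f x $ j) (%xi. g xi $ j)" using assms(1) by (simp add: vft_def)
 moreover have "AL x. f x $ j = f' x $ j" using assms(2) by eventually_elim simp
 moreover have "AL x. g x $ j = g' x $ j" using assms(3) by eventually_elim simp
 moreover have "(%x. f' x $ j) \<in> bmeas" "(%x. g' x $ j) \<in> bmeas"
  by (rule borel_measurable_vec_nth[OF assms(4)], rule borel_measurable_vec_nth[OF assms(5)])
 ultimately show "ft (%x. f' x $ j) (%xi. g' xi $ j)" by (rule ft_cong_AE)
qed

lemma vft_surj: assumes "g \<in> L2" obtains f where "vft f g"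
proof -
 have "\<forall>j. \<exists>f. ft f (%x. g x $ j)" using assms by (auto simp: L2_vec_iff intro: ft_surj)
 then obtain f where "!!j. ft (f j) (%x. g x $ j)" by metis
 then have "vft (%x. \<chi> j. f j x) g" by (simp add: vft_def)
 then show ?thesis by (rule that)
qed

lemma vft_diff:
 assumes "vft f g" "vft f' g'" shows "vft (%x. f x - f' x) (%xi. g xi - g' xi)"
 unfolding vft_def vector_minus_component by (rule allI, rule ft_diff[OF vftD[OF assms(1)] vftD[OF assms(2)]])

lemma vft_inj:
 assumes "vft f g" "vft f' g" shows "AL x. f x = f' x"
 unfolding vec_eq_iff AE_all_countable by (rule allI, rule ft_inj[OF vftD[OF assms(1)] vftD[OF assms(2)]])

lemma vft_pairing:
 assumes "vft f g" "vft f' g'"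
 shows "(LI x. f x \<bullet> f' x) = 1 / (2 * pi)^3 * (LI xi. g xi \<bullet> g' xi)"
proof -
 have exp: "(LI x. h x \<bullet> k x) = (\<Sum>j\<in>UNIV. Re (LI x. h x $ j * cnj (k x $ j)))"
  if "h \<in> L2" "k \<in> L2" for h k :: "real^3 => complex^3"
 proof -
  have i: "integrable lborel (%x. h x $ j * cnj (k x $ j))" for j
   using that by (intro L2_mult_integrable L2_cnj) (auto simp: L2_vec_iff)
  have "(LI x. h x \<bullet> k x) = (LI x. (\<Sum>j\<in>UNIV. Re (h x $ j * cnj (k x $ j))))"
   by (simp add: inner_vec_def inner_complex_def)
  also have "... = (\<Sum>j\<in>UNIV. (LI x. Re (h x $ j * cnj (k x $ j))))"
   using i by (intro Bochner_Integration.integral_sum integrable_Re)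
  finally show ?thesis unfolding integral_bounded_linear[OF bounded_linear_Re i] .
 qed
 have c: "cplx (1 / (2 * pi)^3) * cplx ((2 * pi)^3) = 1" unfolding of_real_mult[symmetric] by simp
 have Re_of_real_mult: "Re (cplx r * z) = r * Re z" for r z by simp
 have "(LI x. f x $ j * cnj (f' x $ j)) = cplx (1 / (2 * pi)^3) * (LI xi. g xi $ j * cnj (g' xi $ j))" for j
  using ft_parseval[of "%x. f x $ j" "%x. g x $ j" "%x. f' x $ j" "%x. g' x $ j"] assms
  unfolding vft_def by (simp only: mult.assoc[symmetric] c) simp
 then show ?thesis unfolding exp[OF vft_L2(1)[OF assms(1)] vft_L2(1)[OF assms(2)]] exp[OF vft_L2(2)[OF assms(1)] vft_L2(2)[OF assms(2)]]
  by (simp only: Re_of_real_mult sum_distrib_left)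
qed

text \<open>A multiplier is determined almost everywhere by its symbol as soon as one candidate \<open>g\<close> exists.\<close>

lemma fourier_multiplier_vft:
 assumes f: "vft f F" and F: "F \<in> bmeas" and m: "vft g (%xi. m xi (F xi))"
 shows "vft (fourier_multiplier m f) (%xi. m xi (F xi))"
proof -
 have F: "AL xi. fourier f xi = F xi" by (rule vft_fourier_eq[OF f])
 have "is_fourier_multiplier m f g" unfolding is_fourier_multiplier_def
  using vft_L2(1)[OF m] vft_fourier_eq[OF m] F by (auto elim: eventually_elim2)
 then have "is_fourier_multiplier m f (fourier_multiplier m f)" unfolding fourier_multiplier_def by (rule someI[of "is_fourier_multiplier m f"])
 then have L: "fourier_multiplier m f \<in> L2" and "AL xi. fourier (fourier_multiplier m f) xi = m xi (fourier f xi)"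
  by (auto simp: is_fourier_multiplier_def)
 then have "AL xi. fourier (fourier_multiplier m f) xi = m xi (F xi)" using F by (auto elim: eventually_elim2)
 then show ?thesis
  by (rule vft_cong_AE[OF vft_fourier[OF L] AE_I2[OF refl]]) (use L vft_L2(2)[OF m] in \<open>auto simp: L2_iff\<close>)
qed

lemma weight_L2_iff_integrable:
 fixes V :: "real^3 => real" and F :: "real^3 => complex^3"
 assumes [measurable]: "V \<in> bmeas" "F \<in> bmeas" and V: "!!xi. V xi \<ge> 0"
 shows "integrable lborel (%xi. (V xi)^2 * (norm (F xi))^2) \<longleftrightarrow> nsq (%xi. ennreal (V xi) * enorm F xi) < \<infinity>"
  and "(LI xi. (V xi)^2 * (norm (F xi))^2) = enn2real (nsq (%xi. ennreal (V xi) * enorm F xi))"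
proof -
 have e: "nsq (%xi. ennreal (V xi) * enorm F xi) = (NI xi. ennreal ((V xi)^2 * (norm (F xi))^2))"
  unfolding nsq_def using V by (simp add: ennreal_mult[symmetric] ennreal_power power_mult_distrib)
 show "integrable lborel (%xi. (V xi)^2 * (norm (F xi))^2) \<longleftrightarrow> nsq (%xi. ennreal (V xi) * enorm F xi) < \<infinity>"
  unfolding e by (simp add: integrable_iff_bounded)
 show "(LI xi. (V xi)^2 * (norm (F xi))^2) = enn2real (nsq (%xi. ennreal (V xi) * enorm F xi))"
  unfolding e by (rule integral_eq_nn_integral) auto
qed

lemma sobolev_gev_density:
 assumes "G xi = gevrey_symbol a \<sigma> xi (F xi)"
 shows "(1 + (norm xi)^2) powr 1 * (norm (G xi))^2 = (gev (1 / \<sigma>) a xi)^2 * (norm (F xi))^2"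
proof -
 have "norm (G xi) = gw (1 / \<sigma>) a xi * norm (F xi)" unfolding assms gevrey_symbol_def gw_def[symmetric]
  by (simp add: norm_vec_def L2_set_def norm_mult power_mult_distrib sum_distrib_left[symmetric] real_sqrt_mult)
 moreover have "1 + (norm xi)^2 \<ge> 0" by simp
 ultimately show ?thesis by (simp add: gev_def power_mult_distrib)
qed

lemma gevrey_space_norm:
 assumes f: "vft f F" and F [measurable]: "F \<in> bmeas"
 shows "f \<in> gevrey_space a \<sigma> 1 \<longleftrightarrow> nsq (%xi. egev (1 / \<sigma>) a xi * enorm F xi) < \<infinity>"
  and "f \<in> gevrey_space a \<sigma> 1 ==> gevrey_norm a \<sigma> 1 f = sqrt (1 / (2 * pi)^3 * enn2real (nsq (%xi. egev (1 / \<sigma>) a xi * enorm F xi)))"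
proof -
 define G where "G xi = gevrey_symbol a \<sigma> xi (F xi)" for xi
 have Gm: "G \<in> bmeas" unfolding borel_measurable_vec_iff[of G] G_def gevrey_symbol_def by simp measurable
 have Fe: "AL xi. fourier f xi = F xi" by (rule vft_fourier_eq[OF f])
 have gF: "vft g G" if g: "is_fourier_multiplier (gevrey_symbol a \<sigma>) f g" for g
 proof (rule vft_cong_AE[OF vft_fourier AE_I2[OF refl]])
  show gL: "g \<in> L2" using g by (simp add: is_fourier_multiplier_def)
  then show "g \<in> bmeas" by (rule L2_measurable)
  show "AL xi. fourier g xi = G xi" using g Fe unfolding is_fourier_multiplier_def G_def by (auto elim: eventually_elim2)
 qed (rule Gm)
 have sob: "integrable lborel (%xi. (1 + (norm xi)^2) powr 1 * (norm (fourier g xi))^2) \<longleftrightarrow> nsq (%xi. egev (1 / \<sigma>) a xi * enorm F xi) < \<infinity>"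
  "(LI xi. (1 + (norm xi)^2) powr 1 * (norm (fourier g xi))^2) = enn2real (nsq (%xi. egev (1 / \<sigma>) a xi * enorm F xi))"
  if g: "vft g G" for g
 proof -
  have [measurable]: "fourier g \<in> bmeas" using vft_L2(2)[OF vft_fourier[OF vft_L2(1)[OF g]]] by (rule L2_measurable)
  have ae: "AL xi. (1 + (norm xi)^2) powr 1 * (norm (fourier g xi))^2 = (gev (1 / \<sigma>) a xi)^2 * (norm (F xi))^2"
   using vft_fourier_eq[OF g] by eventually_elim (rule sobolev_gev_density, simp add: G_def)
  show "integrable lborel (%xi. (1 + (norm xi)^2) powr 1 * (norm (fourier g xi))^2) \<longleftrightarrow> nsq (%xi. egev (1 / \<sigma>) a xi * enorm F xi) < \<infinity>"
   unfolding weight_L2_iff_integrable(1)[OF gev_measurable F gev_nonneg, symmetric] by (rule integrable_cong_AE[OF _ _ ae]) measurable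
  show "(LI xi. (1 + (norm xi)^2) powr 1 * (norm (fourier g xi))^2) = enn2real (nsq (%xi. egev (1 / \<sigma>) a xi * enorm F xi))"
   unfolding weight_L2_iff_integrable(2)[OF gev_measurable F gev_nonneg, symmetric] by (rule integral_cong_AE[OF _ _ ae]) measurable
 qed
 show iff: "f \<in> gevrey_space a \<sigma> 1 \<longleftrightarrow> nsq (%xi. egev (1 / \<sigma>) a xi * enorm F xi) < \<infinity>"
 proof
  assume "f \<in> gevrey_space a \<sigma> 1"
  then obtain g where "g \<in> sobolev_space 1" "is_fourier_multiplier (gevrey_symbol a \<sigma>) f g" by (auto simp: gevrey_space_def)
  then show "nsq (%xi. egev (1 / \<sigma>) a xi * enorm F xi) < \<infinity>" using sob(1)[OF gF] by (auto simp: sobolev_space_def)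
 next
  assume fin: "nsq (%xi. egev (1 / \<sigma>) a xi * enorm F xi) < \<infinity>"
  have "nsq (enorm G) <= nsq (%xi. egev (1 / \<sigma>) a xi * enorm F xi)"
  proof (rule nsq_mono)
   fix xi
   have "(norm (G xi))^2 <= (1 + (norm xi)^2) powr 1 * (norm (G xi))^2" using mult_right_mono[of 1 "1 + (norm xi)^2" "(norm (G xi))^2"] by simp
   also have "... = (gev (1 / \<sigma>) a xi * norm (F xi))^2" using sobolev_gev_density[of G xi a \<sigma> F] by (simp add: G_def power_mult_distrib)
   finally have "norm (G xi) <= gev (1 / \<sigma>) a xi * norm (F xi)" by (rule power2_le_imp_le) auto
   then show "enorm G xi <= egev (1 / \<sigma>) a xi * enorm F xi" by (subst ennreal_mult[symmetric]) (auto intro: ennreal_leI)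
  qed
  then have "G \<in> L2" using fin Gm by (auto simp: L2_iff nsq_enorm intro: le_less_trans)
  then obtain g where g: "vft g G" by (rule vft_surj)
  have "is_fourier_multiplier (gevrey_symbol a \<sigma>) f g" unfolding is_fourier_multiplier_def
   using vft_L2(1)[OF g] vft_fourier_eq[OF g] Fe by (auto simp: G_def elim: eventually_elim2)
  moreover have "g \<in> sobolev_space 1" using sob(1)[OF g] fin vft_L2(1)[OF g] by (simp add: sobolev_space_def)
  ultimately show "f \<in> gevrey_space a \<sigma> 1" using vft_L2(1)[OF f] by (auto simp: gevrey_space_def)
 qed
 assume "f \<in> gevrey_space a \<sigma> 1"
 then obtain g where "is_fourier_multiplier (gevrey_symbol a \<sigma>) f g" by (auto simp: gevrey_space_def)
 then have "is_fourier_multiplier (gevrey_symbol a \<sigma>) f (fourier_multiplier (gevrey_symbol a \<sigma>) f)"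
  unfolding fourier_multiplier_def by (rule someI[of "is_fourier_multiplier (gevrey_symbol a \<sigma>) f"])
 from sob(2)[OF gF[OF this]] show "gevrey_norm a \<sigma> 1 f = sqrt (1 / (2 * pi)^3 * enn2real (nsq (%xi. egev (1 / \<sigma>) a xi * enorm F xi)))"
  by (simp only: gevrey_norm_def sobolev_norm_def)
qed

section \<open>The mild formulation on the Fourier side\<close>

lemma has_L2_integral_unique:
 assumes "has_L2_integral h S w" "has_L2_integral h S w'"
 shows "AL x. w x = w' x"
proof -
 have L: "w \<in> L2" "w' \<in> L2" using assms by (auto simp: has_L2_integral_def)
 define d where "d x = w x - w' x" for x
 have d: "d \<in> L2" using L2_diff[OF L] by (simp add: d_def[abs_def])
 have "(LI x. w x \<bullet> d x) = (LI x. w' x \<bullet> d x)"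
  using assms d by (simp add: has_L2_integral_def)
 then have "(LI x. w x \<bullet> d x - w' x \<bullet> d x) = 0"
  using L2_inner_integrable[OF L(1) d] L2_inner_integrable[OF L(2) d] by simp
 then have "(LI x. (norm (d x))^2) = 0"
  by (simp add: d_def inner_diff_left[symmetric] power2_norm_eq_inner)
 then have "sqnorm d = 0" by (simp add: sqnorm_eq_integral[OF d])
 then show ?thesis using L2_measurable[OF d] by (simp add: sqnorm_eq_0_iff d_def)
qed

text \<open>By Parseval and Fubini the weak integral in time is computed pointwise in \<open>xi\<close>. Square integrability over time and frequency makes all pairings absolutely convergent.\<close>

lemma L2_integral_fourier:
 assumes N: "(%(tau, xi). N tau xi) \<in> bmeas2"
  and h: "!!tau. tau \<in> {0..t} ==> vft (h tau) (N tau)"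
  and fin: "(NI tau. indicator {0..t} tau * sqnorm (N tau)) < \<infinity>" and t: "t \<ge> 0"
 shows "\<exists>w. has_L2_integral h {0..t} w & vft w (%xi. (LI tau. indicator {0..t} tau *\<^sub>R N tau xi))"
proof -
 define G where "G tau xi = indicator {0..t} tau *\<^sub>R N tau xi" for tau xi
 have [measurable]: "(%p. N (fst p) (snd p)) \<in> borel_measurable ((borel :: real measure) \<Otimes>\<^sub>M (borel :: (real^3) measure))"
  using N by (simp add: split_beta')
 have G [measurable]: "(%p. G (fst p) (snd p)) \<in> borel_measurable ((borel :: real measure) \<Otimes>\<^sub>M (borel :: (real^3) measure))"
  unfolding G_def by measurable
 have [measurable]: "(%p. G (snd p) (fst p)) \<in> borel_measurable ((borel :: (real^3) measure) \<Otimes>\<^sub>M (borel :: real measure))"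
  using measurable_compose[OF _ G, of "%p. (snd p, fst p)"] by simp
 have [measurable]: "G tau \<in> bmeas" for tau using measurable_compose[OF _ G, of "%xi. (tau, xi)" borel] by simp
 have [measurable]: "(%tau. G tau xi) \<in> bmeas" for xi using measurable_compose[OF _ G, of "%tau. (tau, xi)" borel] by simp
 have sG: "sqnorm (G tau) = indicator {0..t} tau * sqnorm (N tau)" for tau
  by (cases "tau \<in> {0..t}") (auto simp: G_def[abs_def] sqnorm_def)
 define S where "S = (NI tau. sqnorm (G tau))"
 have S: "S < \<infinity>" unfolding S_def sG by (rule fin)
 have S': "S = (NI xi. NI tau. ennreal ((norm (G tau xi))^2))"
  unfolding S_def sqnorm_def by (rule lborel_pair.Fubini'[symmetric]) (simp add: split_beta', measurable)
 define D where "D xi = (LI tau. G tau xi)" for xi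
 have Dm: "D \<in> bmeas"
  unfolding D_def[abs_def] by (rule lborel.borel_measurable_lebesgue_integral) (simp add: split_beta', measurable)
 have Gint: "integrable lborel (%tau. G tau xi)" if "(NI tau. ennreal ((norm (G tau xi))^2)) < \<infinity>" for xi
 proof (rule integrableI_bounded)
  have "(NI tau. ennreal (norm (G tau xi))) <= (NI tau. indicator {0..t} tau + ennreal ((norm (G tau xi))^2))"
  proof (rule nn_integral_mono)
   fix tau
   have "z <= 1 + z\<^sup>2" for z :: real using zero_le_power2[of "z - 1/2"] by (simp add: power2_eq_square algebra_simps)
   then have "ennreal (norm (G tau xi)) <= ennreal (1 + (norm (G tau xi))^2)" by (intro ennreal_leI)
   then show "ennreal (norm (G tau xi)) <= indicator {0..t} tau + ennreal ((norm (G tau xi))^2)"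
    by (cases "tau \<in> {0..t}") (auto simp: ennreal_plus G_def)
  qed
  also have "... = (NI tau. indicator {0..t} tau) + (NI tau. ennreal ((norm (G tau xi))^2))" by (rule nn_integral_add) measurable
  also have "... < \<infinity>" using that t by (simp add: ennreal_add_less_top)
  finally show "(NI tau. ennreal (norm (G tau xi))) < \<infinity>" .
 qed measurable
 have "sqnorm D <= (NI xi. ennreal t * (NI tau. ennreal ((norm (G tau xi))^2)))"
  unfolding sqnorm_def
 proof (rule nn_integral_mono)
  fix xi
  have "ennreal (norm (D xi)) <= (NI tau. indicator {0..t} tau * ennreal (norm (G tau xi)))"
   unfolding D_def by (rule order_trans[OF ennreal_norm_integral_le]) (auto intro!: nn_integral_mono simp: G_def split: split_indicator)
  then have "(ennreal (norm (D xi)))^2 <= (NI tau. indicator {0..t} tau * ennreal (norm (G tau xi)))^2" by (intro power_mono) auto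
  also have "... <= (NI tau. (indicator {0..t} tau)^2) * (NI tau. (ennreal (norm (G tau xi)))^2)"
   by (rule Cauchy_Schwarz_nn_integral) measurable
  also have "(\<integral>\<^sup>+tau. (indicator {0..t} tau)^2 \<partial>(lborel :: real measure)) = (NI tau. indicator {0..t} tau)"
   by (intro nn_integral_cong) (auto split: split_indicator)
  also have "... = ennreal t" using t by simp
  finally show "ennreal ((norm (D xi))^2) <= ennreal t * (NI tau. ennreal ((norm (G tau xi))^2))" by (simp add: ennreal_power)
 qed
 also have "... = ennreal t * S" unfolding S' by (rule nn_integral_cmult) measurable
 also have "... < \<infinity>" using S by (simp add: ennreal_mult_less_top)
 finally have D: "D \<in> L2" using Dm by (simp add: L2_iff)
 then obtain w where w: "vft w D" by (rule vft_surj)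
 have "has_L2_integral h {0..t} w" unfolding has_L2_integral_def
 proof (intro conjI ballI)
  show "w \<in> L2" by (rule vft_L2(1)[OF w])
  show "h tau \<in> L2" if "tau \<in> {0..t}" for tau by (rule vft_L2(1)[OF h[OF that]])
  fix \<phi> :: "real^3 => complex^3" assume \<phi>: "\<phi> \<in> L2"
  define \<Phi> where "\<Phi> = fourier \<phi>"
  have v: "vft \<phi> \<Phi>" unfolding \<Phi>_def by (rule vft_fourier[OF \<phi>])
  have \<Phi>: "\<Phi> \<in> L2" by (rule vft_L2(2)[OF v])
  then have [measurable]: "\<Phi> \<in> bmeas" by (rule L2_measurable)
  have pair: "indicator {0..t} tau *\<^sub>R (LI x. h tau x \<bullet> \<phi> x) = 1 / (2 * pi)^3 * (LI xi. G tau xi \<bullet> \<Phi> xi)" for tau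
  proof (cases "tau \<in> {0..t}")
   case True
   then show ?thesis using vft_pairing[OF h[OF True] v] by (simp add: G_def)
  qed (simp add: G_def)
  have Pm: "(%(tau, xi). G tau xi \<bullet> \<Phi> xi) \<in> borel_measurable (lborel \<Otimes>\<^sub>M lborel)" by (simp add: split_beta')
  have fin2: "(NI tau. NI xi. ennreal (norm (G tau xi \<bullet> \<Phi> xi))) < \<infinity>"
  proof -
   have "(NI xi. ennreal (norm (G tau xi \<bullet> \<Phi> xi))) <= sqnorm (G tau) + indicator {0..t} tau * sqnorm \<Phi>" for tau
   proof (cases "tau \<in> {0..t}")
    case True
    have "(NI xi. ennreal (norm (G tau xi \<bullet> \<Phi> xi))) <= (NI xi. ennreal ((norm (G tau xi))^2) + ennreal ((norm (\<Phi> xi))^2))"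
    proof (rule nn_integral_mono)
     fix xi
     have "norm (G tau xi \<bullet> \<Phi> xi) <= norm (G tau xi) * norm (\<Phi> xi)" by (simp add: Cauchy_Schwarz_ineq2)
     also have "... <= (norm (G tau xi))^2 + (norm (\<Phi> xi))^2"
      using sum_squares_bound[of "norm (G tau xi)" "norm (\<Phi> xi)"] mult_nonneg_nonneg[OF norm_ge_zero norm_ge_zero, of "G tau xi" "\<Phi> xi"] by linarith
     finally show "ennreal (norm (G tau xi \<bullet> \<Phi> xi)) <= ennreal ((norm (G tau xi))^2) + ennreal ((norm (\<Phi> xi))^2)"
      using ennreal_leI by (fastforce simp: ennreal_plus[symmetric] simp del: ennreal_plus)
    qed
    also have "... = sqnorm (G tau) + sqnorm \<Phi>" unfolding sqnorm_def by (rule nn_integral_add) measurable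
    finally show ?thesis using True by simp
   qed (simp add: G_def)
   then have "(NI tau. NI xi. ennreal (norm (G tau xi \<bullet> \<Phi> xi))) <= (NI tau. sqnorm (G tau) + indicator {0..t} tau * sqnorm \<Phi>)"
    by (rule nn_integral_mono)
   also have "... = S + (\<integral>\<^sup>+tau. indicator {0..t} tau * sqnorm \<Phi> \<partial>(lborel :: real measure))"
    unfolding S_def by (rule nn_integral_add) (unfold sqnorm_def, measurable)
   also have "(\<integral>\<^sup>+tau. indicator {0..t} tau * sqnorm \<Phi> \<partial>(lborel :: real measure)) = ennreal t * sqnorm \<Phi>"
    using t by (subst nn_integral_multc) auto
   also have "S + ennreal t * sqnorm \<Phi> < \<infinity>" using S L2_sqnorm[OF \<Phi>] by (simp add: ennreal_mult_less_top ennreal_add_less_top)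
   finally show ?thesis .
  qed
  have int: "integrable lborel (%tau. (LI xi. G tau xi \<bullet> \<Phi> xi))"
  proof (rule integrableI_bounded)
   show "(%tau. (LI xi. G tau xi \<bullet> \<Phi> xi)) \<in> borel_measurable lborel"
    by (rule lborel.borel_measurable_lebesgue_integral) (use Pm in simp)
   show "(NI tau. ennreal (norm (LI xi. G tau xi \<bullet> \<Phi> xi))) < \<infinity>"
    by (rule le_less_trans[OF nn_integral_mono[OF ennreal_norm_integral_le] fin2])
  qed
  have "(LI tau. LI xi. G tau xi \<bullet> \<Phi> xi) = (LI xi. LI tau. G tau xi \<bullet> \<Phi> xi)"
   by (rule lborel_Fubini_swap[OF Pm fin2])
  also have "... = (LI xi. D xi \<bullet> \<Phi> xi)"
  proof (rule integral_cong_AE)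
   show "(%xi. (LI tau. G tau xi \<bullet> \<Phi> xi)) \<in> borel_measurable lborel"
    unfolding measurable_lborel1 by (rule lborel.borel_measurable_lebesgue_integral) (simp add: split_beta', measurable)
   show "(%xi. D xi \<bullet> \<Phi> xi) \<in> borel_measurable lborel" using Dm by measurable
   have "AL xi. (NI tau. ennreal ((norm (G tau xi))^2)) \<noteq> \<infinity>"
    by (rule nn_integral_PInf_AE) (use S in \<open>simp_all add: S'[symmetric]\<close>)
   then show "AL xi. (LI tau. G tau xi \<bullet> \<Phi> xi) = D xi \<bullet> \<Phi> xi"
    by eventually_elim (simp add: D_def Gint less_top)
  qed
  finally have swap: "(LI tau. LI xi. G tau xi \<bullet> \<Phi> xi) = (LI xi. D xi \<bullet> \<Phi> xi)" .
  show "set_integrable lborel {0..t} (%tau. (LI x. h tau x \<bullet> \<phi> x))"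
   unfolding set_integrable_def pair by (rule integrable_mult_right[OF int])
  have "(LBINT tau:{0..t}. (LI x. h tau x \<bullet> \<phi> x)) = 1 / (2 * pi)^3 * (LI xi. D xi \<bullet> \<Phi> xi)"
   unfolding set_lebesgue_integral_def pair swap[symmetric] by (rule integral_mult_right_zero)
  then show "(LBINT tau:{0..t}. (LI x. h tau x \<bullet> \<phi> x)) = (LI x. w x \<bullet> \<phi> x)"
   unfolding vft_pairing[OF w v] .
 qed
 then show ?thesis using w unfolding D_def[abs_def] G_def by blast
qed

text \<open>Approximation by functions that are constant in time on intervals of length \<open>1 / (n + 1)\<close>.\<close>

lemma caratheodory_measurable:
 fixes f :: "real => 'a => 'b::metric_space"
 assumes f: "!!tau. f tau \<in> borel_measurable M" and cont: "!!tau X x. X ---> tau ==> (%n. f (X n) x) ---> f tau x"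
 shows "(%(tau, x). f tau x) \<in> borel_measurable (borel \<Otimes>\<^sub>M M)"
proof -
 define r where "r n tau = of_int \<lfloor>real (Suc n) * tau\<rfloor> / real (Suc n)" for n and tau :: real
 have "(%n. r n tau) ---> tau" for tau
 proof (rule tendsto_sandwich[OF _ _ _ tendsto_const])
  have "(%n. tau - inverse (real (Suc n))) ---> tau - 0" by (intro tendsto_diff tendsto_const LIMSEQ_inverse_real_of_nat)
  then show "(%n. tau - inverse (real (Suc n))) ---> tau" by simp
  show "eventually (%n. tau - inverse (real (Suc n)) <= r n tau) sequentially"
  proof (intro always_eventually allI)
   fix n
   have "real (Suc n) * tau - 1 <= of_int \<lfloor>real (Suc n) * tau\<rfloor>" by linarith
   then have "(real (Suc n) * tau - 1) / real (Suc n) <= r n tau" unfolding r_def by (rule divide_right_mono) simp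
   then show "tau - inverse (real (Suc n)) <= r n tau" by (simp add: diff_divide_distrib inverse_eq_divide del: of_nat_Suc)
  qed
  show "eventually (%n. r n tau <= tau) sequentially"
   by (intro always_eventually allI) (simp add: r_def pos_divide_le_eq mult.commute del: of_nat_Suc)
 qed
 then have lim: "(%n. f (r n (fst p)) (snd p)) ---> f (fst p) (snd p)" for p by (rule cont)
 have "(%p. f (r n (fst p)) (snd p)) \<in> borel_measurable (borel \<Otimes>\<^sub>M M)" for n
  unfolding r_def
  by (rule measurable_compose_countable[where f = "%i p. f (of_int i / real (Suc n)) (snd p)"])
    (rule measurable_compose[OF measurable_snd f], rule measurable_compose[OF _ measurable_real_floor], measurable)
 then show ?thesis unfolding split_beta' by (rule borel_measurable_LIMSEQ_metric) (rule lim)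
qed

lemma sqnorm_heat_nonlin_le:
 assumes W: "conv_weight C W" and Wn: "!!xi. ennreal (norm xi) <= W xi" and s: "s \<ge> 0"
  and f: "!!x. ennreal (norm (f x)) <= F x" and [measurable]: "F \<in> bmeas"
 shows "sqnorm (%xi. exp (- s * (norm xi)^2) *\<^sub>R nonlin f f xi) <= 36\<^sup>2 * (ennreal C * (nsq (%xi. W xi * F xi))^2)"
proof -
 have [measurable]: "W \<in> bmeas" using W by (simp add: conv_weight_def)
 have "sqnorm (%xi. exp (- s * (norm xi)^2) *\<^sub>R nonlin f f xi) <= nsq (%xi. 36 * (W xi * nconv F F xi))"
  unfolding nsq_enorm[symmetric]
 proof (rule nsq_mono)
  fix xi
  have "exp (- s * (norm xi)^2) * norm (nonlin f f xi) <= norm (nonlin f f xi)" using s by (intro mult_left_le_one_le) auto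
  then have "ennreal (norm (exp (- s * (norm xi)^2) *\<^sub>R nonlin f f xi)) <= ennreal (norm (nonlin f f xi))" by (intro ennreal_leI) simp
  also have "... <= 36 * (ennreal (norm xi) * nconv F F xi)" by (rule norm_nonlin_le[OF f f])
  also have "... <= 36 * (W xi * nconv F F xi)" by (intro mult_left_mono mult_right_mono Wn) auto
  finally show "ennreal (norm (exp (- s * (norm xi)^2) *\<^sub>R nonlin f f xi)) <= 36 * (W xi * nconv F F xi)" .
 qed
 also have "... = 36\<^sup>2 * nsq (%xi. W xi * nconv F F xi)" by (rule nsq_cmult) measurable
 also have "... <= 36\<^sup>2 * (ennreal C * (nsq (%xi. W xi * F xi))^2)"
  using W by (intro mult_left_mono) (auto simp: conv_weight_def)
 finally show ?thesis .
qed

lemma heat_symbol_scaleR: "heat_symbol s xi v = exp (- s * (norm xi)^2) *\<^sub>R v"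
 unfolding heat_symbol_def vec_eq_iff vector_scaleR_component by (simp add: scaleR_conv_of_real)

lemma heat_vft:
 assumes f: "vft f F" and s: "s \<ge> 0"
 shows "vft (heat s f) (%xi. exp (- s * (norm xi)^2) *\<^sub>R F xi)"
proof -
 have F: "F \<in> L2" by (rule vft_L2(2)[OF f])
 then have [measurable]: "F \<in> bmeas" by (rule L2_measurable)
 have "(%xi. heat_symbol s xi (F xi)) \<in> L2"
  unfolding heat_symbol_scaleR by (rule L2_bound[OF F, of _ 1]) (use s in \<open>auto intro!: mult_left_le_one_le\<close>)
 then obtain g where "vft g (%xi. heat_symbol s xi (F xi))" by (rule vft_surj)
 from fourier_multiplier_vft[where m = "heat_symbol s", OF f _ this] show ?thesis unfolding heat_symbol_scaleR by simp
qed

text \<open>Chains the three operators: tensor divergence, Leray projection and heat semigroup are, in this order, a convolution and two multiplications.\<close>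

lemma mild_integrand_vft:
 assumes W: "conv_weight C W" and Wn: "!!xi. ennreal (norm xi) <= W xi" and s: "s \<ge> 0"
  and u: "vft (cvec \<circ> u) U" and fin: "nsq (%xi. W xi * enorm U xi) < \<infinity>"
 shows "vft (heat s (leray (cvec \<circ> div_tensor u u))) (%xi. exp (- s * (norm xi)^2) *\<^sub>R nonlin U U xi)"
proof -
 have [measurable]: "W \<in> bmeas" using W by (simp add: conv_weight_def)
 have [measurable]: "U \<in> bmeas" by (rule L2_measurable[OF vft_L2(2)[OF u]])
 define T where "T k xi = (\<Sum>j\<in>UNIV. \<i> * cplx (xi $ j) * (cplx (1 / (2 * pi)^3) * conv (%x. U x $ j) (%x. U x $ k) xi))" for k xi
 have [measurable]: "T k \<in> bmeas" for k unfolding T_def[abs_def] by measurable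
 have un: "ft (%x. cplx (u x $ j)) (%x. U x $ j)" for j using vftD[OF u, of j] by (simp add: cvec_def)
 have int: "integrable lborel (%x. U x $ j)" for j
 proof (rule integrableI_bounded)
  obtain L :: real where "!!F. F \<in> bmeas ==> (NI xi. F xi)^2 <= ennreal L * nsq (%xi. W xi * F xi)"
   using W by (auto simp: conv_weight_def)
  then have "(NI xi. enorm U xi)^2 <= ennreal L * nsq (%xi. W xi * enorm U xi)" by simp
  also have "... < \<infinity>" using fin by (simp add: ennreal_mult_less_top)
  finally have "(NI xi. enorm U xi) < \<infinity>" by (simp add: power_less_top_ennreal)
  then show "(NI x. ennreal (norm (U x $ j))) < \<infinity>"
   by (rule le_less_trans[rotated]) (intro nn_integral_mono ennreal_leI Finite_Cartesian_Product.norm_nth_le)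
 qed measurable
 have T: "T k \<in> L2" for k
 proof -
  let ?n = "nconv (enorm U) (enorm U)"
  have pi1: "1 / (2 * pi)^3 <= 1"
  proof -
   have "1 <= (2 * pi)^3" using pi_gt3 by (intro one_le_power) auto
   moreover have "1 / X <= 1" if "1 <= X" for X :: real using that by simp
   ultimately show ?thesis by blast
  qed
  have "sqnorm (T k) <= nsq (%xi. 3 * (W xi * ?n xi))"
   unfolding nsq_enorm[symmetric]
  proof (rule nsq_mono)
   fix xi
   have c: "ennreal (norm (conv (%x. U x $ j) (%x. U x $ k) xi)) <= ?n xi" for j
    by (intro norm_conv_le ennreal_leI Finite_Cartesian_Product.norm_nth_le)
   have tm: "ennreal (norm (\<i> * cplx (xi $ j) * (cplx (1 / (2 * pi)^3) * conv (%x. U x $ j) (%x. U x $ k) xi))) <= W xi * ?n xi" for j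
   proof -
    have pi0: "0 <= 1 / (2 * pi)^3" by simp
    have "norm (\<i> * cplx (xi $ j) * (cplx (1 / (2 * pi)^3) * conv (%x. U x $ j) (%x. U x $ k) xi))
     = \<bar>xi $ j\<bar> * (1 / (2 * pi)^3 * norm (conv (%x. U x $ j) (%x. U x $ k) xi))"
     by (simp only: norm_mult norm_of_real norm_ii mult_1 abs_of_nonneg[OF pi0])
    also have "... <= norm xi * (1 * norm (conv (%x. U x $ j) (%x. U x $ k) xi))"
     by (intro mult_mono component_le_norm_cart pi1 mult_nonneg_nonneg order_refl) auto
    finally have "ennreal (norm (\<i> * cplx (xi $ j) * (cplx (1 / (2 * pi)^3) * conv (%x. U x $ j) (%x. U x $ k) xi)))
     <= ennreal (norm xi * norm (conv (%x. U x $ j) (%x. U x $ k) xi))" by (intro ennreal_leI) simp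
    also have "... = ennreal (norm xi) * ennreal (norm (conv (%x. U x $ j) (%x. U x $ k) xi))" by (rule ennreal_mult) auto
    also have "... <= W xi * ?n xi" by (intro mult_mono Wn c) auto
    finally show ?thesis .
   qed
   have "ennreal (norm (T k xi)) <= (\<Sum>j\<in>(UNIV::3 set). W xi * ?n xi)"
    unfolding T_def by (rule order_trans[OF ennreal_leI[OF norm_sum]]) (subst sum_ennreal[symmetric], simp, rule sum_mono, rule tm)
   then show "ennreal (norm (T k xi)) <= 3 * (W xi * ?n xi)" by simp
  qed
  also have "... = 3\<^sup>2 * nsq (%xi. W xi * ?n xi)" by (rule nsq_cmult) measurable
  also have "... <= 3\<^sup>2 * (ennreal C * (nsq (%xi. W xi * enorm U xi))^2)" using W by (intro mult_left_mono) (auto simp: conv_weight_def)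
  also have "... < \<infinity>" using fin by (simp add: ennreal_mult_less_top power_less_top_ennreal)
  finally show ?thesis by (simp add: L2_iff)
 qed
 have "vft (cvec \<circ> div_tensor u u) (%xi. \<chi> k. T k xi)"
  unfolding vft_def using div_tensor_fourier(1)[OF un int T[unfolded T_def[abs_def]]] by (simp add: cvec_def T_def)
 moreover have Tm: "(%xi. (\<chi> k. T k xi) :: complex^3) \<in> bmeas" by (simp add: borel_measurable_vec_iff)
 moreover have nl: "leray_symbol xi (\<chi> k. T k xi) = nonlin U U xi" for xi by (simp add: nonlin_def T_def)
 moreover obtain g where "vft g (%xi. leray_symbol xi (\<chi> k. T k xi))"
 proof (rule vft_surj)
  have TL: "(%xi. (\<chi> k. T k xi) :: complex^3) \<in> L2" using T by (simp add: L2_vec_iff)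
  show "(%xi. leray_symbol xi (\<chi> k. T k xi)) \<in> L2"
   by (rule L2_bound[OF TL, of _ 4]) (auto intro!: norm_leray_le leray_measurable Tm)
 qed
 ultimately have "vft (leray (cvec \<circ> div_tensor u u)) (nonlin U U)"
  using fourier_multiplier_vft[of "cvec \<circ> div_tensor u u" "%xi. \<chi> k. T k xi" g leray_symbol] by simp
 from heat_vft[OF this s] show ?thesis .
qed

lemma cvec_diff: "cvec \<circ> (%x. f x - g x) = (%x. (cvec \<circ> f) x - (cvec \<circ> g) x)"
 by (auto simp: cvec_def vec_eq_iff)

section \<open>Continuity in the Gevrey norm and mild solutions\<close>

lemma gevrey_continuous_iff:
 assumes V: "!!t. t \<in> I ==> vft (cvec \<circ> u t) (V t)"
 shows "gevrey_continuous_on a \<sigma> 1 I u \<longleftrightarrow> (\<forall>t\<in>I. nsq (%xi. egev (1 / \<sigma>) a xi * enorm (V t) xi) < \<infinity>) &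
  (\<forall>X. \<forall>t\<in>I. (\<forall>n. X n \<in> I) & X ---> t --> (%n. nsq (%xi. egev (1 / \<sigma>) a xi * ennreal (norm (V (X n) xi - V t xi)))) ---> 0)"
proof -
 have Vm: "V t \<in> bmeas" if "t \<in> I" for t by (rule L2_measurable[OF vft_L2(2)[OF V[OF that]]])
 let ?g = "%t r. gevrey_norm a \<sigma> 1 (cvec \<circ> (%x. u r x - u t x))"
 let ?d = "%t r. nsq (%xi. egev (1 / \<sigma>) a xi * ennreal (norm (V r xi - V t xi)))"
 have sp: "cvec \<circ> u t \<in> gevrey_space a \<sigma> 1 \<longleftrightarrow> nsq (%xi. egev (1 / \<sigma>) a xi * enorm (V t) xi) < \<infinity>" if t: "t \<in> I" for t
  by (rule gevrey_space_norm(1)[OF V[OF t] Vm[OF t]])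
 have "(?g t \<longlongrightarrow> 0) (at t within I) \<longleftrightarrow> (\<forall>X. (\<forall>n. X n \<in> I) & X ---> t --> (%n. ?d t (X n)) ---> 0)"
  if fin: "\<forall>t\<in>I. nsq (%xi. egev (1 / \<sigma>) a xi * enorm (V t) xi) < \<infinity>" and t: "t \<in> I" for t
 proof -
  have g: "?d t r < \<infinity>" "?g t r = sqrt (1 / (2 * pi)^3 * enn2real (?d t r))" if r: "r \<in> I" for r
  proof -
   note [measurable] = Vm[OF t] Vm[OF r]
   have "?d t r <= nsq (%xi. egev (1 / \<sigma>) a xi * enorm (V r) xi + egev (1 / \<sigma>) a xi * enorm (V t) xi)"
    unfolding distrib_left[symmetric]
    by (intro nsq_mono mult_left_mono) (auto simp: ennreal_plus[symmetric] norm_triangle_ineq4 simp del: ennreal_plus intro!: ennreal_leI)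
   also have "... <= 2 * nsq (%xi. egev (1 / \<sigma>) a xi * enorm (V r) xi) + 2 * nsq (%xi. egev (1 / \<sigma>) a xi * enorm (V t) xi)"
    by (rule nsq_add_le) measurable
   also have "... < \<infinity>" using fin t r by (simp add: ennreal_mult_less_top ennreal_add_less_top)
   finally show d: "?d t r < \<infinity>" .
   have v: "vft (cvec \<circ> (%x. u r x - u t x)) (%xi. V r xi - V t xi)" unfolding cvec_diff by (rule vft_diff[OF V[OF r] V[OF t]])
   have m: "(%xi. V r xi - V t xi) \<in> bmeas" by measurable
   show "?g t r = sqrt (1 / (2 * pi)^3 * enn2real (?d t r))"
    by (rule gevrey_space_norm(2)[OF v m]) (use gevrey_space_norm(1)[OF v m] d in blast)
  qed
  have gt: "?g t t = 0" unfolding g(2)[OF t] by (simp add: nsq_def)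
  have seq: "(%n. ?g t (X n)) ---> 0 \<longleftrightarrow> (%n. ?d t (X n)) ---> 0" if X: "\<forall>n. X n \<in> I" for X
  proof
   assume "(%n. ?d t (X n)) ---> 0"
   from tendsto_enn2real[OF this[folded ennreal_0]] have "(%n. sqrt (1 / (2 * pi)^3 * enn2real (?d t (X n)))) ---> sqrt (1 / (2 * pi)^3 * 0)"
    by (intro tendsto_real_sqrt tendsto_mult tendsto_const) simp
   then show "(%n. ?g t (X n)) ---> 0" using g(2) X by simp
  next
   assume l: "(%n. ?g t (X n)) ---> 0"
   have "?d t (X n) = ennreal ((2 * pi)^3 * (?g t (X n))^2)" for n
   proof -
    have p: "(2 * pi)^3 * (1 / (2 * pi)^3 * r) = r" for r by simp
    have "(?g t (X n))^2 = 1 / (2 * pi)^3 * enn2real (?d t (X n))" unfolding g(2)[OF spec[OF X]] by (rule real_sqrt_pow2) simp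
    then have "(2 * pi)^3 * (?g t (X n))^2 = enn2real (?d t (X n))" by (simp only: p)
    then show ?thesis using g(1)[OF spec[OF X]] by simp
   qed
   moreover have "(%n. ennreal ((2 * pi)^3 * (?g t (X n))^2)) ---> ennreal ((2 * pi)^3 * 0\<^sup>2)"
    by (intro tendsto_ennrealI tendsto_mult tendsto_const tendsto_power l)
   ultimately show "(%n. ?d t (X n)) ---> 0" by simp
  qed
  have "(?g t \<longlongrightarrow> 0) (at t within I) \<longleftrightarrow> continuous (at t within I) (?g t)" unfolding continuous_within gt ..
  also have "... \<longleftrightarrow> (\<forall>X. (\<forall>n. X n \<in> I) & X ---> t --> (%n. ?g t (X n)) ---> 0)"
   by (simp only: continuous_within_sequentially gt o_def[of "?g t"])
  finally show ?thesis using seq by blast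
 qed
 then show ?thesis unfolding gevrey_continuous_on_def using sp by blast
qed

text \<open>Compactness of the time interval, in sequential form since the norm is not at hand as a metric.\<close>

lemma gevrey_continuous_bounded:
 assumes c: "gevrey_continuous_on a \<sigma> 1 {0..T} u" and V: "!!t. t \<in> {0..T} ==> vft (cvec \<circ> u t) (V t)"
 shows "\<exists>K::real. \<forall>t\<in>{0..T}. nsq (%xi. egev (1 / \<sigma>) a xi * enorm (V t) xi) <= ennreal K"
proof (rule ccontr)
 let ?y = "%t. nsq (%xi. egev (1 / \<sigma>) a xi * enorm (V t) xi)"
 let ?d = "%t r. nsq (%xi. egev (1 / \<sigma>) a xi * ennreal (norm (V r xi - V t xi)))"
 assume "\<not> ?thesis"
 then have "\<forall>n::nat. \<exists>t. t \<in> {0..T} & \<not> ?y t <= ennreal (real n)" by blast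
 then obtain X where X: "!!n. X n \<in> {0..T}" "!!n. \<not> ?y (X n) <= ennreal (real n)" by metis
 obtain l r where l: "l \<in> {0..T}" "strict_mono r" "(X \<circ> r) ---> l"
  using compact_Icc[unfolded compact_def, rule_format, of X 0 T] X(1) by auto
 note c' = iffD1[OF gevrey_continuous_iff[where u = u and V = V and I = "{0..T}", OF V] c]
 have fin: "?y l < \<infinity>" using c' l(1) by blast
 have "(\<forall>n. (X \<circ> r) n \<in> {0..T}) & (X \<circ> r) ---> l" using l(3) X(1) by simp
 then have "(%n. ?d l ((X \<circ> r) n)) ---> 0" using conjunct2[OF c'] l(1) by blast
 then have "eventually (%n. ?d l ((X \<circ> r) n) < 1) sequentially" by (intro order_tendstoD(2)) auto
 then obtain N where N: "!!n. n \<ge> N ==> ?d l (X (r n)) < 1" by (auto simp: eventually_sequentially)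
 define b where "b = 2 + 2 * enn2real (?y l)"
 define n where "n = max N (nat \<lceil>b\<rceil>)"
 have [measurable]: "V t \<in> bmeas" if "t \<in> {0..T}" for t by (rule L2_measurable[OF vft_L2(2)[OF V[OF that]]])
 note [measurable] = this[OF l(1)] this[OF X(1)]
 have "?y (X (r n)) <= nsq (%xi. egev (1 / \<sigma>) a xi * ennreal (norm (V (X (r n)) xi - V l xi)) + egev (1 / \<sigma>) a xi * enorm (V l) xi)"
  unfolding distrib_left[symmetric]
 proof (intro nsq_mono mult_left_mono)
  fix xi
  have "norm (V (X (r n)) xi) <= norm (V (X (r n)) xi - V l xi) + norm (V l xi)" using norm_triangle_sub[of "V (X (r n)) xi" "V l xi"] by simp
  from ennreal_leI[OF this] show "enorm (V (X (r n))) xi <= ennreal (norm (V (X (r n)) xi - V l xi)) + enorm (V l) xi" by simp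
 qed auto
 also have "... <= 2 * ?d l (X (r n)) + 2 * ?y l" by (rule nsq_add_le) measurable
 also have "... <= 2 * 1 + 2 * ?y l" using N[of n] by (intro add_right_mono mult_left_mono) (auto simp: n_def)
 also have "... = ennreal b" using fin by (simp add: b_def ennreal_mult)
 also have "... <= ennreal (real (r n))"
 proof (rule ennreal_leI)
  have "b <= real n" unfolding n_def by linarith
  also have "... <= real (r n)" using seq_suble[OF l(2)] by simp
  finally show "b <= real (r n)" .
 qed
 finally show False using X(2) by blast
qed

lemma fsol_mild:
 assumes \<nu>: "\<nu> > 0" and W: "conv_weight C W" and Wn: "!!xi. ennreal (norm xi) <= W xi" and U: "fsol \<nu> W A T U" and T: "T \<ge> 0"
  and u: "!!t. t \<in> {0..T} ==> vft (cvec \<circ> u t) (U t)" and u0: "vft (cvec \<circ> u0) A"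
 shows "\<exists>w. has_L2_integral (%tau. heat (\<nu> * (T - tau)) (leray (cvec \<circ> div_tensor (u tau) (u tau)))) {0..T} w &
    (AL x. cvec (u T x) = heat (\<nu> * T) (cvec \<circ> u0) x - w x)"
proof -
 obtain M where Mm [measurable]: "M \<in> bmeas" and fin: "nsq (%xi. W xi * M xi) < \<infinity>"
  and M: "!!t xi. t \<in> {0..T} ==> ennreal (norm (U t xi)) <= M xi" using fsol_majorant[OF U] by blast
 define N where "N tau xi = exp (- (\<nu> * (T - tau)) * (norm xi)^2) *\<^sub>R nonlin (U tau) (U tau) xi" for tau xi
 have "\<exists>w. has_L2_integral (%tau. heat (\<nu> * (T - tau)) (leray (cvec \<circ> div_tensor (u tau) (u tau)))) {0..T} w &
  vft w (%xi. (LI tau. indicator {0..T} tau *\<^sub>R N tau xi))"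
 proof (rule L2_integral_fourier[OF _ _ _ T])
  have "(%p. nonlin (U (fst p)) (U (fst p)) (snd p)) \<in> bmeas2"
   using nonlin_measurable[OF fsol_measurable[OF U] fsol_measurable[OF U]] by (simp add: split_beta')
  then show "(%(tau, xi). N tau xi) \<in> bmeas2" unfolding N_def split_beta' by measurable
  show "vft (heat (\<nu> * (T - tau)) (leray (cvec \<circ> div_tensor (u tau) (u tau)))) (N tau)" if tau: "tau \<in> {0..T}" for tau
   unfolding N_def
  proof (rule mild_integrand_vft[OF W Wn _ u[OF tau]])
   show "nsq (%xi. W xi * enorm (U tau) xi) < \<infinity>"
    by (rule le_less_trans[OF nsq_mono fin]) (intro mult_left_mono M tau, simp)
  qed (use \<nu> tau in simp)
  let ?B = "36\<^sup>2 * (ennreal C * (nsq (%xi. W xi * M xi))^2)"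
  have "indicator {0..T} tau * sqnorm (N tau) <= ?B * indicator {0..T} tau" for tau
  proof (cases "tau \<in> {0..T}")
   case True
   then have "sqnorm (N tau) <= ?B" unfolding N_def using \<nu> M by (intro sqnorm_heat_nonlin_le[OF W Wn]) auto
   then show ?thesis using True by simp
  qed simp
  then have "(NI tau. indicator {0..T} tau * sqnorm (N tau)) <= (NI tau. ?B * indicator {0..T} tau)" by (rule nn_integral_mono)
  also have "... = ?B * ennreal T" using T by (subst nn_integral_cmult) auto
  also have "... < \<infinity>" using fin by (simp add: ennreal_mult_less_top power_less_top_ennreal)
  finally show "(NI tau. indicator {0..T} tau * sqnorm (N tau)) < \<infinity>" .
 qed
 then obtain w where w: "has_L2_integral (%tau. heat (\<nu> * (T - tau)) (leray (cvec \<circ> div_tensor (u tau) (u tau)))) {0..T} w"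
  "vft w (%xi. (LI tau. indicator {0..T} tau *\<^sub>R N tau xi))" by blast
 have "(LI tau. indicator {0..T} tau *\<^sub>R N tau xi) = duh \<nu> 0 U U T xi" for xi
  unfolding duh_def N_def by (intro Bochner_Integration.integral_cong) (auto split: split_indicator)
 then have w2: "vft w (duh \<nu> 0 U U T)" using w(2) by simp
 have v: "vft (%x. heat (\<nu> * T) (cvec \<circ> u0) x - w x) (%xi. exp (- (\<nu> * T) * (norm xi)^2) *\<^sub>R A xi - duh \<nu> 0 U U T xi)"
  using \<nu> T by (intro vft_diff heat_vft[OF u0] w2) simp
 have "vft (%x. heat (\<nu> * T) (cvec \<circ> u0) x - w x) (U T)"
 proof (rule vft_cong_AE[OF v AE_I2[OF refl]])
  show "AL xi. exp (- (\<nu> * T) * (norm xi)^2) *\<^sub>R A xi - duh \<nu> 0 U U T xi = U T xi"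
   using fsol_eq[OF U] by eventually_elim (use T in simp)
 qed (use L2_measurable[OF vft_L2(1)[OF v]] measurable_slice[OF fsol_measurable[OF U]] in auto)
 from vft_inj[OF u this] T show ?thesis using w(1) by (intro exI[of _ w]) (simp add: comp_def)
qed

lemma nonlin_continuous_L2:
 assumes f: "!!n. f n \<in> L2" and g: "g \<in> L2" and K: "!!n. sqnorm (f n) <= ennreal K" and lim: "(%n. sqnorm (%xi. f n xi - g xi)) ---> 0"
 shows "(%n. nonlin (f n) (f n) xi) ---> nonlin g g xi"
proof -
 have [measurable]: "f n \<in> bmeas" "g \<in> bmeas" for n using f g by (auto simp: L2_iff)
 define d where "d n x = f n x - g x" for n x
 have [measurable]: "d n \<in> bmeas" for n unfolding d_def[abs_def] by measurable
 define c where "c = 36 * ennreal (norm xi)"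
 define B where "B = 2 * (c\<^sup>2 * (ennreal K + sqnorm g))"
 have B: "B < \<infinity>" using L2_sqnorm[OF g] by (simp add: B_def c_def ennreal_mult_less_top power_less_top_ennreal ennreal_add_less_top)
 have le: "ennreal ((norm (nonlin (f n) (f n) xi - nonlin g g xi))^2) <= B * sqnorm (d n)" for n
 proof -
  let ?x = "c * nconv (enorm (d n)) (enorm (f n)) xi" and ?y = "c * nconv (enorm g) (enorm (d n)) xi"
  have n1: "ennreal (norm (nonlin (d n) (f n) xi)) <= ?x" "ennreal (norm (nonlin g (d n) xi)) <= ?y"
   unfolding c_def mult.assoc by (rule norm_nonlin_le; simp)+
  have "norm (nonlin (f n) (f n) xi - nonlin g g xi) <= norm (nonlin (d n) (f n) xi) + norm (nonlin g (d n) xi)"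
   unfolding nonlin_diff[OF f g] d_def by (rule norm_triangle_ineq)
  from ennreal_leI[OF this] have "ennreal (norm (nonlin (f n) (f n) xi - nonlin g g xi)) <= ennreal (norm (nonlin (d n) (f n) xi)) + ennreal (norm (nonlin g (d n) xi))" by simp
  also have "... <= ?x + ?y" by (rule add_mono[OF n1])
  finally have "(ennreal (norm (nonlin (f n) (f n) xi - nonlin g g xi)))^2 <= (?x + ?y)^2" by (intro power_mono) auto
  also have "... <= 2 * ?x\<^sup>2 + 2 * ?y\<^sup>2" by (rule ennreal_sq_add_le)
  also have "... <= 2 * (c\<^sup>2 * (sqnorm (d n) * ennreal K)) + 2 * (c\<^sup>2 * (sqnorm g * sqnorm (d n)))"
  proof -
   have "(nconv (enorm (d n)) (enorm (f n)) xi)^2 <= nsq (enorm (d n)) * nsq (enorm (f n))" by (rule nconv_le_nsq) measurable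
   also have "... <= sqnorm (d n) * ennreal K" unfolding nsq_enorm by (intro mult_left_mono K) auto
   finally have 1: "(nconv (enorm (d n)) (enorm (f n)) xi)^2 <= sqnorm (d n) * ennreal K" .
   have "(nconv (enorm g) (enorm (d n)) xi)^2 <= nsq (enorm g) * nsq (enorm (d n))" by (rule nconv_le_nsq) measurable
   then have 2: "(nconv (enorm g) (enorm (d n)) xi)^2 <= sqnorm g * sqnorm (d n)" unfolding nsq_enorm .
   show ?thesis unfolding power_mult_distrib by (intro add_mono mult_left_mono 1 2) auto
  qed
  also have "... = B * sqnorm (d n)" by (simp add: B_def distrib_left distrib_right mult_ac)
  finally show ?thesis by (simp add: ennreal_power)
 qed
 have "(%n. B * sqnorm (d n)) ---> B * 0"
  by (rule tendsto_mult_ennreal[OF tendsto_const]) (use lim B in \<open>auto simp: d_def[abs_def]\<close>)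
 then have B0: "(%n. B * sqnorm (d n)) ---> 0" by simp
 have "(%n. ennreal ((norm (nonlin (f n) (f n) xi - nonlin g g xi))^2)) ---> 0"
  by (rule tendsto_sandwich[OF always_eventually[OF allI[OF zero_le]] always_eventually[OF allI[OF le]] tendsto_const B0])
 from tendsto_enn2real[OF this[folded ennreal_0]] have "(%n. (norm (nonlin (f n) (f n) xi - nonlin g g xi))^2) ---> 0" by simp
 then have "(%n. sqrt ((norm (nonlin (f n) (f n) xi - nonlin g g xi))^2)) ---> sqrt 0" by (rule tendsto_real_sqrt)
 then have "(%n. norm (nonlin (f n) (f n) xi - nonlin g g xi)) ---> 0" by (simp only: real_sqrt_pow2_iff real_sqrt_abs abs_norm_cancel real_sqrt_zero)
 then show ?thesis by (rule LIM_zero_cancel[OF tendsto_norm_zero_cancel])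
qed

text \<open>An arbitrary continuous solution has transforms \<open>V t\<close> chosen at each time separately, hence without joint measurability. The nonlinearity, however, is continuous in time at each \<open>xi\<close>, so that Duhamel's formula defines a jointly measurable version. Its majorant comes from Cauchy-Schwarz in time.\<close>

lemma mild_fsol:
 assumes \<nu>: "\<nu> > 0" and W: "conv_weight C W" and Wn: "!!xi. ennreal (norm xi) <= W xi" and T: "T \<ge> 0"
  and u0: "vft (cvec \<circ> u0) A" and AW: "nsq (%xi. W xi * enorm A xi) < \<infinity>"
  and V: "!!t. t \<in> {0..T} ==> vft (cvec \<circ> u t) (V t)" and K: "!!t. t \<in> {0..T} ==> nsq (%xi. W xi * enorm (V t) xi) <= ennreal K"
  and cont: "!!X t. (!!n. X n \<in> {0..T}) ==> t \<in> {0..T} ==> X ---> t ==> (%n. sqnorm (%xi. V (X n) xi - V t xi)) ---> 0"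
  and mild: "nse_mild_solution_on \<nu> u0 {0..T} u"
 shows "\<exists>U. fsol \<nu> W A T U & (\<forall>t\<in>{0..T}. AL xi. U t xi = V t xi)"
proof -
 have C: "C > 0" and Wm [measurable]: "W \<in> bmeas" using W by (auto simp: conv_weight_def)
 have Am [measurable]: "A \<in> bmeas" by (rule L2_measurable[OF vft_L2(2)[OF u0]])
 define cl where "cl tau = max 0 (min T tau)" for tau
 have cl: "cl tau \<in> {0..T}" "tau \<in> {0..T} ==> cl tau = tau" for tau using T by (auto simp: cl_def)
 define f where "f tau = V (cl tau)" for tau
 have fL: "f tau \<in> L2" for tau unfolding f_def by (rule vft_L2(2)[OF V[OF cl(1)]])
 have fm [measurable]: "f tau \<in> bmeas" for tau by (rule L2_measurable[OF fL])
 have fK: "nsq (%xi. W xi * enorm (f tau) xi) <= ennreal K" for tau unfolding f_def by (rule K[OF cl(1)])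
 have fs: "sqnorm (f tau) <= ennreal K" for tau using order_trans[OF nsq_le_weighted[OF W] fK[of tau]] by (simp add: nsq_enorm)
 have nlim: "(%n. nonlin (f (X n)) (f (X n)) xi) ---> nonlin (f tau) (f tau) xi" if X: "X ---> tau" for X tau xi
 proof (rule nonlin_continuous_L2[OF fL fL fs])
  have "(%n. cl (X n)) ---> cl tau" unfolding cl_def by (intro tendsto_intros X)
  then show "(%n. sqnorm (%xi. f (X n) xi - f tau xi)) ---> 0" unfolding f_def by (intro cont cl)
 qed
 have nslice: "nonlin (f tau) (f tau) \<in> bmeas" for tau
  using measurable_slice[OF nonlin_measurable[of "%_. f tau" "%_. f tau"]] by (simp add: split_beta')
 have nm: "(%(tau, xi). nonlin (f tau) (f tau) xi) \<in> bmeas2"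
  by (rule caratheodory_measurable[OF nslice nlim])
 have nm' [measurable]: "(%p. nonlin (f (fst p)) (f (fst p)) (snd p)) \<in> borel_measurable ((borel :: real measure) \<Otimes>\<^sub>M (borel :: (real^3) measure))"
  using nm by (simp add: split_beta')
 have dm: "(%(t, xi). duh \<nu> 0 f f t xi) \<in> bmeas2" by (rule duh_measurable_nonlin[OF nm])
 define U where "U t xi = hk \<nu> t xi *\<^sub>R A xi - duh \<nu> 0 f f t xi" for t xi
 have Um: "(%(t, xi). U t xi) \<in> bmeas2"
  using dm unfolding U_def split_beta' by measurable
 have UV: "AL xi. U t xi = V t xi" if t: "t \<in> {0..T}" for t
 proof -
  define N where "N tau xi = exp (- (\<nu> * (t - tau)) * (norm xi)^2) *\<^sub>R nonlin (f tau) (f tau) xi" for tau xi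
  let ?h = "%tau. heat (\<nu> * (t - tau)) (leray (cvec \<circ> div_tensor (u tau) (u tau)))"
  have "\<exists>w. has_L2_integral ?h {0..t} w & vft w (%xi. (LI tau. indicator {0..t} tau *\<^sub>R N tau xi))"
  proof (rule L2_integral_fourier)
   show "(%(tau, xi). N tau xi) \<in> bmeas2" unfolding N_def split_beta' by measurable
   show "vft (?h tau) (N tau)" if tau: "tau \<in> {0..t}" for tau
   proof -
    have tauT: "tau \<in> {0..T}" using tau t by auto
    show ?thesis unfolding N_def f_def cl(2)[OF tauT]
     by (rule mild_integrand_vft[OF W Wn _ V[OF tauT] le_less_trans[OF K[OF tauT]]]) (use \<nu> tau in auto)
   qed
   let ?B = "36\<^sup>2 * (ennreal C * (ennreal K)^2)"
   have "indicator {0..t} tau * sqnorm (N tau) <= ?B * indicator {0..t} tau" for tau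
   proof (cases "tau \<in> {0..t}")
    case True
    have "sqnorm (N tau) <= 36\<^sup>2 * (ennreal C * (nsq (%xi. W xi * enorm (f tau) xi))^2)"
     unfolding N_def using \<nu> True by (intro sqnorm_heat_nonlin_le[OF W Wn]) auto
    also have "... <= ?B" by (intro mult_left_mono power_mono fK) auto
    finally show ?thesis using True by simp
   qed simp
   then have "(NI tau. indicator {0..t} tau * sqnorm (N tau)) <= (NI tau. ?B * indicator {0..t} tau)" by (rule nn_integral_mono)
   also have "... = ?B * ennreal t" using t by (subst nn_integral_cmult) auto
   also have "... < \<infinity>" by (simp add: ennreal_mult_less_top power_less_top_ennreal)
   finally show "(NI tau. indicator {0..t} tau * sqnorm (N tau)) < \<infinity>" .
  qed (use t in simp)
  then obtain w' where w': "has_L2_integral ?h {0..t} w'" "vft w' (%xi. (LI tau. indicator {0..t} tau *\<^sub>R N tau xi))" by blast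
  have "(LI tau. indicator {0..t} tau *\<^sub>R N tau xi) = duh \<nu> 0 f f t xi" for xi
   unfolding duh_def N_def by (intro Bochner_Integration.integral_cong) (auto split: split_indicator)
  then have w2: "vft w' (duh \<nu> 0 f f t)" using w'(2) by simp
  obtain w where w: "has_L2_integral ?h {0..t} w" "AL x. cvec (u t x) = heat (\<nu> * t) (cvec \<circ> u0) x - w x"
   using mild t unfolding nse_mild_solution_on_def by blast
  have vU: "vft (%x. heat (\<nu> * t) (cvec \<circ> u0) x - w' x) (U t)"
   unfolding U_def using \<nu> t heat_vft[OF u0, of "\<nu> * t"] by (intro vft_diff w2) simp
  have "vft (cvec \<circ> u t) (U t)"
  proof (rule vft_cong_AE[OF vU _ AE_I2[OF refl]])
   show "AL x. heat (\<nu> * t) (cvec \<circ> u0) x - w' x = (cvec \<circ> u t) x"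
    using w(2) has_L2_integral_unique[OF w(1) w'(1)] by eventually_elim simp
  qed (use L2_measurable[OF vft_L2(1)[OF V[OF t]]] L2_measurable[OF vft_L2(2)[OF vU]] in auto)
  then show ?thesis using V[OF t] by (rule vft_unique)
 qed
 \<comment> \<open>The heat kernel gains the derivative in the nonlinearity: divide by \<open>norm xi\<close> before integrating in time.\<close>
 define n where "n tau xi = ennreal (norm (nonlin (f tau) (f tau) xi) / norm xi)" for tau xi
 have [measurable]: "(%p. n (fst p) (snd p)) \<in> borel_measurable ((borel :: real measure) \<Otimes>\<^sub>M (borel :: (real^3) measure))"
  unfolding n_def by measurable
 have [measurable]: "(%p. n (snd p) (fst p)) \<in> borel_measurable ((borel :: (real^3) measure) \<Otimes>\<^sub>M (borel :: real measure))"
  using measurable_compose[of "%p. (snd p, fst p)" "borel \<Otimes>\<^sub>M borel" "borel \<Otimes>\<^sub>M borel" "%p. n (fst p) (snd p)"] by simp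
 have n1 [measurable]: "(%tau. n tau xi) \<in> bmeas" for xi
  using measurable_compose[of "%tau. (tau, xi)" borel "borel \<Otimes>\<^sub>M borel" "%p. n (fst p) (snd p)"] by simp
 have n2 [measurable]: "n tau \<in> bmeas" for tau
  using measurable_compose[of "%xi. (tau, xi)" borel "borel \<Otimes>\<^sub>M borel" "%p. n (fst p) (snd p)"] by simp
 have nle: "n tau xi <= 36 * nconv (enorm (f tau)) (enorm (f tau)) xi" for tau xi
 proof (cases "xi = 0")
  case False
  have "n tau xi = ennreal (norm (nonlin (f tau) (f tau) xi)) * ennreal (1 / norm xi)" by (simp add: n_def ennreal_mult[symmetric])
  also have "... <= (36 * (ennreal (norm xi) * nconv (enorm (f tau)) (enorm (f tau)) xi)) * ennreal (1 / norm xi)"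
   by (intro mult_right_mono norm_nonlin_le) auto
  also have "... = 36 * nconv (enorm (f tau)) (enorm (f tau)) xi * (ennreal (norm xi) * ennreal (1 / norm xi))" by (simp add: mult_ac)
  also have "ennreal (norm xi) * ennreal (1 / norm xi) = 1" using False by (simp add: ennreal_mult[symmetric])
  finally show ?thesis by simp
 qed (simp add: n_def)
 define I where "I xi = (NI tau. indicator {0..T} tau * (n tau xi)^2)" for xi
 have Im [measurable]: "I \<in> bmeas" unfolding I_def[abs_def] by measurable
 have Ifin: "I xi < \<infinity>" for xi
 proof -
  have "I xi <= (NI tau. (36\<^sup>2 * (ennreal K * ennreal K)) * indicator {0..T} tau)" unfolding I_def
  proof (rule nn_integral_mono)
   fix tau
   have "(n tau xi)^2 <= (36 * nconv (enorm (f tau)) (enorm (f tau)) xi)^2" by (intro power_mono nle) auto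
   also have "... <= 36\<^sup>2 * (nsq (enorm (f tau)) * nsq (enorm (f tau)))" unfolding power_mult_distrib by (intro mult_left_mono nconv_le_nsq) auto
   also have "... <= 36\<^sup>2 * (ennreal K * ennreal K)" unfolding nsq_enorm by (intro mult_left_mono mult_mono fs) auto
   finally show "indicator {0..T} tau * (n tau xi)^2 <= (36\<^sup>2 * (ennreal K * ennreal K)) * indicator {0..T} tau" by (auto split: split_indicator)
  qed
  also have "... = 36\<^sup>2 * (ennreal K * ennreal K) * ennreal T" using T by (subst nn_integral_cmult) auto
  also have "... < \<infinity>" by (simp add: ennreal_mult_less_top power_less_top_ennreal)
  finally show ?thesis .
 qed
 define Q where "Q xi = ennreal (sqrt (1 / (2 * \<nu>) * enn2real (I xi)))" for xi
 have [measurable]: "Q \<in> bmeas" unfolding Q_def[abs_def] by measurable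
 have Q2: "(Q xi)^2 = ennreal (1 / (2 * \<nu>)) * I xi" for xi
 proof -
  have "(Q xi)^2 = ennreal ((sqrt (1 / (2 * \<nu>) * enn2real (I xi)))^2)" unfolding Q_def using \<nu> by (intro ennreal_power) simp
  also have "(sqrt (1 / (2 * \<nu>) * enn2real (I xi)))^2 = 1 / (2 * \<nu>) * enn2real (I xi)" using \<nu> by (intro real_sqrt_pow2) simp
  also have "ennreal ... = ennreal (1 / (2 * \<nu>)) * ennreal (enn2real (I xi))" using \<nu> by (intro ennreal_mult) auto
  finally show ?thesis using Ifin[of xi] by simp
 qed
 have duhQ: "ennreal (norm (duh \<nu> 0 f f t xi)) <= Q xi" if t: "t \<in> {0..T}" for t xi
 proof (rule ennreal_le_of_sq)
  have n0: "norm (nonlin (f tau) (f tau) xi) = norm xi * (norm (nonlin (f tau) (f tau) xi) / norm xi)" for tau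
   by (cases "xi = 0") (auto simp: nonlin_def leray_symbol_def vec_eq_iff cvec_def)
  have "ennreal (norm (duh \<nu> 0 f f t xi)) <= (NI tau. ennreal (norm (dker \<nu> 0 t f f xi tau)))"
   unfolding duh_def by (rule ennreal_norm_integral_le)
  also have "... = (NI tau. indicator {0..t} tau * (ennreal (hk \<nu> (t - tau) xi * norm xi) * n tau xi))"
  proof (rule nn_integral_cong)
   fix tau
   have "ennreal (hk \<nu> (t - tau) xi * norm xi) * n tau xi = ennreal (hk \<nu> (t - tau) xi * norm xi * (norm (nonlin (f tau) (f tau) xi) / norm xi))"
    unfolding n_def by (intro ennreal_mult[symmetric]) auto
   also have "hk \<nu> (t - tau) xi * norm xi * (norm (nonlin (f tau) (f tau) xi) / norm xi) = norm (hk \<nu> (t - tau) xi *\<^sub>R nonlin (f tau) (f tau) xi)"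
    using n0[of tau] by (simp only: mult.assoc norm_scaleR abs_exp_cancel)
   finally have e: "ennreal (hk \<nu> (t - tau) xi * norm xi) * n tau xi = ennreal (norm (hk \<nu> (t - tau) xi *\<^sub>R nonlin (f tau) (f tau) xi))" .
   show "ennreal (norm (dker \<nu> 0 t f f xi tau))
    = indicator {0..t} tau * (ennreal (hk \<nu> (t - tau) xi * norm xi) * n tau xi)"
    unfolding e by (cases "0 <= tau & tau <= t") auto
  qed
  finally have "(ennreal (norm (duh \<nu> 0 f f t xi)))^2 <= (NI tau. indicator {0..t} tau * (ennreal (hk \<nu> (t - tau) xi * norm xi) * n tau xi))^2"
   by (intro power_mono) auto
  also have "... <= ennreal (1 / (2 * \<nu>)) * (NI tau. indicator {0..t} tau * (n tau xi)^2)"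
   by (rule heat_kernel_CS) (use \<nu> t n1 in auto)
  also have "... <= ennreal (1 / (2 * \<nu>)) * I xi" unfolding I_def
   using t by (intro mult_left_mono nn_integral_mono mult_right_mono) (auto split: split_indicator)
  finally show "(ennreal (norm (duh \<nu> 0 f f t xi)))^2 <= (Q xi)^2" unfolding Q2 .
 qed
 define M where "M xi = enorm A xi + Q xi" for xi
 have MU: "ennreal (norm (U t xi)) <= M xi" if t: "t \<in> {0..T}" for t xi
 proof -
  have "hk \<nu> t xi * norm (A xi) <= norm (A xi)" using \<nu> t by (intro mult_left_le_one_le) auto
  then have "norm (U t xi) <= norm (A xi) + norm (duh \<nu> 0 f f t xi)"
   unfolding U_def by (intro order_trans[OF norm_triangle_ineq4] add_mono) auto
  from ennreal_leI[OF this] have "ennreal (norm (U t xi)) <= enorm A xi + ennreal (norm (duh \<nu> 0 f f t xi))" by simp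
  also have "... <= M xi" unfolding M_def by (intro add_left_mono duhQ t)
  finally show ?thesis .
 qed
 have Qfin: "nsq (%xi. W xi * Q xi) < \<infinity>"
 proof -
  have "nsq (%xi. W xi * Q xi) = (NI xi. ennreal (1 / (2 * \<nu>)) * (NI tau. indicator {0..T} tau * (W xi * n tau xi)^2))"
   unfolding nsq_def
  proof (rule nn_integral_cong)
   fix xi
   have "(NI tau. indicator {0..T} tau * (W xi * n tau xi)^2) = (NI tau. (W xi)^2 * (indicator {0..T} tau * (n tau xi)^2))"
    by (intro nn_integral_cong) (simp add: power_mult_distrib mult_ac)
   also have "... = (W xi)^2 * I xi" unfolding I_def by (rule nn_integral_cmult) measurable
   finally show "(W xi * Q xi)^2 = ennreal (1 / (2 * \<nu>)) * (NI tau. indicator {0..T} tau * (W xi * n tau xi)^2)"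
    by (simp add: power_mult_distrib Q2 mult_ac)
  qed
  also have "... = ennreal (1 / (2 * \<nu>)) * (NI xi. NI tau. indicator {0..T} tau * (W xi * n tau xi)^2)"
   by (rule nn_integral_cmult) measurable
  also have "(NI xi. NI tau. indicator {0..T} tau * (W xi * n tau xi)^2) = (NI tau. NI xi. indicator {0..T} tau * (W xi * n tau xi)^2)"
   by (rule lborel_pair.Fubini') (simp add: split_beta', measurable)
  also have "... <= (NI tau. (36\<^sup>2 * (ennreal C * (ennreal K)^2)) * indicator {0..T} tau)"
  proof (rule nn_integral_mono)
   fix tau :: real
   have "nsq (%xi. W xi * n tau xi) <= nsq (%xi. 36 * (W xi * nconv (enorm (f tau)) (enorm (f tau)) xi))"
    using mult_left_mono[OF nle, of "W _"] by (intro nsq_mono) (simp add: mult_ac)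
   also have "... = 36\<^sup>2 * nsq (%xi. W xi * nconv (enorm (f tau)) (enorm (f tau)) xi)" by (rule nsq_cmult) measurable
   also have "... <= 36\<^sup>2 * (ennreal C * (nsq (%xi. W xi * enorm (f tau) xi))^2)" using W by (intro mult_left_mono) (auto simp: conv_weight_def)
   also have "... <= 36\<^sup>2 * (ennreal C * (ennreal K)^2)" by (intro mult_left_mono power_mono fK) auto
   finally show "(NI xi. indicator {0..T} tau * (W xi * n tau xi)^2) <= (36\<^sup>2 * (ennreal C * (ennreal K)^2)) * indicator {0..T} tau"
    by (cases "tau \<in> {0..T}") (auto simp: nsq_def)
  qed
  also have "... = (36\<^sup>2 * (ennreal C * (ennreal K)^2)) * ennreal T" using T by (subst nn_integral_cmult) auto
  finally have "nsq (%xi. W xi * Q xi) <= ennreal (1 / (2 * \<nu>)) * ((36\<^sup>2 * (ennreal C * (ennreal K)^2)) * ennreal T)"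
   by this (intro mult_left_mono; simp)
  also have "... < \<infinity>" by (simp add: ennreal_mult_less_top power_less_top_ennreal)
  finally show ?thesis .
 qed
 have "fsol \<nu> W A T U" unfolding fsol_def
 proof (intro conjI bexI[of _ M] ballI allI)
  show "(%(t, xi). U t xi) \<in> bmeas2" by (rule Um)
  have "nsq (%xi. W xi * M xi) <= 2 * nsq (%xi. W xi * enorm A xi) + 2 * nsq (%xi. W xi * Q xi)"
   unfolding M_def distrib_left by (rule nsq_add_le) measurable
  also have "... < \<infinity>" using AW Qfin by (simp add: ennreal_mult_less_top ennreal_add_less_top)
  finally show "nsq (%xi. W xi * M xi) < \<infinity>" .
  show "ennreal (norm (U t xi)) <= M xi" if "t \<in> {0..T}" for t xi using that by (rule MU)
  show "M \<in> bmeas" unfolding M_def[abs_def] by measurable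
  have nl: "nonlin (U tau) (U tau) xi = nonlin (f tau) (f tau) xi" if tau: "tau \<in> {0..T}" for tau xi
   by (rule nonlin_cong_AE[OF measurable_slice[OF Um] fm]) (use UV[OF tau] in \<open>simp add: f_def cl(2)[OF tau]\<close>)
  have "duh \<nu> 0 U U t xi = duh \<nu> 0 f f t xi" if t: "t \<in> {0..T}" for t xi
   unfolding duh_def by (intro Bochner_Integration.integral_cong refl if_cong arg_cong2[where f=scaleR] nl) (use t in auto)
  then show "AL xi. \<forall>t\<in>{0..T}. U t xi = hk \<nu> t xi *\<^sub>R A xi - duh \<nu> 0 U U t xi"
   by (intro AE_I2 ballI) (simp only: U_def)
 qed
 then show ?thesis using UV by blast
qed

section \<open>Existence, uniqueness and the blow-up rate\<close>

lemma gevrey_continuous_on_subset: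
 "gevrey_continuous_on a \<sigma> s I u ==> J \<subseteq> I ==> gevrey_continuous_on a \<sigma> s J u"
 unfolding gevrey_continuous_on_def by (meson subset_iff tendsto_within_subset)

lemma real_field_exists:
 assumes U: "U \<in> L2" and sym: "AL xi. U (- xi) = vcnj (U xi)"
 shows "\<exists>u. vft (cvec \<circ> u) U"
proof -
 have "\<exists>v. ft (%x. cplx (v x)) (%xi. U xi $ j)" for j
 proof -
  have "AL xi. U (- xi) $ j = cnj (U xi $ j)" using sym by eventually_elim simp
  from ft_real_exists[OF _ this] U show ?thesis unfolding L2_vec_iff[of U] by blast
 qed
 then obtain v where "!!j. ft (%x. cplx (v j x)) (%xi. U xi $ j)" by metis
 then have "vft (cvec \<circ> (%x. \<chi> j. v j x)) U" by (simp add: vft_def cvec_def)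
 then show ?thesis by blast
qed

text \<open>The divergence of the datum is an \<open>L2\<close> function by the Gevrey bound, so its weak vanishing is pointwise vanishing of its transform.\<close>

lemma divfree_fourier:
 assumes u0: "vft (cvec \<circ> u0) A" and div: "has_weak_div u0 (%x. 0)" and fin: "nsq (%xi. ennreal (norm xi) * enorm A xi) < \<infinity>"
 shows "AL xi. vdot xi (A xi) = 0"
proof -
 have [measurable]: "A \<in> bmeas" by (rule L2_measurable[OF vft_L2(2)[OF u0]])
 have e: "(\<Sum>j\<in>UNIV. \<i> * cplx (xi $ j) * A xi $ j) = \<i> * vdot xi (A xi)" for xi
  by (simp add: vdot_def sum_distrib_left mult.assoc)
 have [measurable]: "(%xi. \<i> * vdot xi (A xi)) \<in> bmeas" unfolding vdot_def by measurable
 have "sqnorm (%xi. \<i> * vdot xi (A xi)) <= nsq (%xi. 3 * (ennreal (norm xi) * enorm A xi))"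
  unfolding nsq_enorm[symmetric]
 proof (rule nsq_mono)
  fix xi
  have "norm (\<i> * vdot xi (A xi)) <= (\<Sum>j\<in>(UNIV::3 set). norm xi * norm (A xi))"
   unfolding norm_mult norm_ii mult_1 vdot_def
   by (intro order_trans[OF norm_sum] sum_mono) (auto simp: norm_mult component_le_norm_cart Finite_Cartesian_Product.norm_nth_le intro!: mult_mono)
  then have "norm (\<i> * vdot xi (A xi)) <= 3 * (norm xi * norm (A xi))" by simp
  from ennreal_leI[OF this] show "ennreal (norm (\<i> * vdot xi (A xi))) <= 3 * (ennreal (norm xi) * enorm A xi)" by (simp add: ennreal_mult)
 qed
 also have "... = 3\<^sup>2 * nsq (%xi. ennreal (norm xi) * enorm A xi)" by (rule nsq_cmult) measurable
 also have "... < \<infinity>" using fin by (simp add: ennreal_mult_less_top power_less_top_ennreal)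
 finally have "(%xi. \<i> * vdot xi (A xi)) \<in> L2" by (simp add: L2_iff)
 with weak_div_zero_fourier[of u0 "%j xi. A xi $ j"] div have "AL xi. \<i> * vdot xi (A xi) = 0"
  using vftD[OF u0] unfolding e by (simp add: cvec_def)
 then show ?thesis by eventually_elim simp
qed

theorem theorem1p1:
 fixes \<sigma> \<nu> \<sigma>\<^sub>0 :: real and u0 :: "real^3 \<Rightarrow> real^3"
 assumes "\<sigma> > 1" and "\<nu> > 0"
  and "2 * \<sigma>\<^sub>0 = real_of_int \<lfloor>2 * \<sigma>\<rfloor>"
  and "has_weak_div u0 (\<lambda>x. 0)"
 shows "\<exists>c2::real. c2 > 0 \<and> (\<forall>a::real. a > 0 \<and> cvec \<circ> u0 \<in> gevrey_space a \<sigma> 1 \<longrightarrow>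
  (\<exists>(T::ereal) (u :: real \<Rightarrow> real^3 \<Rightarrow> real^3).
   nse_maximal_solution \<nu> a \<sigma> u0 T u \<and>
   (\<forall>T' u'. nse_maximal_solution \<nu> a \<sigma> u0 T' u' \<longrightarrow>
     T' = T \<and> (\<forall>t. 0 \<le> t \<and> ereal t < T \<longrightarrow> (AE x in lborel. u' t x = u t x))) \<and>
   (T < \<infinity> \<longrightarrow> (\<exists>c1::real. c1 > 0 \<and> (\<forall>t. 0 \<le> t \<and> ereal t < T \<longrightarrow>
     c1 / (real_of_ereal T - t) powr ((2 * \<sigma>\<^sub>0 + 1) / (3 * \<sigma>) + 1 / 3)
      * exp (a * c2 / (real_of_ereal T - t) powr (1 / (3 * \<sigma>)))
     \<le> gevrey_norm a \<sigma> 1 (cvec \<circ> u t))))))"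
proof -
 note \<sigma> = assms(1) and \<nu> = assms(2) and div = assms(4)
 define th where "th = 1 / \<sigma>"
 have th: "0 < th" "th < 1" using \<sigma> by (auto simp: th_def)
 define p where "p = (2 * \<sigma>\<^sub>0 + 1) / (3 * \<sigma>) + 1 / 3"
 have "2 * \<sigma> < 2 * \<sigma>\<^sub>0 + 1" unfolding assms(3) by linarith
 then have "2 / 3 < (2 * \<sigma>\<^sub>0 + 1) / (3 * \<sigma>)" using \<sigma> by (simp add: field_simps)
 then have p: "p > 1" unfolding p_def by linarith
 define A where "A = fourier (cvec \<circ> u0)"
 \<comment> \<open>The summand 1 keeps \<open>E\<close> positive for the zero datum.\<close>
 define E where "E = 1 + enn2real (sqnorm A)"
 have E: "E > 0" unfolding E_def using enn2real_nonneg[of "sqnorm A"] by linarith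
 from blowup_rate[OF \<nu> th p E] obtain c2 where c2: "c2 > 0" and rate: "!!a C0 A U Tm. a > 0 ==> conv_weight C0 (%xi. egev th a xi) ==>
   (!!T. T < Tm ==> fsol \<nu> (%xi. egev th a xi) A T U) ==>
   (!!K. \<exists>t. 0 <= t & t < Tm & ennreal K < nsq (%xi. egev th a xi * enorm (U t) xi)) ==>
   (!!t. 0 <= t ==> t < Tm ==> sqnorm (U t) <= ennreal E) ==>
   \<exists>c1>0. \<forall>t. 0 <= t & t < Tm --> c1 / (Tm - t) powr p * exp (a * c2 / (Tm - t) powr (th / 3))
    <= sqrt (1 / (2 * pi)^3 * enn2real (nsq (%xi. egev th a xi * enorm (U t) xi)))" by blast
 show ?thesis
 proof (intro exI[of _ c2] conjI c2 allI impI)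
  fix a :: real assume "a > 0 & cvec \<circ> u0 \<in> gevrey_space a \<sigma> 1"
  then have a: "a > 0" and sp: "cvec \<circ> u0 \<in> gevrey_space a \<sigma> 1" by auto
  have u0: "vft (cvec \<circ> u0) A" unfolding A_def using sp by (intro vft_fourier) (simp add: gevrey_space_def)
  have AL: "A \<in> L2" by (rule vft_L2(2)[OF u0])
  note Am = L2_measurable[OF AL]
  let ?W = "%xi. egev th a xi"
  have AW: "nsq (%xi. ?W xi * enorm A xi) < \<infinity>" using gevrey_space_norm(1)[OF u0 Am] sp by (simp add: th_def)
  obtain C where W: "conv_weight C ?W" using gev_conv_weight[OF th a] by blast
  have Wn: "ennreal (norm xi) <= ?W xi" for xi using a by (intro ennreal_leI norm_le_gev) simp
  have even: "?W (- xi) = ?W xi" for xi by (simp add: gev_def gw_def)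
  have sym: "AL xi. A (- xi) = vcnj (A xi)"
   unfolding vec_eq_iff AE_all_countable using ft_real_imp[of "%x. u0 x $ j" "%xi. A xi $ j" for j] vftD[OF u0] by (simp add: cvec_def)
  have dv: "AL xi. vdot xi (A xi) = 0"
   by (rule divfree_fourier[OF u0 div le_less_trans[OF nsq_mono AW]]) (intro mult_right_mono Wn, simp)
  obtain Tm U where Tm: "0 < Tm" and U: "!!T. ereal T < Tm ==> fsol \<nu> ?W A T U"
   and unb: "!!K. Tm < \<infinity> ==> \<exists>t. 0 <= t & ereal t < Tm & ennreal K < nsq (%xi. ?W xi * enorm (U t) xi)"
   using fsol_maximal[OF \<nu> W Am AW] by blast
  define I where "I = {t. 0 <= t & ereal t < Tm}"
  have I: "t \<in> I ==> 0 <= t" "t \<in> I ==> ereal t < Tm" "t \<in> I ==> {0..t} \<subseteq> I" for t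
   by (auto simp: I_def) (meson ereal_less_eq(3) order_le_less_trans)
  have en: "sqnorm (U t) <= ennreal E" if t: "t \<in> I" for t
  proof -
   have "sqnorm (U t) <= sqnorm A" by (rule fsol_energy[OF \<nu> W U[OF I(2)[OF t]] even Wn AL sym dv]) (use I(1)[OF t] in simp)
   also have "... = ennreal (enn2real (sqnorm A))" using L2_sqnorm[OF AL] by simp
   also have "... <= ennreal E" by (intro ennreal_leI) (simp add: E_def)
   finally show ?thesis .
  qed
  have Ufin: "nsq (%xi. ?W xi * enorm (U t) xi) < \<infinity>" if t: "t \<in> I" for t
  proof (rule fsol_majorant[OF U[OF I(2)[OF t]]])
   fix M assume fin: "nsq (%xi. ?W xi * M xi) < \<infinity>" and M: "!!s xi. s \<in> {0..t} ==> ennreal (norm (U s xi)) <= M xi"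
   show ?thesis by (rule le_less_trans[OF nsq_mono fin]) (intro mult_left_mono M, use I(1)[OF t] in auto)
  qed
  have "\<exists>v. vft (cvec \<circ> v) (U t)" if t: "t \<in> I" for t
  proof (rule real_field_exists)
   show "U t \<in> L2" using en[OF t] measurable_slice[OF fsol_measurable[OF U[OF I(2)[OF t]]]] by (auto simp: L2_iff intro: le_less_trans)
   show "AL xi. U t (- xi) = vcnj (U t xi)"
    using fsol_reality[OF \<nu> W U[OF I(2)[OF t]] even sym] by eventually_elim (use I(1)[OF t] in simp)
  qed
  then obtain u where u: "!!t. t \<in> I ==> vft (cvec \<circ> u t) (U t)" by metis
  have gc: "gevrey_continuous_on a \<sigma> 1 I u"
  proof (rule gevrey_continuous_iff[where u = u and V = U and I = I, THEN iffD2], erule u, intro conjI ballI allI impI)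
   show "nsq (%xi. egev (1 / \<sigma>) a xi * enorm (U t) xi) < \<infinity>" if "t \<in> I" for t using Ufin[OF that] by (simp add: th_def)
   fix X t assume t: "t \<in> I" and "(\<forall>n. X n \<in> I) & X ---> t"
   then have X: "!!n. X n \<in> I" "X ---> t" by auto
   obtain T where T: "t < T" "ereal T < Tm" using ereal_dense2[OF I(2)[OF t]] by auto
   have T0: "0 <= T" using T(1) I(1)[OF t] by simp
   have ev: "eventually (%n. X n < T) sequentially" by (rule order_tendstoD(2)[OF X(2) T(1)])
   \<comment> \<open>The cut at \<open>T\<close> puts the whole sequence into one interval on which a majorant is known.\<close>
   have "(%n. min (X n) T) ---> min t T" by (intro tendsto_min X tendsto_const)
   then have "(%n. min (X n) T) ---> t" using T by simp
   then have "(%n. nsq (%xi. ?W xi * ennreal (norm (U (min (X n) T) xi - U t xi)))) ---> 0"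
    by (intro fsol_norm_diff_tendsto(1)[OF \<nu> W U[OF T(2)], of "gev th a" 1]) (use X(1) t T T0 I(1) in \<open>auto simp: min_def\<close>)
   then show "(%n. nsq (%xi. egev (1 / \<sigma>) a xi * ennreal (norm (U (X n) xi - U t xi)))) ---> 0"
    unfolding th_def by (rule Lim_transform_eventually) (use ev in \<open>auto elim!: eventually_mono simp: min_def\<close>)
  qed
  have mild: "nse_mild_solution_on \<nu> u0 I u" unfolding nse_mild_solution_on_def
  proof
   fix t assume t: "t \<in> I"
   show "\<exists>w. has_L2_integral (%tau. heat (\<nu> * (t - tau)) (leray (cvec \<circ> div_tensor (u tau) (u tau)))) {0..t} w &
     (AL x. cvec (u t x) = heat (\<nu> * t) (cvec \<circ> u0) x - w x)"
    by (rule fsol_mild[OF \<nu> W Wn U[OF I(2)[OF t]] I(1)[OF t] u u0]) (use I(3)[OF t] in auto)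
  qed
  have bd: False if fin: "Tm < \<infinity>" and c: "gevrey_continuous_on a \<sigma> 1 {0..real_of_ereal Tm} v"
   and eq: "!!t. t \<in> I ==> AL x. v t x = u t x" for v
  proof -
   have "real_of_ereal Tm \<ge> 0" "I \<subseteq> {0..real_of_ereal Tm}" using Tm fin by (auto simp: I_def) (cases Tm; auto)+
   have V: "vft (cvec \<circ> v t) (fourier (cvec \<circ> v t))" if "t \<in> {0..real_of_ereal Tm}" for t
    using c that by (intro vft_fourier) (auto simp: gevrey_continuous_on_def gevrey_space_def)
   obtain K where K: "!!t. t \<in> {0..real_of_ereal Tm} ==> nsq (%xi. egev (1 / \<sigma>) a xi * enorm (fourier (cvec \<circ> v t)) xi) <= ennreal K"
    using gevrey_continuous_bounded[OF c V] by blast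
   have le: "nsq (%xi. ?W xi * enorm (U t) xi) <= ennreal K" if t: "t \<in> I" for t
   proof -
    have tT: "t \<in> {0..real_of_ereal Tm}" using t \<open>I \<subseteq> _\<close> by blast
    have "vft (cvec \<circ> u t) (fourier (cvec \<circ> v t))"
     by (rule vft_cong_AE[OF V[OF tT] _ AE_I2[OF refl]])
       (use eq[OF t] L2_measurable[OF vft_L2(1)[OF u[OF t]]] L2_measurable[OF vft_L2(2)[OF V[OF tT]]] in \<open>auto elim!: eventually_mono\<close>)
    from vft_unique[OF this u[OF t]] have "nsq (%xi. ?W xi * enorm (U t) xi) <= nsq (%xi. ?W xi * enorm (fourier (cvec \<circ> v t)) xi)"
     by (intro nsq_mono_AE) (auto elim!: eventually_mono)
    then show ?thesis using K[OF tT] by (simp add: th_def)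
   qed
   obtain t where "t \<in> I" "ennreal K < nsq (%xi. ?W xi * enorm (U t) xi)" using unb[OF fin, of K] by (auto simp: I_def)
   then show False using le[of t] by simp
  qed
  have max: "nse_maximal_solution \<nu> a \<sigma> u0 Tm u"
   unfolding nse_maximal_solution_def I_def[symmetric]
  proof (intro conjI impI Tm gc mild notI)
   assume fin: "Tm < \<infinity>" and "\<exists>v. gevrey_continuous_on a \<sigma> 1 {0..real_of_ereal Tm} v & (\<forall>t. 0 <= t & ereal t < Tm --> (AL x. v t x = u t x))"
   then obtain v where "gevrey_continuous_on a \<sigma> 1 {0..real_of_ereal Tm} v" "!!t. t \<in> I ==> AL x. v t x = u t x" by (auto simp: I_def)
   then show False by (rule bd[OF fin])
  qed
  have uni: "T' = Tm & (\<forall>t. 0 <= t & ereal t < Tm --> (AL x. u' t x = u t x))" if m: "nse_maximal_solution \<nu> a \<sigma> u0 T' u'" for T' u'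
  proof -
   let ?I = "{t. 0 <= t & ereal t < T'}"
   have T': "0 < T'" and gc': "gevrey_continuous_on a \<sigma> 1 ?I u'" and mild': "nse_mild_solution_on \<nu> u0 ?I u'"
    using m by (auto simp: nse_maximal_solution_def)
   have eq: "AL x. u' t x = u t x" if t: "t \<in> I" "ereal t < T'" for t
   proof -
    have sub: "{0..t} \<subseteq> ?I" using t(2) by auto (meson ereal_less_eq(3) order_le_less_trans)
    have c: "gevrey_continuous_on a \<sigma> 1 {0..t} u'" by (rule gevrey_continuous_on_subset[OF gc' sub])
    define V where "V s = fourier (cvec \<circ> u' s)" for s
    have V: "vft (cvec \<circ> u' s) (V s)" if "s \<in> {0..t}" for s
     unfolding V_def using c that by (intro vft_fourier) (auto simp: gevrey_continuous_on_def gevrey_space_def)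
    obtain K where K: "!!s. s \<in> {0..t} ==> nsq (%xi. ?W xi * enorm (V s) xi) <= ennreal K"
     unfolding th_def using gevrey_continuous_bounded[OF c V] by blast
    note c' = iffD1[OF gevrey_continuous_iff[where u = u' and V = V and I = "{0..t}", OF V] c]
    have "\<exists>U'. fsol \<nu> ?W A t U' & (\<forall>s\<in>{0..t}. AL xi. U' s xi = V s xi)"
    proof (rule mild_fsol[OF \<nu> W Wn I(1)[OF t(1)] u0 AW V K])
     show "nse_mild_solution_on \<nu> u0 {0..t} u'" using mild' sub unfolding nse_mild_solution_on_def by blast
     fix X s assume X: "!!n. X n \<in> {0..t}" "s \<in> {0..t}" "X ---> s"
     then have l: "(%n. nsq (%xi. ?W xi * ennreal (norm (V (X n) xi - V s xi)))) ---> 0"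
      unfolding th_def using conjunct2[OF c'] by blast
     have "sqnorm (%xi. V (X n) xi - V s xi) <= nsq (%xi. ?W xi * ennreal (norm (V (X n) xi - V s xi)))" for n
      unfolding nsq_enorm[symmetric] by (rule nsq_le_weighted[OF W])
     then show "(%n. sqnorm (%xi. V (X n) xi - V s xi)) ---> 0"
      by (intro tendsto_sandwich[OF always_eventually[OF allI[OF zero_le]] always_eventually tendsto_const l] allI)
    qed
    then obtain U' where U': "fsol \<nu> ?W A t U'" "!!s. s \<in> {0..t} ==> AL xi. U' s xi = V s xi" by blast
    have tt: "t \<in> {0..t}" using I(1)[OF t(1)] by simp
    have "AL xi. V t xi = U t xi"
     using fsol_unique[OF \<nu> W U'(1) U[OF I(2)[OF t(1)]]] U'(2)[OF tt] by eventually_elim (use tt in auto)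
    then have "vft (cvec \<circ> u' t) (U t)"
     by (rule vft_cong_AE[OF V[OF tt] AE_I2[OF refl]])
       (rule L2_measurable[OF vft_L2(1)[OF V[OF tt]]] L2_measurable[OF vft_L2(2)[OF u[OF t(1)]]] | assumption)+
    from vft_inj[OF this u[OF t(1)]] show ?thesis by eventually_elim (simp add: cvec_def vec_eq_iff)
   qed
   have "\<not> T' < Tm"
   proof
    assume lt: "T' < Tm"
    then have fin: "T' < \<infinity>" and T'I: "real_of_ereal T' \<in> I" using T' by (cases T'; auto simp: I_def)+
    have "\<exists>v. gevrey_continuous_on a \<sigma> 1 {0..real_of_ereal T'} v & (\<forall>t. 0 <= t & ereal t < T' --> (AL x. v t x = u' t x))"
    proof (intro exI[of _ u] conjI allI impI)
     show "gevrey_continuous_on a \<sigma> 1 {0..real_of_ereal T'} u" by (rule gevrey_continuous_on_subset[OF gc I(3)[OF T'I]])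
     fix t assume "0 <= t & ereal t < T'"
     then have "t \<in> I" "ereal t < T'" using lt by (auto simp: I_def)
     from eq[OF this] show "AL x. u t x = u' t x" by eventually_elim simp
    qed
    then show False using m fin by (auto simp: nse_maximal_solution_def)
   qed
   moreover have "\<not> Tm < T'"
   proof
    assume lt: "Tm < T'"
    then have fin: "Tm < \<infinity>" by auto
    have sub: "{0..real_of_ereal Tm} \<subseteq> ?I"
    proof
     fix t assume "t \<in> {0..real_of_ereal Tm}"
     then have "0 <= t" "ereal t <= Tm" using Tm fin by (cases Tm; auto)+
     then show "t \<in> ?I" using lt by simp
    qed
    show False
     by (rule bd[OF fin gevrey_continuous_on_subset[OF gc' sub]], rule eq) (use lt I(2) in \<open>auto intro: less_trans\<close>)
   qed
   ultimately have "T' = Tm" by auto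
   then show ?thesis using eq by (auto simp: I_def)
  qed
  have low: "\<exists>c1::real. c1 > 0 & (\<forall>t. 0 <= t & ereal t < Tm -->
     c1 / (real_of_ereal Tm - t) powr ((2 * \<sigma>\<^sub>0 + 1) / (3 * \<sigma>) + 1 / 3) * exp (a * c2 / (real_of_ereal Tm - t) powr (1 / (3 * \<sigma>)))
     <= gevrey_norm a \<sigma> 1 (cvec \<circ> u t))" if fin: "Tm < \<infinity>"
  proof -
   obtain r where r: "Tm = ereal r" using Tm fin by (cases Tm) auto
   have ex: "\<exists>c1>0. \<forall>t. 0 <= t & t < r --> c1 / (r - t) powr p * exp (a * c2 / (r - t) powr (th / 3))
    <= sqrt (1 / (2 * pi)^3 * enn2real (nsq (%xi. ?W xi * enorm (U t) xi)))"
    by (rule rate[OF a W]) (use U unb[OF fin] en in \<open>auto simp: r I_def\<close>)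
   have nm: "sqrt (1 / (2 * pi)^3 * enn2real (nsq (%xi. ?W xi * enorm (U t) xi))) = gevrey_norm a \<sigma> 1 (cvec \<circ> u t)" if t: "t \<in> I" for t
    unfolding th_def
    by (rule gevrey_space_norm(2)[OF u[OF t] L2_measurable[OF vft_L2(2)[OF u[OF t]]], symmetric])
      (use gc t in \<open>auto simp: gevrey_continuous_on_def\<close>)
   have th3: "th / 3 = 1 / (3 * \<sigma>)" by (simp add: th_def)
   obtain c1 where c1: "c1 > 0" "!!t. 0 <= t ==> t < r ==> c1 / (r - t) powr p * exp (a * c2 / (r - t) powr (th / 3))
    <= sqrt (1 / (2 * pi)^3 * enn2real (nsq (%xi. ?W xi * enorm (U t) xi)))" using ex by blast
   show ?thesis
   proof (intro exI conjI allI impI)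
    fix t assume t: "0 <= t & ereal t < Tm"
    then have t': "0 <= t" "t < r" "t \<in> I" by (auto simp: r I_def)
    show "c1 / (real_of_ereal Tm - t) powr ((2 * \<sigma>\<^sub>0 + 1) / (3 * \<sigma>) + 1 / 3) * exp (a * c2 / (real_of_ereal Tm - t) powr (1 / (3 * \<sigma>)))
     <= gevrey_norm a \<sigma> 1 (cvec \<circ> u t)"
     unfolding r real_of_ereal.simps p_def[symmetric] th3[symmetric] nm[OF t'(3), symmetric] by (rule c1(2)[OF t'(1,2)])
   qed (rule c1(1))
  qed
  show "\<exists>(T::ereal) u. nse_maximal_solution \<nu> a \<sigma> u0 T u &
   (\<forall>T' u'. nse_maximal_solution \<nu> a \<sigma> u0 T' u' -->
     T' = T & (\<forall>t. 0 <= t & ereal t < T --> (AL x. u' t x = u t x))) &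
   (T < \<infinity> --> (\<exists>c1::real. c1 > 0 & (\<forall>t. 0 <= t & ereal t < T -->
     c1 / (real_of_ereal T - t) powr ((2 * \<sigma>\<^sub>0 + 1) / (3 * \<sigma>) + 1 / 3)
      * exp (a * c2 / (real_of_ereal T - t) powr (1 / (3 * \<sigma>)))
     <= gevrey_norm a \<sigma> 1 (cvec \<circ> u t))))"
   by (rule exI[of _ Tm], rule exI[of _ u], rule conjI[OF max], rule conjI, rule allI, rule allI, rule impI, erule uni, rule impI, erule low)
 qed
qed

end
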